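(* Let $n\ge2$ and let $M$ be an $n$-dimensional complex manifold which is the union of an increasing sequence of open subsets $M_j\subset M_{j+1}$, each of which is biholomorphic to $\Omega=\Delta\times\mathbb{B}^{n-1}$. If $M$ is (Kobayashi) hyperbolic, then $M$ is biholomorphic to $\Delta\times\mathbb{B}^{n-1}$. If $M$ is non-hyperbolic and the corank of $F_M$ is one, then $M$ is biholomorphic to $Z\times\mathbb{C}$, where $Z$ is a holomorphic retract of $\Delta\times\mathbb{B}^{n-1}$ of one of the following types: (i) $Z=\{(w,c_1w,\dots,c_{n-1}w):w\in\Delta\}$ with $(c_1,\dots,c_{n-1})\in\partial\mathbb{B}^{n-1}$; (ii) $Z$ is the graph of a $\mathbb{B}^{n-1}$-valued holomorphic mapping of $\Delta$; (iii) $Z$ is the graph of a $\Delta$-valued holomorphic function over a complex linear subspace of $\mathbb{B}^{n-1}$; (iv) $Z$ is the intersection of a complex linear subspace of $\mathbb{C}^n$ with $\Delta\times\mathbb{B}^{n-1}$, of complex dimension at least two. Moreover, $Z$ is either the graph of a $\Delta$-valued holomorphic function on $\mathbb{B}^{n-1}$ or a linear subspace of $\Omega$ of complex dimension at least two.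
   Context: $\Delta\subset\mathbb{C}$ is the unit disc and $\mathbb{B}^{n-1}\subset\mathbb{C}^{n-1}$ the unit ball. $F_M$ is the infinitesimal Kobayashi metric of $M$; its corank is the complex dimension of $\{v\in T_pM:F_M(p,v)=0\}$, which is independent of $p$ in this setting. A holomorphic retract of a complex manifold $X$ is the image of a holomorphic map $r:X\to X$ with $r\circ r=r$. A (complex) linear subspace of a domain $D$ means the intersection $l\cap D$ with $l$ a complex linear subspace of the ambient vector space. Graphs of $\mathbb{B}^{n-1}$-valued maps $f$ of $\Delta$ are $\{(w,f(w))\}$; graphs of $\Delta$-valued functions $g$ are $\{(g(z),z)\}$. *)

theory Defs
  imports "HOL-Analysis.Analysis"
begin

section \<open>Finite-dimensional complex vector spaces\<close>

class complex_space = euclidean_space +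
  fixes scaleC :: "complex \<Rightarrow> 'a \<Rightarrow> 'a" (infixr "*\<^sub>C" 75)
  assumes scaleC_add_right: "a *\<^sub>C (x + y) = a *\<^sub>C x + a *\<^sub>C y"
    and scaleC_add_left: "(a + b) *\<^sub>C x = a *\<^sub>C x + b *\<^sub>C x"
    and scaleC_scaleC: "a *\<^sub>C (b *\<^sub>C x) = (a * b) *\<^sub>C x"
    and scaleC_one: "1 *\<^sub>C x = x"
    and scaleC_of_real: "complex_of_real r *\<^sub>C x = r *\<^sub>R x"
    and norm_scaleC: "norm (a *\<^sub>C x) = cmod a * norm x"

instantiation complex :: complex_space
begin

definition scaleC_complex_def: "a *\<^sub>C (x::complex) = a * x"

instance
  by standard (auto simp: scaleC_complex_def algebra_simps norm_mult scaleR_conv_of_real)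

end

instantiation prod :: (complex_space, complex_space) complex_space
begin

definition scaleC_prod_def: "a *\<^sub>C x = (a *\<^sub>C fst x, a *\<^sub>C snd x)"

instance
proof
  fix a :: complex and x :: "'a \<times> 'b"
  have "sqrt ((cmod a * norm (fst x))\<^sup>2 + (cmod a * norm (snd x))\<^sup>2)
      = sqrt ((cmod a)\<^sup>2 * ((norm (fst x))\<^sup>2 + (norm (snd x))\<^sup>2))"
    by (simp add: power_mult_distrib distrib_left)
  also have "\<dots> = cmod a * norm x"
    by (simp add: real_sqrt_mult norm_prod_def)
  finally show "norm (a *\<^sub>C x) = cmod a * norm x"
    by (simp add: scaleC_prod_def norm_prod_def norm_scaleC)
qed (auto simp: scaleC_prod_def scaleC_add_right scaleC_add_left scaleC_scaleC scaleC_one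
      scaleC_of_real prod_eq_iff)

end

instantiation vec :: (complex_space, finite) complex_space
begin

definition scaleC_vec_def: "a *\<^sub>C x = (\<chi> i. a *\<^sub>C (x $ i))"

instance
proof
  fix a :: complex and x :: "'a ^ 'b"
  show "norm (a *\<^sub>C x) = cmod a * norm x"
    by (simp add: scaleC_vec_def norm_vec_def norm_scaleC L2_set_right_distrib)
qed (auto simp: scaleC_vec_def scaleC_add_right scaleC_add_left scaleC_scaleC scaleC_one
      scaleC_of_real vec_eq_iff)

end

interpretation complex_vector:
  vector_space "scaleC :: complex \<Rightarrow> 'a \<Rightarrow> 'a::complex_space"
  by standard (rule scaleC_add_right scaleC_add_left scaleC_scaleC scaleC_one)+


section \<open>Holomorphic maps between subsets of complex vector spaces\<close>

definition complex_differentiable_at ::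
    "('a::complex_space \<Rightarrow> 'b::complex_space) \<Rightarrow> 'a \<Rightarrow> bool" where
  "complex_differentiable_at f x \<longleftrightarrow>
     (\<exists>D. Vector_Spaces.linear scaleC scaleC D \<and> (f has_derivative D) (at x))"

text \<open>
  The set is not required to be open: a map is holomorphic on \<open>S\<close> if it is locally the
  restriction of a holomorphic map on an open subset of the ambient space.  On an open set
  this is complex differentiability at every point, and on a complex submanifold (such as a
  holomorphic retract, or a linear subspace of a domain) it is holomorphy with respect to
  the induced complex structure.
\<close>

definition holo_on :: "('a::complex_space \<Rightarrow> 'b::complex_space) \<Rightarrow> 'a set \<Rightarrow> bool" where
  "holo_on f S \<longleftrightarrow>
     (\<forall>x\<in>S. \<exists>W h. open W \<and> x \<in> W \<and> (\<forall>y\<in>W. complex_differentiable_at h y) \<and>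
        (\<forall>y\<in>S \<inter> W. h y = f y))"

lemma holo_on_open:
  assumes "open S"
  shows "holo_on f S \<longleftrightarrow> (\<forall>x\<in>S. complex_differentiable_at f x)"
proof
  assume L: "holo_on f S"
  show "\<forall>x\<in>S. complex_differentiable_at f x"
  proof
    fix x assume x: "x \<in> S"
    then obtain W h where W: "open W" "x \<in> W" "\<forall>y\<in>W. complex_differentiable_at h y"
        "\<forall>y\<in>S \<inter> W. h y = f y"
      using L unfolding holo_on_def by meson
    then obtain D where D: "Vector_Spaces.linear scaleC scaleC D" "(h has_derivative D) (at x)"
      unfolding complex_differentiable_at_def by blast
    have "(f has_derivative D) (at x)"
      using D(2) open_Int[OF assms W(1)]
      by (rule has_derivative_transform_within_open) (use x W in auto)
    with D show "complex_differentiable_at f x"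
      unfolding complex_differentiable_at_def by blast
  qed
next
  assume "\<forall>x\<in>S. complex_differentiable_at f x"
  with assms show "holo_on f S"
    unfolding holo_on_def by blast
qed

definition holomorphic_retract :: "'a::complex_space set \<Rightarrow> 'a set \<Rightarrow> bool" where
  "holomorphic_retract Z D \<longleftrightarrow>
     (\<exists>r. holo_on r D \<and> r ` D \<subseteq> D \<and> (\<forall>x\<in>D. r (r x) = r x) \<and> Z = r ` D)"


section \<open>Complex manifolds\<close>

text \<open>
  A chart is a pair of its domain and a coordinate map, of which only the values on the domain
  matter.  The complex dimension of the manifold is that of the model space \<^typ>\<open>'e\<close>.
\<close>

type_synonym ('a, 'e) cchart = "'a set \<times> ('a \<Rightarrow> 'e)"

record ('a, 'e) cmanifold =
  mtop :: "'a topology"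
  atlas :: "('a, 'e) cchart set"

definition is_cchart :: "'a topology \<Rightarrow> ('a, 'e::complex_space) cchart \<Rightarrow> bool" where
  "is_cchart X = (\<lambda>(U, \<phi>). openin X U \<and> open (\<phi> ` U) \<and>
     homeomorphic_map (subtopology X U) (top_of_set (\<phi> ` U)) \<phi>)"

definition complex_manifold :: "('a, 'e::complex_space) cmanifold \<Rightarrow> bool" where
  "complex_manifold M \<longleftrightarrow>
     Hausdorff_space (mtop M) \<and> second_countable (mtop M) \<and>
     (\<forall>c\<in>atlas M. is_cchart (mtop M) c) \<and>
     (\<Union>(U, \<phi>)\<in>atlas M. U) = topspace (mtop M) \<and>
     (\<forall>(U, \<phi>)\<in>atlas M. \<forall>(V, \<psi>)\<in>atlas M. holo_on (\<psi> \<circ> inv_into U \<phi>) (\<phi> ` (U \<inter> V)))"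

definition open_submanifold ::
    "('a, 'e::complex_space) cmanifold \<Rightarrow> 'a set \<Rightarrow> ('a, 'e) cmanifold" where
  "open_submanifold M N =
     \<lparr>mtop = subtopology (mtop M) N, atlas = (\<lambda>(U, \<phi>). (U \<inter> N, \<phi>)) ` atlas M\<rparr>"

definition holo_from ::
    "('a, 'e::complex_space) cmanifold \<Rightarrow> ('a \<Rightarrow> 'f::complex_space) \<Rightarrow> bool" where
  "holo_from M F \<longleftrightarrow> (\<forall>(U, \<phi>)\<in>atlas M. holo_on (F \<circ> inv_into U \<phi>) (\<phi> ` U))"

definition holo_into ::
    "'f::complex_space set \<Rightarrow> ('a, 'e::complex_space) cmanifold \<Rightarrow> ('f \<Rightarrow> 'a) \<Rightarrow> bool" where
  "holo_into S M G \<longleftrightarrow>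
     continuous_map (top_of_set S) (mtop M) G \<and>
     (\<forall>(U, \<phi>)\<in>atlas M. holo_on (\<phi> \<circ> G) {x\<in>S. G x \<in> U})"

text \<open>\<open>S\<close> is meant to be an open subset or a complex submanifold of its ambient space.\<close>

definition biholomorphic_to ::
    "('a, 'e::complex_space) cmanifold \<Rightarrow> 'f::complex_space set \<Rightarrow> bool" where
  "biholomorphic_to M S \<longleftrightarrow>
     (\<exists>F G. holo_from M F \<and> holo_into S M G \<and> F ` topspace (mtop M) \<subseteq> S \<and>
        (\<forall>p\<in>topspace (mtop M). G (F p) = p) \<and> (\<forall>y\<in>S. F (G y) = y))"


section \<open>Kobayashi pseudodistance and infinitesimal Kobayashi metric\<close>

abbreviation unit_disc :: "complex set" ("\<Delta>") where
  "\<Delta> \<equiv> ball 0 1"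

definition poincare_dist :: "complex \<Rightarrow> complex \<Rightarrow> real" where
  "poincare_dist a b = artanh (cmod ((a - b) / (1 - cnj b * a)))"

definition kobayashi_dist :: "('a, 'e::complex_space) cmanifold \<Rightarrow> 'a \<Rightarrow> 'a \<Rightarrow> ennreal" where
  "kobayashi_dist M p q =
     Inf {ennreal (\<Sum>i<k. poincare_dist (a i) (b i)) | k a b.
        \<exists>x f. x 0 = p \<and> x k = q \<and>
          (\<forall>i<k. holo_into \<Delta> M (f i) \<and> a i \<in> \<Delta> \<and> b i \<in> \<Delta> \<and>
                 f i (a i) = x i \<and> f i (b i) = x (Suc i))}"

definition kobayashi_hyperbolic :: "('a, 'e::complex_space) cmanifold \<Rightarrow> bool" where
  "kobayashi_hyperbolic M \<longleftrightarrow>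
     (\<forall>p\<in>topspace (mtop M). \<forall>q\<in>topspace (mtop M). kobayashi_dist M p q = 0 \<longrightarrow> p = q)"

text \<open>
  A tangent vector at \<open>p\<close> is given by its coordinate vector \<open>v\<close> in a chart around \<open>p\<close>; coordinate
  vectors in different charts correspond under the complex linear isomorphism given by the
  derivative of the transition map.
\<close>

definition kobayashi_metric ::
    "('a, 'e::complex_space) cmanifold \<Rightarrow> ('a, 'e) cchart \<Rightarrow> 'a \<Rightarrow> 'e \<Rightarrow> real" where
  "kobayashi_metric M = (\<lambda>(U, \<phi>) p v.
     Inf {\<alpha>. \<alpha> > 0 \<and> (\<exists>f w. holo_into \<Delta> M f \<and> f 0 = p \<and>
        ((\<phi> \<circ> f) has_derivative (\<lambda>h. h *\<^sub>C w)) (at 0) \<and> v = \<alpha> *\<^sub>R w)})"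

definition has_kobayashi_corank :: "('a, 'e::complex_space) cmanifold \<Rightarrow> nat \<Rightarrow> bool" where
  "has_kobayashi_corank M k \<longleftrightarrow>
     (\<forall>p\<in>topspace (mtop M). \<forall>c\<in>atlas M. p \<in> fst c \<longrightarrow>
        complex_vector.dim {v. kobayashi_metric M c p v = 0} = k)"


section \<open>The domain and its retracts\<close>

text \<open>
  The ambient space is \<^typ>\<open>complex \<times> (complex ^ 'm)\<close>, of dimension \<open>n = CARD('m) + 1 \<ge> 2\<close>.
  The norm on \<^typ>\<open>complex ^ 'm\<close> is the Hermitian one.
\<close>

abbreviation unit_cball :: "(complex ^ 'm) set" ("\<bool>") where
  "\<bool> \<equiv> ball 0 1"

abbreviation disc_times_ball :: "(complex \<times> (complex ^ 'm)) set" ("\<Omega>") where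
  "\<Omega> \<equiv> \<Delta> \<times> \<bool>"

definition boundary_disc :: "(complex \<times> (complex ^ 'm)) set \<Rightarrow> bool" where
  "boundary_disc Z \<longleftrightarrow> (\<exists>c \<in> frontier \<bool>. Z = {(w, \<chi> i. c $ i * w) | w. w \<in> \<Delta>})"

definition graph_over_disc :: "(complex \<times> (complex ^ 'm)) set \<Rightarrow> bool" where
  "graph_over_disc Z \<longleftrightarrow> (\<exists>f. holo_on f \<Delta> \<and> f ` \<Delta> \<subseteq> \<bool> \<and> Z = {(w, f w) | w. w \<in> \<Delta>})"

definition graph_over :: "(complex ^ 'm) set \<Rightarrow> (complex \<times> (complex ^ 'm)) set \<Rightarrow> bool" where
  "graph_over B Z \<longleftrightarrow> (\<exists>g. holo_on g B \<and> g ` B \<subseteq> \<Delta> \<and> Z = {(g z, z) | z. z \<in> B})"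

text \<open>
  \<open>l \<inter> D\<close> has the dimension of \<open>l\<close> for every domain \<open>D\<close> containing the origin.
\<close>

definition linear_subspace_of :: "'a::complex_space set \<Rightarrow> 'a set \<Rightarrow> nat \<Rightarrow> bool" where
  "linear_subspace_of Z D k \<longleftrightarrow>
     (\<exists>l. complex_vector.subspace l \<and> complex_vector.dim l = k \<and> Z = l \<inter> D)"

end

theory Submission
  imports Defs "HOL-Complex_Analysis.Complex_Analysis"
begin

text \<open>Composing the charts with automorphisms of \<open>\<Omega>\<close>, assume that a point \<open>p\<close> of the first member of the
  sequence has coordinate \<open>0\<close> in all of them. Read in the charts, the inclusions \<open>f j k\<close> of the \<open>j\<close>-th
  member in the \<open>k\<close>-th are self maps of \<open>\<Omega>\<close> fixing \<open>0\<close>. After passing to a subsequence, \<open>f j k\<close>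
  converges to a map \<open>\<alpha> j\<close> as \<open>k\<close> tends to infinity, and \<open>\<alpha> j\<close> converges to a map \<open>\<rho>\<close>; then
  \<open>\<rho> \<circ> \<alpha> j = \<alpha> j\<close> and \<open>\<rho> \<circ> \<rho> = \<rho>\<close>.

  Points identified by \<open>\<alpha> j\<close> lie, for large \<open>k\<close>, at arbitrarily small distance on an affine disc of the
  \<open>k\<close>-th chart, so their Kobayashi distance is \<open>0\<close>. If \<open>M\<close> is hyperbolic, the \<open>\<alpha> j\<close> are therefore
  injective, \<open>\<rho>\<close> is the identity, and the images of the \<open>\<alpha> j\<close> exhaust \<open>\<Omega>\<close>.

  The directions in which \<open>F\<^sub>M\<close> vanishes at \<open>p\<close> form the kernel of the derivative of \<open>\<alpha> 0\<close>. If this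
  is a line, so is the kernel of the derivative \<open>D\<close> of \<open>\<rho>\<close>, and \<open>D\<close> is a projection that does not increase
  the norm of \<open>\<Omega>\<close>. The image of \<open>\<rho>\<close> is a graph over the intersection \<open>Y\<close> of \<open>\<Omega>\<close> with the range of
  \<open>D\<close>, and \<open>M\<close> is fibred over \<open>Y\<close>. Normalised to be \<open>0\<close> and \<open>1\<close> on two sections, the
  coordinates of the charts are univalent on the fibres, hence form a normal family, and a limit maps each
  fibre onto the plane. This gives trivializations over smaller balls; they differ by affine maps of the
  fibres, and solving a multiplicative and an additive Cousin problem on \<open>Y\<close> makes \<open>M\<close> biholomorphic to
  \<open>Y \<times> \<complex>\<close>. For \<open>n = 2\<close>, where \<open>Y\<close> is a disc, \<open>Z\<close> is taken to be \<open>{0} \<times> \<bool>\<close>.\<close>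

section \<open>Holomorphic maps in several variables\<close>

text \<open>The relations for \<open>\<rho>\<close> come from
  \<open>\<alpha> k \<circ> f j k = \<alpha> j\<close> by letting first \<open>k\<close> and then
  \<open>j\<close> tend to infinity. The obstacle in the corank one case is that the charts
  collapse: along a fibre the coordinates tend to a constant, and the limit retraction keeps no
  trace of the fibre direction. The collapse is undone by dividing by the difference of two
  sections. A univalent function is controlled on a smaller disc by its values at two points, which
  gives the normal family; and since the disc in which the coordinates live keeps a fixed radius
  while the two sections approach each other, the renormalised limit cannot omit a value. Only a
  product with the plane is asked for, so the curved image of \<open>\<rho>\<close> may be replaced
  by the linear slice over which it is a graph, and the projection \<open>D\<close> is itself a
  retraction onto that slice; this is why only two of the listed types are ever produced. A slice of
  dimension one is not among the permitted linear ones, hence the separate treatment of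
  \<open>n = 2\<close>.\<close>

abbreviation clinear :: "('a::complex_space \<Rightarrow> 'b::complex_space) \<Rightarrow> bool" where
  "clinear \<equiv> Vector_Spaces.linear scaleC scaleC"

text \<open>Differentiability in the ambient space is demanded at every point, so the notion makes
  sense on closed balls and compact sets without a local extension; on open sets it agrees with
  \<open>holo_on\<close>.\<close>

definition hol :: "('a::complex_space \<Rightarrow> 'b::complex_space) \<Rightarrow> 'a set \<Rightarrow> bool" where
  "hol f S \<longleftrightarrow> (\<forall>x\<in>S. complex_differentiable_at f x)"

lemma holD: "hol f S \<Longrightarrow> x \<in> S \<Longrightarrow> complex_differentiable_at f x"
  by (simp add: hol_def)

lemma holI: "(\<And>x. x \<in> S \<Longrightarrow> complex_differentiable_at f x) \<Longrightarrow> hol f S"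
  by (simp add: hol_def)

lemma hol_subset: "hol f S \<Longrightarrow> T \<subseteq> S \<Longrightarrow> hol f T"
  by (auto simp: hol_def)

lemma hol_imp_holo_on: "open S \<Longrightarrow> hol f S \<Longrightarrow> holo_on f S"
  by (simp add: hol_def holo_on_open)

lemma holo_on_imp_hol: "open S \<Longrightarrow> holo_on f S \<Longrightarrow> hol f S"
  by (simp add: hol_def holo_on_open)

lemma clinear_iff:
  "clinear D \<longleftrightarrow> (\<forall>x y. D (x + y) = D x + D y) \<and> (\<forall>c x. D (c *\<^sub>C x) = c *\<^sub>C D x)"
  unfolding Vector_Spaces.linear_iff
  by (auto intro: complex_vector.vector_space_axioms)

lemma clinear_add: "clinear D \<Longrightarrow> D (x + y) = D x + D y"
  and clinear_scaleC: "clinear D \<Longrightarrow> D (c *\<^sub>C x) = c *\<^sub>C D x"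
  by (auto simp: clinear_iff)

lemma clinear_imp_linear:
  assumes "clinear D" shows "linear D"
proof (rule linearI)
  show "D (x + y) = D x + D y" for x y using assms by (simp add: clinear_iff)
  show "D (r *\<^sub>R x) = r *\<^sub>R D x" for r x
    using assms by (metis clinear_iff scaleC_of_real)
qed

lemma clinear_imp_bounded_linear: "clinear D \<Longrightarrow> bounded_linear D"
  by (simp add: clinear_imp_linear linear_conv_bounded_linear[symmetric])

lemma clinear_diff: "clinear D \<Longrightarrow> D (x - y) = D x - D y"
  using clinear_imp_linear linear_diff by blast

lemma clinear_zero: "clinear D \<Longrightarrow> D 0 = 0"
  using clinear_imp_linear linear_0 by blast

lemma clinear_compose: "clinear D \<Longrightarrow> clinear E \<Longrightarrow> clinear (\<lambda>x. D (E x))"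
  by (auto simp: clinear_iff)

lemma scaleC_minus_left: "(- a) *\<^sub>C x = - (a *\<^sub>C (x::'a::complex_space))"
  by (rule complex_vector.scale_minus_left)

lemma bounded_bilinear_scaleC: "bounded_bilinear (scaleC :: complex \<Rightarrow> 'a::complex_space \<Rightarrow> 'a)"
proof
  fix a b :: complex and x y :: 'a and r :: real
  show "(a + b) *\<^sub>C x = a *\<^sub>C x + b *\<^sub>C x" by (rule scaleC_add_left)
  show "a *\<^sub>C (x + y) = a *\<^sub>C x + a *\<^sub>C y" by (rule scaleC_add_right)
  show "(r *\<^sub>R a) *\<^sub>C x = r *\<^sub>R (a *\<^sub>C x)"
    by (metis scaleC_of_real scaleC_scaleC scaleR_conv_of_real)
  show "a *\<^sub>C (r *\<^sub>R x) = r *\<^sub>R (a *\<^sub>C x)"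
    by (metis scaleC_of_real scaleC_scaleC mult.commute)
  show "\<exists>K. \<forall>a (x::'a). norm (a *\<^sub>C x) \<le> norm a * norm x * K"
    by (rule exI[of _ 1]) (simp add: norm_scaleC)
qed

lemma clinear_id: "clinear (\<lambda>x. x)" by (simp add: clinear_iff)
lemma clinear_zero_map: "clinear (\<lambda>x. 0)" by (simp add: clinear_iff)
lemma clinear_plus: "clinear D \<Longrightarrow> clinear E \<Longrightarrow> clinear (\<lambda>x. D x + E x)"
  by (simp add: clinear_iff scaleC_add_right algebra_simps)
lemma clinear_minus: "clinear D \<Longrightarrow> clinear E \<Longrightarrow> clinear (\<lambda>x. D x - E x)"
  by (simp add: clinear_iff complex_vector.scale_right_diff_distrib algebra_simps)
lemma clinear_fst: "clinear fst" by (simp add: clinear_iff scaleC_prod_def)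
lemma clinear_snd: "clinear snd" by (simp add: clinear_iff scaleC_prod_def)
lemma clinear_Pair: "clinear D \<Longrightarrow> clinear E \<Longrightarrow> clinear (\<lambda>x. (D x, E x))"
  by (simp add: clinear_iff scaleC_prod_def)
lemma clinear_scaleC_left: "clinear (\<lambda>a. a *\<^sub>C v)"
  by (simp add: clinear_iff scaleC_add_left scaleC_complex_def scaleC_scaleC)

lemma cdiff_at_I: "clinear D \<Longrightarrow> (f has_derivative D) (at x) \<Longrightarrow> complex_differentiable_at f x"
  unfolding complex_differentiable_at_def by blast

lemma cdiff_at_E:
  assumes "complex_differentiable_at f x"
  obtains D where "clinear D" "(f has_derivative D) (at x)"
  using assms unfolding complex_differentiable_at_def by blast

lemma cdiff_at_clinear: "clinear D \<Longrightarrow> complex_differentiable_at D x"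
  unfolding complex_differentiable_at_def
  using bounded_linear_imp_has_derivative clinear_imp_bounded_linear by blast

lemma cdiff_at_const: "complex_differentiable_at (\<lambda>x. c) x"
  unfolding complex_differentiable_at_def using clinear_zero_map has_derivative_const by blast

lemma cdiff_at_ident: "complex_differentiable_at (\<lambda>x. x) x"
  by (rule cdiff_at_clinear clinear_id)+

lemma cdiff_at_continuous: "complex_differentiable_at f x \<Longrightarrow> isCont f x"
  unfolding complex_differentiable_at_def using has_derivative_continuous by blast

lemma hol_continuous: "hol f S \<Longrightarrow> continuous_on S f"
  by (simp add: cdiff_at_continuous continuous_at_imp_continuous_on hol_def)

lemma cdiff_at_compose:
  assumes "complex_differentiable_at f x" "complex_differentiable_at g (f x)"
  shows "complex_differentiable_at (\<lambda>x. g (f x)) x"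
  using assms has_derivative_compose clinear_compose
  unfolding complex_differentiable_at_def by blast

lemma cdiff_at_add:
  "complex_differentiable_at f x \<Longrightarrow> complex_differentiable_at g x \<Longrightarrow>
   complex_differentiable_at (\<lambda>x. f x + g x) x"
  by (elim cdiff_at_E, rule cdiff_at_I[rotated], erule (1) has_derivative_add, erule (1) clinear_plus)

lemma cdiff_at_diff:
  "complex_differentiable_at f x \<Longrightarrow> complex_differentiable_at g x \<Longrightarrow>
   complex_differentiable_at (\<lambda>x. f x - g x) x"
  by (elim cdiff_at_E, rule cdiff_at_I[rotated], erule (1) has_derivative_diff, erule (1) clinear_minus)

lemma cdiff_at_Pair:
  "complex_differentiable_at f x \<Longrightarrow> complex_differentiable_at g x \<Longrightarrow>
   complex_differentiable_at (\<lambda>x. (f x, g x)) x"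
  by (elim cdiff_at_E, rule cdiff_at_I[rotated], erule (1) has_derivative_Pair, erule (1) clinear_Pair)

lemma cdiff_at_scaleC:
  assumes "complex_differentiable_at f x" "complex_differentiable_at g x"
  shows "complex_differentiable_at (\<lambda>x. f x *\<^sub>C g x) x"
proof -
  obtain D E where D: "clinear D" "(f has_derivative D) (at x)"
    and E: "clinear E" "(g has_derivative E) (at x)"
    using assms unfolding complex_differentiable_at_def by blast
  have "((\<lambda>x. f x *\<^sub>C g x) has_derivative (\<lambda>h. f x *\<^sub>C E h + D h *\<^sub>C g x)) (at x)"
    by (rule bounded_bilinear.FDERIV[OF bounded_bilinear_scaleC D(2) E(2)])
  moreover have "clinear (\<lambda>h. f x *\<^sub>C E h + D h *\<^sub>C g x)"
    using D(1) E(1)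
    by (simp add: clinear_iff scaleC_add_right scaleC_add_left scaleC_scaleC scaleC_complex_def
        algebra_simps)
  ultimately show ?thesis unfolding complex_differentiable_at_def by blast
qed

lemma cdiff_at_mult:
  fixes f g :: "'a::complex_space \<Rightarrow> complex"
  assumes "complex_differentiable_at f x" "complex_differentiable_at g x"
  shows "complex_differentiable_at (\<lambda>x. f x * g x) x"
  using cdiff_at_scaleC[OF assms] by (simp add: scaleC_complex_def)

lemma cdiff_at_iff_field_differentiable:
  fixes f :: "complex \<Rightarrow> complex"
  shows "complex_differentiable_at f z \<longleftrightarrow> f field_differentiable at z"
proof
  assume "complex_differentiable_at f z"
  then obtain D where D: "clinear D" "(f has_derivative D) (at z)"
    unfolding complex_differentiable_at_def by blast
  have "D x = D 1 * x" for x
    using clinear_scaleC[OF D(1), of x 1] by (simp add: scaleC_complex_def)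
  then have "D = times (D 1)" by blast
  with D(2) show "f field_differentiable at z"
    unfolding field_differentiable_def has_field_derivative_def by metis
next
  assume "f field_differentiable at z"
  then obtain d where "(f has_derivative times d) (at z)"
    unfolding field_differentiable_def has_field_derivative_def by blast
  moreover have "clinear (times d)" by (simp add: clinear_iff scaleC_complex_def distrib_left)
  ultimately show "complex_differentiable_at f z" unfolding complex_differentiable_at_def by blast
qed

lemma hol_iff_holomorphic_on:
  "open S \<Longrightarrow> hol f S \<longleftrightarrow> f holomorphic_on S"
  by (simp add: hol_def cdiff_at_iff_field_differentiable holomorphic_on_def
      at_within_open[of _ S])

lemma cdiff_at_field_compose:
  fixes f :: "'a::complex_space \<Rightarrow> complex"
  assumes "complex_differentiable_at f x" "g field_differentiable at (f x)"
  shows "complex_differentiable_at (\<lambda>x. g (f x)) x"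
  using cdiff_at_compose[OF assms(1), of g] assms(2) by (simp add: cdiff_at_iff_field_differentiable)

lemma cdiff_at_divide:
  fixes f g :: "'a::complex_space \<Rightarrow> complex"
  assumes "complex_differentiable_at f x" "complex_differentiable_at g x" "g x \<noteq> 0"
  shows "complex_differentiable_at (\<lambda>x. f x / g x) x"
proof -
  have "complex_differentiable_at (\<lambda>x. inverse (g x)) x"
    by (rule cdiff_at_field_compose[OF assms(2)])
       (use assms(3) in \<open>auto intro!: derivative_intros field_differentiable_inverse\<close>)
  from cdiff_at_mult[OF assms(1) this] show ?thesis by (simp add: divide_inverse)
qed

lemma cdiff_at_exp:
  fixes f :: "'a::complex_space \<Rightarrow> complex"
  assumes "complex_differentiable_at f x"
  shows "complex_differentiable_at (\<lambda>x. exp (f x)) x"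
  by (rule cdiff_at_field_compose[OF assms field_differentiable_within_exp])

lemma cdiff_at_transform:
  assumes "complex_differentiable_at f x" "open S" "x \<in> S" "\<And>y. y \<in> S \<Longrightarrow> f y = g y"
  shows "complex_differentiable_at g x"
  using assms(1)
proof (rule cdiff_at_E)
  fix D assume "clinear D" "(f has_derivative D) (at x)"
  have "(g has_derivative D) (at x)"
    by (rule has_derivative_transform_within_open[where f = f and s = S]) (use assms \<open>(f has_derivative D) (at x)\<close> in auto)
  with \<open>clinear D\<close> show ?thesis by (rule cdiff_at_I)
qed

lemma hol_cong: "open S \<Longrightarrow> hol f S \<Longrightarrow> (\<And>y. y \<in> S \<Longrightarrow> f y = g y) \<Longrightarrow> hol g S"
  by (auto simp: hol_def intro: cdiff_at_transform)

lemma cdiff_at_line: "complex_differentiable_at (\<lambda>t. x + t *\<^sub>C v) t"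
  by (intro cdiff_at_add cdiff_at_const cdiff_at_clinear clinear_scaleC_left)

lemma cdiff_at_sum:
  assumes "finite A" "\<And>i. i \<in> A \<Longrightarrow> complex_differentiable_at (f i) x"
  shows "complex_differentiable_at (\<lambda>x. \<Sum>i\<in>A. f i x) x"
  using assms by (induction A rule: finite_induct) (auto intro: cdiff_at_const cdiff_at_add)

text \<open>A \<^class>\<open>complex_space\<close> only carries a real inner product; \<open>\<lambda>x. cfun b x\<close> is the complex linear
  functional whose real part is \<open>\<lambda>x. x \<bullet> b\<close>.\<close>

definition cfun :: "'a::complex_space \<Rightarrow> 'a \<Rightarrow> complex" where
  "cfun b x = Complex (x \<bullet> b) (- ((\<i> *\<^sub>C x) \<bullet> b))"

lemma clinear_cfun: "clinear (cfun b)"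
  unfolding clinear_iff
proof (intro conjI allI)
  fix x y :: 'a and c :: complex
  show "cfun b (x + y) = cfun b x + cfun b y"
    by (simp add: cfun_def complex_eq_iff scaleC_add_right inner_add_left)
  have c: "c *\<^sub>C x = Re c *\<^sub>R x + Im c *\<^sub>R (\<i> *\<^sub>C x)" for x :: 'a
  proof -
    have "c = complex_of_real (Re c) + complex_of_real (Im c) * \<i>"
      by (simp add: complex_eq_iff)
    then have "c *\<^sub>C x = complex_of_real (Re c) *\<^sub>C x + complex_of_real (Im c) *\<^sub>C (\<i> *\<^sub>C x)"
      by (metis scaleC_add_left scaleC_scaleC)
    moreover have "complex_of_real (Im c) *\<^sub>C (\<i> *\<^sub>C x) = Im c *\<^sub>R (\<i> *\<^sub>C x)"
      by (rule scaleC_of_real)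
    ultimately show ?thesis by (simp only: scaleC_of_real)
  qed
  have "\<i> *\<^sub>C (c *\<^sub>C x) = c *\<^sub>C (\<i> *\<^sub>C x)"
    by (metis scaleC_scaleC mult.commute)
  also have "\<dots> = Re c *\<^sub>R (\<i> *\<^sub>C x) + Im c *\<^sub>R (\<i> *\<^sub>C (\<i> *\<^sub>C x))" by (rule c)
  also have "\<i> *\<^sub>C (\<i> *\<^sub>C x) = - x" by (simp add: scaleC_minus_left)
  finally have "\<i> *\<^sub>C (c *\<^sub>C x) = Re c *\<^sub>R (\<i> *\<^sub>C x) + Im c *\<^sub>R (- x)" .
  then have "(\<i> *\<^sub>C (c *\<^sub>C x)) \<bullet> b = Re c * ((\<i> *\<^sub>C x) \<bullet> b) - Im c * (x \<bullet> b)"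
    by (simp only: inner_add_left inner_scaleR_left inner_minus_left)
  moreover have "(c *\<^sub>C x) \<bullet> b = Re c * (x \<bullet> b) + Im c * ((\<i> *\<^sub>C x) \<bullet> b)"
    by (simp only: c inner_add_left inner_scaleR_left)
  ultimately show "cfun b (c *\<^sub>C x) = c *\<^sub>C cfun b x"
    unfolding cfun_def scaleC_complex_def complex_eq_iff by (simp del: complex_vector.scale_scale)
qed

lemma Re_cfun: "Re (cfun b x) = x \<bullet> b" by (simp add: cfun_def)

text \<open>Multiplying \<open>x\<close> by a complex number of modulus one makes the value real and
  nonnegative; it is then the inner product of the rotated vector with \<open>b\<close>, and
  Cauchy-Schwarz applies.\<close>

lemma norm_cfun_le: "cmod (cfun b x) \<le> norm x * norm b"
proof (cases "cfun b x = 0")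
  case False
  define u where "u = cnj (cfun b x) / cmod (cfun b x)"
  have u: "cmod u = 1" "u * cfun b x = cmod (cfun b x)"
    using False complex_norm_square[of "cfun b x"]
    by (auto simp: u_def norm_divide power2_eq_square mult.commute divide_eq_eq)
  have "cmod (cfun b x) = Re (cfun b (u *\<^sub>C x))"
    using clinear_scaleC[OF clinear_cfun, of b u x] u(2) by (simp add: scaleC_complex_def)
  also have "\<dots> \<le> norm (u *\<^sub>C x) * norm b" by (simp add: Re_cfun norm_cauchy_schwarz)
  finally show ?thesis using u(1) by (simp add: norm_scaleC)
qed simp

text \<open>Together with \<open>norm_cfun_le\<close> this gives a norming functional for
  \<open>x\<close>: estimates for vector-valued maps follow from scalar ones by composing with it,
  which is how the one-variable theorems enter below.\<close>

lemma cfun_norm_attained: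
  assumes "x \<noteq> 0" shows "cmod (cfun (x /\<^sub>R norm x) x) \<ge> norm x"
proof -
  have "Re (cfun (x /\<^sub>R norm x) x) = norm x"
    using assms by (simp add: Re_cfun inner_scaleR_right power2_norm_eq_inner[symmetric] power2_eq_square)
  then show ?thesis using complex_Re_le_cmod by metis
qed

section \<open>Restriction to complex lines and Cauchy estimates\<close>

lemma cdiff_at_along_line:
  fixes f :: "'a::complex_space \<Rightarrow> 'b::complex_space"
  assumes "complex_differentiable_at f (x + t *\<^sub>C v)"
  shows "complex_differentiable_at (\<lambda>t. f (x + t *\<^sub>C v)) t"
  by (rule cdiff_at_compose[OF cdiff_at_line assms])

lemma has_derivative_along_line:
  fixes f :: "'a::complex_space \<Rightarrow> 'b::complex_space"
  assumes "(f has_derivative D) (at (x + t *\<^sub>C v))"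
  shows "((\<lambda>t. f (x + t *\<^sub>C v)) has_derivative (\<lambda>h. D (h *\<^sub>C v))) (at t)"
proof -
  have "((\<lambda>t. x + t *\<^sub>C v) has_derivative (\<lambda>h. h *\<^sub>C v)) (at t)"
    using has_derivative_add[OF has_derivative_const[of x]
        bounded_linear_imp_has_derivative[OF clinear_imp_bounded_linear[OF clinear_scaleC_left[of v]]]]
    by simp
  from has_derivative_compose[OF this assms] show ?thesis .
qed

lemma cfun_has_field_derivative:
  assumes D: "clinear D" "(g has_derivative D) (at (t::complex))"
  shows "((\<lambda>t. cfun b (g t)) has_field_derivative cfun b (D 1)) (at t)"
proof -
  have 1: "((\<lambda>t. cfun b (g t)) has_derivative (\<lambda>h. cfun b (D h))) (at t)"
    by (rule has_derivative_compose[OF D(2) bounded_linear_imp_has_derivative[OF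
        clinear_imp_bounded_linear[OF clinear_cfun]]])
  have "cfun b (D h) = cfun b (D 1) * h" for h
    using clinear_scaleC[OF D(1), of h 1] clinear_scaleC[OF clinear_cfun, of b h "D 1"]
    by (simp add: scaleC_complex_def mult.commute)
  then have "(\<lambda>h. cfun b (D h)) = times (cfun b (D 1))" by blast
  with 1 show ?thesis unfolding has_field_derivative_def by simp
qed

text \<open>Composed with a functional that norms \<open>D v\<close> and restricted to the line
  through \<open>x\<close> in direction \<open>v\<close>, the map becomes a function of one variable
  on a disc of radius \<open>r / norm v\<close>, to which Cauchy's inequality for the first
  derivative applies.\<close>

lemma cauchy_derivative_bound:
  fixes f :: "'a::complex_space \<Rightarrow> 'b::complex_space"
  assumes hol: "hol f (cball x r)" and r: "0 < r" and B: "\<And>y. y \<in> cball x r \<Longrightarrow> norm (f y) \<le> B"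
    and D: "clinear D" "(f has_derivative D) (at x)"
  shows "norm (D v) \<le> B / r * norm v"
proof (cases "D v = 0")
  case True
  have "0 \<le> B" using B[of x] r norm_ge_zero[of "f x"] by (simp del: norm_ge_zero)
  with True r show ?thesis by simp
next
  case False
  then have v: "v \<noteq> 0" using clinear_zero[OF D(1)] by auto
  define b where "b = D v /\<^sub>R norm (D v)"
  have nb: "norm b = 1" using False by (simp add: b_def)
  define s where "s = r / norm v"
  have s: "0 < s" using r v by (simp add: s_def)
  define g where "g t = cfun b (f (x + t *\<^sub>C v))" for t
  have inb: "x + t *\<^sub>C v \<in> cball x r" if "cmod t \<le> s" for t
    using that v by (simp add: s_def dist_norm norm_scaleC field_simps)
  have cd: "complex_differentiable_at g t" if "cmod t \<le> s" for t
    unfolding g_def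
    by (rule cdiff_at_compose[OF cdiff_at_along_line cdiff_at_clinear[OF clinear_cfun]])
       (use that inb hol in \<open>auto simp: hol_def\<close>)
  have "norm ((deriv ^^ 1) g 0) \<le> fact 1 * B / s ^ 1"
  proof (rule Cauchy_inequality)
    show "g holomorphic_on ball 0 s"
      using cd by (auto simp: hol_iff_holomorphic_on[symmetric] hol_def)
    show "continuous_on (cball 0 s) g"
      using cd by (auto intro!: continuous_at_imp_continuous_on cdiff_at_continuous)
    show "norm (g t) \<le> B" if "norm (0 - t) = s" for t
    proof -
      have "norm (g t) \<le> norm (f (x + t *\<^sub>C v))"
        unfolding g_def using norm_cfun_le[of b] nb by (metis mult.right_neutral)
      also have "\<dots> \<le> B" using that inb B by auto
      finally show ?thesis .
    qed
  qed (use s in auto)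
  moreover have "deriv g 0 = cfun b (D v)"
  proof (rule DERIV_imp_deriv)
    have "((\<lambda>t. f (x + t *\<^sub>C v)) has_derivative (\<lambda>h. D (h *\<^sub>C v))) (at 0)"
      by (rule has_derivative_along_line) (use D in simp)
    from cfun_has_field_derivative[OF _ this, of b]
    show "(g has_field_derivative cfun b (D v)) (at 0)"
      unfolding g_def using clinear_compose[OF D(1) clinear_scaleC_left] by simp
  qed
  moreover have "norm (D v) \<le> cmod (cfun b (D v))"
    unfolding b_def by (rule cfun_norm_attained[OF False])
  ultimately have "norm (D v) \<le> B / s" by simp
  then show ?thesis by (simp add: s_def)
qed

text \<open>The Cauchy estimate bounds the derivative on \<open>S\<close> by \<open>B / r\<close>,
  and the mean value inequality on the convex set \<open>S\<close> integrates it. It supplies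
  equicontinuity for Montel's theorem and the contraction factor in
  \<open>near_identity\<close>.\<close>

lemma hol_lipschitz:
  fixes f :: "'a::complex_space \<Rightarrow> 'b::complex_space"
  assumes S: "convex S" and r: "0 < r" and hol: "\<And>x. x \<in> S \<Longrightarrow> hol f (cball x r)"
    and B: "\<And>x y. x \<in> S \<Longrightarrow> y \<in> cball x r \<Longrightarrow> norm (f y) \<le> B"
    and xy: "x \<in> S" "y \<in> S"
  shows "norm (f x - f y) \<le> B / r * norm (x - y)"
proof -
  have "\<forall>z. \<exists>D. z \<in> S \<longrightarrow> clinear D \<and> (f has_derivative D) (at z)"
    using hol r by (metis centre_in_cball complex_differentiable_at_def hol_def less_imp_le)
  then obtain D where D: "\<And>z. z \<in> S \<Longrightarrow> clinear (D z)" "\<And>z. z \<in> S \<Longrightarrow> (f has_derivative D z) (at z)"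
    by metis
  show ?thesis
  proof (rule differentiable_bound[OF S _ _ xy(1) xy(2)])
    show "(f has_derivative D z) (at z within S)" if "z \<in> S" for z
      using D(2)[OF that] by (rule has_derivative_at_withinI)
    show "onorm (D z) \<le> B / r" if "z \<in> S" for z
      by (rule onorm_le) (rule cauchy_derivative_bound[OF hol[OF that] r B[OF that] D(1)[OF that] D(2)[OF that]])
  qed
qed

text \<open>The families \<open>f\<close> below often consist of maps that are only well behaved near a given compact set
  from some index on. Hence convergence (\<open>luc\<close>, locally uniform), holomorphy (\<open>ehol\<close>) and
  boundedness (\<open>elb\<close>) are all eventual properties on compact sets.\<close>

definition luc :: "(nat \<Rightarrow> 'a::topological_space \<Rightarrow> 'b::metric_space) \<Rightarrow> ('a \<Rightarrow> 'b) \<Rightarrow> 'a set \<Rightarrow> bool" where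
  "luc f g U \<longleftrightarrow> (\<forall>K. compact K \<longrightarrow> K \<subseteq> U \<longrightarrow> uniform_limit K f g sequentially)"

lemma lucD: "luc f g U \<Longrightarrow> compact K \<Longrightarrow> K \<subseteq> U \<Longrightarrow> uniform_limit K f g sequentially"
  by (simp add: luc_def)

lemma luc_eventually:
  "luc f g U \<Longrightarrow> compact K \<Longrightarrow> K \<subseteq> U \<Longrightarrow> e > 0 \<Longrightarrow> \<forall>\<^sub>F n in sequentially. \<forall>x\<in>K. dist (f n x) (g x) < e"
  using lucD uniform_limitD by blast

lemma luc_pointwise: "luc f g U \<Longrightarrow> x \<in> U \<Longrightarrow> (\<lambda>n. f n x) \<longlonglongrightarrow> g x"
  by (metis compact_sing empty_subsetI insert_subset lucD singletonI tendsto_uniform_limitI)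

lemma luc_subseq: "luc f g U \<Longrightarrow> strict_mono r \<Longrightarrow> luc (\<lambda>n. f (r n)) g U"
  unfolding luc_def by (auto intro: filterlim_compose[OF _ filterlim_subseq] simp: comp_def)

definition ehol :: "(nat \<Rightarrow> 'a::complex_space \<Rightarrow> 'b::complex_space) \<Rightarrow> 'a set \<Rightarrow> bool" where
  "ehol f U \<longleftrightarrow> (\<forall>K. compact K \<longrightarrow> K \<subseteq> U \<longrightarrow> (\<forall>\<^sub>F n in sequentially. hol (f n) K))"

lemma eholD: "ehol f U \<Longrightarrow> compact K \<Longrightarrow> K \<subseteq> U \<Longrightarrow> \<forall>\<^sub>F n in sequentially. hol (f n) K"
  by (simp add: ehol_def)

lemma eholI:
  "(\<forall>\<^sub>F n in sequentially. hol (f n) U) \<Longrightarrow> ehol f U"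
  unfolding ehol_def by (metis (mono_tags, lifting) eventually_mono hol_subset)

lemma hol_diff: "hol f S \<Longrightarrow> hol g S \<Longrightarrow> hol (\<lambda>x. f x - g x) S"
  by (simp add: hol_def cdiff_at_diff)

lemma norm_plus_one_pos: "0 < norm h + 1"
  by (simp add: add_nonneg_pos)

lemma divide_norm_plus_one_times_less: "0 < e \<Longrightarrow> e / (norm h + 1) * norm h < e"
  using norm_plus_one_pos[of h] by (simp add: divide_less_eq)

text \<open>Applied to differences of members of the sequence, the Cauchy estimate makes the
  derivatives uniformly Cauchy on a ball of half the size, so they converge to the derivative of the
  limit; complex linearity passes to the limit pointwise.\<close>

lemma weierstrass:
  fixes f :: "nat \<Rightarrow> 'a::complex_space \<Rightarrow> 'b::complex_space"
  assumes U: "open U" and lim: "luc f g U" and hol: "ehol f U"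
  shows "hol g U"
proof (rule holI)
  fix x assume x: "x \<in> U"
  then obtain r0 where r0: "r0 > 0" "cball x r0 \<subseteq> U" using U open_contains_cball by blast
  define r where "r = r0 / 2"
  have r: "r > 0" and inU: "cball x (2 * r) \<subseteq> U" using r0 by (auto simp: r_def)
  define S where "S = ball x r"
  have bS: "cball y r \<subseteq> cball x (2 * r)" if "y \<in> S" for y
  proof
    fix z assume "z \<in> cball y r"
    then show "z \<in> cball x (2 * r)" using that dist_triangle[of x z y] by (auto simp: S_def)
  qed
  obtain N where N: "\<And>n. n \<ge> N \<Longrightarrow> hol (f n) (cball x (2 * r))"
    using eholD[OF hol compact_cball inU] by (auto simp: eventually_sequentially)
  \<comment> \<open>Early members need not be holomorphic near \<open>x\<close>; the shift of index
    discards them.\<close>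
  define F where "F n = f (n + N)" for n
  have holF: "hol (F n) (cball x (2 * r))" for n by (simp add: F_def N)
  have "\<forall>n y. \<exists>D. y \<in> S \<longrightarrow> clinear D \<and> (F n has_derivative D) (at y)"
    using holF bS r by (metis centre_in_cball complex_differentiable_at_def hol_def less_imp_le subsetD)
  then obtain F' where F': "\<And>n y. y \<in> S \<Longrightarrow> clinear (F' n y)"
      "\<And>n y. y \<in> S \<Longrightarrow> (F n has_derivative F' n y) (at y)"
    by metis
  have cau: "\<exists>M. \<forall>m\<ge>M. \<forall>n\<ge>M. \<forall>y\<in>S. \<forall>h. norm (F' m y h - F' n y h) \<le> e * norm h" if e: "e > 0" for e
  proof -
    have "e * r / 2 > 0" using e r by simp
    from luc_eventually[OF lim compact_cball inU this]
    obtain M where M: "\<And>n z. n \<ge> M \<Longrightarrow> z \<in> cball x (2 * r) \<Longrightarrow> dist (f n z) (g z) < e * r / 2"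
      unfolding eventually_sequentially by blast
    have "norm (F' m y h - F' n y h) \<le> e * norm h" if mn: "m \<ge> M" "n \<ge> M" and y: "y \<in> S" for m n y h
    proof -
      have "norm (F' m y h - F' n y h) \<le> (e * r) / r * norm h"
      proof (rule cauchy_derivative_bound[where f = "\<lambda>z. F m z - F n z"])
        show "hol (\<lambda>z. F m z - F n z) (cball y r)"
          by (rule hol_subset[OF hol_diff[OF holF holF] bS[OF y]])
        show "norm (F m z - F n z) \<le> e * r" if "z \<in> cball y r" for z
        proof -
          have z: "z \<in> cball x (2 * r)" using that bS[OF y] by blast
          have "dist (F m z) (F n z) \<le> dist (F m z) (g z) + dist (F n z) (g z)"
            by (rule dist_triangle2)
          then show ?thesis using M[OF _ z, of "m + N"] M[OF _ z, of "n + N"] mn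
            by (simp add: F_def dist_norm)
        qed
        show "clinear (\<lambda>v. F' m y v - F' n y v)" by (intro clinear_minus F' y)
        show "((\<lambda>z. F m z - F n z) has_derivative (\<lambda>v. F' m y v - F' n y v)) (at y)"
          by (intro has_derivative_diff F' y)
      qed (rule r)
      then show ?thesis using r by simp
    qed
    then show ?thesis by blast
  qed
  have "convergent (\<lambda>n. F' n y h)" if y: "y \<in> S" for y h
    unfolding Cauchy_convergent_iff[symmetric]
  proof (rule CauchyI)
    fix e :: real assume e: "e > 0"
    define e' where "e' = e / (norm h + 1)"
    have e': "e' > 0" "e' * norm h < e" unfolding e'_def
      using e norm_plus_one_pos[of h] divide_norm_plus_one_times_less[OF e] by auto
    from cau[OF e'(1)] obtain M where "\<forall>m\<ge>M. \<forall>n\<ge>M. \<forall>y\<in>S. \<forall>h. norm (F' m y h - F' n y h) \<le> e' * norm h" ..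
    then show "\<exists>M. \<forall>m\<ge>M. \<forall>n\<ge>M. norm (F' m y h - F' n y h) < e"
      using y e'(2) by (meson order_le_less_trans)
  qed
  then obtain G' where G': "\<And>y h. y \<in> S \<Longrightarrow> (\<lambda>n. F' n y h) \<longlonglongrightarrow> G' y h"
    unfolding convergent_def by metis
  have xS: "x \<in> S" using r by (simp add: S_def)
  have SU: "S \<subseteq> U" using inU r by (auto simp: S_def)
  have Fg: "(\<lambda>n. F n y) \<longlonglongrightarrow> g y" if "y \<in> S" for y
    unfolding F_def using luc_pointwise[OF lim] SU that LIMSEQ_ignore_initial_segment by blast
  have "\<exists>g0. \<forall>y\<in>S. (\<lambda>n. F n y) \<longlonglongrightarrow> g0 y \<and> (g0 has_derivative G' y) (at y within S)"
  proof (rule has_derivative_sequence[where f = F and f' = F' and ?x0.0 = x and l = "g x"])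
    show "convex S" by (simp add: S_def)
    show "(F n has_derivative F' n y) (at y within S)" if "y \<in> S" for n y
      using F'(2)[OF that] by (rule has_derivative_at_withinI)
    show "\<forall>\<^sub>F n in sequentially. \<forall>y\<in>S. \<forall>h. norm (F' n y h - G' y h) \<le> e * norm h" if e: "e > 0" for e
    proof -
      from cau[OF e] obtain M where
        M: "\<And>m n y h. m \<ge> M \<Longrightarrow> n \<ge> M \<Longrightarrow> y \<in> S \<Longrightarrow> norm (F' m y h - F' n y h) \<le> e * norm h" by metis
      have "norm (F' n y h - G' y h) \<le> e * norm h" if "n \<ge> M" "y \<in> S" for n y h
      proof (rule LIMSEQ_le_const2)
        show "(\<lambda>m. norm (F' n y h - F' m y h)) \<longlonglongrightarrow> norm (F' n y h - G' y h)"
          by (intro tendsto_intros G' that)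
        show "\<exists>N. \<forall>m\<ge>N. norm (F' n y h - F' m y h) \<le> e * norm h" using M that by blast
      qed
      then show ?thesis unfolding eventually_sequentially by blast
    qed
    show "x \<in> S" by (rule xS)
    show "(\<lambda>n. F n x) \<longlonglongrightarrow> g x" by (rule Fg[OF xS])
  qed
  then obtain g0 where g0: "\<And>y. y \<in> S \<Longrightarrow> (\<lambda>n. F n y) \<longlonglongrightarrow> g0 y"
      "\<And>y. y \<in> S \<Longrightarrow> (g0 has_derivative G' y) (at y within S)" by blast
  have eq: "g0 y = g y" if "y \<in> S" for y using LIMSEQ_unique g0(1) Fg that by blast
  have oS: "open S" by (simp add: S_def)
  have "(g0 has_derivative G' x) (at x)" using g0(2)[OF xS] at_within_open[OF xS oS] by simp
  then have "(g has_derivative G' x) (at x)"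
    by (rule has_derivative_transform_within_open[OF _ oS xS]) (simp add: eq)
  moreover have "clinear (G' x)"
    unfolding clinear_iff
  proof (intro conjI allI)
    fix a b :: 'a and c :: complex
    have "(\<lambda>n. F' n x (a + b)) \<longlonglongrightarrow> G' x a + G' x b"
      using tendsto_add[OF G'[OF xS] G'[OF xS]] clinear_add[OF F'(1)[OF xS]] by simp
    then show "G' x (a + b) = G' x a + G' x b" using G'[OF xS] LIMSEQ_unique by blast
    have "(\<lambda>n. F' n x (c *\<^sub>C a)) \<longlonglongrightarrow> c *\<^sub>C G' x a"
      using bounded_linear.tendsto[OF bounded_bilinear.bounded_linear_right[OF bounded_bilinear_scaleC] G'[OF xS]]
        clinear_scaleC[OF F'(1)[OF xS]] by simp
    then show "G' x (c *\<^sub>C a) = c *\<^sub>C G' x a" using G'[OF xS] LIMSEQ_unique by blast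
  qed
  ultimately show "complex_differentiable_at g x" by (rule cdiff_at_I[rotated])
qed

text \<open>The difference \<open>f n - g\<close> tends to \<open>0\<close> uniformly on a ball
  about \<open>x\<close>, so the Cauchy estimate makes the difference of the derivatives
  small.\<close>

lemma luc_derivative:
  fixes f :: "nat \<Rightarrow> 'a::complex_space \<Rightarrow> 'b::complex_space"
  assumes U: "open U" "x \<in> U" and lim: "luc f g U" and hol: "ehol f U"
    and D: "\<forall>\<^sub>F n in sequentially. clinear (D n) \<and> (f n has_derivative D n) (at x)"
    and G: "clinear G" "(g has_derivative G) (at x)"
  shows "(\<lambda>n. D n v) \<longlonglongrightarrow> G v"
proof (rule LIMSEQ_I)
  fix e :: real assume e: "e > 0"
  obtain r where r: "r > 0" "cball x r \<subseteq> U" using U open_contains_cball by blast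
  define d where "d = e * r / (norm v + 1)"
  have d: "d > 0" using e r norm_plus_one_pos[of v] by (simp add: d_def)
  have holg: "hol g (cball x r)" using weierstrass[OF U(1) lim hol] r(2) by (rule hol_subset)
  have "\<forall>\<^sub>F n in sequentially. norm (D n v - G v) < e"
    using luc_eventually[OF lim compact_cball r(2) d] eholD[OF hol compact_cball r(2)] D
  proof eventually_elim
    case (elim n)
    have "norm (D n v - G v) \<le> d / r * norm v"
    proof (rule cauchy_derivative_bound[where f = "\<lambda>z. f n z - g z"])
      show "hol (\<lambda>z. f n z - g z) (cball x r)" using elim holg by (intro hol_diff)
      show "norm (f n z - g z) \<le> d" if "z \<in> cball x r" for z
        using elim that by (auto simp: dist_norm intro: less_imp_le)
      show "clinear (\<lambda>v. D n v - G v)" using elim G by (intro clinear_minus) auto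
      show "((\<lambda>z. f n z - g z) has_derivative (\<lambda>v. D n v - G v)) (at x)"
        using elim G by (intro has_derivative_diff) auto
    qed (rule r)
    also have "\<dots> = e * (norm v / (norm v + 1))" using r by (simp add: d_def)
    also have "\<dots> < e * 1"
      by (rule mult_strict_left_mono[OF _ e]) (use norm_plus_one_pos[of v] in \<open>simp add: divide_less_eq\<close>)
    finally show ?case by simp
  qed
  then show "\<exists>N. \<forall>n\<ge>N. norm (D n v - G v) < e" by (simp add: eventually_sequentially)
qed

section \<open>Montel's theorem for sequences with eventual bounds\<close>

definition elb :: "(nat \<Rightarrow> 'a::complex_space \<Rightarrow> 'b::complex_space) \<Rightarrow> 'a set \<Rightarrow> bool" where
  "elb f U \<longleftrightarrow> (\<forall>K. compact K \<longrightarrow> K \<subseteq> U \<longrightarrow> (\<exists>B. \<forall>\<^sub>F n in sequentially. \<forall>x\<in>K. norm (f n x) \<le> B))"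

text \<open>Arzela-Ascoli, with equicontinuity from \<open>hol_lipschitz\<close>. The number
  \<open>N\<close> is chosen before the sequence \<open>s\<close>, and smaller indices are replaced
  by it: the diagonal argument needs one and the same truncation for all subsequences.\<close>

lemma montel_compact:
  fixes f :: "nat \<Rightarrow> 'a::complex_space \<Rightarrow> 'b::complex_space"
  assumes U: "open U" and hol: "ehol f U" and bd: "elb f U" and K: "compact K" "K \<subseteq> U"
  shows "\<exists>N. \<forall>s. \<exists>g k. strict_mono (k :: nat \<Rightarrow> nat) \<and>
    uniform_limit K (\<lambda>n. f (max (s (k n)) N)) g sequentially"
proof -
  obtain d where d: "d > 0" "(\<Union>x\<in>K. cball x d) \<subseteq> U"
    using compact_subset_open_imp_cball_epsilon_subset[OF K(1) U K(2)] by blast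
  define r where "r = d / 2"
  have r: "r > 0" "d = 2 * r" using d by (auto simp: r_def)
  define L where "L = (\<Union>x\<in>K. cball x d)"
  have L: "compact L" unfolding L_def by (rule compact_minkowski_sum_cball[OF K(1)])
  have LU: "L \<subseteq> U" using d by (simp add: L_def)
  obtain B where B: "\<forall>\<^sub>F n in sequentially. \<forall>x\<in>L. norm (f n x) \<le> B"
    using bd L LU unfolding elb_def by blast
  obtain N where N: "\<And>n. n \<ge> N \<Longrightarrow> hol (f n) L \<and> (\<forall>x\<in>L. norm (f n x) \<le> B)"
    using eventually_conj[OF eholD[OF hol L LU] B] by (auto simp: eventually_sequentially)
  have KL: "K \<subseteq> L" using d by (force simp: L_def)
  show ?thesis
  proof (intro exI[of _ N] allI)
    fix s :: "nat \<Rightarrow> nat"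
    define F where "F n = f (max (s n) N)" for n
    have F: "hol (F n) L" "\<And>x. x \<in> L \<Longrightarrow> norm (F n x) \<le> B" for n by (auto simp: F_def N)
    obtain g k where gk: "strict_mono (k :: nat \<Rightarrow> nat)"
      "\<And>e. 0 < e \<Longrightarrow> \<exists>N. \<forall>n x. n \<ge> N \<and> x \<in> K \<longrightarrow> norm (F (k n) x - g x) < e"
    proof (rule Arzela_Ascoli[OF K(1), of F B])
      show "norm (F n x) \<le> B" if "x \<in> K" for n x using F KL that by blast
      show "\<exists>d. 0 < d \<and> (\<forall>n y. y \<in> K \<and> norm (x - y) < d \<longrightarrow> norm (F n x - F n y) < e)"
        if x: "x \<in> K" and e: "0 < e" for x e
      proof -
        have B0: "B \<ge> 0" using F(2)[of x 0] x KL norm_ge_zero order_trans by blast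
        \<comment> \<open>The Lipschitz constant on the ball of radius \<open>r\<close> is
          \<open>B / r\<close>; the summand \<open>1\<close> covers the case
          \<open>B = 0\<close>.\<close>
        define \<delta> where "\<delta> = min r (e * r / (B + 1))"
        have \<delta>: "\<delta> > 0" using r e B0 by (simp add: \<delta>_def)
        have "norm (F n x - F n y) < e" if y: "norm (x - y) < \<delta>" for n y
        proof -
          have sub: "cball z r \<subseteq> L" if "z \<in> ball x r" for z
          proof
            fix w assume "w \<in> cball z r"
            then have "w \<in> cball x d" using that r dist_triangle[of x w z] by auto
            with x show "w \<in> L" by (auto simp: L_def)
          qed
          have "norm (F n x - F n y) \<le> B / r * norm (x - y)"
          proof (rule hol_lipschitz[where S = "ball x r"])
            show "hol (F n) (cball z r)" if "z \<in> ball x r" for z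
              using F(1) sub[OF that] by (rule hol_subset)
            show "norm (F n w) \<le> B" if "z \<in> ball x r" "w \<in> cball z r" for z w
              using F(2) sub that by blast
          qed (use r y in \<open>auto simp: \<delta>_def dist_norm\<close>)
          also have "\<dots> \<le> B / r * (e * r / (B + 1))"
            by (rule mult_left_mono) (use y B0 r in \<open>auto simp: \<delta>_def\<close>)
          also have "\<dots> = e * (B / (B + 1))" using r by simp
          also have "\<dots> < e * 1" by (rule mult_strict_left_mono[OF _ e]) (use B0 in simp)
          finally show ?thesis by simp
        qed
        with \<delta> show ?thesis by blast
      qed
    qed (rule that)
    have "uniform_limit K (\<lambda>n. f (max (s (k n)) N)) g sequentially"
      unfolding uniform_limit_sequentially_iff dist_norm using gk(2) unfolding F_def by blast
    with gk(1) show "\<exists>g k. strict_mono (k :: nat \<Rightarrow> nat) \<and>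
      uniform_limit K (\<lambda>n. f (max (s (k n)) N)) g sequentially" by blast
  qed
qed

text \<open>A single subsequence has to serve all \<open>j\<close> and all compact sets. The pairs
  of an index \<open>j\<close> and a member of a compact exhaustion of \<open>U j\<close> are
  enumerated by \<open>prod_decode\<close>, and a diagonal subsequence is taken; every compact
  subset lies in a member of the exhaustion.\<close>

lemma montel_family:
  fixes f :: "nat \<Rightarrow> nat \<Rightarrow> 'a::complex_space \<Rightarrow> 'b::complex_space"
  assumes U: "\<And>j. open (U j)" and hol: "\<And>j. ehol (f j) (U j)" and bd: "\<And>j. elb (f j) (U j)"
  obtains g k where "strict_mono (k :: nat \<Rightarrow> nat)" "\<And>j. luc (\<lambda>n. f j (k n)) (g j) (U j)"
proof -
  have "\<forall>j. \<exists>C. (\<forall>i::nat. compact (C i) \<and> C i \<subseteq> U j) \<and>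
      (\<forall>K. compact K \<longrightarrow> K \<subseteq> U j \<longrightarrow> (\<exists>N. \<forall>n\<ge>N. K \<subseteq> C n))"
  proof
    fix j
    from open_Union_compact_subsets[OF U[of j]] obtain C where
      "\<And>i::nat. compact (C i)" "\<And>i. C i \<subseteq> U j" "\<And>i. C i \<subseteq> interior (C (Suc i))" "\<Union> (range C) = U j"
      "\<And>K. compact K \<Longrightarrow> K \<subseteq> U j \<Longrightarrow> \<exists>N. \<forall>n\<ge>N. K \<subseteq> C n" by metis
    then show "\<exists>C. (\<forall>i::nat. compact (C i) \<and> C i \<subseteq> U j) \<and>
      (\<forall>K. compact K \<longrightarrow> K \<subseteq> U j \<longrightarrow> (\<exists>N. \<forall>n\<ge>N. K \<subseteq> C n))" by blast
  qed
  from choice[OF this] obtain C where C0: "\<And>j i::nat. compact (C j i) \<and> C j i \<subseteq> U j"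
    "\<And>j K. compact K \<Longrightarrow> K \<subseteq> U j \<Longrightarrow> \<exists>N. \<forall>n\<ge>N. K \<subseteq> C j n" by metis
  then have C: "\<And>j i. compact (C j i)" "\<And>j i. C j i \<subseteq> U j"
    "\<And>j K. compact K \<Longrightarrow> K \<subseteq> U j \<Longrightarrow> \<exists>N. \<forall>n\<ge>N. K \<subseteq> C j n" by auto
  define Cp where "Cp p = C (fst (prod_decode p)) (snd (prod_decode p))" for p
  define fp where "fp p = f (fst (prod_decode p))" for p
  have "\<exists>N. \<forall>s. \<exists>g k. strict_mono (k :: nat \<Rightarrow> nat) \<and>
      uniform_limit (Cp p) (\<lambda>n. fp p (max (s (k n)) N)) g sequentially" for p
    unfolding Cp_def fp_def by (rule montel_compact[OF U hol bd C(1) C(2)])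
  then obtain N where N: "\<And>p s. \<exists>g k. strict_mono (k :: nat \<Rightarrow> nat) \<and>
      uniform_limit (Cp p) (\<lambda>n. fp p (max (s (k n)) (N p))) g sequentially" by metis
  define P where "P p (s :: nat \<Rightarrow> nat) \<longleftrightarrow>
     (\<exists>g. uniform_limit (Cp p) (\<lambda>n. fp p (max (s n) (N p))) g sequentially)" for p s
  obtain k :: "nat \<Rightarrow> nat" where k: "strict_mono k" and Pk: "\<And>p. P p (id \<circ> k)"
  proof (rule subsequence_diagonalization_lemma[of P id])
    fix p and s :: "nat \<Rightarrow> nat"
    show "\<exists>k. strict_mono (k :: nat \<Rightarrow> nat) \<and> P p (s \<circ> k)"
      using N[of p s] unfolding P_def by auto
  next
    fix p and s k1 k2 :: "nat \<Rightarrow> nat" and M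
    \<comment> \<open>The diagonal lemma asks that the property depends only on tails: from
      \<open>M\<close> on, \<open>k2\<close> equals \<open>k1 \<circ> J\<close> with
      \<open>J j \<ge> j\<close>.\<close>
    assume P: "P p (s \<circ> k1)" and sub: "\<And>j. M \<le> j \<Longrightarrow> \<exists>j'. j \<le> j' \<and> k2 j = k1 j'"
    obtain J where J: "\<And>j. M \<le> j \<Longrightarrow> j \<le> J j \<and> k2 j = k1 (J j)" using sub by metis
    obtain g where g: "uniform_limit (Cp p) (\<lambda>n. fp p (max ((s \<circ> k1) n) (N p))) g sequentially"
      using P unfolding P_def by blast
    have JL: "filterlim J at_top sequentially"
      unfolding filterlim_at_top eventually_sequentially
      by (meson J order_trans max.boundedE)
    have "uniform_limit (Cp p) (\<lambda>n. fp p (max ((s \<circ> k1) (J n)) (N p))) g sequentially"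
      by (rule filterlim_compose[OF g JL])
    moreover have "\<forall>\<^sub>F n in sequentially. \<forall>x\<in>Cp p.
        fp p (max ((s \<circ> k1) (J n)) (N p)) x = fp p (max ((s \<circ> k2) n) (N p)) x"
      using J unfolding eventually_sequentially by (metis comp_apply)
    ultimately have "uniform_limit (Cp p) (\<lambda>n. fp p (max ((s \<circ> k2) n) (N p))) g sequentially"
      by (subst (asm) uniform_limit_cong[where g = "\<lambda>n. fp p (max ((s \<circ> k2) n) (N p))" and i = g]) auto
    then show "P p (s \<circ> k2)" unfolding P_def by blast
  qed (rule that)
  have lim: "\<exists>g. uniform_limit (C j i) (\<lambda>n. f j (k n)) g sequentially" for j i
  proof -
    let ?p = "prod_encode (j, i)"
    obtain g where g: "uniform_limit (C j i) (\<lambda>n. f j (max (k n) (N ?p))) g sequentially"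
      using Pk[of ?p] by (auto simp: P_def Cp_def fp_def)
    have "\<forall>\<^sub>F n in sequentially. N ?p \<le> k n"
      using filterlim_subseq[OF k] by (simp add: filterlim_at_top)
    then have "\<forall>\<^sub>F n in sequentially. \<forall>x\<in>C j i. f j (max (k n) (N ?p)) x = f j (k n) x"
      by eventually_elim (simp add: max_def)
    with g have "uniform_limit (C j i) (\<lambda>n. f j (k n)) g sequentially"
      by (subst (asm) uniform_limit_cong[where g = "\<lambda>n. f j (k n)" and i = g]) auto
    then show ?thesis by blast
  qed
  then obtain G where G: "\<And>j i. uniform_limit (C j i) (\<lambda>n. f j (k n)) (G j i) sequentially" by metis
  \<comment> \<open>The limits obtained on the different compact sets agree with the pointwise
    limit, so they fit together.\<close>
  define g where "g j x = lim (\<lambda>n. f j (k n) x)" for j x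
  have "uniform_limit (C j i) (\<lambda>n. f j (k n)) (g j) sequentially" for j i
  proof -
    have "G j i x = g j x" if "x \<in> C j i" for x
      using tendsto_uniform_limitI[OF G that] unfolding g_def by (simp add: limI)
    then show ?thesis using G[of j i] uniform_limit_cong' by (metis (no_types, lifting))
  qed
  then have "luc (\<lambda>n. f j (k n)) (g j) (U j)" for j
    unfolding luc_def using C(3) uniform_limit_on_subset by (meson order_refl)
  with k that show thesis by blast
qed

section \<open>Identity theorem, Schwarz lemma and maps close to the identity\<close>

lemma cfun_eqI:
  assumes "\<And>b. cfun b x = cfun b y" shows "x = y"
proof -
  have "x \<bullet> b = y \<bullet> b" for b using assms[of b] Re_cfun by metis
  then show ?thesis using euclidean_eqI by blast
qed

lemma hol_compose:
  "hol f S \<Longrightarrow> hol g T \<Longrightarrow> f ` S \<subseteq> T \<Longrightarrow> hol (\<lambda>x. g (f x)) S"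
  unfolding hol_def by (blast intro: cdiff_at_compose)

lemma hol_clinear: "clinear D \<Longrightarrow> hol D S"
  by (simp add: hol_def cdiff_at_clinear)

lemma hol_identity:
  fixes f g :: "'a::complex_space \<Rightarrow> 'b::complex_space"
  assumes S: "open S" "convex S" and fg: "hol f S" "hol g S"
    and V: "open V" "V \<noteq> {}" "V \<subseteq> S" and eq: "\<And>x. x \<in> V \<Longrightarrow> f x = g x" and x: "x \<in> S"
  shows "f x = g x"
proof (rule cfun_eqI)
  fix b
  obtain p where p: "p \<in> V" using V by blast
  define l where "l t = p + t *\<^sub>C (x - p)" for t :: complex
  have lc: "continuous_on A l" for A
    unfolding l_def by (intro hol_continuous holI cdiff_at_line)
  define T where "T = l -` S"
  have oT: "open T" unfolding T_def by (rule open_vimage[OF S(1) lc])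
  have "convex T"
  proof (rule convexI)
    fix s t :: complex and u v :: real
    assume st: "s \<in> T" "t \<in> T" and uv: "0 \<le> u" "0 \<le> v" "u + v = 1"
    have "l (u *\<^sub>R s + v *\<^sub>R t) = (u + v) *\<^sub>R p + (u *\<^sub>R s + v *\<^sub>R t) *\<^sub>C (x - p)"
      using uv by (simp add: l_def)
    also have "\<dots> = u *\<^sub>R l s + v *\<^sub>R l t"
      unfolding l_def scaleC_add_left scaleR_add_left scaleR_add_right
        bounded_bilinear.scaleR_left[OF bounded_bilinear_scaleC] by simp
    finally show "u *\<^sub>R s + v *\<^sub>R t \<in> T"
      using st uv convexD[OF S(2)] by (auto simp: T_def)
  qed
  then have cT: "connected T" by (rule convex_connected)
  define W where "W = l -` V"
  have oW: "open W" unfolding W_def by (rule open_vimage[OF V(1) lc])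
  have holT: "(\<lambda>t. cfun b (h (l t))) holomorphic_on T" if "hol h S" for h :: "'a \<Rightarrow> 'b"
    unfolding hol_iff_holomorphic_on[OF oT, symmetric]
    by (rule hol_compose[OF _ hol_clinear[OF clinear_cfun], of _ _ UNIV])
       (use that in \<open>auto simp: hol_def T_def l_def intro!: cdiff_at_along_line\<close>)
  have "(\<lambda>t. cfun b (f (l t))) 1 = (\<lambda>t. cfun b (g (l t))) 1"
  proof (rule analytic_continuation_open[OF oW oT _ cT _ holT holT])
    have "0 \<in> W" using p by (simp add: W_def l_def)
    then show "W \<noteq> {}" by blast
    show "W \<subseteq> T" using V by (auto simp: W_def T_def)
    show "1 \<in> T" using x by (simp add: T_def l_def)
  qed (use fg eq in \<open>auto simp: W_def\<close>)
  then show "cfun b (f x) = cfun b (g x)" by (simp add: l_def)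
qed

text \<open>The scalar Schwarz lemma for compositions with functionals of norm one, chosen to norm
  \<open>f t\<close> and \<open>D 1\<close> respectively.\<close>

lemma schwarz_disc:
  fixes f :: "complex \<Rightarrow> 'b::complex_space"
  assumes hol: "hol f (ball 0 1)" and f0: "f 0 = 0" and bd: "\<And>t. cmod t < 1 \<Longrightarrow> norm (f t) < 1"
  shows "cmod t < 1 \<Longrightarrow> norm (f t) \<le> cmod t"
    and "clinear D \<Longrightarrow> (f has_derivative D) (at 0) \<Longrightarrow> norm (D 1) \<le> 1"
proof -
  have sch: "(cmod t < 1 \<longrightarrow> cmod (cfun b (f t)) \<le> cmod t) \<and> cmod (deriv (\<lambda>t. cfun b (f t)) 0) \<le> 1"
    if b: "norm b = 1" for t b
  proof -
    have h: "(\<lambda>t. cfun b (f t)) holomorphic_on ball 0 1"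
      unfolding hol_iff_holomorphic_on[OF open_ball, symmetric]
      by (rule hol_compose[OF hol hol_clinear[OF clinear_cfun, where S = UNIV]]) simp
    have z: "cfun b (f 0) = 0" by (simp add: f0 clinear_zero[OF clinear_cfun])
    have l: "cmod (cfun b (f t)) < 1" if "cmod t < 1" for t
      using norm_cfun_le[of b "f t"] bd[OF that] b by simp
    show ?thesis using Schwarz_Lemma(1)[OF h z l, of t] Schwarz_Lemma(2)[OF h z l, of 0] by auto
  qed
  show "norm (f t) \<le> cmod t" if "cmod t < 1"
  proof (cases "f t = 0")
    case False
    then show ?thesis
      using sch[of "f t /\<^sub>R norm (f t)" t] that cfun_norm_attained[OF False] by fastforce
  qed simp
  show "norm (D 1) \<le> 1" if "clinear D" "(f has_derivative D) (at 0)"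
  proof (cases "D 1 = 0")
    case False
    let ?b = "D 1 /\<^sub>R norm (D 1)"
    have "deriv (\<lambda>t. cfun ?b (f t)) 0 = cfun ?b (D 1)"
      by (rule DERIV_imp_deriv[OF cfun_has_field_derivative[OF that]])
    then show ?thesis
      using sch[of ?b 0] cfun_norm_attained[OF False] False by auto
  qed simp
qed

text \<open>Norms are kept abstract because several occur: the Hermitian norm, the maximum norm
  whose unit ball is \<open>\<Omega>\<close>, and the pullback of the latter to the linear slice
  that becomes the base of the fibration. Their open balls are the domains of the function theory
  below.\<close>

definition cnorm :: "('a::complex_space \<Rightarrow> real) \<Rightarrow> bool" where
  "cnorm N \<longleftrightarrow> (\<forall>x y. N (x + y) \<le> N x + N y) \<and> (\<forall>c x. N (c *\<^sub>C x) = cmod c * N x) \<and>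
     (\<forall>x. x \<noteq> 0 \<longrightarrow> 0 < N x)"

context
  fixes N :: "'a::complex_space \<Rightarrow> real"
  assumes N: "cnorm N"
begin

lemma cnorm_triangle: "N (x + y) \<le> N x + N y"
  and cnorm_scaleC: "N (c *\<^sub>C x) = cmod c * N x"
  and cnorm_pos: "x \<noteq> 0 \<Longrightarrow> 0 < N x"
  using N by (auto simp: cnorm_def)

lemma cnorm_zero: "N 0 = 0"
  using cnorm_scaleC[of 0 0] by simp

lemma cnorm_nonneg: "0 \<le> N x"
  using cnorm_pos[of x] cnorm_zero by (cases "x = 0") auto

lemma cnorm_scaleR: "N (r *\<^sub>R x) = \<bar>r\<bar> * N x"
  using cnorm_scaleC[of "complex_of_real r" x] by (simp add: scaleC_of_real)

lemma cnorm_minus: "N (- x) = N x"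
  using cnorm_scaleR[of "-1" x] by simp

lemma cnorm_diff: "N (x - y) \<le> N x + N y"
  using cnorm_triangle[of x "- y"] by (simp add: cnorm_minus)

lemma cnorm_sum: "finite A \<Longrightarrow> N (\<Sum>i\<in>A. f i) \<le> (\<Sum>i\<in>A. N (f i))"
proof (induction A rule: finite_induct)
  case empty then show ?case by (simp add: cnorm_zero)
next
  case (insert i A)
  then show ?case using cnorm_triangle[of "f i" "\<Sum>i\<in>A. f i"] by simp
qed

lemma cnorm_upper: obtains C where "0 < C" "\<And>x. N x \<le> C * norm x"
proof
  define C where "C = (\<Sum>b\<in>Basis. N (b::'a)) + 1"
  show "0 < C" by (simp add: C_def add_nonneg_pos sum_nonneg cnorm_nonneg)
  fix x :: 'a
  have "N x = N (\<Sum>b\<in>Basis. (x \<bullet> b) *\<^sub>R b)" by (simp add: euclidean_representation)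
  also have "\<dots> \<le> (\<Sum>b\<in>Basis. N ((x \<bullet> b) *\<^sub>R b))" by (rule cnorm_sum) simp
  also have "\<dots> = (\<Sum>b\<in>Basis. \<bar>x \<bullet> b\<bar> * N b)" by (simp add: cnorm_scaleR)
  also have "\<dots> \<le> (\<Sum>b\<in>Basis. norm x * N b)"
    by (intro sum_mono mult_right_mono cnorm_nonneg) (simp add: Basis_le_norm)
  also have "\<dots> = norm x * (\<Sum>b\<in>Basis. N (b::'a))" by (simp add: sum_distrib_left)
  also have "\<dots> \<le> C * norm x" by (simp add: C_def algebra_simps)
  finally show "N x \<le> C * norm x" .
qed

lemma cnorm_abs_diff: "\<bar>N x - N y\<bar> \<le> N (x - y)"
  using cnorm_triangle[of "x - y" y] cnorm_triangle[of "y - x" x] cnorm_minus[of "x - y"] by auto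

lemma cnorm_continuous: "continuous_on A N"
proof -
  obtain C where C: "0 < C" "\<And>x. N x \<le> C * norm x" using cnorm_upper by blast
  have "dist (N x) (N y) \<le> C * dist x y" for x y
    using cnorm_abs_diff[of x y] C(2)[of "x - y"] by (simp add: dist_norm)
  then have "C-lipschitz_on A N"
    by (intro lipschitz_onI) (use C in auto)
  then show ?thesis by (rule lipschitz_on_continuous_on)
qed

lemma cnorm_lower: obtains c where "0 < c" "\<And>x. c * norm x \<le> N x"
proof -
  obtain x0 where x0: "x0 \<in> sphere 0 1" "\<And>x. x \<in> sphere 0 1 \<Longrightarrow> N x0 \<le> N x"
    using continuous_attains_inf[OF compact_sphere _ cnorm_continuous, of "0::'a" 1]
    by (metis sphere_eq_empty zero_less_one less_asym)
  show thesis
  proof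
    show "0 < N x0" using x0(1) by (intro cnorm_pos) auto
    fix x :: 'a
    show "N x0 * norm x \<le> N x"
    proof (cases "x = 0")
      case False
      then have "N x0 \<le> N (x /\<^sub>R norm x)" by (intro x0(2)) simp
      with False show ?thesis by (simp add: cnorm_scaleR field_simps)
    qed (simp add: cnorm_zero)
  qed
qed

lemma cnorm_open: "open {x. N x < r}"
  using open_Collect_less[OF cnorm_continuous continuous_on_const] by simp

lemma cnorm_compact: "compact {x. N x \<le> r}"
proof -
  obtain c where c: "0 < c" "\<And>x. c * norm x \<le> N x" by (rule cnorm_lower) blast
  have "bounded {x. N x \<le> r}"
    unfolding bounded_iff
  proof (intro exI[of _ "r / c"] ballI)
    fix x assume "x \<in> {x. N x \<le> r}"
    then have "c * norm x \<le> r" using c(2)[of x] by simp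
    then show "norm x \<le> r / c" using c(1) by (simp add: field_simps)
  qed
  moreover have "closed {x. N x \<le> r}"
    using closed_Collect_le[OF cnorm_continuous continuous_on_const] by simp
  ultimately show ?thesis using compact_eq_bounded_closed by blast
qed

lemma cnorm_comb: "0 \<le> u \<Longrightarrow> 0 \<le> v \<Longrightarrow> N (u *\<^sub>R x + v *\<^sub>R y) \<le> u * N x + v * N y"
  using cnorm_triangle[of "u *\<^sub>R x" "v *\<^sub>R y"] by (simp add: cnorm_scaleR)

lemma cnorm_convex: "convex {x. N x < r}"
proof (rule convexI)
  fix x y :: 'a and u v :: real
  assume xy: "x \<in> {x. N x < r}" "y \<in> {x. N x < r}" and uv: "0 \<le> u" "0 \<le> v" "u + v = 1"
  have "u * N x + v * N y \<le> u * max (N x) (N y) + v * max (N x) (N y)"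
    using uv by (intro add_mono mult_left_mono) auto
  also have "\<dots> = max (N x) (N y)" using uv by (simp flip: distrib_right)
  also have "\<dots> < r" using xy by auto
  finally show "u *\<^sub>R x + v *\<^sub>R y \<in> {x. N x < r}" using cnorm_comb[OF uv(1,2), of x y] by simp
qed

text \<open>For nonzero \<open>v\<close> the unit disc in the complex line through \<open>v\<close>,
  scaled by \<open>1 / N v\<close>, lies in the unit ball of \<open>N\<close>; on it
  \<open>schwarz_disc\<close> applies.\<close>

lemma schwarz_cnorm:
  fixes f :: "'a \<Rightarrow> 'b::complex_space"
  assumes hol: "hol f {x. N x < 1}" and f0: "f 0 = 0" and bd: "\<And>x. N x < 1 \<Longrightarrow> norm (f x) < 1"
  shows "N x < 1 \<Longrightarrow> norm (f x) \<le> N x"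
    and "clinear D \<Longrightarrow> (f has_derivative D) (at 0) \<Longrightarrow> norm (D v) \<le> N v"
proof -
  have disc: "hol (\<lambda>t. f (0 + t *\<^sub>C (v /\<^sub>R N v))) (ball 0 1)"
       "\<And>t. cmod t < 1 \<Longrightarrow> norm (f (0 + t *\<^sub>C (v /\<^sub>R N v))) < 1" if v: "v \<noteq> 0" for v
  proof -
    have "N (t *\<^sub>C (v /\<^sub>R N v)) = cmod t" for t
      using cnorm_pos[OF v] by (simp add: cnorm_scaleC cnorm_scaleR)
    then show "hol (\<lambda>t. f (0 + t *\<^sub>C (v /\<^sub>R N v))) (ball 0 1)"
       "\<And>t. cmod t < 1 \<Longrightarrow> norm (f (0 + t *\<^sub>C (v /\<^sub>R N v))) < 1"
      using hol bd cdiff_at_along_line[of f 0 _ "v /\<^sub>R N v"] by (auto simp: hol_def)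
  qed
  show "norm (f x) \<le> N x" if "N x < 1"
  proof (cases "x = 0")
    case False
    have "f (0 + complex_of_real (N x) *\<^sub>C (x /\<^sub>R N x)) = f x"
      using cnorm_pos[OF False] by (simp add: scaleC_of_real)
    then show ?thesis
      using schwarz_disc(1)[OF disc(1)[OF False] _ disc(2)[OF False], of "complex_of_real (N x)"]
        that cnorm_nonneg[of x] f0 by simp
  qed (simp add: f0 cnorm_zero)
  show "norm (D v) \<le> N v" if D: "clinear D" "(f has_derivative D) (at 0)"
  proof (cases "v = 0")
    case False
    have "((\<lambda>t. f (0 + t *\<^sub>C (v /\<^sub>R N v))) has_derivative (\<lambda>h. D (h *\<^sub>C (v /\<^sub>R N v)))) (at 0)"
      by (rule has_derivative_along_line) (use D in simp)
    from schwarz_disc(2)[OF disc(1)[OF False] _ disc(2)[OF False] _ this]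
    have "norm (D (1 *\<^sub>C (v /\<^sub>R N v))) \<le> 1"
      using f0 clinear_compose[OF D(1) clinear_scaleC_left] by simp
    then have "norm (D v) / N v \<le> 1"
      using cnorm_pos[OF False] linear_cmul[OF clinear_imp_linear[OF D(1)]] by (simp add: divide_inverse mult.commute)
    then show ?thesis using cnorm_pos[OF False] by (simp add: divide_le_eq)
  qed (simp add: clinear_zero[OF D(1)] cnorm_zero)
qed

end

section \<open>Maps with injective derivative and their inverses\<close>

definition immersive :: "('a::complex_space \<Rightarrow> 'b::complex_space) \<Rightarrow> 'a \<Rightarrow> bool" where
  "immersive f x \<longleftrightarrow> (\<exists>D. clinear D \<and> inj D \<and> (f has_derivative D) (at x))"

lemma immersive_cdiff: "immersive f x \<Longrightarrow> complex_differentiable_at f x"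
  unfolding immersive_def complex_differentiable_at_def by blast

lemma immersive_hol: "(\<And>x. x \<in> S \<Longrightarrow> immersive f x) \<Longrightarrow> hol f S"
  by (simp add: hol_def immersive_cdiff)

lemma immersive_compose:
  assumes "immersive f x" "immersive g (f x)"
  shows "immersive (\<lambda>x. g (f x)) x"
proof -
  obtain D E where D: "clinear D" "inj D" "(f has_derivative D) (at x)"
    and E: "clinear E" "inj E" "(g has_derivative E) (at (f x))"
    using assms unfolding immersive_def by blast
  have "inj (\<lambda>v. E (D v))" using D E by (simp add: inj_def)
  then show ?thesis
    unfolding immersive_def
    using clinear_compose[OF E(1) D(1)] has_derivative_compose[OF D(3) E(3)] by blast
qed

lemma immersive_transform:
  assumes "immersive f x" "open S" "x \<in> S" "\<And>y. y \<in> S \<Longrightarrow> f y = g y"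
  shows "immersive g x"
  using assms has_derivative_transform_within_open[of f _ x UNIV S g] unfolding immersive_def
  by auto

lemma clinear_inj_iff: "clinear D \<Longrightarrow> inj D \<longleftrightarrow> (\<forall>v. D v = 0 \<longrightarrow> v = 0)"
  using linear_injective_0[OF clinear_imp_linear] by blast

text \<open>Source and target have the same dimension, so an injective derivative is invertible.
  Openness comes from invariance of domain; the inverse is differentiable by the inverse function
  theorem, and the inverse of a complex linear map is complex linear.\<close>

lemma immersive_inverse:
  fixes f :: "'a::complex_space \<Rightarrow> 'a"
  assumes U: "open U" and inj: "inj_on f U" and imm: "\<And>x. x \<in> U \<Longrightarrow> immersive f x"
  shows "open (f ` U)" and "y \<in> f ` U \<Longrightarrow> immersive (inv_into U f) y"
proof -
  have cont: "continuous_on U f" by (rule hol_continuous[OF immersive_hol[OF imm]])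
  show "open (f ` U)" by (rule invariance_of_domain[OF cont U inj])
  show "immersive (inv_into U f) y" if "y \<in> f ` U"
  proof -
    obtain x where x: "x \<in> U" "y = f x" using \<open>y \<in> f ` U\<close> by blast
    obtain D where D: "clinear D" "inj D" "(f has_derivative D) (at x)"
      using imm[OF x(1)] unfolding immersive_def by blast
    have "surj D" using linear_injective_imp_surjective[OF clinear_imp_linear[OF D(1)] D(2)] by blast
    then have DE: "D (inv D z) = z" for z by (rule surj_f_inv_f)
    have "(inv_into U f has_derivative inv D) (at (f x))"
      by (rule has_derivative_inverse_strong[OF U x(1) cont inv_into_f_f[OF inj] D(3)])
         (use DE in auto)
    moreover have "clinear (inv D)"
      unfolding clinear_iff
      by (intro conjI allI; rule injD[OF D(2)]) (simp_all add: DE clinear_add[OF D(1)] clinear_scaleC[OF D(1)])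
    moreover have "inj (inv D)" using DE by (metis injI)
    ultimately show ?thesis unfolding immersive_def x(2) by blast
  qed
qed

text \<open>Write \<open>g\<close> as the identity plus \<open>u\<close>. By the Cauchy estimate a
  small bound for \<open>u\<close> on the larger ball makes \<open>u\<close> a contraction with
  factor \<open>1/2\<close> on the ball of radius \<open>s\<close>; this gives injectivity and
  injective derivatives, and solves \<open>g x = y\<close> as the fixed point equation
  \<open>x = y - u x\<close>.\<close>

lemma near_identity:
  fixes N :: "'a::complex_space \<Rightarrow> real"
  assumes N: "cnorm N" and r: "r < s" "s < t" "0 \<le> r"
  obtains e where "0 < e"
    "\<And>g. hol g {x. N x < t} \<Longrightarrow> (\<And>x. N x < t \<Longrightarrow> norm (g x - x) \<le> e) \<Longrightarrow>
       inj_on g {x. N x < s} \<and> (\<forall>x. N x < s \<longrightarrow> immersive g x) \<and>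
       {x. N x \<le> r} \<subseteq> g ` {x. N x < s}"
proof -
  obtain C where C: "0 < C" "\<And>x. N x \<le> C * norm x" using cnorm_upper[OF N] by metis
  \<comment> \<open>A Euclidean radius by which the \<open>N\<close>-ball of radius \<open>s\<close>
    can be enlarged inside that of radius \<open>t\<close>; it is the radius of the Cauchy
    estimates.\<close>
  define \<rho> where "\<rho> = (t - s) / (2 * C)"
  have \<rho>: "\<rho> > 0" using r C by (simp add: \<rho>_def)
  define s' where "s' = (r + s) / 2"
  have s': "r < s'" "s' < s" using r by (auto simp: s'_def)
  \<comment> \<open>The first bound gives the contraction factor \<open>1/2\<close>; the second
    keeps \<open>y - u x\<close> in the closed ball of radius \<open>s'\<close> when
    \<open>N y \<le> r\<close>.\<close>
  define e where "e = min (\<rho> / 2) ((s' - r) / C)"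
  have e: "e > 0" "e \<le> \<rho> / 2" "e \<le> (s' - r) / C"
    using \<rho> s' C unfolding e_def by (simp, linarith, linarith)
  then have e3: "C * e \<le> s' - r" using C(1) by (simp add: field_simps)
  show thesis
  proof
    fix g :: "'a \<Rightarrow> 'a" assume g: "hol g {x. N x < t}" "\<And>x. N x < t \<Longrightarrow> norm (g x - x) \<le> e"
    define u where "u x = g x - x" for x
    have holu: "hol u {x. N x < t}" unfolding u_def
      using g(1) by (auto simp: hol_def intro: cdiff_at_diff cdiff_at_ident)
    have ball: "cball x \<rho> \<subseteq> {x. N x < t}" if "N x < s" for x
    proof
      fix y assume "y \<in> cball x \<rho>"
      then have "norm (y - x) \<le> \<rho>" by (simp add: dist_norm norm_minus_commute)
      then have "N (y - x) \<le> C * \<rho>" using C by (meson mult_left_mono less_imp_le order_trans)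
      also have "\<dots> < t - s" using C r by (simp add: \<rho>_def)
      finally show "y \<in> {x. N x < t}" using cnorm_triangle[OF N, of "y - x" x] that by simp
    qed
    have lip: "norm (u x - u y) \<le> 1/2 * norm (x - y)" if "N x < s" "N y < s" for x y
    proof -
      have "norm (u x - u y) \<le> e / \<rho> * norm (x - y)"
      proof (rule hol_lipschitz[OF cnorm_convex[OF N, of s] \<rho>])
        show "hol u (cball x \<rho>)" if "x \<in> {x. N x < s}" for x
          using hol_subset[OF holu ball] that by simp
        show "norm (u y) \<le> e" if "x \<in> {x. N x < s}" "y \<in> cball x \<rho>" for x y
          using g(2) ball that unfolding u_def by blast
      qed (use that in auto)
      also have "\<dots> \<le> 1/2 * norm (x - y)"
        by (rule mult_right_mono) (use e \<rho> in \<open>auto simp: field_simps\<close>)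
      finally show ?thesis .
    qed
    have "inj_on g {x. N x < s}"
    proof (rule inj_onI)
      fix x y assume xy: "x \<in> {x. N x < s}" "y \<in> {x. N x < s}" "g x = g y"
      then have "u x - u y = y - x" by (simp add: u_def)
      then have "norm (x - y) \<le> 1/2 * norm (x - y)" using lip[of x y] xy by (simp add: norm_minus_commute)
      then have "norm (x - y) \<le> 0" by linarith
      then show "x = y" by simp
    qed
    moreover have "immersive g x" if x: "N x < s" for x
    proof -
      have "N x < t" using x r by simp
      then obtain D where D: "clinear D" "(g has_derivative D) (at x)"
        using g(1) by (auto simp: hol_def elim: cdiff_at_E)
      have "norm (D v - v) \<le> e / \<rho> * norm v" for v
      proof (rule cauchy_derivative_bound[where f = u and D = "\<lambda>v. D v - v"])
        show "hol u (cball x \<rho>)" using hol_subset[OF holu ball[OF x]] .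
        show "norm (u y) \<le> e" if "y \<in> cball x \<rho>" for y
          using g(2) ball[OF x] that unfolding u_def by blast
        show "(u has_derivative (\<lambda>v. D v - v)) (at x)"
          unfolding u_def by (intro has_derivative_diff D has_derivative_ident)
      qed (intro \<rho> clinear_minus D clinear_id)+
      moreover have "e / \<rho> \<le> 1/2" using e \<rho> by (simp add: field_simps)
      ultimately have le: "norm (D v - v) \<le> 1/2 * norm v" for v
        by (meson mult_right_mono norm_ge_zero order_trans)
      have "v = 0" if "D v = 0" for v using le[of v] that by simp
      then have "inj D" using clinear_inj_iff[OF D(1)] by blast
      with D show ?thesis unfolding immersive_def by blast
    qed
    moreover have "y \<in> g ` {x. N x < s}" if y: "N y \<le> r" for y
    proof -
      let ?S = "{x. N x \<le> s'}"
      have "\<exists>!x\<in>?S. y - u x = x"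
      proof (rule Banach_fix[where c = "1/2"])
        show "complete ?S" by (rule compact_imp_complete[OF cnorm_compact[OF N]])
        have "y \<in> ?S" using y s' by simp
        then show "?S \<noteq> {}" by blast
        show "(\<lambda>x. y - u x) ` ?S \<subseteq> ?S"
        proof clarsimp
          fix x assume x: "N x \<le> s'"
          have "norm (u x) \<le> e" using g(2)[of x] x s' r by (simp add: u_def)
          then have "N (u x) \<le> C * e" using C by (meson mult_left_mono less_imp_le order_trans)
          then show "N (y - u x) \<le> s'" using cnorm_diff[OF N, of y "u x"] y e3 by simp
        qed
        show "dist (y - u x) (y - u z) \<le> 1/2 * dist x z" if "x \<in> ?S" "z \<in> ?S" for x z
          using lip[of x z] that s' by (auto simp: dist_norm norm_minus_commute)
      qed auto
      then obtain x where "N x \<le> s'" "y - u x = x" by blast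
      then have "N x < s" "g x = y" using s' by (auto simp: u_def algebra_simps)
      then show ?thesis by blast
    qed
    ultimately show "inj_on g {x. N x < s} \<and> (\<forall>x. N x < s \<longrightarrow> immersive g x) \<and>
       {x. N x \<le> r} \<subseteq> g ` {x. N x < s}" by blast
  qed (rule e)
qed

section \<open>Logarithms and univalent functions\<close>

text \<open>The images of a compact set under \<open>f n\<close> eventually lie in a compact
  neighbourhood of its image under \<open>f0\<close>, where \<open>h0\<close> is uniformly
  continuous.\<close>

lemma luc_compose:
  fixes f :: "nat \<Rightarrow> 'a::euclidean_space \<Rightarrow> 'b::euclidean_space" and h :: "nat \<Rightarrow> 'b \<Rightarrow> 'c::metric_space"
  assumes f: "luc f f0 S" "continuous_on S f0" "f0 ` S \<subseteq> T" and T: "open T"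
    and h: "luc h h0 T" "continuous_on T h0"
  shows "luc (\<lambda>n x. h n (f n x)) (\<lambda>x. h0 (f0 x)) S"
  unfolding luc_def
proof (intro allI impI)
  fix K assume K: "compact K" "K \<subseteq> S"
  have c: "compact (f0 ` K)" by (rule compact_continuous_image[OF continuous_on_subset[OF f(2) K(2)] K(1)])
  obtain d where d: "d > 0" "(\<Union>x\<in>f0 ` K. cball x d) \<subseteq> T"
    using compact_subset_open_imp_cball_epsilon_subset[OF c T] f(3) K(2) by blast
  define L where "L = (\<Union>x\<in>f0 ` K. cball x d)"
  have L: "compact L" "L \<subseteq> T" unfolding L_def using compact_minkowski_sum_cball[OF c] d by auto
  have uc: "uniformly_continuous_on L h0"
    by (rule compact_uniformly_continuous[OF continuous_on_subset[OF h(2) L(2)] L(1)])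
  show "uniform_limit K (\<lambda>n x. h n (f n x)) (\<lambda>x. h0 (f0 x)) sequentially"
  proof (rule uniform_limitI)
    fix e :: real assume e: "e > 0"
    obtain d' where d': "d' > 0" "\<And>x y. x \<in> L \<Longrightarrow> y \<in> L \<Longrightarrow> dist y x < d' \<Longrightarrow> dist (h0 y) (h0 x) < e / 2"
      using uc e unfolding uniformly_continuous_on_def by (meson half_gt_zero)
    have "\<forall>\<^sub>F n in sequentially. \<forall>x\<in>K. dist (f n x) (f0 x) < min d d'"
      by (rule luc_eventually[OF f(1) K]) (use d d' in auto)
    moreover have "\<forall>\<^sub>F n in sequentially. \<forall>x\<in>L. dist (h n x) (h0 x) < e / 2"
      by (rule luc_eventually[OF h(1) L]) (use e in auto)
    ultimately show "\<forall>\<^sub>F n in sequentially. \<forall>x\<in>K. dist (h n (f n x)) (h0 (f0 x)) < e"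
    proof eventually_elim
      case (elim n)
      show ?case
      proof
        fix x assume x: "x \<in> K"
        have 1: "dist (f n x) (f0 x) < min d d'" using elim x by blast
        then have 2: "f n x \<in> L" "f0 x \<in> L" using x d unfolding L_def by (force simp: dist_commute)+
        have "dist (h n (f n x)) (h0 (f n x)) < e / 2" using elim 2 by blast
        moreover have "dist (h0 (f n x)) (h0 (f0 x)) < e / 2" using 1 2 d'(2) by simp
        ultimately show "dist (h n (f n x)) (h0 (f0 x)) < e"
          using dist_triangle[of "h n (f n x)" "h0 (f0 x)" "h0 (f n x)"] by simp
      qed
    qed
  qed
qed

lemma luc_const: "luc (\<lambda>n. g) g U"
  unfolding luc_def by (simp add: uniform_limit_const)

lemma luc_post:
  fixes f :: "nat \<Rightarrow> 'a::euclidean_space \<Rightarrow> 'b::euclidean_space" and h :: "'b \<Rightarrow> 'c::metric_space"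
  assumes "luc f f0 S" "continuous_on S f0" "f0 ` S \<subseteq> T" "open T" "continuous_on T h"
  shows "luc (\<lambda>n x. h (f n x)) (\<lambda>x. h (f0 x)) S"
  by (rule luc_compose[OF assms(1-4) luc_const assms(5)])

lemma luc_pre:
  fixes f :: "'a::topological_space \<Rightarrow> 'b::topological_space" and h :: "nat \<Rightarrow> 'b \<Rightarrow> 'c::metric_space"
  assumes "continuous_on S f" "f ` S \<subseteq> T" "luc h h0 T"
  shows "luc (\<lambda>n x. h n (f x)) (\<lambda>x. h0 (f x)) S"
  unfolding luc_def
proof (intro allI impI)
  fix K assume K: "compact K" "K \<subseteq> S"
  have "uniform_limit (f ` K) h h0 sequentially"
    using assms K by (intro lucD compact_continuous_image continuous_on_subset[OF assms(1)]) auto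
  then show "uniform_limit K (\<lambda>n x. h n (f x)) (\<lambda>x. h0 (f x)) sequentially"
    unfolding uniform_limit_iff by simp
qed

text \<open>A continuous logarithm exists on the contractible set \<open>S\<close>. Near each point
  \<open>x\<close> it is the principal logarithm of \<open>q y / q x\<close> plus a constant, and
  therefore holomorphic.\<close>

lemma hol_logarithm:
  fixes q :: "'a::complex_space \<Rightarrow> complex"
  assumes S: "open S" "convex S" and q: "hol q S" "\<And>x. x \<in> S \<Longrightarrow> q x \<noteq> 0"
  obtains g where "hol g S" "\<And>x. x \<in> S \<Longrightarrow> q x = exp (g x)"
proof -
  obtain g where g: "continuous_on S g" "\<And>x. x \<in> S \<Longrightarrow> q x = exp (g x)"
    using continuous_logarithm_on_contractible[OF hol_continuous[OF q(1)] convex_imp_contractible[OF S(2)] q(2)]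
    by blast
  have "complex_differentiable_at g x" if x: "x \<in> S" for x
  proof -
    have "isCont g x" using g(1) S(1) x by (simp add: continuous_on_eq_continuous_at)
    then obtain d where d: "d > 0" "\<And>y. dist y x < d \<Longrightarrow> dist (g y) (g x) < 1"
      unfolding continuous_at_eps_delta by (meson zero_less_one)
    define W where "W = S \<inter> ball x d"
    have W: "open W" "x \<in> W" using S(1) x d by (auto simp: W_def)
    have eq: "Ln (q y / q x) + g x = g y" if y: "y \<in> W" for y
    proof -
      have "q y / q x = exp (g y - g x)" using g(2) x y by (simp add: exp_diff W_def)
      moreover have "\<bar>Im (g y - g x)\<bar> < 1"
        using d(2)[of y] y abs_Im_le_cmod[of "g y - g x"] norm_minus_commute[of "g x" "g y"]
        by (simp add: W_def dist_commute dist_norm)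
      then have "- pi < Im (g y - g x)" "Im (g y - g x) \<le> pi" using pi_gt3 by auto
      ultimately show ?thesis by (simp only: Ln_exp) simp
    qed
    have "complex_differentiable_at (\<lambda>y. Ln (q y / q x) + g x) x"
    proof -
      have 1: "complex_differentiable_at (\<lambda>y. q y / q x) x"
        using q x by (intro cdiff_at_divide cdiff_at_const) (auto simp: hol_def)
      have 2: "Ln field_differentiable at (q x / q x)"
        using q(2)[OF x] by (auto intro!: field_differentiable_at_Ln)
      show ?thesis by (rule cdiff_at_add[OF cdiff_at_field_compose[OF 1 2] cdiff_at_const])
    qed
    then show ?thesis by (rule cdiff_at_transform[OF _ W]) (rule eq)
  qed
  with g(2) show thesis using that hol_def by blast
qed

text \<open>As \<open>1 - f / c\<close> has no zeros, it has a square root. Its branch with value \<open>-1\<close> at \<open>a\<close> omits \<open>0\<close>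
  and \<open>1\<close>, and Schottky's theorem applies.\<close>

lemma omitted_value_bound:
  obtains K :: real where "K > 0"
    "\<And>f a \<rho> c z. f holomorphic_on ball a \<rho> \<Longrightarrow> 0 < \<rho> \<Longrightarrow> f a = 0 \<Longrightarrow>
      (\<And>w. w \<in> ball a \<rho> \<Longrightarrow> f w = 0 \<Longrightarrow> w = a) \<Longrightarrow> c \<notin> f ` ball a \<rho> \<Longrightarrow>
      cmod (z - a) \<le> \<rho> / 2 \<Longrightarrow> cmod (f z) \<le> K * cmod c"
proof -
  \<comment> \<open>Schottky's bound at points of modulus at most \<open>2/3\<close> for a function
    whose value at \<open>0\<close> has modulus at most \<open>1\<close>.\<close>
  define K1 :: real where "K1 = exp (pi * exp (pi * (2 + 2 * 1 + 12 * (2/3) / (1 - 2/3))))"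
  show thesis
  proof
    show "1 + K1\<^sup>2 > 0" by (simp add: add_pos_nonneg)
    fix f :: "complex \<Rightarrow> complex" and a c z :: complex and \<rho> :: real
    assume holf: "f holomorphic_on ball a \<rho>" and \<rho>: "0 < \<rho>" and fa: "f a = 0"
      and zero: "\<And>w. w \<in> ball a \<rho> \<Longrightarrow> f w = 0 \<Longrightarrow> w = a"
      and c: "c \<notin> f ` ball a \<rho>" and z: "cmod (z - a) \<le> \<rho> / 2"
    have c0: "c \<noteq> 0" using c fa \<rho> by (metis centre_in_ball imageI)
    define q where "q w = 1 - f w / c" for w
    have "hol q (ball a \<rho>)"
      unfolding q_def hol_iff_holomorphic_on[OF open_ball] using holf c0 by (intro holomorphic_intros) auto
    moreover have "q w \<noteq> 0" if "w \<in> ball a \<rho>" for w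
      using c that c0 by (auto simp: q_def)
    ultimately obtain g where g: "hol g (ball a \<rho>)" "\<And>w. w \<in> ball a \<rho> \<Longrightarrow> q w = exp (g w)"
      using hol_logarithm[OF open_ball convex_ball] by metis
    \<comment> \<open>\<open>s\<close> is \<open>1\<close> or \<open>-1\<close>; it selects the
      square root with value \<open>-1\<close> at \<open>a\<close>.\<close>
    define s where "s = exp (g a / 2)"
    have s2: "s\<^sup>2 = 1"
      using g(2)[of a] \<rho> fa by (simp add: s_def q_def exp_double[symmetric])
    define F where "F w = - s * exp (g w / 2)" for w
    have Fa: "F a = - 1" using s2 by (simp add: F_def s_def power2_eq_square)
    have F2: "(F w)\<^sup>2 = q w" if "w \<in> ball a \<rho>" for w
      using g(2)[OF that] s2 by (simp add: F_def power_mult_distrib exp_double[symmetric])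
    have F1: "F w \<noteq> 1" if "w \<in> ball a \<rho>" for w
    proof
      assume 1: "F w = 1"
      then have "f w = 0" using F2[OF that] c0 by (simp add: q_def)
      then have "w = a" using zero that by blast
      with 1 Fa show False by simp
    qed
    \<comment> \<open>Schottky's theorem wants a function on the closed unit disc. The factor
      \<open>3/4\<close> keeps that disc inside \<open>ball a \<rho>\<close> and gives the points
      within \<open>\<rho> / 2\<close> of \<open>a\<close> a parameter of modulus at most
      \<open>2/3\<close>.\<close>
    define F' where "F' w = F (a + complex_of_real (3/4 * \<rho>) * w)" for w
    have inb: "a + complex_of_real (3/4 * \<rho>) * w \<in> ball a \<rho>" if "w \<in> cball 0 1" for w
    proof -
      have "3/4 * \<rho> * cmod w \<le> 3/4 * \<rho> * 1" using that \<rho> by (intro mult_left_mono) auto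
      also have "\<dots> < \<rho>" using \<rho> by simp
      finally show ?thesis using \<rho> by (simp add: dist_norm norm_mult)
    qed
    define w where "w = (z - a) / complex_of_real (3/4 * \<rho>)"
    have w: "cmod w \<le> 2/3" "a + complex_of_real (3/4 * \<rho>) * w = z"
    proof -
      have "cmod w = cmod (z - a) / (3/4 * \<rho>)" using \<rho> unfolding w_def norm_divide by (simp only: norm_of_real)
      then show "cmod w \<le> 2/3" using z \<rho> by (simp add: divide_le_eq)
    qed (use \<rho> in \<open>simp add: w_def field_simps\<close>)
    have holg: "g holomorphic_on ball a \<rho>" using g(1) by (simp add: hol_iff_holomorphic_on)
    have holF: "F holomorphic_on ball a \<rho>"
      unfolding F_def by (intro holomorphic_intros holg) auto
    have "(F \<circ> (\<lambda>w. a + complex_of_real (3/4 * \<rho>) * w)) holomorphic_on cball 0 1"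
      by (rule holomorphic_on_compose_gen[OF _ holF]) (use inb in \<open>auto intro!: holomorphic_intros\<close>)
    moreover have "F \<circ> (\<lambda>w. a + complex_of_real (3/4 * \<rho>) * w) = F'"
      by (rule ext) (simp add: F'_def)
    ultimately have holF': "F' holomorphic_on cball 0 1" by metis
    have "cmod (F' w) \<le> K1"
      unfolding K1_def
    proof (rule Schottky[OF holF', of 1 "2/3" w])
      show "\<not> (F' v = 0 \<or> F' v = 1)" if "v \<in> cball 0 1" for v
        using F1[OF inb[OF that]] by (simp add: F'_def F_def s_def)
    qed (use w Fa in \<open>auto simp: F'_def\<close>)
    then have "cmod (F z) \<le> K1" using w by (simp add: F'_def)
    then have "cmod ((F z)\<^sup>2) \<le> K1\<^sup>2" by (simp add: norm_power power_mono)
    moreover have zb: "z \<in> ball a \<rho>" using z \<rho> by (simp add: dist_norm norm_minus_commute)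
    moreover have "f z = c * (1 - (F z)\<^sup>2)" using F2[OF zb] c0 by (simp add: q_def)
    moreover have "cmod (1 - (F z)\<^sup>2) \<le> 1 + cmod ((F z)\<^sup>2)"
      using norm_triangle_ineq4[of 1 "(F z)\<^sup>2"] by simp
    ultimately have "cmod (f z) \<le> cmod c * (1 + K1\<^sup>2)"
      by (simp add: norm_mult mult_left_mono)
    then show "cmod (f z) \<le> (1 + K1\<^sup>2) * cmod c" by (simp add: mult.commute)
  qed
qed

text \<open>A growth estimate of Koebe type. If the image contained the disc of radius
  \<open>s\<close> about \<open>0\<close>, the Schwarz lemma for the inverse function would put
  \<open>b\<close> too close to \<open>a\<close>. So a value of modulus below \<open>s\<close> is
  omitted, and \<open>omitted_value_bound\<close> applies.\<close>

lemma univalent_bound: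
  obtains K :: real where "K > 0"
    "\<And>f a \<rho> b z. f holomorphic_on ball a \<rho> \<Longrightarrow> inj_on f (ball a \<rho>) \<Longrightarrow> f a = 0 \<Longrightarrow>
      b \<in> ball a \<rho> \<Longrightarrow> b \<noteq> a \<Longrightarrow> cmod (z - a) \<le> \<rho> / 2 \<Longrightarrow> cmod (f z) \<le> K * \<rho> * cmod (f b) / cmod (b - a)"
proof -
  obtain K where K: "K > 0"
    "\<And>f a \<rho> c z. f holomorphic_on ball a \<rho> \<Longrightarrow> 0 < \<rho> \<Longrightarrow> f a = 0 \<Longrightarrow>
      (\<And>w. w \<in> ball a \<rho> \<Longrightarrow> f w = 0 \<Longrightarrow> w = a) \<Longrightarrow> c \<notin> f ` ball a \<rho> \<Longrightarrow>
      cmod (z - a) \<le> \<rho> / 2 \<Longrightarrow> cmod (f z) \<le> K * cmod c"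
    using omitted_value_bound by metis
  show thesis
  proof
    show "2 * K > 0" using K by simp
    fix f :: "complex \<Rightarrow> complex" and a b z :: complex and \<rho> :: real
    assume holf: "f holomorphic_on ball a \<rho>" and inj: "inj_on f (ball a \<rho>)" and fa: "f a = 0"
      and b: "b \<in> ball a \<rho>" "b \<noteq> a" and z: "cmod (z - a) \<le> \<rho> / 2"
    have \<rho>: "\<rho> > 0" using b by (metis ball_eq_empty empty_iff not_le)
    have fb: "f b \<noteq> 0" using inj_onD[OF inj, of b a] b fa \<rho> by auto
    have ba: "cmod (b - a) > 0" using b by simp
    \<comment> \<open>The factor \<open>2\<close> makes the contradiction with the Schwarz lemma
      strict.\<close>
    define s where "s = 2 * \<rho> * cmod (f b) / cmod (b - a)"
    have s: "s > 0" using \<rho> fb ba by (simp add: s_def)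
    have "\<not> ball 0 s \<subseteq> f ` ball a \<rho>"
    proof
      assume sub: "ball 0 s \<subseteq> f ` ball a \<rho>"
      obtain g where g: "g holomorphic_on f ` ball a \<rho>" "\<And>z. z \<in> ball a \<rho> \<Longrightarrow> g (f z) = z"
        using holomorphic_has_inverse[OF holf open_ball inj] by metis
      define G where "G w = (g (complex_of_real s * w) - a) / complex_of_real \<rho>" for w
      have sw: "complex_of_real s * w \<in> ball 0 s" if "cmod w < 1" for w
        using that s by (simp add: norm_mult)
      have gs: "g holomorphic_on ball 0 s" by (rule holomorphic_on_subset[OF g(1) sub])
      have "(g \<circ> (\<lambda>w. complex_of_real s * w)) holomorphic_on ball 0 1"
        by (rule holomorphic_on_compose_gen[OF _ gs]) (use sw in \<open>auto intro!: holomorphic_intros\<close>)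
      then have holG: "G holomorphic_on ball 0 1"
        unfolding G_def comp_def using \<rho> by (intro holomorphic_intros) auto
      have G0: "G 0 = 0" using g(2)[of a] fa \<rho> by (simp add: G_def)
      have G1: "cmod (G w) < 1" if "cmod w < 1" for w
      proof -
        obtain y where y: "y \<in> ball a \<rho>" "complex_of_real s * w = f y" using sub sw[OF \<open>cmod w < 1\<close>] by blast
        then have "G w = (y - a) / complex_of_real \<rho>" using g(2) by (simp add: G_def)
        then show ?thesis using y(1) \<rho> by (simp add: norm_divide dist_norm norm_minus_commute)
      qed
      define w where "w = f b / complex_of_real s"
      have "cmod w = cmod (b - a) / (2 * \<rho>)" using fb \<rho> ba by (simp add: w_def norm_divide norm_mult s_def)
      moreover have lt: "cmod (b - a) < \<rho>" using b by (simp add: dist_norm norm_minus_commute)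
      ultimately have "cmod w < 1" using \<rho> by (simp add: divide_less_eq)
      from Schwarz_Lemma(1)[OF holG G0 G1 this] have "cmod (G w) \<le> cmod w" by simp
      moreover have "G w = (b - a) / complex_of_real \<rho>"
        using g(2)[OF b(1)] s by (simp add: G_def w_def)
      ultimately have "cmod (b - a) / \<rho> \<le> cmod (b - a) / (2 * \<rho>)"
        using \<open>cmod w = _\<close> \<rho> by (simp add: norm_divide)
      then show False using \<rho> ba by (simp add: field_simps)
    qed
    then obtain c where "c \<in> ball 0 s" and c2: "c \<notin> f ` ball a \<rho>" by blast
    then have c: "cmod c < s" "c \<notin> f ` ball a \<rho>" by auto
    have "cmod (f z) \<le> K * cmod c"
      by (rule K(2)[OF holf \<rho> fa _ c(2) z]) (metis inj_onD[OF inj] fa centre_in_ball \<rho>)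
    also have "\<dots> \<le> K * s" using c K by simp
    finally show "cmod (f z) \<le> 2 * K * \<rho> * cmod (f b) / cmod (b - a)" by (simp add: s_def mult_ac)
  qed
qed

text \<open>\<open>univalent_bound\<close> on the discs of radius \<open>2 * cmod z\<close>, with
  reference points \<open>0\<close> and \<open>1\<close>, gives linear growth, and Liouville's
  theorem for polynomial growth concludes.\<close>

lemma injective_entire_affine:
  assumes holf: "f holomorphic_on UNIV" and inj: "inj f"
  shows "f z = f 0 + (f 1 - f 0) * z"
proof -
  obtain K :: real where K: "K > 0"
    "\<And>f a \<rho> b z. f holomorphic_on ball a \<rho> \<Longrightarrow> inj_on f (ball a \<rho>) \<Longrightarrow> f a = 0 \<Longrightarrow>
      b \<in> ball a \<rho> \<Longrightarrow> b \<noteq> a \<Longrightarrow> cmod (z - a) \<le> \<rho> / 2 \<Longrightarrow> cmod (f z) \<le> K * \<rho> * cmod (f b) / cmod (b - a)"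
    using univalent_bound by metis
  define g where "g z = f z - f 0" for z
  have holg: "g holomorphic_on S" for S unfolding g_def
    by (intro holomorphic_intros holomorphic_on_subset[OF holf]) auto
  have injg: "inj_on g S" for S unfolding g_def using inj by (auto simp: inj_def inj_on_def)
  have g0: "g 0 = 0" by (simp add: g_def)
  have bd: "cmod (g z) \<le> (2 * K * cmod (g 1)) * cmod z ^ 1" if z: "1 \<le> cmod z" for z :: complex
  proof -
    have "cmod (g z) \<le> K * (2 * cmod z) * cmod (g 1) / cmod (1 - 0)"
      by (rule K(2)[OF holg injg g0]) (use z in simp_all)
    then show ?thesis by (simp add: mult_ac)
  qed
  define A where "A = deriv g 0"
  have lin: "g z = A * z" for z
    using Liouville_polynomial[OF holg bd, where \<xi> = z] by (simp add: A_def g0)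
  have "g 1 = A" using lin[of 1] by simp
  then show ?thesis using lin[of z] by (simp add: g_def algebra_simps)
qed

section \<open>The additive Cousin problem for concentric balls\<close>

context
  fixes N :: "'w::complex_space \<Rightarrow> real" and p :: "'w \<Rightarrow> complex" and r :: real
  assumes N: "cnorm N" and p: "hol p {y. N y < r}"
begin

text \<open>The homogeneous component of degree \<open>m\<close> of \<open>p\<close> at
  \<open>0\<close>, read off along complex lines. Sums of these components serve as the entire
  approximants of \<open>p\<close>.\<close>

definition taylor_form :: "nat \<Rightarrow> 'w \<Rightarrow> complex" where
  "taylor_form m y = (deriv ^^ m) (\<lambda>t. p (t *\<^sub>C y)) 0 / fact m"

lemma disc_hol: "R * N y < r \<Longrightarrow> (\<lambda>t. p (t *\<^sub>C y)) holomorphic_on cball 0 R"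
proof -
  assume R: "R * N y < r"
  have "complex_differentiable_at (\<lambda>t. p (t *\<^sub>C y)) t" if "t \<in> cball 0 R" for t
  proof -
    have "cmod t * N y \<le> R * N y" using that cnorm_nonneg[OF N] by (intro mult_right_mono) auto
    then have "complex_differentiable_at p (0 + t *\<^sub>C y)"
      using R by (intro holD[OF p]) (simp add: cnorm_scaleC[OF N])
    from cdiff_at_along_line[OF this] show ?thesis by simp
  qed
  then show ?thesis
    by (auto simp: holomorphic_on_def cdiff_at_iff_field_differentiable
        intro: field_differentiable_at_within)
qed

text \<open>Cauchy's inequality on the circle of radius \<open>R\<close> in the line through
  \<open>y\<close> bounds the coefficient of degree \<open>m\<close> by \<open>B / R ^ m\<close>;
  the rest is a geometric series.\<close>

lemma taylor_remainder:
  assumes B: "\<And>y. N y \<le> s \<Longrightarrow> cmod (p y) \<le> B" and s: "s < r"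
    and R: "0 < R" "R * N y \<le> s" and h: "cmod h < R"
  shows "cmod (p (h *\<^sub>C y) - (\<Sum>m<M. taylor_form m y * h ^ m)) \<le> B * (cmod h / R) ^ M / (1 - cmod h / R)"
proof -
  define x where "x = cmod h / R"
  have x: "0 \<le> x" "x < 1" using h R by (auto simp: x_def)
  have hol: "(\<lambda>t. p (t *\<^sub>C y)) holomorphic_on cball 0 R" using disc_hol R s by simp
  have coeff: "cmod (taylor_form m y) \<le> B / R ^ m" for m
  proof -
    have "cmod ((deriv ^^ m) (\<lambda>t. p (t *\<^sub>C y)) 0) \<le> fact m * B / R ^ m"
    proof (rule Cauchy_inequality)
      show "(\<lambda>t. p (t *\<^sub>C y)) holomorphic_on ball 0 R" using hol holomorphic_on_subset ball_subset_cball by blast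
      show "continuous_on (cball 0 R) (\<lambda>t. p (t *\<^sub>C y))" by (rule holomorphic_on_imp_continuous_on[OF hol])
      show "cmod (p (t *\<^sub>C y)) \<le> B" if "cmod (0 - t) = R" for t
        using that R by (intro B) (simp add: cnorm_scaleC[OF N])
    qed (rule R)
    then show ?thesis by (simp add: taylor_form_def norm_divide field_simps)
  qed
  have "(\<lambda>m. taylor_form m y * h ^ m) sums p (h *\<^sub>C y)"
    using holomorphic_power_series[of "\<lambda>t. p (t *\<^sub>C y)" 0 R h] h hol holomorphic_on_subset ball_subset_cball
    by (simp add: taylor_form_def)
  from sums_split_initial_segment[OF this, of M]
  have sums: "(\<lambda>m. taylor_form (m + M) y * h ^ (m + M)) sums (p (h *\<^sub>C y) - (\<Sum>m<M. taylor_form m y * h ^ m))"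
    by simp
  have geo: "(\<lambda>m. B * x ^ M * x ^ m) sums (B * x ^ M * (1 / (1 - x)))"
    by (intro sums_mult geometric_sums) (use x in simp)
  have "cmod (taylor_form (m + M) y * h ^ (m + M)) \<le> B * x ^ M * x ^ m" for m
  proof -
    have "cmod (taylor_form (m + M) y * h ^ (m + M)) \<le> B / R ^ (m + M) * cmod h ^ (m + M)"
      unfolding norm_mult norm_power by (intro mult_right_mono coeff) simp
    also have "\<dots> = B * x ^ M * x ^ m" by (simp add: x_def power_divide power_add mult_ac)
    finally show ?thesis .
  qed
  from norm_suminf_le[OF this sums_summable[OF geo]] sums_unique[OF sums] sums_unique[OF geo]
  show ?thesis by (simp add: x_def)
qed

lemma bounded_on_smaller:
  assumes "s < r" obtains B where "0 \<le> B" "\<And>y. N y \<le> s \<Longrightarrow> cmod (p y) \<le> B"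
proof -
  have "compact (p ` {y. N y \<le> s})"
    by (intro compact_continuous_image continuous_on_subset[OF hol_continuous[OF p]] cnorm_compact[OF N])
       (use assms in auto)
  then have "bounded (p ` {y. N y \<le> s})" by (rule compact_imp_bounded)
  then obtain B where "\<forall>z\<in>p ` {y. N y \<le> s}. cmod z \<le> B" unfolding bounded_iff by blast
  then have B: "\<And>y. N y \<le> s \<Longrightarrow> cmod (p y) \<le> B" by blast
  show thesis by (rule that[of "max B 0"]) (use B in \<open>auto simp: le_max_iff_disj\<close>)
qed

text \<open>By induction on the degree: the form is the locally uniform limit, as \<open>h\<close>
  tends to \<open>0\<close>, of \<open>p (h *\<^sub>C y)\<close> minus the lower terms, divided by
  \<open>h ^ m\<close>. Small \<open>h\<close> brings any bounded set of \<open>y\<close> into the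
  domain of \<open>p\<close>, which is why the result is entire.\<close>

lemma taylor_form_hol:
  assumes r: "0 < r" shows "hol (taylor_form m) UNIV"
proof (induction m rule: less_induct)
  case (less m)
  define s where "s = r / 2"
  have s: "0 < s" "s < r" using r by (auto simp: s_def)
  obtain B where B: "0 \<le> B" "\<And>y. N y \<le> s \<Longrightarrow> cmod (p y) \<le> B" using bounded_on_smaller[OF s(2)] by metis
  show ?case
  proof (rule holI)
    fix y0 :: 'w
    define R0 where "R0 = N y0 + 1"
    have R0: "R0 > 0" using cnorm_nonneg[OF N, of y0] by (simp add: R0_def)
    define R where "R = s / R0"
    have R: "R > 0" using s R0 by (simp add: R_def)
    \<comment> \<open>The denominator keeps \<open>h n / R\<close> at most \<open>1/2\<close>, so
      the geometric factor in the remainder is at most \<open>2\<close>.\<close>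
    define h where "h n = R / (real n + 2)" for n
    have h: "0 < h n" "h n \<le> R / 2" for n
    proof -
      show "0 < h n" using R by (simp add: h_def)
      show "h n \<le> R / 2" unfolding h_def using R by (intro divide_left_mono) auto
    qed
    have h0: "h \<longlonglongrightarrow> 0"
      using LIMSEQ_ignore_initial_segment[OF lim_const_over_n[of R], of 2] unfolding h_def by (simp add: add.commute)
    define q where "q n y = (p (complex_of_real (h n) *\<^sub>C y) -
        (\<Sum>j<m. taylor_form j y * complex_of_real (h n) ^ j)) / complex_of_real (h n) ^ m" for n y
    let ?U = "{y. N y < R0}"
    have RN: "R * N y \<le> s" if "N y < R0" for y
    proof -
      have "R * N y \<le> R * R0" using that R by (intro mult_left_mono) auto
      then show ?thesis using R0 by (simp add: R_def)
    qed
    have lim: "uniform_limit ?U q (taylor_form m) sequentially"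
    proof (rule uniform_limitI)
      fix e :: real assume e: "e > 0"
      have "(\<lambda>n. 2 * B / R ^ Suc m * h n) \<longlonglongrightarrow> 2 * B / R ^ Suc m * 0"
        by (intro tendsto_mult tendsto_const h0)
      then have "\<forall>\<^sub>F n in sequentially. 2 * B / R ^ Suc m * h n < e"
        using e by (intro order_tendstoD(2)[of _ 0]) auto
      then show "\<forall>\<^sub>F n in sequentially. \<forall>y\<in>?U. dist (q n y) (taylor_form m y) < e"
      proof eventually_elim
        case (elim n)
        show ?case
        proof
          fix y assume y: "y \<in> ?U"
          let ?h = "complex_of_real (h n)"
          have x: "cmod ?h / R \<le> 1/2" "cmod ?h < R" using h[of n] R by (auto simp: field_simps)
          have "cmod (p (?h *\<^sub>C y) - (\<Sum>j<Suc m. taylor_form j y * ?h ^ j))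
              \<le> B * (cmod ?h / R) ^ Suc m / (1 - cmod ?h / R)"
            by (rule taylor_remainder[OF B(2) s(2) R]) (use y RN x in auto)
          also have "\<dots> \<le> B * (cmod ?h / R) ^ Suc m / (1/2)"
            using x B R h[of n] by (intro divide_left_mono mult_nonneg_nonneg) auto
          also have "\<dots> = 2 * B / R ^ Suc m * h n * h n ^ m" using h[of n] by (simp add: power_divide)
          finally have 1: "cmod (p (?h *\<^sub>C y) - (\<Sum>j<Suc m. taylor_form j y * ?h ^ j)) \<le> 2 * B / R ^ Suc m * h n * h n ^ m" .
          have "q n y - taylor_form m y = (p (?h *\<^sub>C y) - (\<Sum>j<Suc m. taylor_form j y * ?h ^ j)) / ?h ^ m"
            using h[of n] by (simp add: q_def field_simps)
          then have "dist (q n y) (taylor_form m y) = cmod (p (?h *\<^sub>C y) - (\<Sum>j<Suc m. taylor_form j y * ?h ^ j)) / h n ^ m"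
            using h[of n] by (simp add: dist_norm norm_divide norm_power)
          also have "\<dots> \<le> 2 * B / R ^ Suc m * h n" using 1 h[of n] by (simp add: divide_le_eq)
          finally show "dist (q n y) (taylor_form m y) < e" using elim by simp
        qed
      qed
    qed
    have "hol (taylor_form m) ?U"
    proof (rule weierstrass[OF cnorm_open[OF N]])
      show "luc q (taylor_form m) ?U" unfolding luc_def using lim uniform_limit_on_subset by blast
      have "complex_differentiable_at (q n) y" if y: "y \<in> ?U" for n y
        unfolding q_def
      proof (intro cdiff_at_divide cdiff_at_diff cdiff_at_sum cdiff_at_mult cdiff_at_const)
        have "N (complex_of_real (h n) *\<^sub>C y) = h n * N y" using h[of n] by (simp add: cnorm_scaleC[OF N])
        also have "\<dots> \<le> R * N y" using h[of n] cnorm_nonneg[OF N, of y] R by (intro mult_right_mono) auto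
        also have "\<dots> < r" using RN[of y] y s by simp
        finally have "complex_differentiable_at p (complex_of_real (h n) *\<^sub>C y)" by (intro holD[OF p]) simp
        then show "complex_differentiable_at (\<lambda>y. p (complex_of_real (h n) *\<^sub>C y)) y"
          by (intro cdiff_at_compose[of "\<lambda>y. complex_of_real (h n) *\<^sub>C y" _ p] cdiff_at_scaleC cdiff_at_const cdiff_at_ident)
        show "complex_differentiable_at (taylor_form i) y" if "i \<in> {..<m}" for i
          using less[of i] that by (simp add: hol_def)
      qed (use h[of n] in auto)
      then show "ehol q ?U" by (intro eholI always_eventually allI) (simp add: hol_def)
    qed
    then show "complex_differentiable_at (taylor_form m) y0" by (rule holD) (simp add: R0_def)
  qed
qed

text \<open>The Cauchy estimates are made on a slightly larger ball, so the remainder at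
  \<open>h = 1\<close> with \<open>R = s' / s > 1\<close> decays geometrically in the number of
  terms.\<close>

lemma entire_approximation:
  assumes s: "0 < s" "s < r" and e: "0 < e"
  obtains P where "hol P (UNIV :: 'w set)" "\<And>y. N y \<le> s \<Longrightarrow> cmod (p y - P y) < e"
proof -
  define s' where "s' = (s + r) / 2"
  have s': "s < s'" "s' < r" using s by (auto simp: s'_def)
  obtain B where B: "0 \<le> B" "\<And>y. N y \<le> s' \<Longrightarrow> cmod (p y) \<le> B" using bounded_on_smaller[OF s'(2)] by metis
  define R where "R = s' / s"
  have R: "R > 1" using s s' by (simp add: R_def)
  have "(\<lambda>M. B * (1 / R) ^ M / (1 - 1 / R)) \<longlonglongrightarrow> B * 0 / (1 - 1 / R)"
    using R by (intro tendsto_intros LIMSEQ_realpow_zero) auto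
  then have "\<forall>\<^sub>F M in sequentially. B * (1 / R) ^ M / (1 - 1 / R) < e"
    using e by (intro order_tendstoD(2)[of _ 0]) auto
  then obtain M where M: "B * (1 / R) ^ M / (1 - 1 / R) < e" by (auto simp: eventually_sequentially)
  show thesis
  proof
    show "hol (\<lambda>y. \<Sum>m<M. taylor_form m y) UNIV"
      using taylor_form_hol s by (auto simp: hol_def intro!: cdiff_at_sum)
    fix y assume y: "N y \<le> s"
    have "R * N y \<le> R * s" using y R by (intro mult_left_mono) auto
    then have "R * N y \<le> s'" using s by (simp add: R_def)
    from taylor_remainder[OF B(2) s'(2) _ this, of 1 M] R M
    show "cmod (p y - (\<Sum>m<M. taylor_form m y)) < e" by simp
  qed
qed

end

text \<open>Formally \<open>\<gamma> i\<close> is minus the sum of all \<open>g n\<close> with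
  \<open>n \<ge> i\<close>, which need not converge. Subtracting entire functions \<open>Q n\<close>
  from the terms makes the tail converge; the finite sum of \<open>Q l\<close> with
  \<open>l < i\<close> restores the differences, and \<open>\<gamma> (Suc i) - \<gamma> i\<close>
  telescopes to \<open>g i\<close>.\<close>

lemma mittag_leffler:
  fixes N :: "'w::complex_space \<Rightarrow> real" and g :: "nat \<Rightarrow> 'w \<Rightarrow> complex"
  assumes N: "cnorm N" and g: "\<And>i. hol (g i) {y. N y < r i}" and r: "\<And>i. r i < r (Suc i)" "\<And>i. 0 < r i"
  obtains \<gamma> where "\<And>i. hol (\<gamma> i) {y. N y < r i}" "\<And>i y. N y < r i \<Longrightarrow> \<gamma> (Suc i) y - \<gamma> i y = g i y"
proof -
  \<comment> \<open>\<open>g (Suc i)\<close> lives on a ball strictly larger than that of radius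
    \<open>r i\<close>, which leaves room for the approximation; hence the shifted index.\<close>
  have "\<exists>P. hol P (UNIV :: 'w set) \<and> (\<forall>y. N y \<le> r i \<longrightarrow> cmod (g (Suc i) y - P y) < (1/2) ^ i)" for i
    using entire_approximation[OF N g r(2) r(1), of "(1/2) ^ i" i] by (metis zero_less_power half_gt_zero zero_less_one)
  then obtain Q where Q: "\<And>i. hol (Q i) (UNIV :: 'w set)"
    "\<And>i y. N y \<le> r i \<Longrightarrow> cmod (g (Suc i) y - Q i y) < (1/2) ^ i" by metis
  have mono: "r i \<le> r j" if "i \<le> j" for i j
    by (rule lift_Suc_mono_le[of r, OF less_imp_le[OF r(1)] that])
  define d where "d i y = g (Suc i) y - Q i y" for i y
  have db: "cmod (d (n + j) y) \<le> (1/2) ^ n" if y: "N y < r j" for n j y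
  proof -
    have "N y \<le> r (n + j)" using y mono[of j "n + j"] by simp
    then have "cmod (d (n + j) y) \<le> (1/2) ^ (n + j)" using Q(2) by (simp add: d_def less_imp_le)
    also have "\<dots> \<le> (1/2) ^ n" by (intro power_decreasing) auto
    finally show ?thesis .
  qed
  have sm: "summable (\<lambda>n. (1/2) ^ n :: real)" by (rule summable_geometric) simp
  have summ: "summable (\<lambda>n. d (n + j) y)" if "N y < r j" for j y
    by (rule summable_comparison_test'[OF sm]) (use db[OF that] in simp)
  define S where "S j y = (\<Sum>n. d (n + j) y)" for j y
  have holS: "hol (S j) {y. N y < r j}" for j
  proof (rule weierstrass[OF cnorm_open[OF N]])
    have "uniform_limit {y. N y < r j} (\<lambda>M y. \<Sum>n<M. d (n + j) y) (S j) sequentially"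
      unfolding S_def by (rule Weierstrass_m_test_ev[OF _ sm]) (use db in \<open>auto intro!: always_eventually\<close>)
    then show "luc (\<lambda>M y. \<Sum>n<M. d (n + j) y) (S j) {y. N y < r j}"
      unfolding luc_def using uniform_limit_on_subset by blast
    have "hol (d (n + j)) {y. N y < r j}" for n
      unfolding d_def
      by (intro hol_diff hol_subset[OF g] hol_subset[OF Q(1)]) (use mono[of j "Suc (n + j)"] in auto)
    then show "ehol (\<lambda>M y. \<Sum>n<M. d (n + j) y) {y. N y < r j}"
      by (intro eholI always_eventually allI) (auto simp: hol_def intro!: cdiff_at_sum)
  qed
  have S_step: "S j y = d j y + S (Suc j) y" if "N y < r j" for j y
    using suminf_split_head[OF summ[OF that]] by (simp add: S_def)
  show thesis
  proof
    show "hol (\<lambda>y. (\<Sum>l<i. Q l y) - g i y - S i y) {y. N y < r i}" for i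
      by (intro hol_diff holS g) (use Q(1) in \<open>auto simp: hol_def intro!: cdiff_at_sum\<close>)
    show "((\<Sum>l<Suc i. Q l y) - g (Suc i) y - S (Suc i) y) - ((\<Sum>l<i. Q l y) - g i y - S i y) = g i y"
      if "N y < r i" for i y
      using S_step[OF that] by (simp add: d_def)
  qed
qed

section \<open>Towers collapsing to a hyperplane\<close>

text \<open>The derivative is block triangular, with the identity and an injective map on the
  diagonal. It is used to see that \<open>fst\<close> and \<open>R k\<close> form coordinates near
  the hyperplane.\<close>

lemma immersive_fst_Pair:
  fixes g :: "complex \<times> 'w::complex_space \<Rightarrow> 'w"
  assumes g: "complex_differentiable_at g (t, y)" and imm: "immersive (\<lambda>y. g (t, y)) y"
  shows "immersive (\<lambda>x. (fst x, g x)) (t, y)"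
proof -
  obtain D where D: "clinear D" "(g has_derivative D) (at (t, y))" using g by (rule cdiff_at_E)
  obtain E where E: "clinear E" "inj E" "((\<lambda>y. g (t, y)) has_derivative E) (at y)"
    using imm unfolding immersive_def by blast
  have "((\<lambda>y. (t, y)) has_derivative (\<lambda>v. (0, v))) (at y)"
    by (intro has_derivative_Pair has_derivative_const has_derivative_ident)
  from has_derivative_compose[OF this D(2)] have "((\<lambda>y. g (t, y)) has_derivative (\<lambda>v. D (0, v))) (at y)" .
  then have DE: "D (0, v) = E v" for v using has_derivative_unique[OF E(3)] by metis
  have 1: "clinear (\<lambda>v. (fst v, D v))" by (intro clinear_Pair clinear_fst D)
  have "inj (\<lambda>v. (fst v, D v))"
    unfolding clinear_inj_iff[OF 1]
  proof (intro allI impI)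
    fix v :: "complex \<times> 'w" assume "(fst v, D v) = 0"
    then have "fst v = 0" "D v = 0" by (auto simp: zero_prod_def)
    then have "E (snd v) = 0" using DE[of "snd v"] by (metis prod.collapse)
    then have "snd v = 0" using E(1,2) clinear_inj_iff by blast
    with \<open>fst v = 0\<close> show "v = 0" by (simp add: prod_eq_iff)
  qed
  moreover have "((\<lambda>x. (fst x, g x)) has_derivative (\<lambda>v. (fst v, D v))) (at (t, y))"
    by (intro has_derivative_Pair D has_derivative_fst has_derivative_ident)
  ultimately show ?thesis unfolding immersive_def using 1 by blast
qed

text \<open>The mirror case: a nonvanishing fibre derivative and the identity on the base as
  diagonal blocks. It is used for fibre coordinates paired with the projection.\<close>

lemma immersive_Pair_snd:
  fixes g :: "complex \<times> 'w::complex_space \<Rightarrow> complex"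
  assumes g: "complex_differentiable_at g (t, y)" and der: "deriv (\<lambda>t. g (t, y)) t \<noteq> 0"
  shows "immersive (\<lambda>x. (g x, snd x)) (t, y)"
proof -
  obtain D where D: "clinear D" "(g has_derivative D) (at (t, y))" using g by (rule cdiff_at_E)
  have "((\<lambda>t. (t, y)) has_derivative (\<lambda>v. (v, 0))) (at t)"
    by (intro has_derivative_Pair has_derivative_const has_derivative_ident)
  from has_derivative_compose[OF this D(2)] have d: "((\<lambda>t. g (t, y)) has_derivative (\<lambda>v. D (v, 0))) (at t)" .
  have lin: "D (v, 0) = D (1, 0) * v" for v
    using clinear_scaleC[OF D(1), of v "(1, 0)"] by (simp add: scaleC_prod_def scaleC_complex_def)
  have "((\<lambda>t. g (t, y)) has_field_derivative D (1, 0)) (at t)"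
  proof -
    have "(\<lambda>v. D (v, 0)) = times (D (1, 0))" using lin by blast
    with d show ?thesis unfolding has_field_derivative_def by argo
  qed
  then have D1: "D (1, 0) \<noteq> 0" using der DERIV_imp_deriv by metis
  have 1: "clinear (\<lambda>v. (D v, snd v))" by (intro clinear_Pair clinear_snd D)
  have "inj (\<lambda>v. (D v, snd v))"
    unfolding clinear_inj_iff[OF 1]
  proof (intro allI impI)
    fix v :: "complex \<times> 'w" assume "(D v, snd v) = 0"
    then have "snd v = 0" "D v = 0" by (auto simp: zero_prod_def)
    then have "D (1, 0) * fst v = 0" using lin[of "fst v"] by (metis prod.collapse)
    with D1 \<open>snd v = 0\<close> show "v = 0" by (simp add: prod_eq_iff)
  qed
  moreover have "((\<lambda>x. (g x, snd x)) has_derivative (\<lambda>v. (D v, snd v))) (at (t, y))"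
    by (intro has_derivative_Pair D has_derivative_snd has_derivative_ident)
  ultimately show ?thesis unfolding immersive_def using 1 by blast
qed

lemma open_norm_ball_Times: "cnorm N \<Longrightarrow> open (ball (0::complex) \<delta> \<times> {y. N y < r})"
  by (intro open_Times open_ball cnorm_open)

text \<open>This is the direct system of the charts after the image of the limit retraction has been
  straightened to \<open>0 \<times> Y\<close>, where \<open>Y\<close> is the unit ball of \<open>N\<close>. The projection \<open>R\<close> of the direct limit
  onto \<open>Y\<close> is given, and a complementary coordinate is to be found.\<close>

locale straight_tower =
  fixes N :: "'w::complex_space \<Rightarrow> real"
    and X :: "(complex \<times> 'w) set"
    and f :: "nat \<Rightarrow> nat \<Rightarrow> complex \<times> 'w \<Rightarrow> complex \<times> 'w"
    and R :: "nat \<Rightarrow> complex \<times> 'w \<Rightarrow> 'w" and Rl :: "complex \<times> 'w \<Rightarrow> 'w"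
  assumes N: "cnorm N"
    and X: "open X" and zero_in: "\<And>y. N y < 1 \<Longrightarrow> (0, y) \<in> X"
    and f_in: "\<And>j k x. j \<le> k \<Longrightarrow> x \<in> X \<Longrightarrow> f j k x \<in> X"
    and f_imm: "\<And>j k x. j \<le> k \<Longrightarrow> x \<in> X \<Longrightarrow> immersive (f j k) x"
    and f_inj: "\<And>j k. j \<le> k \<Longrightarrow> inj_on (f j k) X"
    and f_comp: "\<And>j k l x. j \<le> k \<Longrightarrow> k \<le> l \<Longrightarrow> x \<in> X \<Longrightarrow> f k l (f j k x) = f j l x"
    and R_hol: "\<And>j. hol (R j) X" and R_in: "\<And>j x. x \<in> X \<Longrightarrow> N (R j x) < 1"
    and R_f: "\<And>j k x. j \<le> k \<Longrightarrow> x \<in> X \<Longrightarrow> R k (f j k x) = R j x"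
    and R_lim: "luc R Rl X" and Rl_zero: "\<And>y. N y < 1 \<Longrightarrow> Rl (0, y) = y"
    and f_lim: "\<And>j. luc (f j) (\<lambda>x. (0, R j x)) X"
begin

lemma f_hol: "j \<le> k \<Longrightarrow> hol (f j k) X"
  by (rule immersive_hol) (rule f_imm)

lemma Rl_hol: "hol Rl X"
  by (rule weierstrass[OF X R_lim]) (intro eholI always_eventually allI R_hol)

text \<open>The point is that the thickness \<open>\<delta>\<close> does not depend on
  \<open>k\<close>. For \<open>t\<close> near \<open>0\<close> and \<open>k\<close> large, the slice
  map \<open>y \<mapsto> R k (t, y)\<close> is close to the identity, since \<open>R k\<close> tends
  to \<open>Rl\<close> and \<open>Rl (0, y) = y\<close>; \<open>near_identity\<close> inverts it
  slice by slice.\<close>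

lemma tube:
  assumes r: "0 \<le> r" "r < 1"
  obtains \<delta> k0 C where "\<delta> > 0"
    "\<And>k. k \<ge> k0 \<Longrightarrow> hol (C k) (ball 0 \<delta> \<times> {y. N y < r})"
    "\<And>k t y. k \<ge> k0 \<Longrightarrow> cmod t < \<delta> \<Longrightarrow> N y < r \<Longrightarrow>
       C k (t, y) \<in> X \<and> fst (C k (t, y)) = t \<and> R k (C k (t, y)) = y \<and>
       N (snd (C k (t, y))) < (1 + r) / 2 \<and> immersive (\<lambda>x. (fst x, R k x)) (C k (t, y))"
    "\<And>k x. k \<ge> k0 \<Longrightarrow> cmod (fst x) < \<delta> \<Longrightarrow> N (snd x) < (1 + r) / 2 \<Longrightarrow> C k (fst x, R k x) = x"
proof -
  define s where "s = (1 + r) / 2"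
  define t where "t = (1 + s) / 2"
  have st: "r < s" "s < t" "t < 1" using r by (auto simp: s_def t_def)
  obtain e where e: "0 < e"
    and ni: "\<And>g. hol g {x. N x < t} \<Longrightarrow> (\<And>x. N x < t \<Longrightarrow> norm (g x - x) \<le> e) \<Longrightarrow>
       inj_on g {x. N x < s} \<and> (\<forall>x. N x < s \<longrightarrow> immersive g x) \<and>
       {x. N x \<le> r} \<subseteq> g ` {x. N x < s}"
    using near_identity[OF N st(1,2) r(1)] by metis
  \<comment> \<open>Half of the error \<open>e\<close> is spent here on \<open>Rl\<close> against
    the second coordinate, the other half on \<open>R k\<close> against \<open>Rl\<close>.\<close>
  define W where "W = {x \<in> X. norm (Rl x - snd x) < e / 2}"
  have "continuous_on X (\<lambda>x. norm (Rl x - snd x))"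
    by (intro continuous_intros hol_continuous Rl_hol)
  then have oW: "open W"
    unfolding W_def using continuous_open_preimage[OF _ X open_lessThan, of "\<lambda>x. norm (Rl x - snd x)" "e / 2"]
    by (simp add: vimage_def Int_def lessThan_def)
  have cK: "compact ({0::complex} \<times> {y. N y \<le> t})"
    by (intro compact_Times cnorm_compact[OF N]) simp
  have "{0::complex} \<times> {y. N y \<le> t} \<subseteq> W"
    using st e zero_in Rl_zero by (auto simp: W_def)
  then obtain \<delta> where \<delta>: "\<delta> > 0" "(\<Union>x\<in>{0::complex} \<times> {y. N y \<le> t}. cball x \<delta>) \<subseteq> W"
    using compact_subset_open_imp_cball_epsilon_subset[OF cK oW] by blast
  define L where "L = cball (0::complex) \<delta> \<times> {y. N y \<le> t}"
  have LW: "L \<subseteq> W"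
  proof
    fix x assume "x \<in> L"
    then have "x \<in> cball (0, snd x) \<delta>" "(0, snd x) \<in> {0::complex} \<times> {y. N y \<le> t}"
      by (auto simp: L_def dist_Pair_Pair)
    then show "x \<in> W" using \<delta>(2) by blast
  qed
  have L: "compact L" "L \<subseteq> X"
    using LW unfolding L_def by (auto intro!: compact_Times cnorm_compact[OF N] simp: W_def)
  obtain k0 where k0: "\<And>k x. k \<ge> k0 \<Longrightarrow> x \<in> L \<Longrightarrow> dist (R k x) (Rl x) < e / 2"
    using luc_eventually[OF R_lim L, of "e / 2"] e unfolding eventually_sequentially by auto
  define Q where "Q = ball (0::complex) \<delta> \<times> {y. N y < s}"
  have oQ: "open Q" unfolding Q_def by (rule open_norm_ball_Times[OF N])
  have QX: "Q \<subseteq> X" using L(2) st by (force simp: Q_def L_def)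
  define T where "T k x = (fst x, R k x)" for k x
  define C where "C k = inv_into Q (T k)" for k
  have g: "inj_on (\<lambda>y. R k (\<tau>, y)) {x. N x < s} \<and> (\<forall>y. N y < s \<longrightarrow> immersive (\<lambda>y. R k (\<tau>, y)) y) \<and>
       {x. N x \<le> r} \<subseteq> (\<lambda>y. R k (\<tau>, y)) ` {x. N x < s}" if k: "k \<ge> k0" and \<tau>: "cmod \<tau> < \<delta>" for k \<tau>
  proof (rule ni)
    have "complex_differentiable_at (\<lambda>y. R k (\<tau>, y)) y" if "N y < t" for y
    proof (rule cdiff_at_compose[of "\<lambda>y. (\<tau>, y)"])
      show "complex_differentiable_at (\<lambda>y. (\<tau>, y)) y"
        by (intro cdiff_at_Pair cdiff_at_const cdiff_at_ident)
      show "complex_differentiable_at (R k) (\<tau>, y)"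
        using L(2) that \<tau> by (intro holD[OF R_hol]) (auto simp: L_def)
    qed
    then show "hol (\<lambda>y. R k (\<tau>, y)) {x. N x < t}" by (simp add: hol_def)
    show "norm (R k (\<tau>, x) - x) \<le> e" if "N x < t" for x
    proof -
      have x: "(\<tau>, x) \<in> L" using that \<tau> by (simp add: L_def)
      have 1: "norm (R k (\<tau>, x) - Rl (\<tau>, x)) < e / 2" using k0[OF k x] by (simp add: dist_norm)
      have 2: "norm (Rl (\<tau>, x) - x) < e / 2" using LW x by (auto simp: W_def)
      show ?thesis using norm_triangle_ineq[of "R k (\<tau>, x) - Rl (\<tau>, x)" "Rl (\<tau>, x) - x"] 1 2 by simp
    qed
  qed
  have Tinj: "inj_on (T k) Q" if k: "k \<ge> k0" for k
  proof (rule inj_onI)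
    fix x x' assume x: "x \<in> Q" "x' \<in> Q" "T k x = T k x'"
    then have "fst x = fst x'" "R k x = R k x'" by (auto simp: T_def)
    then have "fst x = fst x'" "R k (fst x, snd x) = R k (fst x, snd x')" by (auto, metis prod.collapse)
    moreover have "snd x = snd x'"
      using inj_onD[OF g[OF k, of "fst x", THEN conjunct1], of "snd x" "snd x'"] x calculation
      by (auto simp: Q_def)
    ultimately show "x = x'" by (simp add: prod_eq_iff)
  qed
  have Timm: "immersive (T k) x" if k: "k \<ge> k0" and x: "x \<in> Q" for k x
  proof -
    have "immersive (\<lambda>x. (fst x, R k x)) (fst x, snd x)"
    proof (rule immersive_fst_Pair)
      show "complex_differentiable_at (R k) (fst x, snd x)"
        using holD[OF R_hol, of x k] QX x by auto
      show "immersive (\<lambda>y. R k (fst x, y)) (snd x)"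
        using g[OF k, of "fst x"] x by (auto simp: Q_def)
    qed
    then show ?thesis by (simp add: T_def[abs_def])
  qed
  have im: "(\<tau>, y) \<in> T k ` Q" if "k \<ge> k0" "cmod \<tau> < \<delta>" "N y < r" for k \<tau> y
  proof -
    have "y \<in> (\<lambda>y. R k (\<tau>, y)) ` {x. N x < s}" using g[OF that(1,2)] that(3) by auto
    then obtain \<eta> where "N \<eta> < s" "y = R k (\<tau>, \<eta>)" by blast
    then have "(\<tau>, y) = T k (\<tau>, \<eta>)" "(\<tau>, \<eta>) \<in> Q" using that by (auto simp: T_def Q_def)
    then show ?thesis by blast
  qed
  show thesis
  proof
    show "\<delta> > 0" by (rule \<delta>)
    show "hol (C k) (ball 0 \<delta> \<times> {y. N y < r})" if "k \<ge> k0" for k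
    proof (rule immersive_hol)
      fix x :: "complex \<times> 'w" assume "x \<in> ball 0 \<delta> \<times> {y. N y < r}"
      then have "x \<in> T k ` Q" using im[OF that, of "fst x" "snd x"] by auto
      then show "immersive (C k) x"
        unfolding C_def using immersive_inverse(2)[OF oQ Tinj Timm] that by blast
    qed
    fix k \<tau> y assume k: "k \<ge> k0" "cmod \<tau> < \<delta>" "N y < r"
    have CQ: "C k (\<tau>, y) \<in> Q" "T k (C k (\<tau>, y)) = (\<tau>, y)"
      unfolding C_def using im[OF k] by (auto intro: inv_into_into f_inv_into_f)
    then show "C k (\<tau>, y) \<in> X \<and> fst (C k (\<tau>, y)) = \<tau> \<and> R k (C k (\<tau>, y)) = y \<and>
       N (snd (C k (\<tau>, y))) < (1 + r) / 2 \<and> immersive (\<lambda>x. (fst x, R k x)) (C k (\<tau>, y))"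
      using QX Timm[OF k(1) CQ(1)] by (auto simp: T_def[abs_def] Q_def s_def)
  next
    fix k x assume "k \<ge> k0" "cmod (fst x) < \<delta>" "N (snd x) < (1 + r) / 2"
    then have "x \<in> Q" "k \<ge> k0" by (auto simp: Q_def s_def mem_Times_iff)
    then have "C k (T k x) = x" unfolding C_def using Tinj by (intro inv_into_f_f) auto
    then show "C k (fst x, R k x) = x" by (simp add: T_def)
  qed
qed

end

lemma open_vimage_on:
  assumes "open S" "continuous_on S f" "open T" shows "open {x \<in> S. f x \<in> T}"
  using continuous_open_preimage[OF assms(2,1,3)] by (simp add: vimage_def Int_def)

lemma ehol_subseq: "ehol f U \<Longrightarrow> strict_mono r \<Longrightarrow> ehol (\<lambda>n. f (r n)) U"
  unfolding ehol_def using eventually_subseq by blast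

lemma norm_fst_le_norm: "norm (fst z) \<le> norm z" and norm_snd_le_norm: "norm (snd z) \<le> norm z"
  by (metis norm_fst_le prod.collapse) (metis norm_snd_le prod.collapse)

text \<open>\<open>C k\<close> inverts \<open>\<lambda>x. (fst x, R k x)\<close> near \<open>0 \<times> Y\<close>; \<open>C k (t, y)\<close> is the point of the fibre over
  \<open>y\<close> with first coordinate \<open>t\<close>.\<close>

locale tubed = straight_tower N X f R Rl
  for N :: "'w::complex_space \<Rightarrow> real" and X f R Rl +
  fixes r' r \<delta> :: real and \<kappa> :: nat and C :: "nat \<Rightarrow> complex \<times> 'w \<Rightarrow> complex \<times> 'w"
  assumes r': "0 < r'" "r' < r" "r < 1" and \<delta>: "\<delta> > 0"
    and C_hol: "\<And>k. k \<ge> \<kappa> \<Longrightarrow> hol (C k) (ball 0 \<delta> \<times> {y. N y < r})"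
    and C: "\<And>k t y. k \<ge> \<kappa> \<Longrightarrow> cmod t < \<delta> \<Longrightarrow> N y < r \<Longrightarrow>
       C k (t, y) \<in> X \<and> fst (C k (t, y)) = t \<and> R k (C k (t, y)) = y \<and>
       N (snd (C k (t, y))) < (1 + r) / 2 \<and> immersive (\<lambda>x. (fst x, R k x)) (C k (t, y))"
    and C_unique: "\<And>k x. k \<ge> \<kappa> \<Longrightarrow> cmod (fst x) < \<delta> \<Longrightarrow> N (snd x) < (1 + r) / 2 \<Longrightarrow> C k (fst x, R k x) = x"
begin

text \<open>As \<open>f j k\<close> converges to \<open>(0, R j x)\<close>, a compact set over the
  ball of radius \<open>r\<close> eventually lands in the tube. There a point is determined by its
  first coordinate and its base point, and the base point is invariant under the tower; hence the
  description by \<open>C k\<close>.\<close>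

lemma absorb:
  assumes K: "compact K" "K \<subseteq> X" "\<And>x. x \<in> K \<Longrightarrow> N (R j x) < r" and e: "0 < e"
  shows "\<forall>\<^sub>F k in sequentially. \<forall>x\<in>K. cmod (fst (f j k x)) < e \<and> cmod (fst (f j k x)) < \<delta> \<and>
    N (snd (f j k x)) < (1 + r) / 2 \<and> C k (fst (f j k x), R j x) = f j k x"
proof -
  obtain B where B: "0 < B" "\<And>x. N x \<le> B * norm x" using cnorm_upper[OF N] by metis
  \<comment> \<open>The last bound lets \<open>N\<close> of the second component exceed
    \<open>r\<close> by at most \<open>(1 - r) / 2\<close>, which is the room up to
    \<open>(1 + r) / 2\<close>.\<close>
  define d where "d = min (min e \<delta>) ((1 - r) / 2 / B)"
  have d: "d > 0" "d \<le> e" "d \<le> \<delta>" "d \<le> (1 - r) / 2 / B" using e \<delta> B r' by (auto simp: d_def)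
  have dB: "B * d \<le> (1 - r) / 2"
  proof -
    have "B * d \<le> B * ((1 - r) / 2 / B)" using d B by (intro mult_left_mono) auto
    then show ?thesis using B by simp
  qed
  have "\<forall>\<^sub>F k in sequentially. \<forall>x\<in>K. dist (f j k x) (0, R j x) < d"
    by (rule luc_eventually[OF f_lim K(1,2) d(1)])
  moreover have "\<forall>\<^sub>F k in sequentially. k \<ge> max j \<kappa>" by (rule eventually_ge_at_top)
  ultimately show ?thesis
  proof eventually_elim
    case (elim k)
    show ?case
    proof
      fix x assume x: "x \<in> K"
      have n: "norm (f j k x - (0, R j x)) < d" using elim x by (simp add: dist_norm)
      have 1: "cmod (fst (f j k x)) < d" using norm_fst_le_norm[of "f j k x - (0, R j x)"] n by simp
      have "norm (snd (f j k x) - R j x) < d" using norm_snd_le_norm[of "f j k x - (0, R j x)"] n by simp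
      then have "N (snd (f j k x) - R j x) \<le> B * d" using B(2)[of "snd (f j k x) - R j x"] B(1)
        by (meson less_imp_le mult_left_mono order_trans)
      then have 2: "N (snd (f j k x)) < (1 + r) / 2"
        using cnorm_triangle[OF N, of "snd (f j k x) - R j x" "R j x"] K(3)[OF x] dB by (simp add: field_simps)
      have "C k (fst (f j k x), R k (f j k x)) = f j k x"
        by (rule C_unique) (use 1 2 d elim in auto)
      moreover have "R k (f j k x) = R j x" using R_f[of j k x] K(2) x elim by auto
      ultimately show "cmod (fst (f j k x)) < e \<and> cmod (fst (f j k x)) < \<delta> \<and>
        N (snd (f j k x)) < (1 + r) / 2 \<and> C k (fst (f j k x), R j x) = f j k x"
        using 1 2 d by simp
    qed
  qed
qed

definition Xr :: "nat \<Rightarrow> (complex \<times> 'w) set" where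
  "Xr j = {x \<in> X. N (R j x) < r'}"

lemma Xr_open: "open (Xr j)"
  unfolding Xr_def using open_vimage_on[OF X hol_continuous[OF R_hol] cnorm_open[OF N, of r'], of j] by simp

lemma Xr_f: "j \<le> k \<Longrightarrow> x \<in> Xr j \<Longrightarrow> f j k x \<in> Xr k"
  by (simp add: Xr_def f_in R_f)

text \<open>\<open>q b l\<close> is the first coordinate at level \<open>l\<close> of the section \<open>C \<kappa> (b, _)\<close> of the projection. The sections
  for \<open>b = 0\<close> and \<open>b = b1\<close> are disjoint and are used to normalise the fibre coordinate \<open>fst \<circ> f j l\<close>.\<close>

definition q :: "complex \<Rightarrow> nat \<Rightarrow> 'w \<Rightarrow> complex" where
  "q b l y = fst (f \<kappa> l (C \<kappa> (b, y)))"

definition "b1 = complex_of_real (\<delta> / 2)"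

lemma b1: "cmod b1 < \<delta>" "b1 \<noteq> 0"
  using \<delta> by (auto simp: b1_def)

lemma C_pre:
  assumes "k \<ge> \<kappa>" "cmod b < \<delta>"
  shows "hol (\<lambda>y. C k (b, y)) {y. N y < r}"
  by (rule hol_compose[OF _ C_hol[OF assms(1)]])
     (use assms in \<open>auto simp: hol_def intro!: cdiff_at_Pair cdiff_at_const cdiff_at_ident\<close>)

lemma q_hol:
  assumes "\<kappa> \<le> l" "cmod b < \<delta>"
  shows "hol (q b l) {y. N y < r}"
  unfolding q_def
proof (rule hol_compose[OF _ hol_clinear[OF clinear_fst, where S = UNIV]])
  show "hol (\<lambda>y. f \<kappa> l (C \<kappa> (b, y))) {y. N y < r}"
    by (rule hol_compose[OF C_pre f_hol]) (use assms C in auto)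
qed simp

text \<open>The two sections over a closed ball are compact and therefore absorbed: both values tend
  to \<open>0\<close>, yet stay distinct because \<open>f \<kappa> l\<close> is injective and the
  starting points have different first coordinates.\<close>

lemma q_eventually:
  assumes "e > 0"
  shows "\<forall>\<^sub>F l in sequentially. \<forall>y. N y \<le> r' \<longrightarrow> cmod (q 0 l y) < e \<and> cmod (q b1 l y) < e \<and> q 0 l y \<noteq> q b1 l y \<and>
     C l (q 0 l y, y) = f \<kappa> l (C \<kappa> (0, y)) \<and> C l (q b1 l y, y) = f \<kappa> l (C \<kappa> (b1, y))"
proof -
  define K where "K = (\<lambda>y. C \<kappa> (0, y)) ` {y. N y \<le> r'} \<union> (\<lambda>y. C \<kappa> (b1, y)) ` {y. N y \<le> r'}"
  have sub: "{y. N y \<le> r'} \<subseteq> {y. N y < r}" using r' by auto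
  have "compact K" unfolding K_def
    by (intro compact_Un compact_continuous_image cnorm_compact[OF N] continuous_on_subset[OF hol_continuous[OF C_pre] sub])
       (use \<delta> b1(1) in auto)
  moreover have "K \<subseteq> X" "\<And>x. x \<in> K \<Longrightarrow> N (R \<kappa> x) < r"
    using C[of \<kappa> 0] C[of \<kappa> b1] \<delta> b1(1) r' by (auto simp: K_def)
  ultimately have "\<forall>\<^sub>F k in sequentially. \<forall>x\<in>K. cmod (fst (f \<kappa> k x)) < e \<and> cmod (fst (f \<kappa> k x)) < \<delta> \<and>
    N (snd (f \<kappa> k x)) < (1 + r) / 2 \<and> C k (fst (f \<kappa> k x), R \<kappa> x) = f \<kappa> k x"
    using absorb[of K \<kappa> e] assms by blast
  moreover have "\<forall>\<^sub>F k in sequentially. k \<ge> \<kappa>" by (rule eventually_ge_at_top)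
  ultimately show ?thesis
  proof eventually_elim
    case (elim l)
    show ?case
    proof (intro allI impI)
      fix y assume y: "N y \<le> r'"
      have in0: "C \<kappa> (0, y) \<in> K" and in1: "C \<kappa> (b1, y) \<in> K" using y by (auto simp: K_def)
      have p0: "C \<kappa> (0, y) \<in> X \<and> fst (C \<kappa> (0, y)) = 0 \<and> R \<kappa> (C \<kappa> (0, y)) = y"
        and p1: "C \<kappa> (b1, y) \<in> X \<and> fst (C \<kappa> (b1, y)) = b1 \<and> R \<kappa> (C \<kappa> (b1, y)) = y"
        using C[of \<kappa> 0 y] C[of \<kappa> b1 y] \<delta> b1(1) y r' by auto
      have e0: "C l (q 0 l y, y) = f \<kappa> l (C \<kappa> (0, y))" "cmod (q 0 l y) < e"
        using elim(1) in0 p0 unfolding q_def by auto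
      have e1: "C l (q b1 l y, y) = f \<kappa> l (C \<kappa> (b1, y))" "cmod (q b1 l y) < e"
        using elim(1) in1 p1 unfolding q_def by auto
      have "q 0 l y \<noteq> q b1 l y"
      proof
        assume "q 0 l y = q b1 l y"
        then have "f \<kappa> l (C \<kappa> (0, y)) = f \<kappa> l (C \<kappa> (b1, y))" using e0 e1 by metis
        then have "C \<kappa> (0, y) = C \<kappa> (b1, y)" using inj_onD[OF f_inj[OF elim(2)]] p0 p1 by blast
        then have "b1 = 0" using p0 p1 by metis
        then show False using b1(2) by simp
      qed
      with e0 e1 show "cmod (q 0 l y) < e \<and> cmod (q b1 l y) < e \<and> q 0 l y \<noteq> q b1 l y \<and>
         C l (q 0 l y, y) = f \<kappa> l (C \<kappa> (0, y)) \<and> C l (q b1 l y, y) = f \<kappa> l (C \<kappa> (b1, y))" by blast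
    qed
  qed
qed

text \<open>Both sections are evaluated at the base point, which the tower maps preserve; therefore
  the value at level \<open>l\<close> does not depend on the level \<open>j\<close> from which a
  point is observed.\<close>

definition fibre_coord :: "nat \<Rightarrow> nat \<Rightarrow> complex \<times> 'w \<Rightarrow> complex" where
  "fibre_coord j l x = (fst (f j l x) - q 0 l (R j x)) / (q b1 l (R j x) - q 0 l (R j x))"

lemma fibre_coord_f: "j \<le> k \<Longrightarrow> k \<le> l \<Longrightarrow> x \<in> X \<Longrightarrow> fibre_coord k l (f j k x) = fibre_coord j l x"
  by (simp add: fibre_coord_def f_comp R_f)

lemma l0_ex: "\<exists>l0\<ge>\<kappa>. \<forall>l\<ge>l0. \<forall>y. N y \<le> r' \<longrightarrow>
     cmod (q 0 l y) < \<delta>/16 \<and> cmod (q b1 l y) < \<delta>/16 \<and> q 0 l y \<noteq> q b1 l y \<and>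
     C l (q 0 l y, y) = f \<kappa> l (C \<kappa> (0, y)) \<and> C l (q b1 l y, y) = f \<kappa> l (C \<kappa> (b1, y))"
proof -
  have "\<delta>/16 > 0" using \<delta> by simp
  from eventually_conj[OF q_eventually[OF this] eventually_ge_at_top[of \<kappa>]]
  obtain l where l: "\<And>n. n \<ge> l \<Longrightarrow> (\<forall>y. N y \<le> r' \<longrightarrow>
     cmod (q 0 n y) < \<delta>/16 \<and> cmod (q b1 n y) < \<delta>/16 \<and> q 0 n y \<noteq> q b1 n y \<and>
     C n (q 0 n y, y) = f \<kappa> n (C \<kappa> (0, y)) \<and> C n (q b1 n y, y) = f \<kappa> n (C \<kappa> (b1, y))) \<and> \<kappa> \<le> n"
    unfolding eventually_sequentially by auto
  then show ?thesis by (intro exI[of _ l]) auto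
qed

text \<open>With both sections within \<open>\<delta> / 16\<close> of \<open>0\<close>, the disc of
  radius \<open>\<delta> / 4\<close> about \<open>q 0 l y\<close> fits into
  \<open>ball 0 (\<delta> / 2)\<close>, and its inner half contains every parameter of modulus below
  \<open>\<delta> / 16\<close>, as the growth estimate requires.\<close>

definition l0 where "l0 = (SOME l0. l0 \<ge> \<kappa> \<and> (\<forall>l\<ge>l0. \<forall>y. N y \<le> r' \<longrightarrow>
     cmod (q 0 l y) < \<delta>/16 \<and> cmod (q b1 l y) < \<delta>/16 \<and> q 0 l y \<noteq> q b1 l y \<and>
     C l (q 0 l y, y) = f \<kappa> l (C \<kappa> (0, y)) \<and> C l (q b1 l y, y) = f \<kappa> l (C \<kappa> (b1, y))))"

lemma l0: "l0 \<ge> \<kappa>"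
  "\<And>l y. l \<ge> l0 \<Longrightarrow> N y \<le> r' \<Longrightarrow>
     cmod (q 0 l y) < \<delta>/16 \<and> cmod (q b1 l y) < \<delta>/16 \<and> q 0 l y \<noteq> q b1 l y \<and>
     C l (q 0 l y, y) = f \<kappa> l (C \<kappa> (0, y)) \<and> C l (q b1 l y, y) = f \<kappa> l (C \<kappa> (b1, y))"
  using someI_ex[OF l0_ex, folded l0_def] by auto

lemma fibre_coord_hol:
  assumes "l \<ge> j" "l \<ge> l0" shows "hol (fibre_coord j l) (Xr j)"
proof (rule holI)
  fix x assume x: "x \<in> Xr j"
  then have xX: "x \<in> X" and Rx: "N (R j x) < r'" by (auto simp: Xr_def)
  have lk: "\<kappa> \<le> l" using l0(1) assms by simp
  have 1: "complex_differentiable_at (\<lambda>x. fst (f j l x)) x"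
    by (rule cdiff_at_compose[OF holD[OF f_hol[OF assms(1)] xX] cdiff_at_clinear[OF clinear_fst]])
  have 2: "complex_differentiable_at (\<lambda>x. q b l (R j x)) x" if "cmod b < \<delta>" for b
    by (rule cdiff_at_compose[OF holD[OF R_hol xX] holD[OF q_hol[OF lk that]]]) (use Rx r' in simp)
  show "complex_differentiable_at (fibre_coord j l) x"
    unfolding fibre_coord_def[abs_def]
    by (intro cdiff_at_divide cdiff_at_diff 1 2) (use l0(2)[of l "R j x"] assms Rx \<delta> b1 in auto)
qed

lemma ehol_fibre_coord: "ehol (fibre_coord j) (Xr j)"
  by (rule eholI)
     (use fibre_coord_hol in \<open>auto simp: eventually_sequentially intro!: exI[of _ "max j l0"]\<close>)

lemma C_fibre:
  assumes "k \<ge> \<kappa>" "N y < r'"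
  shows "hol (\<lambda>t. C k (t, y)) (ball 0 \<delta>)" "(\<lambda>t. C k (t, y)) ` ball 0 \<delta> \<subseteq> Xr k"
proof -
  show "hol (\<lambda>t. C k (t, y)) (ball 0 \<delta>)"
    by (rule hol_compose[OF _ C_hol[OF assms(1)]])
       (use assms r' in \<open>auto simp: hol_def intro!: cdiff_at_Pair cdiff_at_const cdiff_at_ident\<close>)
  show "(\<lambda>t. C k (t, y)) ` ball 0 \<delta> \<subseteq> Xr k"
    using C[OF assms(1), of _ y] assms r' by (auto simp: Xr_def)
qed

lemma fibre_coord_holomorphic:
  assumes "k \<ge> \<kappa>" "l \<ge> k" "l \<ge> l0" "N y < r'"
  shows "(\<lambda>t. fibre_coord k l (C k (t, y))) holomorphic_on ball 0 \<delta>"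
  unfolding hol_iff_holomorphic_on[OF open_ball, symmetric]
  by (rule hol_compose[OF C_fibre(1) fibre_coord_hol C_fibre(2)]) (use assms in auto)

text \<open>The two sections are transported by the tower, so at every level \<open>k\<close> from
  \<open>l0\<close> on they run through the points where the coordinate of level \<open>l\<close> is
  normalised.\<close>

lemma fibre_coord_values:
  assumes "k \<ge> l0" "l \<ge> k" "N y < r'"
  shows "fibre_coord k l (C k (q 0 k y, y)) = 0" "fibre_coord k l (C k (q b1 k y, y)) = 1"
proof -
  have kk: "\<kappa> \<le> k" "\<kappa> \<le> l" using l0(1) assms by auto
  have y: "N y \<le> r'" "N y < r" using assms r' by auto
  have *: "fibre_coord k l (C k (q b k y, y)) = (q b l y - q 0 l y) / (q b1 l y - q 0 l y)"
    if "b = 0 \<or> b = b1" for b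
  proof -
    have bd: "cmod b < \<delta>" using that b1(1) \<delta> by (metis norm_zero)
    have e: "C k (q b k y, y) = f \<kappa> k (C \<kappa> (b, y))" using l0(2)[OF assms(1) y(1)] that by auto
    have cX: "C \<kappa> (b, y) \<in> X" "R \<kappa> (C \<kappa> (b, y)) = y" using C[of \<kappa> b y] bd y by auto
    have "f k l (C k (q b k y, y)) = f \<kappa> l (C \<kappa> (b, y))" unfolding e by (rule f_comp) (use kk assms cX in auto)
    moreover have "R k (C k (q b k y, y)) = y" unfolding e using R_f[OF kk(1) cX(1)] cX(2) by simp
    ultimately show ?thesis by (simp add: fibre_coord_def q_def)
  qed
  show "fibre_coord k l (C k (q 0 k y, y)) = 0" using *[of 0] by simp
  show "fibre_coord k l (C k (q b1 k y, y)) = 1" using *[of b1] l0(2)[of l y] assms y by (simp split: if_splits)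
qed

text \<open>On one fibre the denominator is a nonzero constant, so only the first coordinate at
  level \<open>l\<close> matters. After absorption it determines the point at level
  \<open>l\<close>, and \<open>f k l\<close> is injective. The disc is halved so that its image lies
  in a compact set.\<close>

lemma fibre_coord_inj:
  assumes "k \<ge> \<kappa>"
  shows "\<forall>\<^sub>F l in sequentially. \<forall>y. N y < r' \<longrightarrow> inj_on (\<lambda>t. fibre_coord k l (C k (t, y))) (ball 0 (\<delta>/2))"
proof -
  define K where "K = C k ` (cball 0 (\<delta>/2) \<times> {y. N y \<le> r'})"
  have sub: "cball 0 (\<delta>/2) \<times> {y. N y \<le> r'} \<subseteq> ball 0 \<delta> \<times> {y. N y < r}" using \<delta> r' by auto
  have "compact K" unfolding K_def
    by (intro compact_continuous_image compact_Times compact_cball cnorm_compact[OF N]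
        continuous_on_subset[OF hol_continuous[OF C_hol[OF assms]] sub])
  moreover have "K \<subseteq> X" "\<And>x. x \<in> K \<Longrightarrow> N (R k x) < r"
    using C[OF assms] \<delta> r' by (auto simp: K_def)
  ultimately have "\<forall>\<^sub>F l in sequentially. \<forall>x\<in>K. cmod (fst (f k l x)) < 1 \<and> cmod (fst (f k l x)) < \<delta> \<and>
    N (snd (f k l x)) < (1 + r) / 2 \<and> C l (fst (f k l x), R k x) = f k l x"
    using absorb[of K k 1] by simp
  moreover have "\<forall>\<^sub>F l in sequentially. l \<ge> max k l0" by (rule eventually_ge_at_top)
  ultimately show ?thesis
  proof eventually_elim
    case (elim l)
    show ?case
    proof (intro allI impI inj_onI)
      fix y t t' assume y: "N y < r'" and t: "t \<in> ball 0 (\<delta>/2)" "t' \<in> ball 0 (\<delta>/2)"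
        and eq: "fibre_coord k l (C k (t, y)) = fibre_coord k l (C k (t', y))"
      have in1: "C k (t, y) \<in> K" "C k (t', y) \<in> K" using t y by (auto simp: K_def)
      have p: "C k (t, y) \<in> X \<and> fst (C k (t, y)) = t \<and> R k (C k (t, y)) = y"
        "C k (t', y) \<in> X \<and> fst (C k (t', y)) = t' \<and> R k (C k (t', y)) = y"
        using C[OF assms, of t y] C[OF assms, of t' y] t y \<delta> r' by auto
      have "q 0 l y \<noteq> q b1 l y" using l0(2)[of l y] elim(2) y by simp
      then have "q b1 l y - q 0 l y \<noteq> 0" by simp
      then have "fst (f k l (C k (t, y))) = fst (f k l (C k (t', y)))"
        using eq p by (simp add: fibre_coord_def)
      then have "f k l (C k (t, y)) = f k l (C k (t', y))"
        using elim(1) in1 p by metis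
      then have "C k (t, y) = C k (t', y)" using inj_onD[OF f_inj[of k l]] p elim(2) by auto
      then show "t = t'" using p by metis
    qed
  qed
qed

text \<open>A fixed level \<open>k\<close> absorbs \<open>K\<close>, so its points have small
  parameters in discs on which all later coordinates are univalent and take the values
  \<open>0\<close> and \<open>1\<close> at the two sections. \<open>univalent_bound\<close> then
  gives a bound that does not involve \<open>l\<close>.\<close>

lemma elb_fibre_coord: "elb (fibre_coord j) (Xr j)"
  unfolding elb_def
proof (intro allI impI)
  fix K assume K: "compact K" "K \<subseteq> Xr j"
  obtain B :: real where B: "B > 0"
    "\<And>f a \<rho> b z. f holomorphic_on ball a \<rho> \<Longrightarrow> inj_on f (ball a \<rho>) \<Longrightarrow> f a = 0 \<Longrightarrow>
      b \<in> ball a \<rho> \<Longrightarrow> b \<noteq> a \<Longrightarrow> cmod (z - a) \<le> \<rho> / 2 \<Longrightarrow> cmod (f z) \<le> B * \<rho> * cmod (f b) / cmod (b - a)"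
    using univalent_bound by metis
  have KX: "K \<subseteq> X" "\<And>x. x \<in> K \<Longrightarrow> N (R j x) < r'" using K(2) by (auto simp: Xr_def)
  have "\<forall>\<^sub>F k in sequentially. \<forall>x\<in>K. cmod (fst (f j k x)) < \<delta>/16 \<and> cmod (fst (f j k x)) < \<delta> \<and>
    N (snd (f j k x)) < (1 + r) / 2 \<and> C k (fst (f j k x), R j x) = f j k x"
    by (rule absorb[OF K(1) KX(1)]) (use KX(2) r' \<delta> in \<open>auto intro: less_trans\<close>)
  from eventually_conj[OF this eventually_ge_at_top[of "max j l0"]]
  obtain k where k: "k \<ge> j" "k \<ge> l0"
    and kK: "\<And>x. x \<in> K \<Longrightarrow> cmod (fst (f j k x)) < \<delta>/16 \<and> C k (fst (f j k x), R j x) = f j k x"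
    unfolding eventually_sequentially by (metis max.bounded_iff order_refl)
  have kk: "k \<ge> \<kappa>" using k l0(1) by simp
  define \<phi> where "\<phi> y = 1 / cmod (q b1 k y - q 0 k y)" for y
  have Rc: "compact (R j ` K)"
    by (rule compact_continuous_image[OF continuous_on_subset[OF hol_continuous[OF R_hol] KX(1)] K(1)])
  have ne: "cmod (q b1 k y - q 0 k y) \<noteq> 0" if "y \<in> R j ` K" for y
  proof -
    have "N y \<le> r'" using that KX(2) by (auto simp: less_imp_le)
    from l0(2)[OF k(2) this] show ?thesis by auto
  qed
  have RK: "R j ` K \<subseteq> {y. N y < r}" using KX(2) r' by fastforce
  have "continuous_on (R j ` K) \<phi>"
    unfolding \<phi>_def using ne \<delta> b1(1)
    by (intro continuous_intros continuous_on_subset[OF hol_continuous[OF q_hol[OF kk]] RK]) auto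
  then have "bounded (\<phi> ` R j ` K)" using Rc compact_continuous_image compact_imp_bounded by blast
  then obtain M where M: "\<And>x. x \<in> K \<Longrightarrow> norm (\<phi> (R j x)) \<le> M" unfolding bounded_iff by auto
  have "\<forall>\<^sub>F l in sequentially. \<forall>x\<in>K. cmod (fibre_coord j l x) \<le> B * (\<delta>/4) * M"
    using fibre_coord_inj[OF kk] eventually_ge_at_top[of k]
  proof eventually_elim
    case (elim l)
    show ?case
    proof
      fix x assume x: "x \<in> K"
      define y where "y = R j x"
      have y: "N y < r'" using KX(2) x by (simp add: y_def)
      define E where "E t = fibre_coord k l (C k (t, y))" for t
      have qs: "cmod (q 0 k y) < \<delta>/16" "cmod (q b1 k y) < \<delta>/16" "q b1 k y \<noteq> q 0 k y"
        using l0(2)[OF k(2) less_imp_le[OF y]] by auto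
      have sub: "ball (q 0 k y) (\<delta>/4) \<subseteq> ball 0 (\<delta>/2)"
      proof
        fix z assume "z \<in> ball (q 0 k y) (\<delta>/4)"
        then have "cmod (z - q 0 k y) < \<delta>/4" by (simp add: dist_norm norm_minus_commute)
        then show "z \<in> ball 0 (\<delta>/2)" using norm_triangle_ineq[of "z - q 0 k y" "q 0 k y"] qs \<delta> by simp
      qed
      have sub2: "ball (q 0 k y) (\<delta>/4) \<subseteq> ball 0 \<delta>" using sub subset_ball[of "\<delta>/2" \<delta> "0::complex"] \<delta> by auto
      have "cmod (E (fst (f j k x))) \<le> B * (\<delta>/4) * cmod (E (q b1 k y)) / cmod (q b1 k y - q 0 k y)"
      proof (rule B(2))
        show "E holomorphic_on ball (q 0 k y) (\<delta>/4)"
          unfolding E_def by (rule holomorphic_on_subset[OF fibre_coord_holomorphic sub2]) (use kk elim k y in auto)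
        show "inj_on E (ball (q 0 k y) (\<delta>/4))"
          unfolding E_def using elim(1) y by (intro inj_on_subset[OF _ sub]) blast
        show "E (q 0 k y) = 0" unfolding E_def by (rule fibre_coord_values) (use k elim y in auto)
        show "q b1 k y \<in> ball (q 0 k y) (\<delta>/4)"
          using norm_triangle_ineq4[of "q 0 k y" "q b1 k y"] qs \<delta> by (simp add: dist_norm)
        show "cmod (fst (f j k x) - q 0 k y) \<le> \<delta>/4/2"
          using norm_triangle_ineq4[of "fst (f j k x)" "q 0 k y"] qs kK[OF x] \<delta> by simp
      qed (rule qs)
      also have "E (q b1 k y) = 1" unfolding E_def by (rule fibre_coord_values) (use k elim y in auto)
      also have "E (fst (f j k x)) = fibre_coord j l x"
        unfolding E_def y_def using kK[OF x] fibre_coord_f[OF k(1) elim(2), of x] KX(1) x by auto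
      also have "B * (\<delta>/4) * cmod 1 / cmod (q b1 k y - q 0 k y) = B * (\<delta>/4) * \<phi> y"
        by (simp add: \<phi>_def)
      also have "\<dots> \<le> B * (\<delta>/4) * M"
        using M[OF x] B \<delta> by (intro mult_left_mono) (auto simp: y_def)
      finally show "cmod (fibre_coord j l x) \<le> B * (\<delta>/4) * M" .
    qed
  qed
  then show "\<exists>B. \<forall>\<^sub>F l in sequentially. \<forall>x\<in>K. cmod (fibre_coord j l x) \<le> B" by blast
qed

text \<open>A limit of the fibre coordinates inherits compatibility with the tower, and injectivity
  on fibres by Hurwitz. Surjectivity is a statement about all levels together and comes from the
  sections approaching each other.\<close>

lemma tube_trivialization:
  obtains h :: "nat \<Rightarrow> complex \<times> 'w \<Rightarrow> complex" where "\<And>j. hol (h j) (Xr j)"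
    "\<And>j k x. j \<le> k \<Longrightarrow> x \<in> Xr j \<Longrightarrow> h k (f j k x) = h j x"
    "\<And>j x x'. x \<in> Xr j \<Longrightarrow> x' \<in> Xr j \<Longrightarrow> R j x = R j x' \<Longrightarrow> h j x = h j x' \<Longrightarrow> x = x'"
    "\<And>y \<xi>. N y < r' \<Longrightarrow> \<exists>j x. x \<in> Xr j \<and> R j x = y \<and> h j x = \<xi>"
    "\<And>j x. x \<in> Xr j \<Longrightarrow> immersive (\<lambda>x. (h j x, R j x)) x"
proof -
  obtain h \<nu> where \<nu>: "strict_mono (\<nu> :: nat \<Rightarrow> nat)" and lim: "\<And>j. luc (\<lambda>n. fibre_coord j (\<nu> n)) (h j) (Xr j)"
  proof -
    note m = montel_family[where U = Xr and f = fibre_coord]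
    show ?thesis
    proof (rule m)
      show "open (Xr j)" for j by (rule Xr_open)
      show "ehol (fibre_coord j) (Xr j)" for j by (rule ehol_fibre_coord)
      show "elb (fibre_coord j) (Xr j)" for j by (rule elb_fibre_coord)
    qed (rule that)
  qed
  have hol: "hol (h j) (Xr j)" for j
    by (rule weierstrass[OF Xr_open lim ehol_subseq[OF ehol_fibre_coord \<nu>]])
  have \<nu>_ge: "\<forall>\<^sub>F n in sequentially. \<nu> n \<ge> k" for k
    using filterlim_subseq[OF \<nu>] by (simp add: filterlim_at_top)
  have compat: "h k (f j k x) = h j x" if jk: "j \<le> k" and x: "x \<in> Xr j" for j k x
  proof -
    have 1: "(\<lambda>n. fibre_coord k (\<nu> n) (f j k x)) \<longlonglongrightarrow> h k (f j k x)"
      by (rule luc_pointwise[OF lim Xr_f[OF jk x]])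
    have "\<forall>\<^sub>F n in sequentially. fibre_coord k (\<nu> n) (f j k x) = fibre_coord j (\<nu> n) x"
      using \<nu>_ge[of k] by eventually_elim (use fibre_coord_f[OF jk] x in \<open>auto simp: Xr_def\<close>)
    then have "(\<lambda>n. fibre_coord j (\<nu> n) x) \<longlonglongrightarrow> h k (f j k x)" using 1 by (rule Lim_transform_eventually[rotated])
    then show ?thesis using luc_pointwise[OF lim x] LIMSEQ_unique by blast
  qed
  define E where "E k y t = h k (C k (t, y))" for k y t
  have E_luc: "luc (\<lambda>n t. fibre_coord k (\<nu> n) (C k (t, y))) (E k y) (ball 0 \<delta>)" if "k \<ge> \<kappa>" "N y < r'" for k y
    unfolding E_def by (rule luc_pre[OF hol_continuous[OF C_fibre(1)] C_fibre(2) lim]) (use that in auto)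
  have E_holo: "E k y holomorphic_on ball 0 \<delta>" if "k \<ge> \<kappa>" "N y < r'" for k y
    unfolding E_def hol_iff_holomorphic_on[OF open_ball, symmetric]
    by (rule hol_compose[OF C_fibre(1) hol C_fibre(2)]) (use that in auto)
  have E01: "E k y (q 0 k y) = 0" "E k y (q b1 k y) = 1" if k: "k \<ge> l0" and y: "N y < r'" for k y
  proof -
    have kk: "k \<ge> \<kappa>" using k l0(1) by simp
    have qs: "q 0 k y \<in> ball 0 \<delta>" "q b1 k y \<in> ball 0 \<delta>" using l0(2)[OF k, of y] y \<delta> by auto
    have "\<forall>\<^sub>F n in sequentially. fibre_coord k (\<nu> n) (C k (q 0 k y, y)) = 0"
      using \<nu>_ge[of k] by eventually_elim (rule fibre_coord_values[OF k _ y])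
    then have "(\<lambda>n. fibre_coord k (\<nu> n) (C k (q 0 k y, y))) \<longlonglongrightarrow> 0" by (rule tendsto_eventually)
    then show "E k y (q 0 k y) = 0" using luc_pointwise[OF E_luc[OF kk y] qs(1)] LIMSEQ_unique by blast
    have "\<forall>\<^sub>F n in sequentially. fibre_coord k (\<nu> n) (C k (q b1 k y, y)) = 1"
      using \<nu>_ge[of k] by eventually_elim (rule fibre_coord_values[OF k _ y])
    then have "(\<lambda>n. fibre_coord k (\<nu> n) (C k (q b1 k y, y))) \<longlonglongrightarrow> 1" by (rule tendsto_eventually)
    then show "E k y (q b1 k y) = 1" using luc_pointwise[OF E_luc[OF kk y] qs(2)] LIMSEQ_unique by blast
  qed
  have half: "ball 0 (\<delta>/2) \<subseteq> ball (0::complex) \<delta>" using \<delta> by auto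
  have E_inj': "inj_on (E k y) (ball 0 (\<delta>/2))" if k: "k \<ge> l0" and y: "N y < r'" for k y
  proof -
    have kk: "k \<ge> \<kappa>" using k l0(1) by simp
    obtain n0 where n0: "\<And>n. n \<ge> n0 \<Longrightarrow> \<nu> n \<ge> max k l0 \<and> inj_on (\<lambda>t. fibre_coord k (\<nu> n) (C k (t, y))) (ball 0 (\<delta>/2))"
      using eventually_conj[OF \<nu>_ge[of "max k l0"] eventually_subseq[OF \<nu> fibre_coord_inj[OF kk]]] y
      unfolding eventually_sequentially by blast
    \<comment> \<open>The limit takes the values \<open>0\<close> and \<open>1\<close> at the two
      sections, so it is not constant and Hurwitz's theorem keeps it injective.\<close>
    show ?thesis
    proof (rule Hurwitz_injective[where \<F> = "\<lambda>n t. fibre_coord k (\<nu> (n + n0)) (C k (t, y))"])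
      show "(\<lambda>t. fibre_coord k (\<nu> (n + n0)) (C k (t, y))) holomorphic_on ball 0 (\<delta>/2)" for n
        by (rule holomorphic_on_subset[OF fibre_coord_holomorphic half]) (use n0[of "n + n0"] kk y in auto)
      show "E k y holomorphic_on ball 0 (\<delta>/2)" by (rule holomorphic_on_subset[OF E_holo[OF kk y] half])
      show "uniform_limit K (\<lambda>n t. fibre_coord k (\<nu> (n + n0)) (C k (t, y))) (E k y) sequentially"
        if "compact K" "K \<subseteq> ball 0 (\<delta>/2)" for K
      proof -
        have "strict_mono (\<lambda>n. n + n0)" by (simp add: strict_mono_def)
        from luc_subseq[OF E_luc[OF kk y] this] show ?thesis
          using that(1) order_trans[OF that(2) half] by (rule lucD)
      qed
      have "q 0 k y \<in> ball 0 (\<delta>/2)" "q b1 k y \<in> ball 0 (\<delta>/2)"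
        using l0(2)[OF k less_imp_le[OF y]] \<delta> by auto
      then show "\<not> E k y constant_on ball 0 (\<delta>/2)"
        using E01[OF k y] unfolding constant_on_def by (metis zero_neq_one)
      show "inj_on (\<lambda>t. fibre_coord k (\<nu> (n + n0)) (C k (t, y))) (ball 0 (\<delta>/2))" for n using n0[of "n + n0"] by simp
    qed (auto simp: convex_connected)
  qed
  have absorb_finite: "\<exists>k\<ge>max j l0. \<forall>x\<in>K. cmod (fst (f j k x)) < \<delta>/2 \<and>
      N (snd (f j k x)) < (1 + r) / 2 \<and> C k (fst (f j k x), R j x) = f j k x"
    if K: "finite K" "K \<subseteq> Xr j" for j K
  proof -
    have "\<forall>\<^sub>F k in sequentially. \<forall>x\<in>K. cmod (fst (f j k x)) < \<delta>/2 \<and> cmod (fst (f j k x)) < \<delta> \<and>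
       N (snd (f j k x)) < (1 + r) / 2 \<and> C k (fst (f j k x), R j x) = f j k x"
      by (rule absorb) (use K r' \<delta> in \<open>auto simp: Xr_def finite_imp_compact intro: less_trans\<close>)
    from eventually_conj[OF this eventually_ge_at_top[of "max j l0"]]
    show ?thesis unfolding eventually_sequentially by (meson order_refl)
  qed
  show thesis
  proof (rule that[of h])
    show "hol (h j) (Xr j)" for j by (rule hol)
    show "h k (f j k x) = h j x" if "j \<le> k" "x \<in> Xr j" for j k x by (rule compat[OF that])
    show "x = x'" if x: "x \<in> Xr j" "x' \<in> Xr j" and eq: "R j x = R j x'" "h j x = h j x'" for j x x'
    proof -
      obtain k where k: "k \<ge> max j l0" and kK: "\<And>z. z \<in> {x, x'} \<Longrightarrow> cmod (fst (f j k z)) < \<delta>/2 \<and>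
        C k (fst (f j k z), R j z) = f j k z" using absorb_finite[of "{x, x'}" j] x by blast
      have y: "N (R j x) < r'" using x by (simp add: Xr_def)
      have "E k (R j x) (fst (f j k z)) = h j z" if "z \<in> {x, x'}" for z
      proof -
        have "R j z = R j x" using that eq by auto
        then have "E k (R j x) (fst (f j k z)) = h k (f j k z)" using kK[OF that] by (metis E_def)
        also have "\<dots> = h j z" using k that x by (intro compat) auto
        finally show ?thesis .
      qed
      then have "E k (R j x) (fst (f j k x)) = E k (R j x) (fst (f j k x'))"
        using eq(2) by simp
      then have "fst (f j k x) = fst (f j k x')"
        using inj_onD[OF E_inj'[of k "R j x"]] kK k y by auto
      then have "f j k x = f j k x'" using kK[of x] kK[of x'] eq by (metis insertCI)
      then show "x = x'" using inj_onD[OF f_inj[of j k]] k x by (auto simp: Xr_def)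
    qed
    \<comment> \<open>If \<open>\<xi>\<close> were omitted on the fibre at every level,
      \<open>omitted_value_bound\<close> would bound all \<open>E k y\<close> on discs of a fixed
      radius, so they would be Lipschitz there with one constant. But they take the values
      \<open>0\<close> and \<open>1\<close> at the two sections, which come arbitrarily
      close.\<close>
    show "\<exists>j x. x \<in> Xr j \<and> R j x = y \<and> h j x = \<xi>" if y: "N y < r'" for y \<xi>
    proof (rule ccontr)
      assume "\<nexists>j x. x \<in> Xr j \<and> R j x = y \<and> h j x = \<xi>"
      then have no: "\<And>j x. x \<in> Xr j \<Longrightarrow> R j x = y \<Longrightarrow> h j x \<noteq> \<xi>" by blast
      obtain B :: real where B: "B > 0"
        "\<And>f a \<rho> c z. f holomorphic_on ball a \<rho> \<Longrightarrow> 0 < \<rho> \<Longrightarrow> f a = 0 \<Longrightarrow>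
          (\<And>w. w \<in> ball a \<rho> \<Longrightarrow> f w = 0 \<Longrightarrow> w = a) \<Longrightarrow> c \<notin> f ` ball a \<rho> \<Longrightarrow>
          cmod (z - a) \<le> \<rho> / 2 \<Longrightarrow> cmod (f z) \<le> B * cmod c"
        using omitted_value_bound by metis
      \<comment> \<open>The common Lipschitz constant: the bound divided by the radius of the Cauchy
        estimate. The sections are then brought within \<open>1 / (A + 1)\<close> of each
        other.\<close>
      define A where "A = B * cmod \<xi> / (\<delta>/16)"
      have A: "A \<ge> 0" using B \<delta> by (simp add: A_def)
      define e where "e = min (\<delta>/32) (1 / (2 * (A + 1)))"
      have e: "e > 0" "e \<le> \<delta>/32" "e \<le> 1 / (2 * (A + 1))" using \<delta> A by (auto simp: e_def)
      from eventually_conj[OF q_eventually[OF e(1)] eventually_ge_at_top[of l0]]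
      obtain k where k: "k \<ge> l0" "cmod (q 0 k y) < e" "cmod (q b1 k y) < e"
        using y unfolding eventually_sequentially by (metis less_imp_le order_refl)
      have kk: "k \<ge> \<kappa>" using k l0(1) by simp
      let ?a = "q 0 k y"
      have sub: "ball ?a (\<delta>/4) \<subseteq> ball 0 (\<delta>/2)"
      proof
        fix z assume "z \<in> ball ?a (\<delta>/4)"
        then have "cmod (z - ?a) < \<delta>/4" by (simp add: dist_norm norm_minus_commute)
        then show "z \<in> ball 0 (\<delta>/2)" using norm_triangle_ineq[of "z - ?a" ?a] k e \<delta> by simp
      qed
      have bound: "cmod (E k y z) \<le> B * cmod \<xi>" if z: "cmod (z - ?a) \<le> \<delta>/8" for z
      proof (rule B(2)[of "E k y" ?a "\<delta>/4" \<xi>])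
        show "E k y holomorphic_on ball ?a (\<delta>/4)"
          using E_holo[OF kk y] sub half by (meson holomorphic_on_subset order_trans)
        show "w = ?a" if "w \<in> ball ?a (\<delta>/4)" "E k y w = 0" for w
          using inj_onD[OF E_inj'[OF k(1) y], of w ?a] that sub E01[OF k(1) y] \<delta> by (auto simp: subset_iff)
        show "\<xi> \<notin> E k y ` ball ?a (\<delta>/4)"
        proof
          assume "\<xi> \<in> E k y ` ball ?a (\<delta>/4)"
          then obtain t where t: "t \<in> ball 0 \<delta>" "h k (C k (t, y)) = \<xi>" using sub half by (auto simp: E_def)
          have "C k (t, y) \<in> Xr k" using C_fibre(2)[OF kk y] t(1) by blast
          then show False using no[of "C k (t, y)" k] C[OF kk, of t y] t y r' by auto
        qed
      qed (use \<delta> E01[OF k(1) y] z in auto)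
      have close: "cmod (q b1 k y - ?a) \<le> 2 * e" using norm_triangle_ineq4[of "q b1 k y" ?a] k by simp
      have "norm (E k y (q b1 k y) - E k y ?a) \<le> B * cmod \<xi> / (\<delta>/16) * norm (q b1 k y - ?a)"
      proof (rule hol_lipschitz[where S = "cball ?a (\<delta>/16)"])
        show "hol (E k y) (cball x (\<delta>/16))" if x: "x \<in> cball ?a (\<delta>/16)" for x
        proof -
          have "hol (E k y) (ball 0 \<delta>)" using E_holo[OF kk y] by (simp add: hol_iff_holomorphic_on)
          moreover have "cball x (\<delta>/16) \<subseteq> ball ?a (\<delta>/4)"
          proof
            fix z assume "z \<in> cball x (\<delta>/16)"
            then show "z \<in> ball ?a (\<delta>/4)" using x dist_triangle[of ?a z x] \<delta> by simp
          qed
          ultimately show ?thesis using sub half hol_subset by (metis order_trans)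
        qed
        show "norm (E k y z) \<le> B * cmod \<xi>" if "x \<in> cball ?a (\<delta>/16)" "z \<in> cball x (\<delta>/16)" for x z
          by (rule bound) (use that dist_triangle[of ?a z x] in \<open>simp add: dist_norm norm_minus_commute\<close>)
        show "q b1 k y \<in> cball ?a (\<delta>/16)" using close e by (simp add: dist_norm norm_minus_commute)
      qed (use \<delta> in auto)
      then have "1 \<le> A * cmod (q b1 k y - ?a)" using E01[OF k(1) y] by (simp add: A_def)
      also have "\<dots> \<le> A * (2 * e)" by (rule mult_left_mono[OF close A])
      also have "\<dots> \<le> A * (1 / (A + 1))" using e A by (intro mult_left_mono) (auto simp: field_simps)
      also have "\<dots> < 1" using A by simp
      finally show False by simp
    qed
    \<comment> \<open>At an absorbing level the map factors through the coordinates
      \<open>(t, y)\<close> of the tube, where it is \<open>(E k y t, y)\<close>; the derivative in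
      \<open>t\<close> does not vanish because \<open>E k y\<close> is univalent.\<close>
    show "immersive (\<lambda>x. (h j x, R j x)) x" if x: "x \<in> Xr j" for j x
    proof -
      obtain k where k: "k \<ge> j" "k \<ge> l0" and kK: "cmod (fst (f j k x)) < \<delta>/2"
        "N (snd (f j k x)) < (1 + r) / 2" "C k (fst (f j k x), R j x) = f j k x"
        using absorb_finite[of "{x}" j] x by auto
      have kk: "k \<ge> \<kappa>" using k l0(1) by simp
      define V where "V = {x \<in> Xr j. f j k x \<in> ball 0 \<delta> \<times> {y. N y < (1 + r) / 2}}"
      have V: "open V" unfolding V_def
        by (rule open_vimage_on[OF Xr_open _ open_norm_ball_Times[OF N]])
           (use hol_continuous[OF f_hol[OF k(1)]] in \<open>auto simp: Xr_def intro: continuous_on_subset\<close>)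
      have xV: "x \<in> V" using x kK \<delta> by (auto simp: V_def mem_Times_iff)
      define y where "y = R j x"
      define t where "t = fst (f j k x)"
      have y: "N y < r'" using x by (simp add: y_def Xr_def)
      have xX: "x \<in> X" using x by (simp add: Xr_def)
      let ?T = "\<lambda>x. (fst x, R k x)"
      let ?E = "\<lambda>z. (h k (C k z), snd z)"
      have fx: "f j k x = C k (t, y)" using kK by (simp add: t_def y_def)
      have t: "cmod t < \<delta>/2" using kK by (simp add: t_def)
      have Tx: "?T (f j k x) = (t, y)" using R_f[OF k(1) xX] by (simp add: t_def y_def)
      have immE: "immersive ?E (t, y)"
      proof (rule immersive_Pair_snd)
        show "complex_differentiable_at (\<lambda>z. h k (C k z)) (t, y)"
        proof (rule cdiff_at_compose[of "C k" "(t, y)" "h k"])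
          show "complex_differentiable_at (C k) (t, y)"
            by (rule holD[OF C_hol[OF kk]]) (use t y r' \<delta> in auto)
          show "complex_differentiable_at (h k) (C k (t, y))"
            by (rule holD[OF hol]) (use Xr_f[OF k(1) x] fx in simp)
        qed
        have "deriv (E k y) t \<noteq> 0"
          by (rule holomorphic_injective_imp_regular[OF holomorphic_on_subset[OF E_holo[OF kk y] half] _ E_inj'[OF k(2) y]])
             (use t in auto)
        then show "deriv (\<lambda>t. h k (C k (t, y))) t \<noteq> 0" by (simp add: E_def[abs_def])
      qed
      have immT: "immersive (\<lambda>x. ?T (f j k x)) x"
        by (rule immersive_compose[OF f_imm[OF k(1) xX]]) (use C[OF kk, of t y] t y r' \<delta> fx in auto)
      have "immersive (\<lambda>x. ?E (?T (f j k x))) x"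
        by (rule immersive_compose[of "\<lambda>x. ?T (f j k x)" x ?E, OF immT]) (unfold Tx, rule immE)
      then show ?thesis
      proof (rule immersive_transform[OF _ V xV])
        fix z assume z: "z \<in> V"
        then have zX: "z \<in> Xr j" "z \<in> X" by (auto simp: V_def Xr_def)
        have "C k (fst (f j k z), R k (f j k z)) = f j k z"
          by (rule C_unique[OF kk]) (use z in \<open>auto simp: V_def mem_Times_iff\<close>)
        then show "?E (?T (f j k z)) = (h j z, R j z)"
          using compat[OF k(1) zX(1)] R_f[OF k(1) zX(2)] by simp
      qed
    qed
  qed
qed

end

section \<open>Gluing the fibre coordinates over an exhaustion of the base\<close>

context straight_tower
begin

lemma local_trivialization:
  assumes r': "0 < r'" "r' < 1"
  obtains h :: "nat \<Rightarrow> complex \<times> 'w \<Rightarrow> complex" where "\<And>j. hol (h j) {x \<in> X. N (R j x) < r'}"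
    "\<And>j k x. j \<le> k \<Longrightarrow> x \<in> X \<Longrightarrow> N (R j x) < r' \<Longrightarrow> h k (f j k x) = h j x"
    "\<And>j x x'. x \<in> X \<Longrightarrow> x' \<in> X \<Longrightarrow> N (R j x) < r' \<Longrightarrow> R j x = R j x' \<Longrightarrow> h j x = h j x' \<Longrightarrow> x = x'"
    "\<And>y \<xi>. N y < r' \<Longrightarrow> \<exists>j x. x \<in> X \<and> R j x = y \<and> h j x = \<xi>"
    "\<And>j x. x \<in> X \<Longrightarrow> N (R j x) < r' \<Longrightarrow> immersive (\<lambda>x. (h j x, R j x)) x"
proof -
  define r where "r = (1 + r') / 2"
  have r: "0 \<le> r" "r < 1" "r' < r" using r' by (auto simp: r_def)
  show thesis
  proof (rule tube[OF r(1,2)])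
    fix \<delta> k0 C
    assume T: "\<delta> > 0"
      "\<And>k. k \<ge> k0 \<Longrightarrow> hol (C k) (ball 0 \<delta> \<times> {y. N y < r})"
      "\<And>k t y. k \<ge> k0 \<Longrightarrow> cmod t < \<delta> \<Longrightarrow> N y < r \<Longrightarrow>
         C k (t, y) \<in> X \<and> fst (C k (t, y)) = t \<and> R k (C k (t, y)) = y \<and>
         N (snd (C k (t, y))) < (1 + r) / 2 \<and> immersive (\<lambda>x. (fst x, R k x)) (C k (t, y))"
      "\<And>k x. k \<ge> k0 \<Longrightarrow> cmod (fst x) < \<delta> \<Longrightarrow> N (snd x) < (1 + r) / 2 \<Longrightarrow> C k (fst x, R k x) = x"
    interpret tubed N X f R Rl r' r \<delta> k0 C
      by (unfold_locales; fact r r' T)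
    obtain h :: "nat \<Rightarrow> complex \<times> 'w \<Rightarrow> complex" where h: "\<And>j. hol (h j) (Xr j)"
      "\<And>j k x. j \<le> k \<Longrightarrow> x \<in> Xr j \<Longrightarrow> h k (f j k x) = h j x"
      "\<And>j x x'. x \<in> Xr j \<Longrightarrow> x' \<in> Xr j \<Longrightarrow> R j x = R j x' \<Longrightarrow> h j x = h j x' \<Longrightarrow> x = x'"
      "\<And>y \<xi>. N y < r' \<Longrightarrow> \<exists>j x. x \<in> Xr j \<and> R j x = y \<and> h j x = \<xi>"
      "\<And>j x. x \<in> Xr j \<Longrightarrow> immersive (\<lambda>x. (h j x, R j x)) x"
      by (rule tube_trivialization) (rule that)
    show thesis
    proof (rule that[of h])
      show "hol (h j) {x \<in> X. N (R j x) < r'}" for j using h(1)[of j] by (simp add: Xr_def)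
      show "h k (f j k x) = h j x" if "j \<le> k" "x \<in> X" "N (R j x) < r'" for j k x
        using h(2) that by (simp add: Xr_def)
      show "x = x'" if "x \<in> X" "x' \<in> X" "N (R j x) < r'" "R j x = R j x'" "h j x = h j x'" for j x x'
        using h(3)[of x j x'] that by (simp add: Xr_def)
      show "\<exists>j x. x \<in> X \<and> R j x = y \<and> h j x = \<xi>" if "N y < r'" for y \<xi>
        using h(4)[OF that, of \<xi>] unfolding Xr_def by blast
      show "immersive (\<lambda>x. (h j x, R j x)) x" if "x \<in> X" "N (R j x) < r'" for j x
        using h(5) that by (simp add: Xr_def)
    qed
  qed
qed

lemma global_trivialization:
  obtains T :: "nat \<Rightarrow> complex \<times> 'w \<Rightarrow> complex" where
    "\<And>j k x. j \<le> k \<Longrightarrow> x \<in> X \<Longrightarrow> T k (f j k x) = T j x"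
    "\<And>j x x'. x \<in> X \<Longrightarrow> x' \<in> X \<Longrightarrow> R j x = R j x' \<Longrightarrow> T j x = T j x' \<Longrightarrow> x = x'"
    "\<And>y \<xi>. N y < 1 \<Longrightarrow> \<exists>j x. x \<in> X \<and> R j x = y \<and> T j x = \<xi>"
    "\<And>j x. x \<in> X \<Longrightarrow> immersive (\<lambda>x. (T j x, R j x)) x"
proof -
  define \<rho> :: "nat \<Rightarrow> real" where "\<rho> i = 1 - 1 / (real i + 2)" for i
  have \<rho>: "0 < \<rho> i" "\<rho> i < 1" for i by (auto simp: \<rho>_def)
  have \<rho>_Suc: "\<rho> i < \<rho> (Suc i)" for i by (simp add: \<rho>_def field_simps)
  have \<rho>_mono: "\<rho> i \<le> \<rho> j" if "i \<le> j" for i j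
    by (rule lift_Suc_mono_le[of \<rho>, OF less_imp_le[OF \<rho>_Suc] that])
  have "\<forall>i. \<exists>h :: nat \<Rightarrow> complex \<times> 'w \<Rightarrow> complex. (\<forall>j. hol (h j) {x \<in> X. N (R j x) < \<rho> i}) \<and>
    (\<forall>j k x. j \<le> k \<longrightarrow> x \<in> X \<longrightarrow> N (R j x) < \<rho> i \<longrightarrow> h k (f j k x) = h j x) \<and>
    (\<forall>j x x'. x \<in> X \<longrightarrow> x' \<in> X \<longrightarrow> N (R j x) < \<rho> i \<longrightarrow> R j x = R j x' \<longrightarrow> h j x = h j x' \<longrightarrow> x = x') \<and>
    (\<forall>y \<xi>. N y < \<rho> i \<longrightarrow> (\<exists>j x. x \<in> X \<and> R j x = y \<and> h j x = \<xi>)) \<and>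
    (\<forall>j x. x \<in> X \<longrightarrow> N (R j x) < \<rho> i \<longrightarrow> immersive (\<lambda>x. (h j x, R j x)) x)"
    by (rule allI, rule local_trivialization[OF \<rho>]) blast
  from choice[OF this]
  obtain h :: "nat \<Rightarrow> nat \<Rightarrow> complex \<times> 'w \<Rightarrow> complex" where H: "\<And>i. (\<forall>j. hol (h i j) {x \<in> X. N (R j x) < \<rho> i}) \<and>
    (\<forall>j k x. j \<le> k \<longrightarrow> x \<in> X \<longrightarrow> N (R j x) < \<rho> i \<longrightarrow> h i k (f j k x) = h i j x) \<and>
    (\<forall>j x x'. x \<in> X \<longrightarrow> x' \<in> X \<longrightarrow> N (R j x) < \<rho> i \<longrightarrow> R j x = R j x' \<longrightarrow> h i j x = h i j x' \<longrightarrow> x = x') \<and>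
    (\<forall>y \<xi>. N y < \<rho> i \<longrightarrow> (\<exists>j x. x \<in> X \<and> R j x = y \<and> h i j x = \<xi>)) \<and>
    (\<forall>j x. x \<in> X \<longrightarrow> N (R j x) < \<rho> i \<longrightarrow> immersive (\<lambda>x. (h i j x, R j x)) x)" by blast
  have h_hol: "complex_differentiable_at (h i j) x" if "x \<in> X" "N (R j x) < \<rho> i" for i j x
    using H[of i] that unfolding hol_def by blast
  have h_f: "h i k (f j k x) = h i j x" if "j \<le> k" "x \<in> X" "N (R j x) < \<rho> i" for i j k x
    using H[of i] that by blast
  have h_inj: "x = x'" if "x \<in> X" "x' \<in> X" "N (R j x) < \<rho> i" "R j x = R j x'" "h i j x = h i j x'" for i j x x'
    using H[of i] that by blast
  have h_surj: "\<exists>j x. x \<in> X \<and> R j x = y \<and> h i j x = \<xi>" if "N y < \<rho> i" for i y \<xi>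
    using H[of i] that by blast
  have h_imm: "immersive (\<lambda>x. (h i j x, R j x)) x" if "x \<in> X" "N (R j x) < \<rho> i" for i j x
    using H[of i] that by blast
  define U where "U i = {y. N y < \<rho> i}" for i
  have U: "open (U i)" "convex (U i)" for i
    unfolding U_def by (rule cnorm_open[OF N] cnorm_convex[OF N])+
  text \<open>\<open>E i\<close> is the transition function between the trivializations over \<open>U i\<close> and over
    \<open>U (Suc i)\<close>; it is an affine automorphism of each fibre.\<close>
  define E where "E i \<xi> y = (SOME w. \<exists>j x. x \<in> X \<and> R j x = y \<and> h i j x = \<xi> \<and> w = h (Suc i) j x)" for i \<xi> y
  have E0: "\<exists>j x. x \<in> X \<and> R j x = y \<and> h i j x = \<xi> \<and> E i \<xi> y = h (Suc i) j x" if y: "N y < \<rho> i" for i \<xi> y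
    unfolding E_def by (rule someI_ex) (use h_surj[OF y, of \<xi>] in blast)
  have RU: "N (R j x) < \<rho> (Suc i)" if "N (R j x) < \<rho> i" for j x i
    using that \<rho>_Suc[of i] by simp
  \<comment> \<open>The choice in \<open>E\<close> does not matter: two points with the same base
    point and the same coordinate become equal at a common later level, and both trivializations are
    compatible with the tower.\<close>
  have E: "E i (h i j x) (R j x) = h (Suc i) j x" if x: "x \<in> X" "N (R j x) < \<rho> i" for i j x
  proof -
    obtain j' x' where x': "x' \<in> X" "R j' x' = R j x" "h i j' x' = h i j x"
      "E i (h i j x) (R j x) = h (Suc i) j' x'" using E0[OF x(2)] by blast
    define k where "k = max j j'"
    have k: "j \<le> k" "j' \<le> k" by (auto simp: k_def)
    have N': "N (R j' x') < \<rho> i" using x' x by simp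
    have "f j k x = f j' k x'"
      by (rule h_inj[where i = i and j = k]) (use x x' k N' in \<open>simp_all add: f_in R_f h_f\<close>)
    then show ?thesis using x'(4) h_f[OF k(1) x(1) RU[OF x(2)]] h_f[OF k(2) x'(1) RU[OF N']] by metis
  qed
  have E_hol: "complex_differentiable_at (\<lambda>z. E i (fst z) (snd z)) (\<xi>, y)" if y: "N y < \<rho> i" for i \<xi> y
  proof -
    obtain j x where x: "x \<in> X" "R j x = y" "h i j x = \<xi>" using h_surj[OF y] by blast
    define S where "S = {x \<in> X. N (R j x) < \<rho> i}"
    have oS: "open S" unfolding S_def
      using open_vimage_on[OF X hol_continuous[OF R_hol] cnorm_open[OF N, of "\<rho> i"], of j] by simp
    define \<Phi> where "\<Phi> x = (h i j x, R j x)" for x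
    have inj: "inj_on \<Phi> S"
    proof (rule inj_onI)
      fix x x' assume "x \<in> S" "x' \<in> S" "\<Phi> x = \<Phi> x'"
      then show "x = x'" unfolding \<Phi>_def S_def by (intro h_inj[of x x' j i]) simp_all
    qed
    have imm: "immersive \<Phi> x" if "x \<in> S" for x
      using h_imm that by (simp add: \<Phi>_def[abs_def] S_def)
    have xS: "x \<in> S" using x y by (simp add: S_def)
    have im: "(\<xi>, y) \<in> \<Phi> ` S" using xS x by (metis \<Phi>_def imageI)
    have inv: "inv_into S \<Phi> (\<xi>, y) = x" using inv_into_f_f[OF inj xS] x by (simp add: \<Phi>_def)
    have "complex_differentiable_at (\<lambda>z. h (Suc i) j (inv_into S \<Phi> z)) (\<xi>, y)"
    proof (rule cdiff_at_compose[of "inv_into S \<Phi>" "(\<xi>, y)" "h (Suc i) j"])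
      show "complex_differentiable_at (inv_into S \<Phi>) (\<xi>, y)"
        by (rule immersive_cdiff[OF immersive_inverse(2)[OF oS inj imm im]])
      show "complex_differentiable_at (h (Suc i) j) (inv_into S \<Phi> (\<xi>, y))"
        unfolding inv by (rule h_hol[OF x(1)]) (use x y \<rho>_Suc[of i] in simp)
    qed
    then show ?thesis
    proof (rule cdiff_at_transform[OF _ immersive_inverse(1)[OF oS inj imm] im])
      fix z assume "z \<in> \<Phi> ` S"
      then obtain x' where x': "x' \<in> S" "z = \<Phi> x'" by blast
      then show "h (Suc i) j (inv_into S \<Phi> z) = E i (fst z) (snd z)"
        using inv_into_f_f[OF inj x'(1)] E[of x' j i] by (simp add: \<Phi>_def S_def)
    qed
  qed
  have E_inj: "inj (\<lambda>\<xi>. E i \<xi> y)" if y: "N y < \<rho> i" for i y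
  proof (rule injI)
    fix \<xi> \<xi>' assume eq: "E i \<xi> y = E i \<xi>' y"
    obtain j x where x: "x \<in> X" "R j x = y" "h i j x = \<xi>" using h_surj[OF y] by blast
    obtain j' x' where x': "x' \<in> X" "R j' x' = y" "h i j' x' = \<xi>'" using h_surj[OF y] by blast
    define k where "k = max j j'"
    have k: "j \<le> k" "j' \<le> k" by (auto simp: k_def)
    have N': "N (R j x) < \<rho> i" "N (R j' x') < \<rho> i" using x x' y by auto
    have e: "h (Suc i) j x = h (Suc i) j' x'" using eq E[OF x(1) N'(1)] E[OF x'(1) N'(2)] x x' by simp
    have "f j k x = f j' k x'"
      by (rule h_inj[where i = "Suc i" and j = k]) (use x x' k RU[OF N'(1)] e in \<open>simp_all add: f_in R_f h_f\<close>)
    then have "h i j x = h i j' x'" using h_f[OF k(1) x(1) N'(1)] h_f[OF k(2) x'(1) N'(2)] by simp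
    then show "\<xi> = \<xi>'" using x x' by simp
  qed
  define a where "a i y = E i 0 y" for i y
  define b where "b i y = E i 1 y - E i 0 y" for i y
  have E_aff: "E i \<xi> y = a i y + b i y * \<xi>" if y: "N y < \<rho> i" for i \<xi> y
    unfolding a_def b_def
  proof (rule injective_entire_affine[OF _ E_inj[OF y]])
    have "complex_differentiable_at (\<lambda>\<xi>. E i \<xi> y) \<xi>" for \<xi>
      using cdiff_at_compose[of "\<lambda>\<xi>. (\<xi>, y)" \<xi> "\<lambda>z. E i (fst z) (snd z)"] E_hol[OF y]
      by (simp add: cdiff_at_Pair cdiff_at_const cdiff_at_ident)
    then show "(\<lambda>\<xi>. E i \<xi> y) holomorphic_on UNIV"
      by (simp add: hol_iff_holomorphic_on[symmetric] hol_def)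
  qed
  have Ec_hol: "hol (E i c) (U i)" for i c
    using cdiff_at_compose[of "\<lambda>y. (c, y)" _ "\<lambda>z. E i (fst z) (snd z)"] E_hol[of _ i c]
    by (simp add: hol_def U_def cdiff_at_Pair cdiff_at_const cdiff_at_ident)
  have a_hol: "hol (a i) (U i)" for i unfolding a_def by (rule Ec_hol)
  have b_hol: "hol (b i) (U i)" for i unfolding b_def by (intro hol_diff Ec_hol)
  have b_nz: "b i y \<noteq> 0" if "y \<in> U i" for i y
    using injD[OF E_inj[of y i], of 1 0] that by (auto simp: b_def U_def)
  \<comment> \<open>The linear factors \<open>b i\<close> have no zeros, so on the convex sets
    \<open>U i\<close> they have logarithms, and the multiplicative problem becomes
    additive.\<close>
  have "\<exists>g. hol g (U i) \<and> (\<forall>y\<in>U i. b i y = exp (g y))" for i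
    using hol_logarithm[OF U b_hol b_nz] by metis
  then obtain g where g: "\<And>i. hol (g i) (U i)" "\<And>i y. y \<in> U i \<Longrightarrow> b i y = exp (g i y)" by metis
  have additive: "\<exists>\<gamma>. (\<forall>i. hol (\<gamma> i) (U i)) \<and> (\<forall>i. \<forall>y\<in>U i. \<gamma> (Suc i) y - \<gamma> i y = g i y)"
    if g: "\<And>i. hol (g i) (U i)" for g :: "nat \<Rightarrow> 'w \<Rightarrow> complex"
  proof (rule mittag_leffler[where N = N and g = g and r = \<rho>])
    show "hol (g i) {y. N y < \<rho> i}" for i using g[of i] by (simp add: U_def)
    show ?thesis if "\<And>i. hol (\<gamma> i) {y. N y < \<rho> i}"
      "\<And>i y. N y < \<rho> i \<Longrightarrow> \<gamma> (Suc i) y - \<gamma> i y = g i y" for \<gamma>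
      using that unfolding U_def by blast
  qed (rule N \<rho>_Suc \<rho>(1))+
  obtain \<gamma> where \<gamma>: "\<And>i. hol (\<gamma> i) (U i)" "\<And>i y. y \<in> U i \<Longrightarrow> \<gamma> (Suc i) y - \<gamma> i y = g i y"
    using additive[OF g(1)] by blast
  have U_Suc: "U i \<subseteq> U (Suc i)" for i using \<rho>_Suc[of i] by (auto simp: U_def)
  \<comment> \<open>Once the coordinate over each \<open>U i\<close> is multiplied by
    \<open>exp (- \<gamma> i)\<close>, the transition functions are translations; \<open>a'\<close>
    is the translation in the rescaled coordinate over \<open>U (Suc i)\<close>.\<close>
  define a' where "a' i y = exp (- \<gamma> (Suc i) y) * a i y" for i y
  have a'_hol: "hol (a' i) (U i)" for i
    unfolding a'_def hol_def
  proof (intro ballI cdiff_at_mult cdiff_at_exp)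
    fix y assume y: "y \<in> U i"
    show "complex_differentiable_at (\<lambda>x. - \<gamma> (Suc i) x) y"
      using cdiff_at_diff[OF cdiff_at_const[of 0] holD[OF \<gamma>(1)[of "Suc i"], of y]] y U_Suc by auto
  qed (use a_hol in \<open>auto simp: hol_def\<close>)
  obtain \<sigma> where \<sigma>: "\<And>i. hol (\<sigma> i) (U i)" "\<And>i y. y \<in> U i \<Longrightarrow> \<sigma> (Suc i) y - \<sigma> i y = a' i y"
    using additive[OF a'_hol] by blast
  define \<tau> where "\<tau> i j x = exp (- \<gamma> i (R j x)) * h i j x - \<sigma> i (R j x)" for i j x
  have \<tau>_Suc: "\<tau> (Suc i) j x = \<tau> i j x" if x: "x \<in> X" "R j x \<in> U i" for i j x
  proof -
    let ?y = "R j x"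
    have "h (Suc i) j x = a i ?y + exp (g i ?y) * h i j x"
      using E[OF x(1)] E_aff[of ?y i "h i j x"] x(2) g(2)[OF x(2)] by (simp add: U_def)
    moreover have "exp (- \<gamma> (Suc i) ?y) * exp (g i ?y) = exp (- \<gamma> i ?y)"
      using \<gamma>(2)[OF x(2)] by (simp add: exp_add[symmetric] algebra_simps)
    ultimately have "exp (- \<gamma> (Suc i) ?y) * h (Suc i) j x = a' i ?y + exp (- \<gamma> i ?y) * h i j x"
      by (simp add: a'_def algebra_simps)
    then show ?thesis using \<sigma>(2)[OF x(2)] by (simp add: \<tau>_def algebra_simps)
  qed
  have \<tau>_le: "\<tau> i' j x = \<tau> i j x" if "i \<le> i'" and x: "x \<in> X" "R j x \<in> U i" for i i' j x
    using that(1)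
  proof (induction i' rule: dec_induct)
    case (step n)
    have "R j x \<in> U n" using x(2) \<rho>_mono[OF step(1)] by (auto simp: U_def)
    with \<tau>_Suc[OF x(1) this] step show ?case by simp
  qed simp
  have ex: "\<exists>i. y \<in> U i" if "N y < 1" for y
  proof -
    have "(\<lambda>i. 1 / (real i + 2)) \<longlonglongrightarrow> 0"
      using LIMSEQ_ignore_initial_segment[OF lim_const_over_n[of "1::real"], of 2] by (simp add: add.commute)
    then have "\<forall>\<^sub>F i in sequentially. 1 / (real i + 2) < 1 - N y"
      using that by (intro order_tendstoD(2)[of _ 0]) auto
    then obtain i where "1 / (real i + 2) < 1 - N y" by (auto simp: eventually_sequentially)
    then show ?thesis by (intro exI[of _ i]) (simp add: U_def \<rho>_def)
  qed
  \<comment> \<open>The corrected coordinates \<open>\<tau> i\<close> agree on common domains, so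
    the least admissible index merely selects a value.\<close>
  define I where "I y = (LEAST i. y \<in> U i)" for y
  have I: "y \<in> U (I y)" if "N y < 1" for y
    unfolding I_def using ex[OF that] by (rule LeastI_ex)
  define T where "T j x = \<tau> (I (R j x)) j x" for j x
  have T: "T j x = \<tau> i j x" if x: "x \<in> X" "R j x \<in> U i" for i j x
  proof -
    have "I (R j x) \<le> i" unfolding I_def using x(2) by (rule Least_le)
    from \<tau>_le[OF this x(1) I[OF R_in[OF x(1)]]] show ?thesis by (simp add: T_def)
  qed
  have \<tau>_f: "\<tau> i k (f j k x) = \<tau> i j x" if "j \<le> k" "x \<in> X" "R j x \<in> U i" for i j k x
    using h_f[OF that(1,2)] that R_f by (simp add: \<tau>_def U_def)
  show thesis
  proof (rule that[of T])
    show "T k (f j k x) = T j x" if jk: "j \<le> k" and x: "x \<in> X" for j k x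
      unfolding T_def using \<tau>_f[OF jk x I[OF R_in[OF x]]] R_f[OF jk x] by simp
    show "x = x'" if x: "x \<in> X" "x' \<in> X" and eq: "R j x = R j x'" "T j x = T j x'" for j x x'
    proof -
      obtain i where i: "R j x \<in> U i" using ex[OF R_in[OF x(1)]] by blast
      have "\<tau> i j x = \<tau> i j x'" using T[OF x(1) i] T[OF x(2), of j i] i eq by simp
      then have "h i j x = h i j x'" using eq(1) by (simp add: \<tau>_def)
      then show ?thesis using h_inj[OF x _ eq(1)] i by (simp add: U_def)
    qed
    show "\<exists>j x. x \<in> X \<and> R j x = y \<and> T j x = \<xi>" if y: "N y < 1" for y \<xi>
    proof -
      obtain i where i: "y \<in> U i" using ex[OF y] by blast
      obtain j x where x: "x \<in> X" "R j x = y" "h i j x = exp (\<gamma> i y) * (\<xi> + \<sigma> i y)"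
        using h_surj[of y i "exp (\<gamma> i y) * (\<xi> + \<sigma> i y)"] i unfolding U_def by blast
      have "T j x = \<xi>" using T[OF x(1), of j i] i x
        by (simp add: \<tau>_def mult.assoc[symmetric] exp_add[symmetric])
      with x show ?thesis by blast
    qed
    show "immersive (\<lambda>x. (T j x, R j x)) x" if x: "x \<in> X" for j x
    proof -
      obtain i where i: "R j x \<in> U i" using ex[OF R_in[OF x]] by blast
      define A where "A z = (exp (- \<gamma> i (snd z)) * fst z - \<sigma> i (snd z), snd z)" for z :: "complex \<times> 'w"
      define S where "S = {x \<in> X. R j x \<in> U i}"
      have oS: "open S" unfolding S_def by (rule open_vimage_on[OF X hol_continuous[OF R_hol] U(1)])
      have xS: "x \<in> S" using x i by (simp add: S_def)
      have "immersive (\<lambda>z. (exp (- \<gamma> i (snd z)) * fst z - \<sigma> i (snd z), snd z)) (h i j x, R j x)"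
      proof (rule immersive_Pair_snd)
        have s: "complex_differentiable_at snd (h i j x, R j x)" by (rule cdiff_at_clinear[OF clinear_snd])
        have n: "complex_differentiable_at (\<lambda>z. - \<gamma> i (snd z)) (h i j x, R j x)"
          using cdiff_at_diff[OF cdiff_at_const[of 0] cdiff_at_compose[OF s holD[OF \<gamma>(1), of _ i]]] i by simp
        show "complex_differentiable_at (\<lambda>z. exp (- \<gamma> i (snd z)) * fst z - \<sigma> i (snd z)) (h i j x, R j x)"
          by (intro cdiff_at_diff cdiff_at_mult cdiff_at_exp n cdiff_at_clinear[OF clinear_fst]
              cdiff_at_compose[OF s holD[OF \<sigma>(1), of _ i]]) (use i in simp)
        have "((\<lambda>t. exp (- \<gamma> i (R j x)) * t - \<sigma> i (R j x)) has_field_derivative exp (- \<gamma> i (R j x))) (at (h i j x))"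
          by (auto intro!: derivative_eq_intros)
        then show "deriv (\<lambda>t. exp (- \<gamma> i (snd (t, R j x))) * fst (t, R j x) - \<sigma> i (snd (t, R j x))) (h i j x) \<noteq> 0"
          by (simp add: DERIV_imp_deriv)
      qed
      then have A: "immersive A (h i j x, R j x)" by (simp add: A_def[abs_def])
      have "N (R j x) < \<rho> i" using i by (simp add: U_def)
      from immersive_compose[of "\<lambda>x. (h i j x, R j x)" x A, OF h_imm[OF x this] A]
      have "immersive (\<lambda>x. A (h i j x, R j x)) x" .
      then show ?thesis
        by (rule immersive_transform[OF _ oS xS]) (use T in \<open>auto simp: A_def S_def \<tau>_def\<close>)
    qed
  qed
qed

end

section \<open>Automorphisms of the ball and projections\<close>

text \<open>Compare the two computations of the squared norm of
  \<open>(1 + \<i>) *\<^sub>C x\<close>. Homogeneity of the norm thus makes the real inner product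
  the real part of a Hermitian one, namely \<open>cfun\<close>.\<close>

lemma inner_scaleC_i: "(\<i> *\<^sub>C x) \<bullet> (x::'a::complex_space) = 0"
proof -
  have "(norm ((1 + \<i>) *\<^sub>C x))\<^sup>2 = 2 * (norm x)\<^sup>2"
    by (simp add: norm_scaleC power_mult_distrib cmod_def)
  moreover have "(1 + \<i>) *\<^sub>C x = x + \<i> *\<^sub>C x" by (simp add: scaleC_add_left)
  moreover have "(norm (x + \<i> *\<^sub>C x))\<^sup>2 = (norm x)\<^sup>2 + (norm (\<i> *\<^sub>C x))\<^sup>2 + 2 * ((\<i> *\<^sub>C x) \<bullet> x)"
    by (simp add: power2_norm_eq_inner inner_add_left inner_add_right inner_commute)
  ultimately show ?thesis by (simp add: norm_scaleC)
qed

lemma cfun_self: "cfun x x = complex_of_real ((norm x)\<^sup>2)"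
  by (simp add: cfun_def inner_scaleC_i power2_norm_eq_inner complex_eq_iff)

lemma cfun_sym: "cfun x y = cnj (cfun y x)"
proof -
  have "(\<i> *\<^sub>C (x + y)) \<bullet> (x + y) = 0" by (rule inner_scaleC_i)
  then have "(\<i> *\<^sub>C x) \<bullet> y + (\<i> *\<^sub>C y) \<bullet> x = 0"
    by (simp add: scaleC_add_right inner_add_left inner_add_right inner_scaleC_i)
  then show ?thesis by (simp add: cfun_def complex_eq_iff inner_commute)
qed

lemma norm_diff_scaleC:
  "(norm (\<alpha> *\<^sub>C a - s *\<^sub>R z))\<^sup>2 =
     (cmod \<alpha>)\<^sup>2 * (norm a)\<^sup>2 + s\<^sup>2 * (norm z)\<^sup>2 - 2 * s * Re (\<alpha> * cnj (cfun a (z::'a::complex_space)))"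
proof -
  have "(\<alpha> *\<^sub>C a) \<bullet> z = Re (\<alpha> * cnj (cfun a z))"
    using Re_cfun[of z "\<alpha> *\<^sub>C a"] clinear_scaleC[OF clinear_cfun, of z \<alpha> a] cfun_sym[of z a]
    by (simp add: scaleC_complex_def)
  moreover have "(norm (\<alpha> *\<^sub>C a - s *\<^sub>R z))\<^sup>2 =
      (norm (\<alpha> *\<^sub>C a))\<^sup>2 + s\<^sup>2 * (norm z)\<^sup>2 - 2 * s * ((\<alpha> *\<^sub>C a) \<bullet> z)"
    unfolding power2_norm_eq_inner by (simp add: algebra_simps inner_commute power2_eq_square)
  ultimately show ?thesis by (simp add: norm_scaleC power_mult_distrib)
qed

text \<open>Here \<open>p = 1 / (1 + s)\<close>, \<open>x\<close> and \<open>m\<close> stand for the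
  real part and the squared modulus of the Hermitian product of \<open>z\<close> with
  \<open>a\<close>, \<open>Z\<close> for the squared norm of \<open>z\<close>, and
  \<open>(1 - s) * (1 + s)\<close> for that of \<open>a\<close>. It is the numerator of the
  classical formula for the norm of the image under a ball automorphism.\<close>

lemma ball_automorphism_identity:
  fixes s p x m Z :: real
  assumes "p * (1 + s) = 1"
  shows "(1 - 2 * x * p + m * p\<^sup>2) * ((1 - s) * (1 + s)) + s\<^sup>2 * Z - 2 * s * (x - m * p) =
    1 - 2 * x + m - s\<^sup>2 * (1 - Z)"
  using assms by algebra

text \<open>The classical involution exchanging \<open>0\<close> and \<open>a\<close>. The component
  along \<open>a\<close> is written with the factor \<open>1 / (1 + s)\<close> instead of a
  projection divided by the squared norm of \<open>a\<close>, so that \<open>a = 0\<close> needs no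
  separate case.\<close>

lemma ball_automorphism:
  fixes a :: "'a::complex_space"
  assumes a: "norm a < 1"
  obtains \<phi> where "hol \<phi> (ball 0 1)" "\<And>z. norm z < 1 \<Longrightarrow> norm (\<phi> z) < 1"
    "\<And>z. norm z < 1 \<Longrightarrow> \<phi> (\<phi> z) = z" "\<phi> a = 0"
proof -
  define s where "s = sqrt (1 - (norm a)\<^sup>2)"
  have A: "(norm a)\<^sup>2 < 1" using a by (simp add: abs_square_less_1)
  have s: "s > 0" "s\<^sup>2 = 1 - (norm a)\<^sup>2" using A by (auto simp: s_def)
  let ?s = "complex_of_real s"
  define c where "c = cfun a"
  have c_lin: "clinear c" by (simp add: c_def clinear_cfun)
  have caa: "c a = 1 - ?s\<^sup>2" using s(2) by (simp add: c_def cfun_self flip: of_real_power)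
  have s1: "1 + ?s \<noteq> 0" using s(1) by (metis add_pos_pos of_real_1 of_real_add of_real_eq_0_iff order_less_irrefl zero_less_one)
  have s0: "?s \<noteq> 0" using s(1) by simp
  have D: "1 - c z \<noteq> 0" if "norm z < 1" for z
  proof
    assume "1 - c z = 0"
    then have "cmod (c z) = 1" by simp
    moreover have "norm z * norm a < 1"
      by (metis a mult_strict_mono' that norm_ge_zero mult_1)
    ultimately show False using norm_cfun_le[of a z] by (simp add: c_def)
  qed
  define \<alpha> where "\<alpha> z = 1 - c z / (1 + ?s)" for z
  define \<phi> where "\<phi> z = (1 / (1 - c z)) *\<^sub>C (\<alpha> z *\<^sub>C a - s *\<^sub>R z)" for z
  have c_phi: "c (\<phi> z) = (1 - ?s\<^sup>2 - c z) / (1 - c z)" if "norm z < 1" for z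
  proof -
    have "c (\<phi> z) = (\<alpha> z * c a - ?s * c z) / (1 - c z)"
      using clinear_scaleC[OF c_lin] clinear_diff[OF c_lin]
      by (simp add: \<phi>_def scaleC_complex_def scaleC_of_real[symmetric] del: complex_vector.scale_scale)
    moreover have "\<alpha> z * c a - ?s * c z = 1 - ?s\<^sup>2 - c z"
      unfolding \<alpha>_def caa using s1 by (simp add: field_simps power2_eq_square)
    ultimately show ?thesis by simp
  qed
  show thesis
  proof (rule that[of \<phi>])
    show "hol \<phi> (ball 0 1)"
      unfolding hol_def
    proof
      fix z :: 'a assume "z \<in> ball 0 1"
      then have z: "norm z < 1" by simp
      have cz: "complex_differentiable_at c z" by (rule cdiff_at_clinear[OF c_lin])
      have sz: "complex_differentiable_at (\<lambda>z. s *\<^sub>R z) z"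
        unfolding scaleC_of_real[symmetric] by (intro cdiff_at_scaleC cdiff_at_const cdiff_at_ident)
      show "complex_differentiable_at \<phi> z"
        unfolding \<phi>_def[abs_def] \<alpha>_def
        by (intro cdiff_at_scaleC cdiff_at_diff cdiff_at_divide cdiff_at_const cz sz D z s1)
    qed
    show "norm (\<phi> z) < 1" if z: "norm z < 1" for z
    proof -
      let ?x = "Re (c z)" let ?m = "(cmod (c z))\<^sup>2"
      have n: "(norm (\<alpha> z *\<^sub>C a - s *\<^sub>R z))\<^sup>2 = (cmod (1 - c z))\<^sup>2 - s\<^sup>2 * (1 - (norm z)\<^sup>2)"
      proof -
        have al: "\<alpha> z = 1 - c z / complex_of_real (1 + s)" by (simp add: \<alpha>_def)
        have s1': "1 + s > 0" using s(1) by simp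
        have Re_al: "Re (\<alpha> z) = 1 - ?x / (1 + s)" and Im_al: "Im (\<alpha> z) = - Im (c z) / (1 + s)"
          unfolding al by (simp_all only: minus_complex.sel one_complex.sel Re_divide_of_real Im_divide_of_real)
        have m: "?m = (Re (c z))\<^sup>2 + (Im (c z))\<^sup>2" by (rule cmod_power2)
        define p where "p = 1 / (1 + s)"
        have p: "p * (1 + s) = 1" using s1' by (simp add: p_def)
        have re_im: "Re (\<alpha> z) = 1 - ?x * p" "Im (\<alpha> z) = - Im (c z) * p"
          by (simp_all add: Re_al Im_al p_def)
        have al2: "(cmod (\<alpha> z))\<^sup>2 = 1 - 2 * ?x * p + ?m * p\<^sup>2"
          unfolding cmod_power2[of "\<alpha> z"] re_im m by algebra
        have re: "Re (\<alpha> z * cnj (c z)) = ?x - ?m * p"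
          unfolding times_complex.sel re_im m by (simp add: power2_eq_square algebra_simps)
        have d: "(cmod (1 - c z))\<^sup>2 = 1 - 2 * ?x + ?m"
          unfolding cmod_power2[of "1 - c z"] m by (simp add: power2_diff)
        have A1: "(norm a)\<^sup>2 = (1 - s) * (1 + s)" using s(2) by (simp add: power2_eq_square algebra_simps)
        show ?thesis
          unfolding norm_diff_scaleC c_def[symmetric] al2 re d A1 by (rule ball_automorphism_identity[OF p])
      qed
      have "s\<^sup>2 * (1 - (norm z)\<^sup>2) > 0" using s(1) z by (simp add: abs_square_less_1)
      then have "(norm (\<alpha> z *\<^sub>C a - s *\<^sub>R z))\<^sup>2 < (cmod (1 - c z))\<^sup>2" using n by simp
      then have "norm (\<alpha> z *\<^sub>C a - s *\<^sub>R z) < cmod (1 - c z)" by (rule power2_less_imp_less) simp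
      then show ?thesis using D[OF z] by (simp add: \<phi>_def norm_scaleC norm_divide divide_less_eq)
    qed
    show "\<phi> (\<phi> z) = z" if z: "norm z < 1" for z
    proof -
      have d: "1 - c z \<noteq> 0" by (rule D[OF z])
      have e1: "1 - c (\<phi> z) = ?s\<^sup>2 / (1 - c z)" using c_phi[OF z] d by (simp add: field_simps)
      define k where "k = (1 - c z) / ?s\<^sup>2"
      define \<beta> where "\<beta> = 1 / (1 - c z)"
      have \<phi>z: "\<phi> z = \<beta> *\<^sub>C (\<alpha> z *\<^sub>C a - ?s *\<^sub>C z)"
        by (simp only: \<phi>_def \<beta>_def scaleC_of_real)
      have "\<phi> (\<phi> z) = k *\<^sub>C (\<alpha> (\<phi> z) *\<^sub>C a - ?s *\<^sub>C \<phi> z)"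
        by (subst \<phi>_def) (simp add: e1 scaleC_of_real k_def)
      also have "\<dots> = (k * \<alpha> (\<phi> z) - k * ?s * \<beta> * \<alpha> z) *\<^sub>C a + (k * ?s * \<beta> * ?s) *\<^sub>C z"
        by (subst (2) \<phi>z) (simp only: complex_vector.scale_right_diff_distrib
            complex_vector.scale_left_diff_distrib complex_vector.scale_right_distrib scaleC_scaleC mult.assoc diff_diff_eq2 diff_add_eq)
      also have "k * \<alpha> (\<phi> z) - k * ?s * \<beta> * \<alpha> z = 0"
      proof -
        define p where "p = 1 / (1 + ?s)"
        have p: "p * (1 + ?s) = 1" using s1 by (simp add: p_def)
        have "(1 - c z) * \<alpha> (\<phi> z) = (1 - c z) - (1 - c z) * c (\<phi> z) * p"
          by (simp add: \<alpha>_def p_def right_diff_distrib)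
        also have "(1 - c z) * c (\<phi> z) = 1 - ?s\<^sup>2 - c z" using c_phi[OF z] d by simp
        also have "(1 - c z) - (1 - ?s\<^sup>2 - c z) * p = ?s * (1 - c z * p)" using p by algebra
        also have "1 - c z * p = \<alpha> z" by (simp add: \<alpha>_def p_def)
        finally have "k * \<alpha> (\<phi> z) = ?s * \<alpha> z / ?s\<^sup>2" by (simp add: k_def)
        moreover have "k * ?s * \<beta> * \<alpha> z = ?s * \<alpha> z / ?s\<^sup>2" using d by (simp add: k_def \<beta>_def)
        ultimately show ?thesis by simp
      qed
      also have "k * ?s * \<beta> * ?s = 1" using d s0 by (simp add: k_def \<beta>_def power2_eq_square)
      finally show ?thesis by simp
    qed
    have "1 - ?s\<^sup>2 = (1 - ?s) * (1 + ?s)" by algebra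
    then have "\<alpha> a = ?s" unfolding \<alpha>_def caa using s1 by simp
    then show "\<phi> a = 0" by (simp add: \<phi>_def scaleC_of_real)
  qed
qed

lemma cnorm_norm: "cnorm (norm :: 'a::complex_space \<Rightarrow> real)"
  by (simp add: cnorm_def norm_triangle_ineq norm_scaleC)

text \<open>The rescaled maps \<open>x \<mapsto> T (r *\<^sub>R x) / r\<close> tend to the identity
  as \<open>r\<close> tends to \<open>0\<close>, and \<open>near_identity\<close> applies with the
  radii \<open>1/2\<close>, \<open>1\<close> and \<open>2\<close>.\<close>

lemma near_zero_diffeo:
  fixes T :: "'a::complex_space \<Rightarrow> 'a"
  assumes hol: "hol T (ball 0 R)" and R: "0 < R" and T0: "T 0 = 0"
    and der: "(T has_derivative (\<lambda>v. v)) (at 0)"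
  obtains r where "0 < r" "r \<le> R" "inj_on T (ball 0 r)" "ball 0 (r / 2) \<subseteq> T ` ball 0 r"
proof -
  obtain e where e: "0 < e"
    "\<And>g. hol g {x::'a. norm x < 2} \<Longrightarrow> (\<And>x. norm x < 2 \<Longrightarrow> norm (g x - x) \<le> e) \<Longrightarrow>
       inj_on g {x. norm x < 1} \<and> (\<forall>x. norm x < 1 \<longrightarrow> immersive g x) \<and>
       {x. norm x \<le> 1/2} \<subseteq> g ` {x. norm x < 1}"
  proof (rule near_identity[OF cnorm_norm, where 'a = 'a and r = "1/2" and s = 1 and t = 2])
    fix e :: real assume "0 < e"
      "\<And>g. hol g {x::'a. norm x < 2} \<Longrightarrow> (\<And>x. norm x < 2 \<Longrightarrow> norm (g x - x) \<le> e) \<Longrightarrow>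
       inj_on g {x. norm x < 1} \<and> (\<forall>x. norm x < 1 \<longrightarrow> immersive g x) \<and>
       {x. norm x \<le> 1/2} \<subseteq> g ` {x. norm x < 1}"
    then show thesis by (rule that)
  qed auto
  obtain d where d: "0 < d" "\<And>x. norm x < d \<Longrightarrow> norm (T x - x) \<le> e / 2 * norm x"
  proof -
    have "\<exists>d>0. \<forall>y. norm (y - 0) < d \<longrightarrow> norm (T y - T 0 - (y - 0)) \<le> e / 2 * norm (y - 0)"
      using der[unfolded has_derivative_at_alt, THEN conjunct2] half_gt_zero[OF e(1)] by blast
    then obtain d where "d > 0" "\<forall>y. norm y < d \<longrightarrow> norm (T y - y) \<le> e / 2 * norm y"
      unfolding T0 diff_0_right by blast
    then show ?thesis using that by blast
  qed
  define r where "r = min R d / 3"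
  have r: "0 < r" "2 * r < R" "2 * r < d" using R d by (auto simp: r_def)
  define g where "g x = (1 / r) *\<^sub>R T (r *\<^sub>R x)" for x
  have "inj_on g {x. norm x < 1} \<and> (\<forall>x. norm x < 1 \<longrightarrow> immersive g x) \<and>
       {x. norm x \<le> 1/2} \<subseteq> g ` {x. norm x < 1}"
  proof (rule e(2))
    have "complex_differentiable_at g x" if x: "norm x < 2" for x
    proof -
      have "r * norm x < R" using mult_strict_left_mono[OF x r(1)] r by linarith
      then have "complex_differentiable_at T (complex_of_real r *\<^sub>C x)"
        using r by (intro holD[OF hol]) (simp add: norm_scaleC)
      then show ?thesis
        unfolding g_def[abs_def] scaleC_of_real[symmetric]
        by (intro cdiff_at_scaleC cdiff_at_const cdiff_at_compose[of "\<lambda>x. complex_of_real r *\<^sub>C x" x T] cdiff_at_ident)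
    qed
    then show "hol g {x. norm x < 2}" by (simp add: hol_def)
    show "norm (g x - x) \<le> e" if x: "norm x < 2" for x
    proof -
      have "r * norm x < d" using mult_strict_left_mono[OF x r(1)] r by linarith
      then have "norm (T (r *\<^sub>R x) - r *\<^sub>R x) \<le> e / 2 * (r * norm x)"
        using d(2)[of "r *\<^sub>R x"] r by simp
      moreover have "g x - x = (1 / r) *\<^sub>R (T (r *\<^sub>R x) - r *\<^sub>R x)"
        using r by (simp add: g_def scaleR_diff_right)
      then have "norm (g x - x) = (1 / r) * norm (T (r *\<^sub>R x) - r *\<^sub>R x)" using r by simp
      ultimately have "norm (g x - x) \<le> (1 / r) * (e / 2 * (r * norm x))"
        using r by (metis mult_left_mono less_imp_le divide_pos_pos zero_less_one)
      also have "\<dots> = e / 2 * norm x" using r by simp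
      also have "\<dots> \<le> e" using x e by (simp add: mult_left_le)
      finally show ?thesis .
    qed
  qed
  then have g: "inj_on g {x. norm x < 1}" "{x. norm x \<le> 1/2} \<subseteq> g ` {x. norm x < 1}" by auto
  have Tg: "T x = r *\<^sub>R g ((1 / r) *\<^sub>R x)" for x using r by (simp add: g_def)
  show thesis
  proof (rule that[of r])
    show "inj_on T (ball 0 r)"
    proof (rule inj_onI)
      fix x y assume xy: "x \<in> ball 0 r" "y \<in> ball 0 r" "T x = T y"
      then have "g ((1 / r) *\<^sub>R x) = g ((1 / r) *\<^sub>R y)" using r by (simp add: Tg)
      then have "(1 / r) *\<^sub>R x = (1 / r) *\<^sub>R y"
        by (rule inj_onD[OF g(1)]) (use xy r in \<open>auto simp: divide_less_eq\<close>)
      then show "x = y" using r by simp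
    qed
    show "ball 0 (r / 2) \<subseteq> T ` ball 0 r"
    proof
      fix y :: 'a assume "y \<in> ball 0 (r / 2)"
      then have "(1 / r) *\<^sub>R y \<in> {x. norm x \<le> 1/2}" using r by (simp add: field_simps)
      then obtain x where x: "norm x < 1" "(1 / r) *\<^sub>R y = g x" using g(2) by blast
      have "T (r *\<^sub>R x) = r *\<^sub>R g x" using Tg[of "r *\<^sub>R x"] r by simp
      also have "\<dots> = y" unfolding x(2)[symmetric] using r by simp
      finally show "y \<in> T ` ball 0 r" using x r by (intro image_eqI[of _ _ "r *\<^sub>R x"]) auto
    qed
  qed (use r in auto)
qed

section \<open>Invertibility of self maps tangent to the identity\<close>

lemma montel_single:
  fixes f :: "nat \<Rightarrow> 'a::complex_space \<Rightarrow> 'b::complex_space"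
  assumes "open U" "ehol f U" "elb f U"
  obtains g k where "strict_mono (k :: nat \<Rightarrow> nat)" "luc (\<lambda>n. f (k n)) g U"
  by (rule montel_family[where U = "\<lambda>_. U" and f = "\<lambda>_. f"]) (use assms that in blast)+

lemma elb_bounded:
  assumes "\<And>n x. x \<in> U \<Longrightarrow> norm (f n x) \<le> B" shows "elb f U"
  unfolding elb_def using assms by (intro allI impI exI[of _ B] always_eventually) blast

lemma ehol_always: "(\<And>n. hol (f n) U) \<Longrightarrow> ehol f U"
  by (intro eholI always_eventually allI)

text \<open>Cartan's uniqueness theorem would give that the self map is the identity. Only its invertibility is
  needed, and this comes out of the compactness of the set of its iterates.\<close>

lemma tangent_to_identity_invertible:
  fixes N :: "'a::complex_space \<Rightarrow> real"
  assumes N: "cnorm N" and hol: "hol \<phi> {x. N x < 1}" and le: "\<And>x. N x < 1 \<Longrightarrow> N (\<phi> x) \<le> N x"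
    and der: "(\<phi> has_derivative (\<lambda>v. v)) (at 0)"
  obtains \<psi> where "hol \<psi> {x. N x < 1}" "\<And>x. N x < 1 \<Longrightarrow> N (\<psi> x) \<le> N x"
    "\<And>x. N x < 1 \<Longrightarrow> \<phi> (\<psi> x) = x" "\<And>x. N x < 1 \<Longrightarrow> \<psi> (\<phi> x) = x"
proof -
  define Y where "Y = {x. N x < 1}"
  have Y: "open Y" "convex Y" "0 \<in> Y" unfolding Y_def
    using cnorm_open[OF N] cnorm_convex[OF N] cnorm_zero[OF N] by auto
  obtain c where c: "0 < c" "\<And>x. c * norm x \<le> N x" using cnorm_lower[OF N] by blast
  have contN: "continuous_on UNIV N" by (rule cnorm_continuous[OF N])
  define it where "it n = \<phi> ^^ n" for n
  have it_le: "N (it n x) \<le> N x" if "x \<in> Y" for n x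
  proof (induction n)
    case (Suc n)
    have "N (it n x) < 1" using Suc that by (simp add: Y_def)
    then show ?case using le[of "it n x"] Suc by (simp add: it_def)
  qed (simp add: it_def)
  have it_Y: "it n x \<in> Y" if "x \<in> Y" for n x using it_le[OF that, of n] that by (simp add: Y_def)
  have \<phi>Y: "hol \<phi> Y" using hol by (simp add: Y_def)
  have it_Suc: "it (Suc n) x = \<phi> (it n x)" "it (Suc n) x = it n (\<phi> x)" for n x
    by (simp_all add: it_def funpow_swap1)
  have it_add: "it (m + n) x = it m (it n x)" for m n x by (simp add: it_def funpow_add)
  have it_hol: "hol (it n) Y" for n
  proof (induction n)
    case 0 show ?case by (simp add: it_def hol_def cdiff_at_ident)
  next
    case (Suc n)
    have "hol (\<lambda>x. \<phi> (it n x)) Y" by (rule hol_compose[OF Suc \<phi>Y]) (use it_Y in auto)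
    then show ?case by (simp add: it_Suc(1)[abs_def])
  qed
  have \<phi>0: "\<phi> 0 = 0" using le[of 0] cnorm_zero[OF N] cnorm_pos[OF N, of "\<phi> 0"] by fastforce
  have it0: "it n 0 = 0" for n by (induction n) (simp_all add: it_def \<phi>0)
  have it_der: "(it n has_derivative (\<lambda>v. v)) (at 0)" for n
  proof (induction n)
    case 0 show ?case by (simp add: it_def)
  next
    case (Suc n)
    have "((\<lambda>x. \<phi> (it n x)) has_derivative (\<lambda>v. v)) (at 0)"
      by (rule has_derivative_compose[OF Suc]) (simp add: it0 der)
    then show ?case by (simp add: it_Suc(1)[abs_def])
  qed
  have bd: "norm (it n x) \<le> 1 / c" if "x \<in> Y" for n x
  proof -
    have "c * norm (it n x) \<le> 1" using c(2)[of "it n x"] it_Y[OF that, of n] by (simp add: Y_def)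
    then show ?thesis using c(1) by (simp add: field_simps)
  qed
  have sub: "\<exists>g k. strict_mono (k :: nat \<Rightarrow> nat) \<and> luc (\<lambda>n. it (s (k n))) g Y" for s :: "nat \<Rightarrow> nat"
    by (rule montel_single[OF Y(1), of "\<lambda>n. it (s n)"])
      (use it_hol bd in \<open>auto intro!: ehol_always elb_bounded\<close>)
  have lim_hol: "hol g Y" and lim_le: "\<And>x. x \<in> Y \<Longrightarrow> N (g x) \<le> N x" and lim_Y: "g ` Y \<subseteq> Y"
    and lim_der: "(g has_derivative (\<lambda>v. v)) (at 0)" if L: "luc (\<lambda>n. it (s n)) g Y" for g and s :: "nat \<Rightarrow> nat"
  proof -
    have eh: "ehol (\<lambda>n. it (s n)) Y" by (intro ehol_always it_hol)
    show h: "hol g Y" by (rule weierstrass[OF Y(1) L eh])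
    show le': "N (g x) \<le> N x" if "x \<in> Y" for x
    proof (rule LIMSEQ_le_const2)
      show "(\<lambda>n. N (it (s n) x)) \<longlonglongrightarrow> N (g x)"
        using continuous_on_tendsto_compose[OF contN luc_pointwise[OF L that]] by simp
    qed (use it_le that in blast)
    then show "g ` Y \<subseteq> Y" by (force simp: Y_def)
    obtain G where G: "clinear G" "(g has_derivative G) (at 0)" using h Y(3) by (auto simp: hol_def elim: cdiff_at_E)
    have G_lim: "(\<lambda>n. v) \<longlonglongrightarrow> G v" for v
      by (rule luc_derivative[OF Y(1,3) L eh _ G, where D = "\<lambda>n v. v"]) (simp add: it_der clinear_id)
    have "G v = v" for v using G_lim[of v] by (simp add: LIMSEQ_const_iff)
    then have "G = (\<lambda>v. v)" by blast
    with G show "(g has_derivative (\<lambda>v. v)) (at 0)" by simp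
  qed
  obtain h \<nu> where \<nu>: "strict_mono (\<nu> :: nat \<Rightarrow> nat)" and h: "luc (\<lambda>n. it (\<nu> n)) h Y"
    using sub[of id] by auto
  \<comment> \<open>As \<open>it (\<nu> (Suc n))\<close> is \<open>it (K n)\<close> after
    \<open>it (\<nu> n)\<close>, a limit \<open>g\<close> of the \<open>it (K n)\<close> satisfies
    \<open>g \<circ> h = h\<close>. Since \<open>h\<close> is tangent to the identity, its image
    contains a neighbourhood of \<open>0\<close>, so \<open>g\<close> is the identity there and
    hence everywhere.\<close>
  define K where "K n = \<nu> (Suc n) - \<nu> n" for n
  have K: "K n \<ge> 1" "K n + \<nu> n = \<nu> (Suc n)" for n
    using strict_monoD[OF \<nu>, of n "Suc n"] by (auto simp: K_def)
  obtain g \<mu> where \<mu>: "strict_mono (\<mu> :: nat \<Rightarrow> nat)" and g: "luc (\<lambda>n. it (K (\<mu> n))) g Y"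
    using sub[of K] by blast
  \<comment> \<open>One iteration less: \<open>\<phi> \<circ> \<psi>\<close> and
    \<open>\<psi> \<circ> \<phi>\<close> are both limits of the \<open>it (K n)\<close>, hence the
    identity. As \<open>K n \<ge> 1\<close>, the subtraction of natural numbers is exact.\<close>
  obtain \<psi> \<theta> where \<theta>: "strict_mono (\<theta> :: nat \<Rightarrow> nat)" and \<psi>: "luc (\<lambda>n. it (K (\<mu> (\<theta> n)) - 1)) \<psi> Y"
    using sub[of "\<lambda>n. K (\<mu> n) - 1"] by blast
  have gh: "g (h x) = h x" if x: "x \<in> Y" for x
  proof -
    have "luc (\<lambda>n x. it (K (\<mu> n)) (it (\<nu> (\<mu> n)) x)) (\<lambda>x. g (h x)) Y"
      by (rule luc_compose[OF luc_subseq[OF h \<mu>] hol_continuous[OF lim_hol[OF h]] lim_Y[OF h] Y(1) g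
            hol_continuous[OF lim_hol[OF g]]])
    from luc_pointwise[OF this x] have "(\<lambda>n. it (\<nu> (Suc (\<mu> n))) x) \<longlonglongrightarrow> g (h x)"
      by (simp add: it_add[symmetric] K(2))
    moreover have "strict_mono (\<lambda>n. Suc (\<mu> n))" using \<mu> by (simp add: strict_mono_def)
    from luc_pointwise[OF luc_subseq[OF h this] x] have "(\<lambda>n. it (\<nu> (Suc (\<mu> n))) x) \<longlonglongrightarrow> h x" .
    ultimately show ?thesis using LIMSEQ_unique by blast
  qed
  have "h 0 = 0" using luc_pointwise[OF h Y(3)] by (simp add: it0 LIMSEQ_const_iff)
  obtain R where R: "R > 0" "ball 0 R \<subseteq> Y" using Y by (meson openE)
  obtain r where r: "0 < r" "r \<le> R" "ball 0 (r / 2) \<subseteq> h ` ball 0 r"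
    by (rule near_zero_diffeo[OF hol_subset[OF lim_hol[OF h] R(2)] R(1) \<open>h 0 = 0\<close> lim_der[OF h]])
  have rY: "ball 0 r \<subseteq> Y" using r R by (meson order_trans subset_ball)
  have gid: "g x = x" if "x \<in> ball 0 (r / 2)" for x
  proof -
    obtain z where "z \<in> Y" "x = h z" using r(3) \<open>x \<in> ball 0 (r / 2)\<close> rY by blast
    with gh show ?thesis by simp
  qed
  have g_id: "g x = x" if "x \<in> Y" for x
  proof (rule hol_identity[OF Y(1,2) lim_hol[OF g] _ open_ball _ _ gid that])
    show "hol (\<lambda>x. x) Y" by (simp add: hol_def cdiff_at_ident)
    show "ball 0 (r / 2) \<noteq> ({} :: 'a set)" using r by simp
    have "ball 0 (r / 2) \<subseteq> ball 0 r" using r(1) by auto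
    then show "ball 0 (r / 2) \<subseteq> Y" using rY by blast
  qed
  have Kl: "it (K (\<mu> (\<theta> n))) x = \<phi> (it (K (\<mu> (\<theta> n)) - 1) x)"
    "it (K (\<mu> (\<theta> n))) x = it (K (\<mu> (\<theta> n)) - 1) (\<phi> x)" for n x
    using it_Suc[of "K (\<mu> (\<theta> n)) - 1" x] K(1)[of "\<mu> (\<theta> n)"] by simp_all
  have g': "(\<lambda>n. it (K (\<mu> (\<theta> n))) x) \<longlonglongrightarrow> x" if "x \<in> Y" for x
    using luc_pointwise[OF luc_subseq[OF g \<theta>] that] g_id[OF that] by simp
  show thesis
  proof (rule that[of \<psi>])
    show "hol \<psi> {x. N x < 1}" using lim_hol[OF \<psi>] by (simp add: Y_def)
    fix x assume "N x < 1"
    then have x: "x \<in> Y" by (simp add: Y_def)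
    show "N (\<psi> x) \<le> N x" by (rule lim_le[OF \<psi> x])
    have "\<psi> x \<in> Y" using lim_Y[OF \<psi>] x by blast
    then have "isCont \<phi> (\<psi> x)" by (intro cdiff_at_continuous holD[OF \<phi>Y])
    from isCont_tendsto_compose[OF this luc_pointwise[OF \<psi> x]]
    have "(\<lambda>n. it (K (\<mu> (\<theta> n))) x) \<longlonglongrightarrow> \<phi> (\<psi> x)" by (simp add: Kl(1))
    then show "\<phi> (\<psi> x) = x" using g'[OF x] LIMSEQ_unique by blast
    have "\<phi> x \<in> Y" using it_Y[OF x, of 1] by (simp add: it_def)
    from luc_pointwise[OF \<psi> this] have "(\<lambda>n. it (K (\<mu> (\<theta> n))) x) \<longlonglongrightarrow> \<psi> (\<phi> x)" by (simp add: Kl(2))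
    then show "\<psi> (\<phi> x) = x" using g'[OF x] LIMSEQ_unique by blast
  qed
qed

text \<open>A complement of the line spanned by \<open>u\<close> is taken to be \<open>0 \<times> \<complex>\<^sup>m\<close> if the first
  component of \<open>u\<close> does not vanish, and otherwise the hyperplane on which some coordinate
  vanishes.\<close>

lemma complement_of_line:
  fixes u :: "complex \<times> (complex ^ 'm)"
  assumes u: "u \<noteq> 0"
  obtains p q t where "clinear p" "clinear q" "clinear t"
    "p u = 0" "\<And>y :: complex ^ 'm. p (q y) = y" "t u = 1" "\<And>x. x = t x *\<^sub>C u + q (p x)"
proof (cases "fst u = 0")
  case False
  define t where "t x = fst x / fst u" for x :: "complex \<times> (complex ^ 'm)"
  define p where "p x = snd x - t x *\<^sub>C snd u" for x
  define q where "q y = ((0::complex), y)" for y :: "complex ^ 'm"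
  have t: "clinear t" by (simp add: t_def clinear_iff scaleC_prod_def scaleC_complex_def add_divide_distrib)
  show thesis
  proof (rule that[of p q t])
    show "clinear p" unfolding p_def
      by (intro clinear_minus clinear_snd clinear_compose[OF clinear_scaleC_left t])
    show "clinear q" unfolding q_def by (intro clinear_Pair clinear_zero_map clinear_id)
    show "t u = 1" using False by (simp add: t_def)
    show "p u = 0" using False by (simp add: p_def t_def)
    show "p (q y) = y" for y by (simp add: p_def q_def t_def)
    show "x = t x *\<^sub>C u + q (p x)" for x
      using False by (simp add: p_def q_def t_def prod_eq_iff scaleC_prod_def scaleC_complex_def)
  qed (rule t)
next
  case True
  then obtain i where i: "snd u $ i \<noteq> 0" using u by (auto simp: prod_eq_iff vec_eq_iff)
  define t where "t x = snd x $ i / snd u $ i" for x :: "complex \<times> (complex ^ 'm)"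
  define p where "p x = (\<chi> k. if k = i then fst x else snd x $ k - t x * snd u $ k)" for x
  define q where "q y = (y $ i, \<chi> k. if k = i then 0 else y $ k)" for y :: "complex ^ 'm"
  have t: "clinear t"
    by (simp add: t_def clinear_iff scaleC_prod_def scaleC_vec_def scaleC_complex_def add_divide_distrib)
  show thesis
  proof (rule that[of p q t])
    show "clinear p"
      using t by (auto simp: p_def clinear_iff vec_eq_iff scaleC_prod_def scaleC_vec_def scaleC_complex_def algebra_simps)
    show "clinear q"
      by (auto simp: q_def clinear_iff vec_eq_iff scaleC_prod_def scaleC_vec_def scaleC_complex_def)
    show "t u = 1" using i by (simp add: t_def)
    show "p u = 0" using i True by (auto simp: p_def t_def vec_eq_iff)
    show "p (q y) = y" for y by (auto simp: p_def q_def t_def vec_eq_iff)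
    show "x = t x *\<^sub>C u + q (p x)" for x
      using i True by (auto simp: p_def q_def t_def prod_eq_iff vec_eq_iff scaleC_prod_def scaleC_vec_def scaleC_complex_def)
  qed (rule t)
qed

text \<open>Any complement of the kernel line is mapped isomorphically onto the range of
  \<open>D\<close>. With coordinates \<open>p\<close>, \<open>q\<close> of a complement,
  \<open>D \<circ> q\<close> parametrises the range, and \<open>p\<close> inverts it because
  \<open>p\<close> kills the kernel.\<close>

lemma projection_coordinates:
  fixes D :: "complex \<times> (complex ^ 'm) \<Rightarrow> complex \<times> (complex ^ 'm)"
  assumes D: "clinear D" "\<And>x. D (D x) = D x" and u: "u \<noteq> 0" "\<And>v. D v = 0 \<longleftrightarrow> (\<exists>c. v = c *\<^sub>C u)"
  obtains e \<pi> \<tau> where "clinear e" "clinear \<pi>" "clinear \<tau>"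
    "\<And>x. e (\<pi> x) = D x" "\<And>y :: complex ^ 'm. \<pi> (e y) = y" "\<tau> u = 1" "\<pi> u = 0"
    "\<And>y. \<tau> (e y) = 0" "\<And>x. x = e (\<pi> x) + \<tau> x *\<^sub>C u"
proof -
  obtain p q t where p: "clinear p" "clinear q" "clinear t"
    "p u = 0" "\<And>y :: complex ^ 'm. p (q y) = y" "t u = 1" "\<And>x. x = t x *\<^sub>C u + q (p x)"
    by (rule complement_of_line[OF u(1)]) (rule that)
  have Du: "D u = 0" using u(2) by (metis scaleC_one)
  have Dx: "D x = D (q (p x))" for x
  proof -
    have "D x = D (t x *\<^sub>C u + q (p x))" using p(7) by metis
    then show ?thesis using Du by (simp add: clinear_add[OF D(1)] clinear_scaleC[OF D(1)])
  qed
  have ker: "x - D x = t (x - D x) *\<^sub>C u" for x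
  proof -
    have "D (x - D x) = 0" by (simp add: clinear_diff[OF D(1)] D(2))
    then obtain c where c: "x - D x = c *\<^sub>C u" using u(2) by blast
    then have "t (x - D x) = c" by (simp add: clinear_scaleC[OF p(3)] p(6) scaleC_complex_def)
    with c show ?thesis by simp
  qed
  have pD: "p (D x) = p x" for x
  proof -
    have "p (x - D x) = 0" by (subst ker) (simp add: clinear_scaleC[OF p(1)] p(4))
    then show ?thesis by (simp add: clinear_diff[OF p(1)])
  qed
  show thesis
  proof (rule that[of "\<lambda>y. D (q y)" p "\<lambda>x. t (x - D x)"])
    show "clinear (\<lambda>y. D (q y))" by (rule clinear_compose[OF D(1) p(2)])
    show "clinear (\<lambda>x. t (x - D x))" by (intro clinear_compose[OF p(3)] clinear_minus clinear_id D(1))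
    show "D (q (p x)) = D x" for x using Dx by simp
    show "p (D (q y)) = y" for y by (simp add: pD p(5))
    show "t (u - D u) = 1" by (simp add: Du p(6))
    show "t (D (q y) - D (D (q y))) = 0" for y by (simp add: D(2) clinear_zero[OF p(3)])
    show "x = D (q (p x)) + t (x - D x) *\<^sub>C u" for x using ker[of x] Dx[of x] by (simp add: algebra_simps)
  qed (rule p)+
qed

section \<open>Towers of self maps of the domain\<close>

text \<open>The Minkowski functional of \<open>\<Omega>\<close>; for self maps of
  \<open>\<Omega>\<close> fixing \<open>0\<close> the Schwarz lemma says that it does not
  increase.\<close>

definition mnorm :: "'a::real_normed_vector \<times> 'b::real_normed_vector \<Rightarrow> real" where
  "mnorm x = max (norm (fst x)) (norm (snd x))"

lemma mnorm_less: "mnorm x < r \<longleftrightarrow> norm (fst x) < r \<and> norm (snd x) < r"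
  by (simp add: mnorm_def)

lemma mnorm_ball: "{x. mnorm x < 1} = ball 0 1 \<times> ball 0 1"
  by (auto simp: mnorm_less)

lemma cnorm_mnorm: "cnorm (mnorm :: 'a::complex_space \<times> 'b::complex_space \<Rightarrow> real)"
  unfolding cnorm_def
proof (intro conjI allI impI)
  fix x y :: "'a \<times> 'b" and c :: complex
  show "mnorm (x + y) \<le> mnorm x + mnorm y"
    using norm_triangle_ineq[of "fst x" "fst y"] norm_triangle_ineq[of "snd x" "snd y"]
    by (auto simp: mnorm_def max_def)
  show "mnorm (c *\<^sub>C x) = cmod c * mnorm x"
    by (simp add: mnorm_def scaleC_prod_def norm_scaleC max_mult_distrib_left)
  show "0 < mnorm x" if "x \<noteq> 0"
    using that by (auto simp: mnorm_def less_max_iff_disj prod_eq_iff)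
qed

lemma mnorm_zero [simp]: "mnorm 0 = 0"
  by (simp add: mnorm_def)

lemma mnorm_eq_0: "mnorm x \<le> 0 \<Longrightarrow> x = 0"
  by (simp add: mnorm_def prod_eq_iff)

lemma mnorm_nonneg [simp]: "0 \<le> mnorm x"
  by (simp add: mnorm_def le_max_iff_disj)

lemma mnorm_tendsto: "(X \<longlongrightarrow> l) F \<Longrightarrow> ((\<lambda>n. mnorm (X n)) \<longlongrightarrow> mnorm l) F"
  unfolding mnorm_def by (intro tendsto_intros)

lemma norm_le_2_mnorm: "norm x \<le> 2 * mnorm x"
proof -
  have "norm x \<le> norm (fst x) + norm (snd x)" using norm_Pair_le[of "fst x" "snd x"] by simp
  then show ?thesis by (simp add: mnorm_def)
qed

lemma schwarz_mnorm:
  fixes f :: "'a::complex_space \<times> 'b::complex_space \<Rightarrow> 'c::complex_space \<times> 'd::complex_space"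
  assumes hol: "hol f {x. mnorm x < 1}" and f0: "f 0 = 0" and bd: "\<And>x. mnorm x < 1 \<Longrightarrow> mnorm (f x) < 1"
  shows "mnorm x < 1 \<Longrightarrow> mnorm (f x) \<le> mnorm x"
    and "clinear D \<Longrightarrow> (f has_derivative D) (at 0) \<Longrightarrow> mnorm (D v) \<le> mnorm v"
proof -
  have h: "hol (\<lambda>x. fst (f x)) {x. mnorm x < 1}" "hol (\<lambda>x. snd (f x)) {x. mnorm x < 1}"
    by (rule hol_compose[OF hol hol_clinear[OF clinear_fst, where S = UNIV]], simp)
       (rule hol_compose[OF hol hol_clinear[OF clinear_snd, where S = UNIV]], simp)
  note 1 = schwarz_cnorm[OF cnorm_mnorm h(1)] and 2 = schwarz_cnorm[OF cnorm_mnorm h(2)]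
  show "mnorm (f x) \<le> mnorm x" if "mnorm x < 1"
  proof -
    have "norm (fst (f x)) \<le> mnorm x" by (rule 1(1)) (use that bd f0 in \<open>auto simp: mnorm_less\<close>)
    moreover have "norm (snd (f x)) \<le> mnorm x" by (rule 2(1)) (use that bd f0 in \<open>auto simp: mnorm_less\<close>)
    ultimately show ?thesis by (simp add: mnorm_def)
  qed
  show "mnorm (D v) \<le> mnorm v" if D: "clinear D" "(f has_derivative D) (at 0)"
  proof -
    have "norm (fst (D v)) \<le> mnorm v"
    proof (rule 1(2))
      show "clinear (\<lambda>v. fst (D v))" by (rule clinear_compose[OF clinear_fst D(1)])
      show "((\<lambda>x. fst (f x)) has_derivative (\<lambda>v. fst (D v))) (at 0)" by (rule has_derivative_fst[OF D(2)])
    qed (use bd f0 in \<open>auto simp: mnorm_less\<close>)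
    moreover have "norm (snd (D v)) \<le> mnorm v"
    proof (rule 2(2))
      show "clinear (\<lambda>v. snd (D v))" by (rule clinear_compose[OF clinear_snd D(1)])
      show "((\<lambda>x. snd (f x)) has_derivative (\<lambda>v. snd (D v))) (at 0)" by (rule has_derivative_snd[OF D(2)])
    qed (use bd f0 in \<open>auto simp: mnorm_less\<close>)
    ultimately show ?thesis by (simp add: mnorm_def)
  qed
qed

lemma luc_cong:
  assumes "luc f g U" "\<And>x. x \<in> U \<Longrightarrow> g x = h x" shows "luc f h U"
  unfolding luc_def
proof (intro allI impI)
  fix K assume K: "compact K" "K \<subseteq> U"
  from lucD[OF assms(1) this] show "uniform_limit K f h sequentially"
    by (rule uniform_limit_cong'[THEN iffD1, rotated -1]) (use K assms(2) in auto)
qed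

lemma immersive_left_inverse:
  assumes f: "complex_differentiable_at f x" and g: "complex_differentiable_at g (f x)"
    and inv: "open S" "x \<in> S" "\<And>y. y \<in> S \<Longrightarrow> g (f y) = y"
  shows "immersive f x"
proof -
  obtain D where D: "clinear D" "(f has_derivative D) (at x)" using f by (rule cdiff_at_E)
  obtain E where E: "clinear E" "(g has_derivative E) (at (f x))" using g by (rule cdiff_at_E)
  have "((\<lambda>y. y) has_derivative (\<lambda>v. E (D v))) (at x)"
    by (rule has_derivative_transform_within_open[OF has_derivative_compose[OF D(2) E(2)] inv(1,2)]) (rule inv(3))
  then have "E (D v) = v" for v
    using has_derivative_unique[OF has_derivative_ident] by metis
  then have "inj D" by (metis injI)
  with D show ?thesis unfolding immersive_def by blast
qed

locale polydisc_tower =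
  fixes f :: "nat \<Rightarrow> nat \<Rightarrow> complex \<times> (complex ^ 'm) \<Rightarrow> complex \<times> (complex ^ 'm)"
    and \<alpha> :: "nat \<Rightarrow> complex \<times> (complex ^ 'm) \<Rightarrow> complex \<times> (complex ^ 'm)"
    and \<rho> :: "complex \<times> (complex ^ 'm) \<Rightarrow> complex \<times> (complex ^ 'm)"
    and S :: "(complex \<times> (complex ^ 'm)) set"
  defines "S \<equiv> {x. mnorm x < 1}"
  assumes f_in: "\<And>j k x. j \<le> k \<Longrightarrow> x \<in> S \<Longrightarrow> f j k x \<in> S"
    and f_imm: "\<And>j k x. j \<le> k \<Longrightarrow> x \<in> S \<Longrightarrow> immersive (f j k) x"
    and f_inj: "\<And>j k. j \<le> k \<Longrightarrow> inj_on (f j k) S"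
    and f_comp: "\<And>j k l x. j \<le> k \<Longrightarrow> k \<le> l \<Longrightarrow> x \<in> S \<Longrightarrow> f k l (f j k x) = f j l x"
    and f_zero: "\<And>j k. j \<le> k \<Longrightarrow> f j k 0 = 0"
    and f_lim: "\<And>j. luc (f j) (\<alpha> j) S"
    and \<alpha>_lim: "luc \<alpha> \<rho> S"
begin

lemma S_open: "open S" and S_convex: "convex S" and S_zero: "0 \<in> S"
  unfolding S_def by (rule cnorm_open[OF cnorm_mnorm], rule cnorm_convex[OF cnorm_mnorm], simp)

lemma f_hol: "j \<le> k \<Longrightarrow> hol (f j k) S"
  by (rule immersive_hol) (rule f_imm)

lemma f_le: "mnorm (f j k x) \<le> mnorm x" if jk: "j \<le> k" and x: "x \<in> S"
proof (rule schwarz_mnorm(1)[of "f j k"])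
  show "hol (f j k) {x. mnorm x < 1}" using f_hol[OF jk] by (simp add: S_def)
  show "mnorm (f j k x) < 1" if "mnorm x < 1" for x using f_in[OF jk, of x] that by (simp add: S_def)
qed (use x f_zero[OF jk] in \<open>auto simp: S_def\<close>)

lemma ehol_f: "ehol (f j) S"
  by (rule eholI) (use f_hol in \<open>auto simp: eventually_sequentially\<close>)

lemma \<alpha>_hol: "hol (\<alpha> j) S"
  by (rule weierstrass[OF S_open f_lim ehol_f])

lemma \<alpha>_le: "mnorm (\<alpha> j x) \<le> mnorm x" if x: "x \<in> S"
proof (rule LIMSEQ_le_const2)
  show "(\<lambda>k. mnorm (f j k x)) \<longlonglongrightarrow> mnorm (\<alpha> j x)"
    by (rule mnorm_tendsto[OF luc_pointwise[OF f_lim x]])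
  show "\<exists>K. \<forall>k\<ge>K. mnorm (f j k x) \<le> mnorm x" using f_le[OF _ x] by blast
qed

lemma \<alpha>_in: "x \<in> S \<Longrightarrow> \<alpha> j x \<in> S"
  using \<alpha>_le[of x j] by (simp add: S_def)

lemma \<alpha>_f: "\<alpha> k (f j k x) = \<alpha> j x" if jk: "j \<le> k" and x: "x \<in> S"
proof -
  have "(\<lambda>l. f k l (f j k x)) \<longlonglongrightarrow> \<alpha> k (f j k x)" by (rule luc_pointwise[OF f_lim f_in[OF jk x]])
  moreover have "\<forall>\<^sub>F l in sequentially. f k l (f j k x) = f j l x"
    using eventually_ge_at_top[of k] by eventually_elim (rule f_comp[OF jk _ x])
  ultimately have "(\<lambda>l. f j l x) \<longlonglongrightarrow> \<alpha> k (f j k x)" by (rule Lim_transform_eventually)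
  then show ?thesis using luc_pointwise[OF f_lim x] LIMSEQ_unique by blast
qed

lemma \<alpha>_zero: "\<alpha> j 0 = 0"
  using \<alpha>_le[OF S_zero, of j] by (intro mnorm_eq_0) simp

lemma \<rho>_hol: "hol \<rho> S"
  by (rule weierstrass[OF S_open \<alpha>_lim ehol_always[OF \<alpha>_hol]])

lemma \<rho>_le: "mnorm (\<rho> x) \<le> mnorm x" if x: "x \<in> S"
proof (rule LIMSEQ_le_const2)
  show "(\<lambda>j. mnorm (\<alpha> j x)) \<longlonglongrightarrow> mnorm (\<rho> x)"
    by (rule mnorm_tendsto[OF luc_pointwise[OF \<alpha>_lim x]])
  show "\<exists>J. \<forall>j\<ge>J. mnorm (\<alpha> j x) \<le> mnorm x" using \<alpha>_le[OF x] by blast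
qed

lemma \<rho>_in: "x \<in> S \<Longrightarrow> \<rho> x \<in> S"
  using \<rho>_le[of x] by (simp add: S_def)

lemma \<rho>_zero: "\<rho> 0 = 0"
  using \<rho>_le[OF S_zero] by (intro mnorm_eq_0) simp

text \<open>In \<open>\<alpha>_f\<close> let \<open>k\<close> tend to infinity; outer map and
  argument converge together, which \<open>luc_compose\<close> permits.\<close>

lemma \<rho>_\<alpha>: "\<rho> (\<alpha> j x) = \<alpha> j x" if x: "x \<in> S"
proof -
  have "luc (\<lambda>k x. \<alpha> k (f j k x)) (\<lambda>x. \<rho> (\<alpha> j x)) S"
    by (rule luc_compose[OF f_lim hol_continuous[OF \<alpha>_hol] _ S_open \<alpha>_lim hol_continuous[OF \<rho>_hol]])
       (use \<alpha>_in in blast)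
  from luc_pointwise[OF this x] have "(\<lambda>k. \<alpha> k (f j k x)) \<longlonglongrightarrow> \<rho> (\<alpha> j x)" .
  moreover have "\<forall>\<^sub>F k in sequentially. \<alpha> k (f j k x) = \<alpha> j x"
    using eventually_ge_at_top[of j] by eventually_elim (rule \<alpha>_f[OF _ x])
  ultimately have "(\<lambda>k. \<alpha> j x) \<longlonglongrightarrow> \<rho> (\<alpha> j x)" by (rule Lim_transform_eventually)
  then show ?thesis by (simp add: LIMSEQ_const_iff)
qed

lemma \<rho>_\<rho>: "\<rho> (\<rho> x) = \<rho> x" if x: "x \<in> S"
proof -
  have "luc (\<lambda>j x. \<rho> (\<alpha> j x)) (\<lambda>x. \<rho> (\<rho> x)) S"
    by (rule luc_post[OF \<alpha>_lim hol_continuous[OF \<rho>_hol] _ S_open hol_continuous[OF \<rho>_hol]]) (use \<rho>_in in blast)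
  from luc_pointwise[OF this x] have "(\<lambda>j. \<alpha> j x) \<longlonglongrightarrow> \<rho> (\<rho> x)" by (simp add: \<rho>_\<alpha>[OF x])
  then show ?thesis using luc_pointwise[OF \<alpha>_lim x] LIMSEQ_unique by blast
qed

text \<open>The image of \<open>\<alpha> 0\<close> is open and consists of fixed points of
  \<open>\<rho>\<close>, so \<open>\<rho>\<close> is the identity. Hence \<open>\<alpha> k\<close>
  is close to the identity for large \<open>k\<close>, and \<open>near_identity\<close> applies on
  each smaller ball. The case of a small index follows by composing with \<open>f j k\<close>, which
  does not increase \<open>mnorm\<close>.\<close>

lemma injective_limit:
  assumes inj: "\<And>j. inj_on (\<alpha> j) S"
  shows "x \<in> S \<Longrightarrow> immersive (\<alpha> j) x" and "y \<in> S \<Longrightarrow> \<exists>j. y \<in> \<alpha> j ` S"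
proof -
  have "open (\<alpha> 0 ` S)" by (rule invariance_of_domain[OF hol_continuous[OF \<alpha>_hol] S_open inj])
  moreover have "\<alpha> 0 ` S \<noteq> {}" "\<alpha> 0 ` S \<subseteq> S" using S_zero \<alpha>_in by auto
  moreover have "\<rho> x = x" if "x \<in> \<alpha> 0 ` S" for x using that \<rho>_\<alpha> by auto
  ultimately have \<rho>_id: "\<rho> x = x" if "x \<in> S" for x
    using hol_identity[OF S_open S_convex \<rho>_hol hol_clinear[OF clinear_id], of "\<alpha> 0 ` S" x] that by blast
  have main: "\<exists>K. \<forall>k\<ge>K. (\<forall>x. mnorm x \<le> r \<longrightarrow> immersive (\<alpha> k) x) \<and> {x. mnorm x \<le> r} \<subseteq> \<alpha> k ` S"
    if r: "0 \<le> r" "r < 1" for r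
  proof -
    define s where "s = (1 + r) / 2"
    define t where "t = (1 + s) / 2"
    have st: "r < s" "s < t" "t < 1" using r by (auto simp: s_def t_def)
    obtain e where e: "0 < e"
      and ni: "\<And>g. hol g {x :: complex \<times> (complex ^ 'm). mnorm x < t} \<Longrightarrow>
         (\<And>x. mnorm x < t \<Longrightarrow> norm (g x - x) \<le> e) \<Longrightarrow>
         inj_on g {x. mnorm x < s} \<and> (\<forall>x. mnorm x < s \<longrightarrow> immersive g x) \<and>
         {x. mnorm x \<le> r} \<subseteq> g ` {x. mnorm x < s}"
    proof (rule near_identity[OF cnorm_mnorm st(1,2) r(1)])
      fix e :: real assume "0 < e" "\<And>g. hol g {x :: complex \<times> (complex ^ 'm). mnorm x < t} \<Longrightarrow>
         (\<And>x. mnorm x < t \<Longrightarrow> norm (g x - x) \<le> e) \<Longrightarrow>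
         inj_on g {x. mnorm x < s} \<and> (\<forall>x. mnorm x < s \<longrightarrow> immersive g x) \<and>
         {x. mnorm x \<le> r} \<subseteq> g ` {x. mnorm x < s}"
      then show thesis by (rule that)
    qed
    have sub: "{x :: complex \<times> (complex ^ 'm). mnorm x \<le> t} \<subseteq> S" using st by (auto simp: S_def)
    obtain K where K: "\<And>k x. k \<ge> K \<Longrightarrow> mnorm x \<le> t \<Longrightarrow> dist (\<alpha> k x) (\<rho> x) < e"
      using luc_eventually[OF \<alpha>_lim cnorm_compact[OF cnorm_mnorm] sub e]
      unfolding eventually_sequentially by blast
    have "(\<forall>x. mnorm x \<le> r \<longrightarrow> immersive (\<alpha> k) x) \<and> {x. mnorm x \<le> r} \<subseteq> \<alpha> k ` S" if k: "k \<ge> K" for k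
    proof -
      have "inj_on (\<alpha> k) {x. mnorm x < s} \<and> (\<forall>x. mnorm x < s \<longrightarrow> immersive (\<alpha> k) x) \<and>
         {x. mnorm x \<le> r} \<subseteq> \<alpha> k ` {x. mnorm x < s}"
      proof (rule ni)
        show "hol (\<alpha> k) {x. mnorm x < t}" by (rule hol_subset[OF \<alpha>_hol]) (use sub in auto)
        fix x :: "complex \<times> (complex ^ 'm)" assume x: "mnorm x < t"
        then have "x \<in> S" using sub by auto
        with K[OF k, of x] x show "norm (\<alpha> k x - x) \<le> e" by (simp add: \<rho>_id dist_norm)
      qed
      moreover have "{x :: complex \<times> (complex ^ 'm). mnorm x < s} \<subseteq> S" using st by (auto simp: S_def)
      ultimately show ?thesis using st(1) by (auto simp: subset_iff image_iff) (metis)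
    qed
    then show ?thesis by blast
  qed
  show "immersive (\<alpha> j) x" if x: "x \<in> S"
  proof -
    have "0 \<le> mnorm x" "mnorm x < 1" using x by (auto simp: S_def)
    from main[OF this] obtain K where K: "\<And>k y. k \<ge> K \<Longrightarrow> mnorm y \<le> mnorm x \<Longrightarrow> immersive (\<alpha> k) y" by blast
    define k where "k = max j K"
    have k: "j \<le> k" "K \<le> k" by (auto simp: k_def)
    from immersive_compose[OF f_imm[OF k(1) x] K[OF k(2) f_le[OF k(1) x]]]
    have "immersive (\<lambda>x. \<alpha> k (f j k x)) x" .
    then show ?thesis by (rule immersive_transform[OF _ S_open x]) (rule \<alpha>_f[OF k(1)])
  qed
  show "\<exists>j. y \<in> \<alpha> j ` S" if y: "y \<in> S"
  proof -
    have "0 \<le> mnorm y" "mnorm y < 1" using y by (auto simp: S_def)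
    from main[OF this] show ?thesis by blast
  qed
qed

text \<open>The kernel cannot shrink in the limit: the images of \<open>u0\<close> under the
  derivatives of \<open>f 0 k\<close>, scaled to unit length, are killed by the derivatives of
  \<open>\<alpha> k\<close>, which do not increase \<open>mnorm\<close>, so an accumulation point is
  killed by \<open>D\<close>. It cannot grow either, because \<open>D\<close> fixes the range of
  \<open>A\<close>.\<close>

lemma limit_derivative_kernel:
  assumes A: "clinear A" "(\<alpha> 0 has_derivative A) (at 0)"
    and u0: "u0 \<noteq> 0" "\<And>v. A v = 0 \<longleftrightarrow> (\<exists>c. v = c *\<^sub>C u0)"
    and D: "clinear D" "(\<rho> has_derivative D) (at 0)"
  obtains u where "u \<noteq> 0" "\<And>v. D v = 0 \<longleftrightarrow> (\<exists>c. v = c *\<^sub>C u)"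
proof -
  have "\<forall>k. \<exists>B. clinear B \<and> (\<alpha> k has_derivative B) (at 0)"
    using \<alpha>_hol S_zero unfolding hol_def complex_differentiable_at_def by blast
  then obtain B where B: "\<And>k. clinear (B k)" "\<And>k. (\<alpha> k has_derivative B k) (at 0)" by metis
  have "\<forall>k. \<exists>E. clinear E \<and> inj E \<and> (f 0 k has_derivative E) (at 0)"
    using f_imm[OF _ S_zero, of 0] unfolding immersive_def by blast
  then obtain E where E: "\<And>k. clinear (E k)" "\<And>k. inj (E k)" "\<And>k. (f 0 k has_derivative E k) (at 0)" by metis
  have B_le: "mnorm (B k v) \<le> mnorm v" for k v
  proof (rule schwarz_mnorm(2)[OF _ \<alpha>_zero _ B])
    show "hol (\<alpha> k) {x. mnorm x < 1}" using \<alpha>_hol by (simp add: S_def)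
    show "mnorm (\<alpha> k x) < 1" if "mnorm x < 1" for x using \<alpha>_in[of x k] that by (simp add: S_def)
  qed
  have BE: "B k (E k v) = A v" for k v
  proof -
    have "((\<lambda>x. \<alpha> k (f 0 k x)) has_derivative (\<lambda>v. B k (E k v))) (at 0)"
      by (rule has_derivative_compose[OF E(3)]) (simp add: f_zero B(2))
    then have "(\<alpha> 0 has_derivative (\<lambda>v. B k (E k v))) (at 0)"
      by (rule has_derivative_transform_within_open[OF _ S_open S_zero]) (simp add: \<alpha>_f)
    from has_derivative_unique[OF this A(2)] show ?thesis by metis
  qed
  have Au0: "A u0 = 0" using u0(2)[of u0] by (metis scaleC_one)
  define w where "w k = E k u0 /\<^sub>R norm (E k u0)" for k
  have w: "norm (w k) = 1" "B k (w k) = 0" for k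
  proof -
    have "E k u0 \<noteq> 0" using E(1,2)[of k] u0(1) clinear_inj_iff by blast
    then show "norm (w k) = 1" by (simp add: w_def)
    show "B k (w k) = 0" using BE[of k u0] Au0 by (simp add: w_def linear_cmul[OF clinear_imp_linear[OF B(1)]])
  qed
  have "\<forall>n. w n \<in> sphere 0 1" using w(1) by simp
  then have "\<exists>l\<in>sphere 0 1. \<exists>r. strict_mono r \<and> (w \<circ> r) \<longlonglongrightarrow> l"
    using compact_sphere[of "0 :: complex \<times> (complex ^ 'm)" 1] unfolding compact_def by blast
  then obtain u \<nu> where u: "norm u = 1" and \<nu>: "strict_mono (\<nu> :: nat \<Rightarrow> nat)" "(\<lambda>n. w (\<nu> n)) \<longlonglongrightarrow> u"
    unfolding comp_def by auto
  have BD: "(\<lambda>k. B k v) \<longlonglongrightarrow> D v" for v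
    by (rule luc_derivative[OF S_open S_zero \<alpha>_lim ehol_always[OF \<alpha>_hol] _ D]) (simp add: B)
  have "(\<lambda>n. B (\<nu> n) u) \<longlonglongrightarrow> 0"
  proof -
    have "(\<lambda>n. mnorm (w (\<nu> n) - u)) \<longlonglongrightarrow> mnorm (u - u)"
      by (intro mnorm_tendsto tendsto_intros \<nu>(2))
    from tendsto_mult_left[OF this, of 2] have lim0: "(\<lambda>n. 2 * mnorm (w (\<nu> n) - u)) \<longlonglongrightarrow> 0" by simp
    have "norm (B (\<nu> n) u) \<le> 2 * mnorm (w (\<nu> n) - u)" for n
    proof -
      have "B (\<nu> n) (w (\<nu> n) - u) = - B (\<nu> n) u" by (simp add: clinear_diff[OF B(1)] w(2))
      then have "mnorm (- B (\<nu> n) u) \<le> mnorm (w (\<nu> n) - u)" using B_le[of "\<nu> n" "w (\<nu> n) - u"] by simp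
      moreover have "norm (B (\<nu> n) u) \<le> 2 * mnorm (- B (\<nu> n) u)"
        using norm_le_2_mnorm[of "- B (\<nu> n) u"] by simp
      ultimately show ?thesis by simp
    qed
    then show ?thesis by (intro Lim_null_comparison[OF _ lim0] always_eventually allI)
  qed
  moreover have "(\<lambda>n. B (\<nu> n) u) \<longlonglongrightarrow> D u"
    using LIMSEQ_subseq_LIMSEQ[OF BD \<nu>(1)] by (simp add: comp_def)
  ultimately have Du: "D u = 0" using LIMSEQ_unique by blast
  have DA: "D (A v) = A v" for v
  proof -
    have "((\<lambda>x. \<rho> (\<alpha> 0 x)) has_derivative (\<lambda>v. D (A v))) (at 0)"
      by (rule has_derivative_compose[OF A(2)]) (simp add: \<alpha>_zero D(2))
    then have "(\<alpha> 0 has_derivative (\<lambda>v. D (A v))) (at 0)"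
      by (rule has_derivative_transform_within_open[OF _ S_open S_zero]) (simp add: \<rho>_\<alpha>)
    from has_derivative_unique[OF this A(2)] show ?thesis by metis
  qed
  text \<open>Adding to \<open>A\<close> a map onto the line spanned by \<open>u\<close> makes it injective, hence surjective;
    this replaces a count of dimensions.\<close>
  define l where "l x = cfun u0 x / complex_of_real ((norm u0)\<^sup>2)" for x
  have l: "clinear l" "l u0 = 1"
    using clinear_cfun[of u0] u0(1)
    by (auto simp: l_def clinear_iff scaleC_complex_def add_divide_distrib cfun_self)
  have linM: "clinear (\<lambda>x. A x + l x *\<^sub>C u)"
    by (intro clinear_plus A(1) clinear_compose[OF clinear_scaleC_left l(1)])
  have "inj (\<lambda>x. A x + l x *\<^sub>C u)"
    unfolding clinear_inj_iff[OF linM]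
  proof (intro allI impI)
    fix x assume x: "A x + l x *\<^sub>C u = 0"
    then have "D (A x + l x *\<^sub>C u) = 0" by (simp add: clinear_zero[OF D(1)])
    then have Ax: "A x = 0" by (simp add: clinear_add[OF D(1)] clinear_scaleC[OF D(1)] DA Du)
    then obtain c where c: "x = c *\<^sub>C u0" using u0(2) by blast
    have "l x *\<^sub>C u = 0" using x Ax by simp
    then have "cmod (l x) * norm u = 0" by (metis norm_scaleC norm_zero)
    then have "l x = 0" using u by simp
    then have "c = 0" using c l by (simp add: clinear_scaleC[OF l(1)] scaleC_complex_def)
    then show "x = 0" using c by simp
  qed
  then have surj: "surj (\<lambda>x. A x + l x *\<^sub>C u)"
    using linear_injective_imp_surjective[OF clinear_imp_linear[OF linM]] by blast
  show thesis
  proof (rule that[of u])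
    show "u \<noteq> 0" using u by auto
    show "D v = 0 \<longleftrightarrow> (\<exists>c. v = c *\<^sub>C u)" for v
    proof
      assume Dv: "D v = 0"
      have "v \<in> range (\<lambda>x. A x + l x *\<^sub>C u)" unfolding surj by blast
      then obtain x where x: "v = A x + l x *\<^sub>C u" by blast
      then have "D v = A x" by (simp add: clinear_add[OF D(1)] clinear_scaleC[OF D(1)] DA Du)
      then have "v = l x *\<^sub>C u" using x Dv by simp
      then show "\<exists>c. v = c *\<^sub>C u" by blast
    qed (auto simp: clinear_scaleC[OF D(1)] Du)
  qed
qed

lemma corank_one_limit:
  assumes A: "clinear A" "(\<alpha> 0 has_derivative A) (at 0)"
    and u0: "u0 \<noteq> 0" "\<And>v. A v = 0 \<longleftrightarrow> (\<exists>c. v = c *\<^sub>C u0)"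
  obtains e :: "complex ^ 'm \<Rightarrow> complex \<times> (complex ^ 'm)" and \<pi> and \<beta> :: "nat \<Rightarrow> _ \<Rightarrow> complex \<times> (complex ^ 'm)"
  where "clinear e" "clinear \<pi>" "\<And>y. \<pi> (e y) = y" "\<And>x. mnorm (e (\<pi> x)) \<le> mnorm x"
    "\<And>j x. x \<in> S \<Longrightarrow> immersive (\<beta> j) x" "\<And>j. inj_on (\<beta> j) S"
    "\<And>j k x. j \<le> k \<Longrightarrow> x \<in> S \<Longrightarrow> \<beta> k (f j k x) = \<beta> j x"
    "\<And>j x. x \<in> S \<Longrightarrow> mnorm (e (snd (\<beta> j x))) < 1"
    "\<And>z. mnorm (e (snd z)) < 1 \<Longrightarrow> \<exists>j. z \<in> \<beta> j ` S"
proof -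
  obtain D where D: "clinear D" "(\<rho> has_derivative D) (at 0)"
    using \<rho>_hol S_zero by (auto simp: hol_def elim: cdiff_at_E)
  obtain u where u: "u \<noteq> 0" "\<And>v. D v = 0 \<longleftrightarrow> (\<exists>c. v = c *\<^sub>C u)"
    by (rule limit_derivative_kernel[OF A u0 D]) (rule that)
  have DD: "D (D v) = D v" for v
  proof -
    have "((\<lambda>x. \<rho> (\<rho> x)) has_derivative (\<lambda>v. D (D v))) (at 0)"
      by (rule has_derivative_compose[OF D(2)]) (simp add: \<rho>_zero D(2))
    then have "(\<rho> has_derivative (\<lambda>v. D (D v))) (at 0)"
      by (rule has_derivative_transform_within_open[OF _ S_open S_zero]) (simp add: \<rho>_\<rho>)
    from has_derivative_unique[OF this D(2)] show ?thesis by metis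
  qed
  have D_le: "mnorm (D v) \<le> mnorm v" for v
  proof (rule schwarz_mnorm(2)[OF _ \<rho>_zero _ D])
    show "hol \<rho> {x. mnorm x < 1}" using \<rho>_hol by (simp add: S_def)
    show "mnorm (\<rho> x) < 1" if "mnorm x < 1" for x using \<rho>_in[of x] that by (simp add: S_def)
  qed
  obtain e \<pi> \<tau> where e: "clinear e" and \<pi>: "clinear \<pi>" and \<tau>: "clinear \<tau>"
    and e\<pi>: "\<And>x. e (\<pi> x) = D x" and \<pi>e: "\<And>y :: complex ^ 'm. \<pi> (e y) = y" and \<tau>u: "\<tau> u = 1"
    and \<pi>u: "\<pi> u = 0" and \<tau>e: "\<And>y. \<tau> (e y) = 0" and split: "\<And>x. x = e (\<pi> x) + \<tau> x *\<^sub>C u"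
    by (rule projection_coordinates[OF D(1) DD u]) (rule that)
  define N where "N y = mnorm (e y)" for y
  define Y where "Y = {y. N y < 1}"
  have N: "cnorm N"
    unfolding cnorm_def N_def
  proof (intro conjI allI impI)
    fix x y :: "complex ^ 'm" and c
    show "mnorm (e (x + y)) \<le> mnorm (e x) + mnorm (e y)"
      unfolding clinear_add[OF e] by (rule cnorm_triangle[OF cnorm_mnorm])
    show "mnorm (e (c *\<^sub>C x)) = cmod c * mnorm (e x)"
      unfolding clinear_scaleC[OF e] by (rule cnorm_scaleC[OF cnorm_mnorm])
    show "0 < mnorm (e x)" if "x \<noteq> 0"
    proof (rule cnorm_pos[OF cnorm_mnorm])
      show "e x \<noteq> 0" using \<pi>e[of x] that clinear_zero[OF \<pi>] by auto
    qed
  qed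
  have Y: "open Y" "convex Y" "0 \<in> Y"
    unfolding Y_def using cnorm_open[OF N] cnorm_convex[OF N] cnorm_zero[OF N] by auto
  have N_\<pi>: "N (\<pi> x) \<le> mnorm x" for x using D_le[of x] by (simp add: N_def e\<pi>)
  have \<pi>S: "\<pi> x \<in> Y" if "x \<in> S" for x using N_\<pi>[of x] that by (simp add: Y_def S_def)
  have eY: "e y \<in> S" if "y \<in> Y" for y using that by (simp add: Y_def S_def N_def)
  \<comment> \<open>Compares the image of \<open>\<rho>\<close> with the linear slice to which it is
    tangent: pushed to that image by \<open>\<rho>\<close> and projected back, the slice undergoes a
    self map tangent to the identity.\<close>
  define \<phi> where "\<phi> y = \<pi> (\<rho> (e y))" for y
  have \<rho>e_hol: "hol (\<lambda>y. \<rho> (e y)) Y" by (rule hol_compose[OF hol_clinear[OF e] \<rho>_hol]) (use eY in blast)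
  have \<phi>_hol: "hol \<phi> Y" unfolding \<phi>_def
    by (rule hol_compose[OF \<rho>e_hol hol_clinear[OF \<pi>, where S = UNIV]]) simp
  have \<phi>_le: "N (\<phi> y) \<le> N y" if "N y < 1" for y
    using order_trans[OF N_\<pi> \<rho>_le[OF eY]] that by (simp add: \<phi>_def Y_def) (simp add: N_def)
  have \<phi>_der: "(\<phi> has_derivative (\<lambda>v. v)) (at 0)"
  proof -
    have e0: "(e has_derivative e) (at 0)" and \<pi>0: "(\<pi> has_derivative \<pi>) (at x)" for x
      by (rule bounded_linear_imp_has_derivative clinear_imp_bounded_linear e \<pi>)+
    have "((\<lambda>y. \<rho> (e y)) has_derivative (\<lambda>v. D (e v))) (at 0)"
      by (rule has_derivative_compose[OF e0]) (simp add: clinear_zero[OF e] D(2))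
    from has_derivative_compose[OF this \<pi>0] show ?thesis
      by (simp add: \<phi>_def[abs_def] e\<pi>[symmetric] \<pi>e)
  qed
  obtain \<psi> where \<psi>: "hol \<psi> Y" "\<And>y. N y < 1 \<Longrightarrow> N (\<psi> y) \<le> N y"
    "\<And>y. N y < 1 \<Longrightarrow> \<phi> (\<psi> y) = y" "\<And>y. N y < 1 \<Longrightarrow> \<psi> (\<phi> y) = y"
  proof (rule tangent_to_identity_invertible[OF N _ _ \<phi>_der])
    show "hol \<phi> {x. N x < 1}" using \<phi>_hol by (simp add: Y_def)
    show "N (\<phi> x) \<le> N x" if "N x < 1" for x by (rule \<phi>_le[OF that])
    fix \<psi> assume "hol \<psi> {x. N x < 1}" "\<And>x. N x < 1 \<Longrightarrow> N (\<psi> x) \<le> N x"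
      "\<And>x. N x < 1 \<Longrightarrow> \<phi> (\<psi> x) = x" "\<And>x. N x < 1 \<Longrightarrow> \<psi> (\<phi> x) = x"
    then show thesis by (intro that[of \<psi>]) (simp_all add: Y_def)
  qed
  have \<psi>Y: "\<psi> y \<in> Y" if "y \<in> Y" for y using \<psi>(2)[of y] that by (simp add: Y_def)
  have \<psi>0: "\<psi> 0 = 0"
    using \<psi>(2)[of 0] cnorm_zero[OF N] cnorm_pos[OF N, of "\<psi> 0"] by fastforce
  \<comment> \<open>The reparametrisation by the inverse of \<open>\<phi>\<close> yields a section
    of \<open>\<pi>\<close> whose values are fixed by \<open>\<rho>\<close>, that is, a
    graph.\<close>
  define \<sigma> where "\<sigma> y = \<rho> (e (\<psi> y))" for y
  have \<sigma>_hol: "hol \<sigma> Y" unfolding \<sigma>_def by (rule hol_compose[OF \<psi>(1) \<rho>e_hol]) (use \<psi>Y in blast)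
  have \<sigma>S: "\<sigma> y \<in> S" if "y \<in> Y" for y unfolding \<sigma>_def by (intro \<rho>_in eY \<psi>Y that)
  have \<pi>\<sigma>: "\<pi> (\<sigma> y) = y" if "y \<in> Y" for y using \<psi>(3)[of y] that by (simp add: \<sigma>_def \<phi>_def Y_def)
  have \<rho>\<sigma>: "\<rho> (\<sigma> y) = \<sigma> y" if "y \<in> Y" for y unfolding \<sigma>_def by (intro \<rho>_\<rho> eY \<psi>Y that)
  define \<kappa> where "\<kappa> x = \<sigma> (\<pi> (\<rho> x))" for x
  have \<pi>\<rho>_hol: "hol (\<lambda>x. \<pi> (\<rho> x)) S"
    by (rule hol_compose[OF \<rho>_hol hol_clinear[OF \<pi>, where S = UNIV]]) simp
  have \<pi>\<rho>Y: "\<pi> (\<rho> x) \<in> Y" if "x \<in> S" for x by (intro \<pi>S \<rho>_in that)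
  have \<kappa>_hol: "hol \<kappa> S" unfolding \<kappa>_def by (rule hol_compose[OF \<pi>\<rho>_hol \<sigma>_hol]) (use \<pi>\<rho>Y in blast)
  have \<kappa>S: "\<kappa> x \<in> S" if "x \<in> S" for x unfolding \<kappa>_def by (intro \<sigma>S \<pi>\<rho>Y that)
  have \<kappa>0: "\<kappa> 0 = 0" by (simp add: \<kappa>_def \<sigma>_def \<rho>_zero clinear_zero[OF \<pi>] clinear_zero[OF e] \<psi>0)
  text \<open>\<open>\<rho>\<close> and \<open>\<kappa>\<close> are retractions onto submanifolds which are tangent at \<open>0\<close>; near \<open>0\<close> both are
    determined by \<open>\<pi> \<circ> \<rho>\<close> because of the following local coordinates.\<close>
  define T where "T x = D (\<rho> x) + ((x - \<rho> x) - D (x - \<rho> x))" for x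
  have x\<rho>: "complex_differentiable_at (\<lambda>x. x - \<rho> x) x" if "x \<in> S" for x
    by (intro cdiff_at_diff cdiff_at_ident holD[OF \<rho>_hol that])
  have T_hol: "hol T S"
    unfolding T_def hol_def
    by (intro ballI cdiff_at_add cdiff_at_diff cdiff_at_compose[OF holD[OF \<rho>_hol] cdiff_at_clinear[OF D(1)]]
        cdiff_at_compose[OF x\<rho> cdiff_at_clinear[OF D(1)]] cdiff_at_ident holD[OF \<rho>_hol])
  have T0: "T 0 = 0" by (simp add: T_def \<rho>_zero clinear_zero[OF D(1)])
  have T_der: "(T has_derivative (\<lambda>v. v)) (at 0)"
  proof -
    have Dx: "(D has_derivative D) (at x)" for x
      by (rule bounded_linear_imp_has_derivative[OF clinear_imp_bounded_linear[OF D(1)]])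
    have 1: "((\<lambda>x. x - \<rho> x) has_derivative (\<lambda>v. v - D v)) (at 0)"
      by (intro has_derivative_diff has_derivative_ident D(2))
    have "(T has_derivative (\<lambda>v. D (D v) + ((v - D v) - D (v - D v)))) (at 0)"
      unfolding T_def
      by (intro has_derivative_add has_derivative_diff has_derivative_compose[OF D(2) Dx]
          has_derivative_compose[OF 1 Dx] has_derivative_ident D(2))
    then show ?thesis by (simp add: DD clinear_diff[OF D(1)])
  qed
  obtain R where R: "R > 0" "ball 0 R \<subseteq> S" using S_open S_zero by (meson openE)
  obtain r where r: "0 < r" "r \<le> R" "inj_on T (ball 0 r)"
    by (rule near_zero_diffeo[OF hol_subset[OF T_hol R(2)] R(1) T0 T_der])
  define V where "V = {x \<in> S. \<rho> x \<in> ball 0 r} \<inter> {x \<in> S. \<kappa> x \<in> ball 0 r}"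
  have V: "open V" unfolding V_def
    by (intro open_Int open_vimage_on S_open open_ball hol_continuous \<rho>_hol \<kappa>_hol)
  have "0 \<in> V" using r by (simp add: V_def S_zero \<rho>_zero \<kappa>0)
  have T\<rho>: "T (\<rho> x) = D (\<rho> x)" if "x \<in> S" for x
    by (simp add: T_def \<rho>_\<rho>[OF that] clinear_zero[OF D(1)])
  have T\<kappa>: "T (\<kappa> x) = D (\<rho> x)" if x: "x \<in> S" for x
  proof -
    have "\<rho> (\<kappa> x) = \<kappa> x" unfolding \<kappa>_def by (rule \<rho>\<sigma>[OF \<pi>\<rho>Y[OF x]])
    then have "T (\<kappa> x) = D (\<kappa> x)" by (simp add: T_def clinear_zero[OF D(1)])
    also have "\<dots> = e (\<pi> (\<kappa> x))" by (simp add: e\<pi>)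
    also have "\<pi> (\<kappa> x) = \<pi> (\<rho> x)" unfolding \<kappa>_def by (rule \<pi>\<sigma>[OF \<pi>\<rho>Y[OF x]])
    finally show ?thesis by (simp add: e\<pi>)
  qed
  \<comment> \<open>\<open>T\<close> sends a fixed point of \<open>\<rho>\<close> to its image under
    \<open>D\<close>; both \<open>\<rho> x\<close> and \<open>\<kappa> x\<close> are fixed points,
    with the same image, and \<open>T\<close> is injective near \<open>0\<close>.\<close>
  have on_V: "\<rho> x = \<kappa> x" if "x \<in> V" for x
  proof (rule inj_onD[OF r(3)])
    have "x \<in> S" using that by (simp add: V_def)
    then show "T (\<rho> x) = T (\<kappa> x)" by (simp only: T\<rho> T\<kappa>)
  qed (use that in \<open>simp_all add: V_def\<close>)
  have "V \<noteq> {}" "V \<subseteq> S" using \<open>0 \<in> V\<close> unfolding V_def by blast+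
  from hol_identity[OF S_open S_convex \<rho>_hol \<kappa>_hol V this on_V]
  have \<rho>\<kappa>: "\<rho> x = \<sigma> (\<pi> (\<rho> x))" if "x \<in> S" for x using that unfolding \<kappa>_def by blast
  have \<alpha>\<sigma>: "\<alpha> j x = \<sigma> (\<pi> (\<alpha> j x))" if "x \<in> S" for j x
    using \<rho>\<kappa>[OF \<alpha>_in[OF that], of j] \<rho>_\<alpha>[OF that, of j] by simp
  define s where "s y = \<tau> (\<sigma> y)" for y
  have s_hol: "hol s Y" unfolding s_def
    by (rule hol_compose[OF \<sigma>_hol hol_clinear[OF \<tau>, where S = UNIV]]) simp
  \<comment> \<open>A shear along \<open>u\<close> that moves the image of \<open>\<rho>\<close>,
    where the coordinate \<open>\<tau>\<close> equals \<open>s\<close>, to the hyperplane with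
    vanishing first coordinate.\<close>
  define \<Theta> where "\<Theta> x = (\<tau> x - s (\<pi> x), \<pi> x)" for x
  define \<Theta>' where "\<Theta>' z = e (snd z) + (fst z + s (snd z)) *\<^sub>C u" for z
  have \<Theta>'\<Theta>: "\<Theta>' (\<Theta> x) = x" for x using split[of x] by (simp add: \<Theta>_def \<Theta>'_def)
  have \<Theta>\<Theta>': "\<Theta> (\<Theta>' z) = z" for z
    by (simp add: \<Theta>_def \<Theta>'_def clinear_add[OF \<pi>] clinear_add[OF \<tau>] clinear_scaleC[OF \<pi>]
        clinear_scaleC[OF \<tau>] \<pi>e \<tau>e \<pi>u \<tau>u scaleC_complex_def)
  have s\<pi>: "complex_differentiable_at (\<lambda>x. s (\<pi> x)) x" if "\<pi> x \<in> Y" for x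
    by (rule cdiff_at_compose[OF cdiff_at_clinear[OF \<pi>] holD[OF s_hol that]])
  have \<Theta>_cd: "complex_differentiable_at \<Theta> x" if "\<pi> x \<in> Y" for x
    unfolding \<Theta>_def[abs_def] by (intro cdiff_at_Pair cdiff_at_diff cdiff_at_clinear \<tau> \<pi> s\<pi> that)
  have ssnd: "complex_differentiable_at (\<lambda>z. s (snd z)) z" if "snd z \<in> Y" for z :: "complex \<times> (complex ^ 'm)"
    by (rule cdiff_at_compose[OF cdiff_at_clinear[OF clinear_snd] holD[OF s_hol that]])
  have \<Theta>'_cd: "complex_differentiable_at \<Theta>' z" if "snd z \<in> Y" for z
    unfolding \<Theta>'_def[abs_def]
    by (intro cdiff_at_add cdiff_at_scaleC cdiff_at_const ssnd that cdiff_at_clinear clinear_fst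
        clinear_compose[OF e clinear_snd])
  have snd\<Theta>: "snd (\<Theta> x) = \<pi> x" for x by (simp add: \<Theta>_def)
  have \<Theta>_imm: "immersive \<Theta> x" if "\<pi> x \<in> Y" for x
    by (rule immersive_left_inverse[OF \<Theta>_cd[OF that] \<Theta>'_cd open_UNIV]) (use that \<Theta>'\<Theta> snd\<Theta> in auto)
  have \<pi>\<Theta>': "\<pi> (\<Theta>' z) = snd z" for z using \<Theta>\<Theta>'[of z] snd\<Theta>[of "\<Theta>' z"] by simp
  have \<Theta>'_imm: "immersive \<Theta>' z" if "snd z \<in> Y" for z
    by (rule immersive_left_inverse[OF \<Theta>'_cd[OF that] \<Theta>_cd open_UNIV]) (use that \<Theta>\<Theta>' \<pi>\<Theta>' in auto)
  define X where "X = {z. snd z \<in> Y \<and> \<Theta>' z \<in> S}"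
  have X\<Theta>: "\<Theta> x \<in> X" if "x \<in> S" for x using that \<pi>S[OF that] by (simp add: X_def \<Theta>'\<Theta> snd\<Theta>)
  have XD: "snd z \<in> Y" "\<Theta>' z \<in> S" if "z \<in> X" for z using that by (auto simp: X_def)
  have YU: "open {z :: complex \<times> (complex ^ 'm). snd z \<in> Y}"
    using open_vimage_snd[OF Y(1)] by (simp add: vimage_def)
  have "hol \<Theta>' {z. snd z \<in> Y}" using \<Theta>'_cd unfolding hol_def by blast
  from open_vimage_on[OF YU hol_continuous[OF this] S_open]
  have oX: "open X" unfolding X_def mem_Collect_eq .
  have \<Theta>'_holX: "hol \<Theta>' X" using \<Theta>'_cd XD unfolding hol_def by blast
  have \<Theta>_holS: "hol \<Theta> S" using \<Theta>_cd \<pi>S unfolding hol_def by blast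
  have \<alpha>\<Theta>_hol: "hol (\<lambda>z. \<alpha> j (\<Theta>' z)) X" for j by (rule hol_compose[OF \<Theta>'_holX \<alpha>_hol]) (use XD in blast)
  have \<Theta>\<alpha>: "\<Theta> (\<alpha> j x) = (0, \<pi> (\<alpha> j x))" if "x \<in> S" for j x
    using \<alpha>\<sigma>[OF that, of j] by (simp add: \<Theta>_def s_def)
  interpret st: straight_tower N X "\<lambda>j k z. \<Theta> (f j k (\<Theta>' z))" "\<lambda>j z. \<pi> (\<alpha> j (\<Theta>' z))" "\<lambda>z. \<pi> (\<rho> (\<Theta>' z))"
  proof unfold_locales
    show "cnorm N" by (rule N)
    show "open X" by (rule oX)
    have \<Theta>'0: "\<Theta>' (0, y) = \<sigma> y" if "y \<in> Y" for y
      using split[of "\<sigma> y"] \<pi>\<sigma>[OF that] by (simp add: \<Theta>'_def s_def)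
    show "(0, y) \<in> X" if "N y < 1" for y
    proof -
      have y: "y \<in> Y" using that by (simp add: Y_def)
      show ?thesis using \<sigma>S[OF y] y by (simp add: X_def \<Theta>'0[OF y])
    qed
    show "\<pi> (\<rho> (\<Theta>' (0, y))) = y" if "N y < 1" for y
    proof -
      have y: "y \<in> Y" using that by (simp add: Y_def)
      show ?thesis using \<rho>\<sigma>[OF y] \<pi>\<sigma>[OF y] by (simp add: \<Theta>'0[OF y])
    qed
    fix j
    show "luc (\<lambda>k z. \<Theta> (f j k (\<Theta>' z))) (\<lambda>z. (0, \<pi> (\<alpha> j (\<Theta>' z)))) X"
    proof -
      have "luc (\<lambda>k z. f j k (\<Theta>' z)) (\<lambda>z. \<alpha> j (\<Theta>' z)) X"
        by (rule luc_pre[OF hol_continuous[OF \<Theta>'_holX] _ f_lim]) (use XD in blast)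
      from luc_post[OF this hol_continuous[OF \<alpha>\<Theta>_hol] _ S_open hol_continuous[OF \<Theta>_holS]]
      have "luc (\<lambda>k z. \<Theta> (f j k (\<Theta>' z))) (\<lambda>z. \<Theta> (\<alpha> j (\<Theta>' z))) X" using \<alpha>_in XD by blast
      moreover have "\<Theta> (\<alpha> j (\<Theta>' z)) = (0, \<pi> (\<alpha> j (\<Theta>' z)))" if "z \<in> X" for z
        by (rule \<Theta>\<alpha>[OF XD(2)[OF that]])
      ultimately show ?thesis by (rule luc_cong)
    qed
    show "hol (\<lambda>z. \<pi> (\<alpha> j (\<Theta>' z))) X"
      by (rule hol_compose[OF \<alpha>\<Theta>_hol hol_clinear[OF \<pi>, where S = UNIV]]) simp
    show "N (\<pi> (\<alpha> j (\<Theta>' z))) < 1" if "z \<in> X" for z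
      using \<pi>S[OF \<alpha>_in[OF XD(2)[OF that]]] by (simp add: Y_def)
  next
    show "luc (\<lambda>j z. \<pi> (\<alpha> j (\<Theta>' z))) (\<lambda>z. \<pi> (\<rho> (\<Theta>' z))) X"
    proof (rule luc_pre[OF hol_continuous[OF \<Theta>'_holX], where T = S])
      show "luc (\<lambda>j x. \<pi> (\<alpha> j x)) (\<lambda>x. \<pi> (\<rho> x)) S"
        by (rule luc_post[OF \<alpha>_lim hol_continuous[OF \<rho>_hol] _ open_UNIV hol_continuous[OF hol_clinear[OF \<pi>]]]) simp
    qed (use XD in blast)
    fix j k :: nat and z assume jk: "j \<le> k"
    show "\<Theta> (f j k (\<Theta>' z)) \<in> X" if "z \<in> X" using X\<Theta>[OF f_in[OF jk XD(2)[OF that]]] .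
    show "immersive (\<lambda>z. \<Theta> (f j k (\<Theta>' z))) z" if z: "z \<in> X"
    proof -
      have "immersive (\<lambda>z. f j k (\<Theta>' z)) z"
        by (rule immersive_compose[OF \<Theta>'_imm[OF XD(1)[OF z]] f_imm[OF jk XD(2)[OF z]]])
      from immersive_compose[OF this \<Theta>_imm] show ?thesis using \<pi>S[OF f_in[OF jk XD(2)[OF z]]] by blast
    qed
    show "inj_on (\<lambda>z. \<Theta> (f j k (\<Theta>' z))) X"
    proof (rule inj_onI)
      fix x y assume xy: "x \<in> X" "y \<in> X" "\<Theta> (f j k (\<Theta>' x)) = \<Theta> (f j k (\<Theta>' y))"
      then have "f j k (\<Theta>' x) = f j k (\<Theta>' y)" by (metis \<Theta>'\<Theta>)
      then have "\<Theta>' x = \<Theta>' y" using inj_onD[OF f_inj[OF jk]] XD xy by blast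
      then show "x = y" by (metis \<Theta>\<Theta>')
    qed
    show "\<Theta> (f k l (\<Theta>' (\<Theta> (f j k (\<Theta>' z))))) = \<Theta> (f j l (\<Theta>' z))" if "k \<le> l" "z \<in> X" for l
      by (simp add: \<Theta>'\<Theta> f_comp[OF jk that(1) XD(2)[OF that(2)]])
    show "\<pi> (\<alpha> k (\<Theta>' (\<Theta> (f j k (\<Theta>' z))))) = \<pi> (\<alpha> j (\<Theta>' z))" if "z \<in> X"
      by (simp add: \<Theta>'\<Theta> \<alpha>_f[OF jk XD(2)[OF that]])
  qed
  obtain T' :: "nat \<Rightarrow> complex \<times> (complex ^ 'm) \<Rightarrow> complex" where
    T': "\<And>j k x. j \<le> k \<Longrightarrow> x \<in> X \<Longrightarrow> T' k (\<Theta> (f j k (\<Theta>' x))) = T' j x"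
    "\<And>j x x'. x \<in> X \<Longrightarrow> x' \<in> X \<Longrightarrow> \<pi> (\<alpha> j (\<Theta>' x)) = \<pi> (\<alpha> j (\<Theta>' x')) \<Longrightarrow> T' j x = T' j x' \<Longrightarrow> x = x'"
    "\<And>y \<xi>. N y < 1 \<Longrightarrow> \<exists>j x. x \<in> X \<and> \<pi> (\<alpha> j (\<Theta>' x)) = y \<and> T' j x = \<xi>"
    "\<And>j x. x \<in> X \<Longrightarrow> immersive (\<lambda>x. (T' j x, \<pi> (\<alpha> j (\<Theta>' x)))) x"
    by (rule st.global_trivialization) (rule that)
  define \<beta> where "\<beta> j x = (T' j (\<Theta> x), \<pi> (\<alpha> j x))" for j x
  show thesis
  proof (rule that[of e \<pi> \<beta>])
    show "mnorm (e (\<pi> x)) \<le> mnorm x" for x by (simp add: e\<pi> D_le)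
    show "immersive (\<beta> j) x" if x: "x \<in> S" for j x
      using immersive_compose[OF \<Theta>_imm[OF \<pi>S[OF x]] T'(4)[OF X\<Theta>[OF x], of j]]
      by (simp add: \<beta>_def[abs_def] \<Theta>'\<Theta>)
    show "inj_on (\<beta> j) S" for j
    proof (rule inj_onI)
      fix x y assume xy: "x \<in> S" "y \<in> S" "\<beta> j x = \<beta> j y"
      then have "\<Theta> x = \<Theta> y" by (intro T'(2)[of _ _ j] X\<Theta>) (auto simp: \<beta>_def \<Theta>'\<Theta>)
      then show "x = y" by (metis \<Theta>'\<Theta>)
    qed
    show "\<beta> k (f j k x) = \<beta> j x" if "j \<le> k" "x \<in> S" for j k x
      using T'(1)[OF that(1) X\<Theta>[OF that(2)]] \<alpha>_f[OF that] by (simp add: \<beta>_def \<Theta>'\<Theta>)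
    show "mnorm (e (snd (\<beta> j x))) < 1" if "x \<in> S" for j x
      using \<pi>S[OF \<alpha>_in[OF that, of j]] by (simp add: \<beta>_def Y_def N_def)
    show "\<exists>j. z \<in> \<beta> j ` S" if "mnorm (e (snd z)) < 1" for z
    proof -
      obtain j x where x: "x \<in> X" "\<pi> (\<alpha> j (\<Theta>' x)) = snd z" "T' j x = fst z"
        using T'(3)[of "snd z" "fst z", unfolded N_def, OF \<open>mnorm (e (snd z)) < 1\<close>] by blast
      have "\<beta> j (\<Theta>' x) = z" using x by (simp add: \<beta>_def \<Theta>\<Theta>')
      then show ?thesis using XD(2)[OF x(1)] by blast
    qed
  qed (rule e \<pi> \<pi>e)+
qed

end

section \<open>Exhausted manifolds\<close>

locale exhausted_manifold =
  fixes M :: "('a, complex \<times> (complex ^ 'm)) cmanifold" and Mseq :: "nat \<Rightarrow> 'a set"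
    and F :: "nat \<Rightarrow> 'a \<Rightarrow> complex \<times> (complex ^ 'm)" and G :: "nat \<Rightarrow> complex \<times> (complex ^ 'm) \<Rightarrow> 'a"
    and S :: "(complex \<times> (complex ^ 'm)) set"
  defines "S \<equiv> {x. mnorm x < 1}"
  assumes M: "complex_manifold M"
    and Mo: "\<And>j. openin (mtop M) (Mseq j)"
    and Minc: "\<And>j k. j \<le> k \<Longrightarrow> Mseq j \<subseteq> Mseq k"
    and Mun: "(\<Union>j. Mseq j) = topspace (mtop M)"
    and F_from: "\<And>j. holo_from (open_submanifold M (Mseq j)) (F j)"
    and G_into: "\<And>j. holo_into S (open_submanifold M (Mseq j)) (G j)"
    and F_S: "\<And>j q. q \<in> Mseq j \<Longrightarrow> F j q \<in> S"
    and GF: "\<And>j q. q \<in> Mseq j \<Longrightarrow> G j (F j q) = q"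
    and FG: "\<And>j x. x \<in> S \<Longrightarrow> F j (G j x) = x"
begin

lemma S_open: "open S"
  unfolding S_def by (rule cnorm_open[OF cnorm_mnorm])

lemma G_cont: "continuous_map (top_of_set S) (subtopology (mtop M) (Mseq j)) (G j)"
  using G_into[of j] by (simp add: holo_into_def open_submanifold_def)

lemma G_in: "x \<in> S \<Longrightarrow> G j x \<in> Mseq j"
  using continuous_map_image_subset_topspace[OF G_cont[of j]] by auto

lemma G_vimage_open: "openin (mtop M) V \<Longrightarrow> open {x \<in> S. G j x \<in> V}"
proof -
  assume V: "openin (mtop M) V"
  have "openin (subtopology (mtop M) (Mseq j)) (V \<inter> Mseq j)"
    by (metis V openin_subtopology_Int)
  from openin_continuous_map_preimage[OF G_cont this]
  have "openin (top_of_set S) {x \<in> S. G j x \<in> V \<inter> Mseq j}" by simp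
  moreover have "{x \<in> S. G j x \<in> V \<inter> Mseq j} = {x \<in> S. G j x \<in> V}" using G_in by blast
  ultimately show ?thesis using S_open openin_open_eq by auto
qed

lemma chart:
  assumes "(U, \<phi>) \<in> atlas M"
  shows "openin (mtop M) U" "inj_on \<phi> U" "V \<subseteq> U \<Longrightarrow> openin (mtop M) V \<Longrightarrow> open (\<phi> ` V)"
proof -
  have c: "is_cchart (mtop M) (U, \<phi>)" using M assms unfolding complex_manifold_def by blast
  then have U: "openin (mtop M) U" "open (\<phi> ` U)"
    and h: "homeomorphic_map (subtopology (mtop M) U) (top_of_set (\<phi> ` U)) \<phi>"
    by (auto simp: is_cchart_def)
  show "openin (mtop M) U" by (rule U)
  have ts: "topspace (subtopology (mtop M) U) = U" using openin_subset[OF U(1)] by auto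
  show "inj_on \<phi> U" using h ts by (auto simp: homeomorphic_eq_everything_map)
  show "open (\<phi> ` V)" if V: "V \<subseteq> U" "openin (mtop M) V"
  proof -
    have "openin (subtopology (mtop M) U) V" using V by (metis inf.absorb_iff2 openin_subtopology_Int2)
    then have "openin (top_of_set (\<phi> ` U)) (\<phi> ` V)"
      using h by (simp add: homeomorphic_eq_everything_map open_map_def)
    then show ?thesis using U(2) openin_open_eq by auto
  qed
qed

lemma chart_at: "q \<in> topspace (mtop M) \<Longrightarrow> \<exists>U \<phi>. (U, \<phi>) \<in> atlas M \<and> q \<in> U"
  using M unfolding complex_manifold_def by blast

lemma G_chart:
  assumes "(U, \<phi>) \<in> atlas M" shows "hol (\<lambda>x. \<phi> (G j x)) {x \<in> S. G j x \<in> U}"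
proof -
  have "holo_on (\<phi> \<circ> G j) {x \<in> S. G j x \<in> U \<inter> Mseq j}"
    using G_into[of j] assms unfolding holo_into_def open_submanifold_def by fastforce
  moreover have "{x \<in> S. G j x \<in> U \<inter> Mseq j} = {x \<in> S. G j x \<in> U}" using G_in by blast
  ultimately show ?thesis
    using holo_on_imp_hol[OF G_vimage_open[OF chart(1)[OF assms]]] by (simp add: comp_def)
qed

lemma F_chart:
  assumes "(U, \<phi>) \<in> atlas M" shows "hol (\<lambda>z. F j (inv_into U \<phi> z)) (\<phi> ` (U \<inter> Mseq j))"
proof -
  have o: "open (\<phi> ` (U \<inter> Mseq j))"
    by (rule chart(3)[OF assms]) (auto intro: openin_Int chart(1)[OF assms] Mo)
  have "holo_on (F j \<circ> inv_into (U \<inter> Mseq j) \<phi>) (\<phi> ` (U \<inter> Mseq j))"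
    using F_from[of j] assms unfolding holo_from_def open_submanifold_def by fastforce
  then have "hol (F j \<circ> inv_into (U \<inter> Mseq j) \<phi>) (\<phi> ` (U \<inter> Mseq j))" by (rule holo_on_imp_hol[OF o])
  then show ?thesis
  proof (rule hol_cong[OF o])
    fix z assume "z \<in> \<phi> ` (U \<inter> Mseq j)"
    then obtain q where q: "q \<in> U" "q \<in> Mseq j" "z = \<phi> q" by blast
    have "inj_on \<phi> (U \<inter> Mseq j)" using chart(2)[OF assms] by (rule inj_on_subset) blast
    then have "inv_into (U \<inter> Mseq j) \<phi> z = q" "inv_into U \<phi> z = q"
      using q chart(2)[OF assms] by (auto simp: inv_into_f_f)
    then show "(F j \<circ> inv_into (U \<inter> Mseq j) \<phi>) z = F j (inv_into U \<phi> z)" by simp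
  qed
qed

lemma transition:
  assumes x: "x \<in> S" "G j x \<in> Mseq k"
  shows "complex_differentiable_at (\<lambda>x. F k (G j x)) x"
proof -
  have "G j x \<in> topspace (mtop M)" using x(2) Mun by blast
  then obtain U \<phi> where c: "(U, \<phi>) \<in> atlas M" "G j x \<in> U" using chart_at by blast
  have 1: "complex_differentiable_at (\<lambda>x. \<phi> (G j x)) x" by (rule holD[OF G_chart[OF c(1)]]) (use x c in simp)
  have 2: "complex_differentiable_at (\<lambda>z. F k (inv_into U \<phi> z)) (\<phi> (G j x))"
    by (rule holD[OF F_chart[OF c(1)]]) (use x c in blast)
  show ?thesis
  proof (rule cdiff_at_transform[OF cdiff_at_compose[OF 1 2] G_vimage_open[OF chart(1)[OF c(1)], of j]])
    show "x \<in> {x \<in> S. G j x \<in> U}" using x c by simp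
    show "F k (inv_into U \<phi> (\<phi> (G j y))) = F k (G j y)" if "y \<in> {x \<in> S. G j x \<in> U}" for y
      using that inv_into_f_f[OF chart(2)[OF c(1)]] by simp
  qed
qed

lemma tr_in: "j \<le> k \<Longrightarrow> x \<in> S \<Longrightarrow> F k (G j x) \<in> S"
  and tr_G: "j \<le> k \<Longrightarrow> x \<in> S \<Longrightarrow> G k (F k (G j x)) = G j x"
  using F_S GF G_in Minc by blast+

lemma tr_immersive:
  assumes jk: "j \<le> k" and x: "x \<in> S"
  shows "immersive (\<lambda>x. F k (G j x)) x"
proof (rule immersive_left_inverse[OF transition transition[of _ k j] S_open x])
  show "G j x \<in> Mseq k" using G_in[OF x] Minc[OF jk] by blast
  show "F k (G j x) \<in> S" by (rule tr_in[OF jk x])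
  show "G k (F k (G j x)) \<in> Mseq j" using tr_G[OF jk x] G_in[OF x] by simp
  show "F j (G k (F k (G j y))) = y" if "y \<in> S" for y using tr_G[OF jk that] FG[OF that] by simp
qed (rule x)

lemma tr_inj: "j \<le> k \<Longrightarrow> inj_on (\<lambda>x. F k (G j x)) S"
  by (rule inj_onI) (metis tr_G FG)

lemma tr_comp: "j \<le> k \<Longrightarrow> k \<le> l \<Longrightarrow> x \<in> S \<Longrightarrow> F l (G k (F k (G j x))) = F l (G j x)"
  by (simp add: tr_G)

section \<open>Holomorphic maps from and into an exhausted manifold\<close>

lemma hol_from_chart:
  assumes "\<And>j. hol (\<lambda>x. \<beta> (G j x)) S" and c: "(U, \<phi>) \<in> atlas M"
  shows "hol (\<lambda>z. \<beta> (inv_into U \<phi> z)) (\<phi> ` U)"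
proof (rule holI)
  fix z assume "z \<in> \<phi> ` U"
  then obtain q where q: "q \<in> U" "z = \<phi> q" by blast
  then have "q \<in> topspace (mtop M)" using openin_subset[OF chart(1)[OF c]] by blast
  then obtain j where j: "q \<in> Mseq j" using Mun by blast
  have o: "open (\<phi> ` (U \<inter> Mseq j))"
    by (rule chart(3)[OF c]) (auto intro: openin_Int chart(1)[OF c] Mo)
  have z: "z \<in> \<phi> ` (U \<inter> Mseq j)" using q j by blast
  have iq: "inv_into U \<phi> (\<phi> q') = q'" if "q' \<in> U" for q' using inv_into_f_f[OF chart(2)[OF c] that] .
  have 1: "complex_differentiable_at (\<lambda>z. F j (inv_into U \<phi> z)) z" by (rule holD[OF F_chart[OF c] z])
  have 2: "complex_differentiable_at (\<lambda>x. \<beta> (G j x)) (F j (inv_into U \<phi> z))"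
    by (rule holD[OF assms(1)]) (simp add: q iq F_S[OF j])
  show "complex_differentiable_at (\<lambda>z. \<beta> (inv_into U \<phi> z)) z"
  proof (rule cdiff_at_transform[OF cdiff_at_compose[OF 1 2] o z])
    fix y assume "y \<in> \<phi> ` (U \<inter> Mseq j)"
    then obtain q' where "q' \<in> U" "q' \<in> Mseq j" "y = \<phi> q'" by blast
    then show "\<beta> (G j (F j (inv_into U \<phi> y))) = \<beta> (inv_into U \<phi> y)" by (simp add: iq GF)
  qed
qed

lemma holo_fromI:
  assumes "\<And>j. hol (\<lambda>x. \<beta> (G j x)) S"
  shows "holo_from M \<beta>"
  unfolding holo_from_def
proof clarify
  fix U \<phi> assume c: "(U, \<phi>) \<in> atlas M"
  have "open (\<phi> ` U)" by (rule chart(3)[OF c order_refl chart(1)[OF c]])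
  then show "holo_on (\<beta> \<circ> inv_into U \<phi>) (\<phi> ` U)"
    using hol_imp_holo_on hol_from_chart[OF assms c] by (simp add: comp_def)
qed

text \<open>\<open>A\<close> may fail to be open. Factoring the map near each point through a chart
  inverse \<open>G j\<close> and a holomorphic \<open>h\<close> on an ambient neighbourhood provides
  the extension that \<open>holo_on\<close> asks for.\<close>

lemma holo_intoI:
  fixes P :: "'f::complex_space \<Rightarrow> 'a" and A :: "'f set"
  assumes loc: "\<And>x. x \<in> A \<Longrightarrow> \<exists>W j h. open W \<and> x \<in> W \<and> hol h W \<and> h ` W \<subseteq> S \<and> (\<forall>y\<in>A \<inter> W. P y = G j (h y))"
  shows "holo_into A M P"
  unfolding holo_into_def
proof (intro conjI)
  have loc2: "\<exists>T. open T \<and> x \<in> T \<and> A \<inter> T \<subseteq> {x \<in> A. P x \<in> V}"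
    if x: "x \<in> A" "P x \<in> V" and V: "openin (mtop M) V" for x V
  proof -
    obtain W j h where W: "open W" "x \<in> W" "hol h W" "h ` W \<subseteq> S" "\<forall>y\<in>A \<inter> W. P y = G j (h y)"
      using loc[OF x(1)] by blast
    have "open {y \<in> W. h y \<in> {z \<in> S. G j z \<in> V}}"
      by (rule open_vimage_on[OF W(1) hol_continuous[OF W(3)] G_vimage_open[OF V]])
    moreover have "x \<in> {y \<in> W. h y \<in> {z \<in> S. G j z \<in> V}}" using W x by force
    moreover have "A \<inter> {y \<in> W. h y \<in> {z \<in> S. G j z \<in> V}} \<subseteq> {x \<in> A. P x \<in> V}" using W(5) by auto
    ultimately show ?thesis by blast
  qed
  show "continuous_map (top_of_set A) (mtop M) P"
    unfolding continuous_map_def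
  proof (intro conjI allI impI)
    show "P \<in> topspace (top_of_set A) \<rightarrow> topspace (mtop M)"
    proof
      fix x assume "x \<in> topspace (top_of_set A)"
      then have x: "x \<in> A" by simp
      obtain W j h where "x \<in> W" "h ` W \<subseteq> S" "\<forall>y\<in>A \<inter> W. P y = G j (h y)" using loc[OF x] by blast
      then have "P x \<in> Mseq j" using G_in x by (metis IntI image_subset_iff)
      then show "P x \<in> topspace (mtop M)" using Mun by blast
    qed
    fix V assume V: "openin (mtop M) V"
    show "openin (top_of_set A) {x \<in> topspace (top_of_set A). P x \<in> V}"
      unfolding openin_subopen[of _ "{x \<in> topspace (top_of_set A). P x \<in> V}"]
    proof
      fix x assume "x \<in> {x \<in> topspace (top_of_set A). P x \<in> V}"
      then have x: "x \<in> A" "P x \<in> V" by auto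
      obtain T where T: "open T" "x \<in> T" "A \<inter> T \<subseteq> {x \<in> A. P x \<in> V}" using loc2[OF x V] by blast
      then have "openin (top_of_set A) (A \<inter> T)" "x \<in> A \<inter> T" using x by auto
      then show "\<exists>T. openin (top_of_set A) T \<and> x \<in> T \<and> T \<subseteq> {x \<in> topspace (top_of_set A). P x \<in> V}"
        using T(3) by (intro exI[of _ "A \<inter> T"]) simp
    qed
  qed
  show "\<forall>(U, \<phi>)\<in>atlas M. holo_on (\<phi> \<circ> P) {x \<in> A. P x \<in> U}"
  proof clarify
    fix U \<phi> assume c: "(U, \<phi>) \<in> atlas M"
    show "holo_on (\<phi> \<circ> P) {x \<in> A. P x \<in> U}"
      unfolding holo_on_def
    proof
      fix x assume "x \<in> {x \<in> A. P x \<in> U}"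
      then have x: "x \<in> A" "P x \<in> U" by auto
      obtain W j h where W: "open W" "x \<in> W" "hol h W" "h ` W \<subseteq> S" "\<forall>y\<in>A \<inter> W. P y = G j (h y)"
        using loc[OF x(1)] by blast
      define W' where "W' = {y \<in> W. h y \<in> {z \<in> S. G j z \<in> U}}"
      have "open W'" unfolding W'_def
        by (rule open_vimage_on[OF W(1) hol_continuous[OF W(3)] G_vimage_open[OF chart(1)[OF c]]])
      moreover have "x \<in> W'" using W x by (force simp: W'_def)
      moreover have "\<forall>y\<in>W'. complex_differentiable_at (\<lambda>y. \<phi> (G j (h y))) y"
      proof
        fix y assume y: "y \<in> W'"
        show "complex_differentiable_at (\<lambda>y. \<phi> (G j (h y))) y"
          by (rule cdiff_at_compose[OF holD[OF W(3)] holD[OF G_chart[OF c]]]) (use y in \<open>auto simp: W'_def\<close>)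
      qed
      moreover have "\<forall>y\<in>{x \<in> A. P x \<in> U} \<inter> W'. \<phi> (G j (h y)) = (\<phi> \<circ> P) y" using W(5) by (auto simp: W'_def)
      ultimately show "\<exists>W h. open W \<and> x \<in> W \<and> (\<forall>y\<in>W. complex_differentiable_at h y) \<and>
        (\<forall>y\<in>{x \<in> A. P x \<in> U} \<inter> W. h y = (\<phi> \<circ> P) y)" by blast
    qed
  qed
qed

lemma disc_into:
  assumes d: "hol d \<Delta>" "d ` \<Delta> \<subseteq> S" shows "holo_into \<Delta> M (\<lambda>t. G j (d t))"
  by (rule holo_intoI) (use d in \<open>auto intro!: exI[of _ "\<Delta>"] exI[of _ j] exI[of _ d]\<close>)

lemma holo_into_compose:
  assumes d: "holo_into \<Delta> M d" and \<beta>: "\<And>j. hol (\<lambda>x. \<beta> (G j x)) S"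
  shows "hol (\<lambda>t. \<beta> (d t)) \<Delta>"
proof (rule holI)
  fix t :: complex assume t: "t \<in> \<Delta>"
  have dc: "continuous_map (top_of_set \<Delta>) (mtop M) d" using d by (simp add: holo_into_def)
  then have "d t \<in> topspace (mtop M)" using t continuous_map_image_subset_topspace by fastforce
  then obtain U \<phi> where c: "(U, \<phi>) \<in> atlas M" "d t \<in> U" using chart_at by blast
  define W where "W = {t \<in> \<Delta>. d t \<in> U}"
  have "openin (top_of_set \<Delta>) W"
    using openin_continuous_map_preimage[OF dc chart(1)[OF c(1)]] by (simp add: W_def)
  then have W: "open W" using openin_open_eq[OF open_ball] by blast
  have "holo_on (\<phi> \<circ> d) W" using d c(1) by (auto simp: holo_into_def W_def)
  then have 1: "hol (\<lambda>t. \<phi> (d t)) W" using holo_on_imp_hol[OF W] by (simp add: comp_def)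
  have tW: "t \<in> W" using t c by (simp add: W_def)
  show "complex_differentiable_at (\<lambda>t. \<beta> (d t)) t"
  proof (rule cdiff_at_transform[OF cdiff_at_compose[OF holD[OF 1 tW] holD[OF hol_from_chart[OF \<beta> c(1)]]] W tW])
    show "\<phi> (d t) \<in> \<phi> ` U" using c by blast
    show "\<beta> (inv_into U \<phi> (\<phi> (d y))) = \<beta> (d y)" if "y \<in> W" for y
      using that inv_into_f_f[OF chart(2)[OF c(1)]] by (simp add: W_def)
  qed
qed

text \<open>Compatibility makes the value independent of the level at which it is computed, so the
  least level containing a point may serve.\<close>

lemma direct_limit_function:
  fixes \<beta> :: "nat \<Rightarrow> complex \<times> (complex ^ 'm) \<Rightarrow> 'b"
  assumes compat: "\<And>j k x. j \<le> k \<Longrightarrow> x \<in> S \<Longrightarrow> \<beta> k (F k (G j x)) = \<beta> j x"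
  obtains b where "\<And>j x. x \<in> S \<Longrightarrow> b (G j x) = \<beta> j x"
proof -
  define J where "J q = (LEAST j. q \<in> Mseq j)" for q
  define b where "b q = \<beta> (J q) (F (J q) q)" for q
  show thesis
  proof (rule that[of b])
    fix j x assume x: "x \<in> S"
    let ?q = "G j x"
    have q: "?q \<in> Mseq j" by (rule G_in[OF x])
    have J: "J ?q \<le> j" "?q \<in> Mseq (J ?q)" unfolding J_def using q by (auto intro: Least_le LeastI)
    have "\<beta> j (F j (G (J ?q) (F (J ?q) ?q))) = b ?q"
      unfolding b_def by (rule compat[OF J(1) F_S[OF J(2)]])
    then show "b ?q = \<beta> j x" by (simp add: GF[OF J(2)] FG[OF x])
  qed
qed

text \<open>The linear embedding \<open>l\<close> may raise the dimension, so \<open>Z\<close> need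
  not be open. Its left inverse \<open>l'\<close> is defined on the whole target space and supplies
  the ambient extension of the inverse map.\<close>

lemma biholomorphic_to_direct_limit:
  fixes \<beta> :: "nat \<Rightarrow> complex \<times> (complex ^ 'm) \<Rightarrow> complex \<times> (complex ^ 'm)"
    and l :: "complex \<times> (complex ^ 'm) \<Rightarrow> 'f::complex_space"
  assumes imm: "\<And>j x. x \<in> S \<Longrightarrow> immersive (\<beta> j) x" and inj: "\<And>j. inj_on (\<beta> j) S"
    and compat: "\<And>j k x. j \<le> k \<Longrightarrow> x \<in> S \<Longrightarrow> \<beta> k (F k (G j x)) = \<beta> j x"
    and l: "clinear l" "clinear l'" "\<And>v. l' (l v) = v" and Z: "Z = l ` (\<Union>j. \<beta> j ` S)"
  shows "biholomorphic_to M Z"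
proof -
  obtain b where b: "\<And>j x. x \<in> S \<Longrightarrow> b (G j x) = \<beta> j x"
    by (rule direct_limit_function[of \<beta>, OF compat]) (assumption+, rule that)
  define J where "J t = (LEAST j. t \<in> \<beta> j ` S)" for t
  define P where "P z = G (J (l' z)) (inv_into S (\<beta> (J (l' z))) (l' z))" for z
  have P: "P z = G j (inv_into S (\<beta> j) (l' z))" if t: "l' z \<in> \<beta> j ` S" for z j
  proof -
    let ?i = "J (l' z)"
    have i: "?i \<le> j" "l' z \<in> \<beta> ?i ` S" unfolding J_def using t by (auto intro: Least_le LeastI)
    define x where "x = inv_into S (\<beta> ?i) (l' z)"
    have x: "x \<in> S" "\<beta> ?i x = l' z" using i(2) by (auto simp: x_def inv_into_into f_inv_into_f)
    have "\<beta> j (F j (G ?i x)) = l' z" using compat[OF i(1) x(1)] x(2) by simp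
    then have "inv_into S (\<beta> j) (l' z) = F j (G ?i x)"
      using inv_into_f_f[OF inj tr_in[OF i(1) x(1)], of j] by simp
    then show ?thesis using tr_G[OF i(1) x(1)] by (simp add: P_def x_def)
  qed
  have holo_l: "hol l A" for A by (rule hol_clinear[OF l(1)])
  have "holo_from M (\<lambda>q. l (b q))"
  proof (rule holo_fromI)
    fix j
    have "hol (\<lambda>x. l (\<beta> j x)) S"
      by (rule hol_compose[OF immersive_hol[OF imm] holo_l[of UNIV]]) auto
    then show "hol (\<lambda>x. l (b (G j x))) S" by (rule hol_cong[OF S_open]) (simp add: b)
  qed
  moreover have "holo_into Z M P"
  proof (rule holo_intoI)
    fix z assume "z \<in> Z"
    then obtain t j where t: "z = l t" "t \<in> \<beta> j ` S" using Z by blast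
    define W where "W = l' -` (\<beta> j ` S)"
    define h where "h z = inv_into S (\<beta> j) (l' z)" for z
    have l'_cont: "continuous_on UNIV l'" by (rule hol_continuous[OF hol_clinear[OF l(2)]])
    have "open W" unfolding W_def by (rule open_vimage[OF immersive_inverse(1)[OF S_open inj imm] l'_cont])
    moreover have "z \<in> W" using t l(3) by (simp add: W_def)
    moreover have "hol h W" unfolding h_def
      by (rule hol_compose[OF hol_clinear[OF l(2)] immersive_hol[OF immersive_inverse(2)[OF S_open inj imm]]])
         (auto simp: W_def)
    moreover have "h ` W \<subseteq> S" using inv_into_into[of _ "\<beta> j" S] unfolding h_def W_def by blast
    moreover have "\<forall>y\<in>Z \<inter> W. P y = G j (h y)" using P unfolding h_def W_def by blast
    ultimately show "\<exists>W j h. open W \<and> z \<in> W \<and> hol h W \<and> h ` W \<subseteq> S \<and> (\<forall>y\<in>Z \<inter> W. P y = G j (h y))"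
      by blast
  qed
  moreover have bq: "b q = \<beta> j (F j q)" "b q \<in> \<beta> j ` S" if "q \<in> Mseq j" for q j
    using b[OF F_S[OF that], of j] GF[OF that] F_S[OF that] by auto
  have "(\<lambda>q. l (b q)) ` topspace (mtop M) \<subseteq> Z"
  proof
    fix z assume "z \<in> (\<lambda>q. l (b q)) ` topspace (mtop M)"
    then obtain q j where q: "z = l (b q)" "q \<in> Mseq j" unfolding Mun[symmetric] by blast
    show "z \<in> Z" unfolding q(1) Z using bq(2)[OF q(2)] by blast
  qed
  moreover have "P (l (b q)) = q" if q: "q \<in> topspace (mtop M)" for q
  proof -
    obtain j where j: "q \<in> Mseq j" using q unfolding Mun[symmetric] by blast
    have "P (l (b q)) = G j (inv_into S (\<beta> j) (b q))"
      by (rule P[of "l (b q)" j, unfolded l(3), OF bq(2)[OF j]])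
    also have "inv_into S (\<beta> j) (b q) = F j q" using inv_into_f_f[OF inj F_S[OF j]] bq(1)[OF j] by simp
    finally show ?thesis by (simp add: GF[OF j])
  qed
  moreover have "l (b (P z)) = z" if "z \<in> Z" for z
  proof -
    obtain j x where x: "z = l (\<beta> j x)" "x \<in> S" using \<open>z \<in> Z\<close> Z by blast
    have "P z = G j x" using P[of z j] x inv_into_f_f[OF inj x(2)] by (simp add: l(3))
    then show ?thesis using x b by simp
  qed
  ultimately show ?thesis unfolding biholomorphic_to_def by blast
qed

text \<open>At a late level \<open>k\<close> the two points differ by a small vector
  \<open>v\<close>. By the Schwarz lemma the first has stayed away from the boundary, so an affine
  disc about it in direction \<open>v\<close> can be stretched by any factor \<open>R\<close> and
  meets the second point at parameter \<open>1 / R\<close>. One disc is a chain, of length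
  \<open>artanh (1 / R)\<close>.\<close>

lemma kobayashi_dist_zero:
  assumes zero: "\<And>j k. j \<le> k \<Longrightarrow> F k (G j 0) = 0"
    and x: "x \<in> S" and y: "y \<in> S" and lim: "(\<lambda>k. F k (G j y) - F k (G j x)) \<longlonglongrightarrow> 0"
  shows "kobayashi_dist M (G j x) (G j y) = 0"
proof -
  have le: "kobayashi_dist M (G j x) (G j y) \<le> ennreal (artanh (1 / (real n + 2)))" for n
  proof -
    define R where "R = real n + 2"
    have R: "R > 1" by (simp add: R_def)
    have r0: "0 < 1 - mnorm x" using x by (simp add: S_def)
    have "(\<lambda>k. mnorm (F k (G j y) - F k (G j x))) \<longlonglongrightarrow> 0" using mnorm_tendsto[OF lim] by simp
    then have "\<forall>\<^sub>F k in sequentially. mnorm (F k (G j y) - F k (G j x)) < (1 - mnorm x) / R"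
      using r0 R by (intro order_tendstoD(2)) auto
    from eventually_conj[OF this eventually_ge_at_top[of j]]
    obtain k where k: "j \<le> k" "mnorm (F k (G j y) - F k (G j x)) < (1 - mnorm x) / R"
      unfolding eventually_sequentially by blast
    define x' where "x' = F k (G j x)"
    define v where "v = F k (G j y) - x'"
    have x'_le: "mnorm x' \<le> mnorm x"
    unfolding x'_def
    proof (rule schwarz_mnorm(1)[of "\<lambda>x. F k (G j x)" x])
      show "hol (\<lambda>x. F k (G j x)) {x. mnorm x < 1}"
        unfolding S_def[symmetric] by (rule immersive_hol) (rule tr_immersive[OF k(1)])
      show "mnorm (F k (G j z)) < 1" if "mnorm z < 1" for z using tr_in[OF k(1), of z] that by (simp add: S_def)
    qed (use zero[OF k(1)] x in \<open>auto simp: S_def\<close>)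
    define d where "d t = x' + t *\<^sub>C (R *\<^sub>R v)" for t
    have d: "hol d \<Delta>" unfolding d_def by (simp add: hol_def cdiff_at_line)
    have dS: "d t \<in> S" if "t \<in> \<Delta>" for t
    proof -
      have "mnorm (t *\<^sub>C (R *\<^sub>R v)) = cmod t * (R * mnorm v)"
        using R by (simp add: cnorm_scaleC[OF cnorm_mnorm] cnorm_scaleR[OF cnorm_mnorm])
      also have "\<dots> \<le> 1 * (R * mnorm v)" using that R by (intro mult_right_mono) auto
      also have "\<dots> < 1 - mnorm x" using k(2) R by (simp add: v_def x'_def less_divide_eq mult.commute)
      finally show ?thesis using cnorm_triangle[OF cnorm_mnorm, of x' "t *\<^sub>C (R *\<^sub>R v)"] x'_le
        by (simp add: S_def d_def)
    qed
    have d0: "G k (d 0) = G j x" using tr_G[OF k(1) x] by (simp add: d_def x'_def)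
    have "complex_of_real (1 / R) *\<^sub>C (R *\<^sub>R v) = v"
      using R by (simp only: scaleC_of_real) simp
    then have d1: "G k (d (complex_of_real (1 / R))) = G j y"
      using tr_G[OF k(1) y] by (simp only: d_def v_def x'_def) simp
    define a b :: "nat \<Rightarrow> complex" where "a = (\<lambda>_. 0)" and "b = (\<lambda>_. complex_of_real (1 / R))"
    have into: "holo_into \<Delta> M (\<lambda>t. G k (d t))" by (rule disc_into[OF d]) (use dS in blast)
    have bR: "complex_of_real (1 / R) \<in> \<Delta>" using R by (simp add: norm_divide)
    have pd: "poincare_dist 0 (complex_of_real (1 / R)) = artanh (1 / R)"
      using R by (simp add: poincare_dist_def norm_divide)
    have chain: "\<exists>xx f. xx 0 = G j x \<and> xx 1 = G j y \<and>
          (\<forall>i<1. holo_into \<Delta> M (f i) \<and> a i \<in> \<Delta> \<and> b i \<in> \<Delta> \<and>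
                 f i (a i) = xx i \<and> f i (b i) = xx (Suc i))"
      by (rule exI[of _ "\<lambda>i::nat. if i = 0 then G j x else G j y"], rule exI[of _ "\<lambda>_ t. G k (d t)"])
         (use into bR d0 d1 in \<open>simp add: a_def b_def\<close>)
    have "ennreal (\<Sum>i<1. poincare_dist (a i) (b i)) \<in>
      {ennreal (\<Sum>i<k. poincare_dist (a i) (b i)) | k a b.
        \<exists>xx f. xx 0 = G j x \<and> xx k = G j y \<and>
          (\<forall>i<k. holo_into \<Delta> M (f i) \<and> a i \<in> \<Delta> \<and> b i \<in> \<Delta> \<and>
                 f i (a i) = xx i \<and> f i (b i) = xx (Suc i))}"
      unfolding mem_Collect_eq by (intro exI[of _ 1] exI[of _ a] exI[of _ b] conjI refl) (rule chain)
    then have "kobayashi_dist M (G j x) (G j y) \<le> ennreal (\<Sum>i<1. poincare_dist (a i) (b i))"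
      unfolding kobayashi_dist_def by (rule Inf_lower)
    also have "(\<Sum>i<1. poincare_dist (a i) (b i)) = artanh (1 / R)" using pd by (simp add: a_def b_def)
    finally show ?thesis by (simp add: R_def)
  qed
  have "(\<lambda>n. 1 / (real n + 2)) \<longlonglongrightarrow> 0"
    using LIMSEQ_ignore_initial_segment[OF lim_const_over_n[of "1::real"], of 2] by (simp add: add.commute)
  moreover have "isCont artanh (0::real)" by (rule isCont_artanh) auto
  ultimately have "(\<lambda>n. artanh (1 / (real n + 2))) \<longlonglongrightarrow> artanh 0" by (rule isCont_tendsto_compose[rotated])
  then have "(\<lambda>n. ennreal (artanh (1 / (real n + 2)))) \<longlonglongrightarrow> ennreal (artanh 0)" by (rule tendsto_ennrealI)
  then have "(\<lambda>n. ennreal (artanh (1 / (real n + 2)))) \<longlonglongrightarrow> 0" by simp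
  from LIMSEQ_le_const[OF this, of "kobayashi_dist M (G j x) (G j y)"] le
  have "kobayashi_dist M (G j x) (G j y) \<le> 0" by blast
  then show ?thesis by simp
qed

text \<open>Affine discs in the \<open>k\<close>-th chart bound the metric from above by
  \<open>mnorm (E k (L v))\<close>, which tends to \<open>mnorm (A (L v))\<close>. From below, the
  maps \<open>\<alpha> j\<close> glue to a holomorphic map of \<open>M\<close> into
  \<open>S\<close>, and the Schwarz lemma for its composition with a competing disc gives the same
  number. Here \<open>L\<close> reads tangent vectors in the first chart of the exhaustion.\<close>

lemma kobayashi_metric_kernel:
  assumes zero: "\<And>j k. j \<le> k \<Longrightarrow> F k (G j 0) = 0"
    and lim: "\<And>j. luc (\<lambda>k x. F k (G j x)) (\<alpha> j) S"
    and compat: "\<And>j k x. j \<le> k \<Longrightarrow> x \<in> S \<Longrightarrow> \<alpha> k (F k (G j x)) = \<alpha> j x"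
    and \<alpha>_in: "\<And>j x. x \<in> S \<Longrightarrow> \<alpha> j x \<in> S" and \<alpha>0: "\<And>j. \<alpha> j 0 = 0" and \<alpha>_hol: "\<And>j. hol (\<alpha> j) S"
    and A: "clinear A" "(\<alpha> 0 has_derivative A) (at 0)"
    and c: "(U, \<phi>) \<in> atlas M" "G 0 0 \<in> U"
  obtains L L' where "clinear L" "clinear L'" "\<And>v. L (L' v) = v" "\<And>v. L' (L v) = v"
    "\<And>v. kobayashi_metric M (U, \<phi>) (G 0 0) v = 0 \<longleftrightarrow> A (L v) = 0"
proof -
  have S0: "0 \<in> S" by (simp add: S_def)
  let ?p = "G 0 0"
  have Gp: "G k 0 = ?p" for k using tr_G[of 0 k 0] zero[of 0 k] S0 by simp
  have pM: "?p \<in> Mseq 0" by (rule G_in[OF S0])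
  have iq: "inv_into U \<phi> (\<phi> q) = q" if "q \<in> U" for q using inv_into_f_f[OF chart(2)[OF c(1)] that] .
  have "complex_differentiable_at (\<lambda>z. F 0 (inv_into U \<phi> z)) (\<phi> ?p)"
    by (rule holD[OF F_chart[OF c(1)]]) (use c pM in blast)
  then obtain L where L: "clinear L" "((\<lambda>z. F 0 (inv_into U \<phi> z)) has_derivative L) (at (\<phi> ?p))"
    by (rule cdiff_at_E)
  have Gc: "complex_differentiable_at (\<lambda>x. \<phi> (G k x)) 0" for k
    by (rule holD[OF G_chart[OF c(1)]]) (use S0 Gp[of k] c(2) in auto)
  obtain L' where L': "clinear L'" "((\<lambda>x. \<phi> (G 0 x)) has_derivative L') (at 0)"
    using Gc by (rule cdiff_at_E)
  have oV: "open {x \<in> S. G k x \<in> U}" for k by (rule G_vimage_open[OF chart(1)[OF c(1)]])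
  have LL': "L (L' v) = v" for v
  proof -
    have "((\<lambda>x. F 0 (inv_into U \<phi> (\<phi> (G 0 x)))) has_derivative (\<lambda>v. L (L' v))) (at 0)"
      by (rule has_derivative_compose[OF L'(2) L(2)])
    then have "((\<lambda>x. x) has_derivative (\<lambda>v. L (L' v))) (at 0)"
      by (rule has_derivative_transform_within_open[OF _ oV[of 0]]) (use S0 c in \<open>simp_all add: iq FG\<close>)
    from has_derivative_unique[OF this has_derivative_ident] show ?thesis by metis
  qed
  have "inj L'" using LL' by (metis injI)
  then have "surj L'" using linear_injective_imp_surjective[OF clinear_imp_linear[OF L'(1)]] by blast
  then have L'L: "L' (L v) = v" for v using LL' by (metis surjD)
  have "\<forall>k. \<exists>E. clinear E \<and> inj E \<and> ((\<lambda>x. F k (G 0 x)) has_derivative E) (at 0)"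
    using tr_immersive[OF _ S0, of 0] unfolding immersive_def by blast
  then obtain E where E: "\<And>k. clinear (E k)" "\<And>k. inj (E k)" "\<And>k. ((\<lambda>x. F k (G 0 x)) has_derivative E k) (at 0)" by metis
  have EA: "(\<lambda>k. E k v) \<longlonglongrightarrow> A v" for v
  proof (rule luc_derivative[OF S_open S0 lim _ _ A])
    show "ehol (\<lambda>k x. F k (G 0 x)) S"
      by (intro ehol_always immersive_hol tr_immersive) auto
  qed (use E in simp)
  let ?K = "\<lambda>v. {\<alpha>. \<alpha> > 0 \<and> (\<exists>f w. holo_into \<Delta> M f \<and> f 0 = ?p \<and>
        ((\<phi> \<circ> f) has_derivative (\<lambda>h. h *\<^sub>C w)) (at 0) \<and> v = \<alpha> *\<^sub>R w)}"
  have metric: "kobayashi_metric M (U, \<phi>) ?p v = Inf (?K v)" for v by (simp add: kobayashi_metric_def)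
  have upper: "r \<in> ?K v" if r: "0 < r" "mnorm (E k (L v)) < r" for r k v
  proof -
    define w where "w = v /\<^sub>R r"
    define d where "d t = t *\<^sub>C E k (L w)" for t
    have EL: "E k (L w) = E k (L v) /\<^sub>R r"
      by (simp add: w_def linear_cmul[OF clinear_imp_linear[OF L(1)]] linear_cmul[OF clinear_imp_linear[OF E(1)]])
    have dS: "d t \<in> S" if "t \<in> \<Delta>" for t
    proof -
      have "mnorm (d t) = cmod t * (mnorm (E k (L v)) / r)"
        using r by (simp add: d_def EL cnorm_scaleC[OF cnorm_mnorm] cnorm_scaleR[OF cnorm_mnorm] divide_inverse mult.commute)
      also have "\<dots> \<le> 1 * (mnorm (E k (L v)) / r)" using that r by (intro mult_right_mono) auto
      also have "\<dots> < 1" using r by simp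
      finally show ?thesis by (simp add: S_def)
    qed
    have "holo_into \<Delta> M (\<lambda>t. G k (d t))"
    proof (rule disc_into)
      show "hol d \<Delta>" unfolding d_def by (rule hol_clinear[OF clinear_scaleC_left])
      show "d ` \<Delta> \<subseteq> S" using dS by blast
    qed
    moreover have "G k (d 0) = ?p" by (simp add: d_def Gp[of k])
    moreover have "((\<lambda>t. \<phi> (G k (d t))) has_derivative (\<lambda>h. h *\<^sub>C w)) (at 0)"
    proof -
      obtain Q where Q: "clinear Q" "((\<lambda>x. \<phi> (G k x)) has_derivative Q) (at 0)" using Gc by (rule cdiff_at_E)
      have QE: "Q (E k v) = L' v" for v
      proof -
        have "((\<lambda>x. \<phi> (G k (F k (G 0 x)))) has_derivative (\<lambda>v. Q (E k v))) (at 0)"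
          by (rule has_derivative_compose[OF E(3)]) (use Q(2) zero[of 0 k] in simp)
        then have "((\<lambda>x. \<phi> (G 0 x)) has_derivative (\<lambda>v. Q (E k v))) (at 0)"
          by (rule has_derivative_transform_within_open[OF _ S_open S0]) (simp add: tr_G[of 0 k])
        from has_derivative_unique[OF this L'(2)] show ?thesis by (rule fun_cong)
      qed
      have "(d has_derivative d) (at 0)"
        unfolding d_def by (rule bounded_linear_imp_has_derivative[OF clinear_imp_bounded_linear[OF clinear_scaleC_left]])
      from has_derivative_compose[OF this, of "\<lambda>x. \<phi> (G k x)" Q] Q(2)
      have "((\<lambda>t. \<phi> (G k (d t))) has_derivative (\<lambda>h. Q (d h))) (at 0)" by (simp add: d_def)
      moreover have "Q (d h) = h *\<^sub>C w" for h by (simp add: d_def clinear_scaleC[OF Q(1)] QE L'L)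
      ultimately show ?thesis by simp
    qed
    moreover have "v = r *\<^sub>R w" using r by (simp add: w_def)
    ultimately show ?thesis using r(1) unfolding mem_Collect_eq comp_def by blast
  qed
  have lower: "mnorm (A (L v)) \<le> r" if "r \<in> ?K v" for r v
  proof -
    obtain f w where r: "r > 0" and f: "holo_into \<Delta> M f" "f 0 = ?p"
      "((\<phi> \<circ> f) has_derivative (\<lambda>h. h *\<^sub>C w)) (at 0)" "v = r *\<^sub>R w" using \<open>r \<in> ?K v\<close> by blast
    obtain b where b: "\<And>j x. x \<in> S \<Longrightarrow> b (G j x) = \<alpha> j x"
      by (rule direct_limit_function[of \<alpha>, OF compat]) (assumption+, rule that)
    have bh: "hol (\<lambda>x. b (G j x)) S" for j by (rule hol_cong[OF S_open \<alpha>_hol[of j]]) (simp add: b)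
    have bf_hol: "hol (\<lambda>t. b (f t)) \<Delta>" by (rule holo_into_compose[OF f(1) bh])
    have fc: "continuous_map (top_of_set \<Delta>) (mtop M) f" using f(1) by (simp add: holo_into_def)
    have bfS: "b (f t) \<in> S" if t: "t \<in> \<Delta>" for t
    proof -
      have "f t \<in> topspace (mtop M)" using t continuous_map_image_subset_topspace[OF fc] by fastforce
      then obtain j where "f t \<in> Mseq j" using Mun by blast
      then show ?thesis using b[OF F_S, of "f t" j j] GF \<alpha>_in F_S by metis
    qed
    define W where "W = {t \<in> \<Delta>. f t \<in> U \<inter> Mseq 0}"
    have oUM: "openin (mtop M) (U \<inter> Mseq 0)" by (intro openin_Int chart(1)[OF c(1)] Mo)
    have "openin (top_of_set \<Delta>) W"
      using openin_continuous_map_preimage[OF fc oUM] by (simp add: W_def)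
    then have W: "open W" using openin_open_eq[OF open_ball] by blast
    have W0: "0 \<in> W" using f(2) c(2) pM by (simp add: W_def)
    have "((\<lambda>t. F 0 (inv_into U \<phi> ((\<phi> \<circ> f) t))) has_derivative (\<lambda>h. L (h *\<^sub>C w))) (at 0)"
      by (rule has_derivative_compose[OF f(3)]) (simp add: f(2) L(2))
    then have "((\<lambda>t. F 0 (f t)) has_derivative (\<lambda>h. L (h *\<^sub>C w))) (at 0)"
      by (rule has_derivative_transform_within_open[OF _ W W0]) (simp add: W_def iq)
    from has_derivative_compose[OF this, of "\<alpha> 0" A]
    have "((\<lambda>t. \<alpha> 0 (F 0 (f t))) has_derivative (\<lambda>h. A (L (h *\<^sub>C w)))) (at 0)"
      using A(2) f(2) FG[OF S0] by simp
    then have der: "((\<lambda>t. b (f t)) has_derivative (\<lambda>h. A (L (h *\<^sub>C w)))) (at 0)"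
    proof (rule has_derivative_transform_within_open[OF _ W W0])
      fix t assume "t \<in> W"
      then have "f t \<in> Mseq 0" by (simp add: W_def)
      then show "\<alpha> 0 (F 0 (f t)) = b (f t)" using b[OF F_S, of "f t" 0 0] GF by simp
    qed
    have lin: "clinear (\<lambda>h. A (L (h *\<^sub>C w)))"
      by (intro clinear_compose[OF A(1)] clinear_compose[OF L(1)] clinear_scaleC_left)
    have b0: "b (f 0) = 0" using b[OF S0, of 0] f(2) \<alpha>0 by simp
    have "norm (fst (A (L (1 *\<^sub>C w)))) \<le> 1"
    proof (rule schwarz_disc(2)[of "\<lambda>t. fst (b (f t))" "\<lambda>h. fst (A (L (h *\<^sub>C w)))"])
      show "hol (\<lambda>t. fst (b (f t))) \<Delta>"
        by (rule hol_compose[OF bf_hol hol_clinear[OF clinear_fst, where S = UNIV]]) simp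
      show "norm (fst (b (f t))) < 1" if "cmod t < 1" for t using bfS[of t] that by (simp add: S_def mnorm_less)
    qed (use b0 clinear_compose[OF clinear_fst lin] has_derivative_fst[OF der] in auto)
    moreover have "norm (snd (A (L (1 *\<^sub>C w)))) \<le> 1"
    proof (rule schwarz_disc(2)[of "\<lambda>t. snd (b (f t))" "\<lambda>h. snd (A (L (h *\<^sub>C w)))"])
      show "hol (\<lambda>t. snd (b (f t))) \<Delta>"
        by (rule hol_compose[OF bf_hol hol_clinear[OF clinear_snd, where S = UNIV]]) simp
      show "norm (snd (b (f t))) < 1" if "cmod t < 1" for t using bfS[of t] that by (simp add: S_def mnorm_less)
    qed (use b0 clinear_compose[OF clinear_snd lin] has_derivative_snd[OF der] in auto)
    ultimately have "mnorm (A (L w)) \<le> 1" by (simp add: mnorm_def)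
    moreover have "A (L v) = r *\<^sub>R A (L w)"
      by (simp add: f(4) linear_cmul[OF clinear_imp_linear[OF L(1)]] linear_cmul[OF clinear_imp_linear[OF A(1)]])
    ultimately show ?thesis using r by (simp add: cnorm_scaleR[OF cnorm_mnorm])
  qed
  show thesis
  proof (rule that[of L L'])
    show "kobayashi_metric M (U, \<phi>) ?p v = 0 \<longleftrightarrow> A (L v) = 0" for v
    proof
      assume "kobayashi_metric M (U, \<phi>) ?p v = 0"
      then have inf: "Inf (?K v) = 0" by (simp add: metric)
      \<comment> \<open>The infimum of an empty set of reals would carry no information; the affine
        discs at level \<open>0\<close> exclude this.\<close>
      have "?K v \<noteq> {}"
        using upper[of "mnorm (E 0 (L v)) + 1" 0 v] by (force simp: add_nonneg_pos)
      then have "\<exists>r\<in>?K v. r < e" if "e > 0" for e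
        using cInf_lessD[of "?K v" e] inf that by simp
      then have "mnorm (A (L v)) < e" if "e > 0" for e using lower that by (meson order_le_less_trans)
      then have "mnorm (A (L v)) \<le> 0" by (meson less_irrefl not_le)
      then show "A (L v) = 0" by (rule mnorm_eq_0)
    next
      assume 0: "A (L v) = 0"
      have bdd: "bdd_below (?K v)" by (rule bdd_belowI[of _ 0]) auto
      have "Inf (?K v) \<le> e" if e: "e > 0" for e
      proof -
        have "(\<lambda>k. mnorm (E k (L v))) \<longlonglongrightarrow> 0" using mnorm_tendsto[OF EA[of "L v"]] 0 by simp
        then have "\<forall>\<^sub>F k in sequentially. mnorm (E k (L v)) < e" using e by (rule order_tendstoD(2))
        then obtain k where "mnorm (E k (L v)) < e" by (auto simp: eventually_sequentially)
        from cInf_lower[OF upper[OF e this] bdd] show ?thesis .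
      qed
      then have "Inf (?K v) \<le> 0" by (rule field_le_epsilon[of _ 0, simplified])
      moreover have "?K v \<noteq> {}" using upper[of "mnorm (E 0 (L v)) + 1" 0 v] by (force simp: add_nonneg_pos)
      then have "0 \<le> Inf (?K v)" by (rule cInf_greatest) auto
      ultimately show "kobayashi_metric M (U, \<phi>) ?p v = 0" by (simp add: metric)
    qed
  qed (rule L L' LL' L'L)+
qed

end

section \<open>Convergence of the charts\<close>

lemma holo_from_postcompose:
  assumes F: "holo_from N F" and \<psi>: "hol \<psi> S" "open S"
    and FS: "\<And>U \<phi>. (U, \<phi>) \<in> atlas N \<Longrightarrow> F ` U \<subseteq> S"
  shows "holo_from N (\<lambda>p. \<psi> (F p))"
  unfolding holo_from_def
proof clarify
  fix U \<phi> assume c: "(U, \<phi>) \<in> atlas N"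
  show "holo_on ((\<lambda>p. \<psi> (F p)) \<circ> inv_into U \<phi>) (\<phi> ` U)"
    unfolding holo_on_def
  proof
    fix x assume x: "x \<in> \<phi> ` U"
    have "holo_on (F \<circ> inv_into U \<phi>) (\<phi> ` U)" using F c by (auto simp: holo_from_def)
    then obtain W h where W: "open W" "x \<in> W" "\<forall>y\<in>W. complex_differentiable_at h y"
        "\<forall>y\<in>\<phi> ` U \<inter> W. h y = (F \<circ> inv_into U \<phi>) y"
      using x unfolding holo_on_def by blast
    have fibre_coord: "hol h W" using W(3) by (simp add: hol_def)
    have "open {y \<in> W. h y \<in> S}" by (rule open_vimage_on[OF W(1) hol_continuous[OF fibre_coord] \<psi>(2)])
    moreover have "h x = F (inv_into U \<phi> x)" using W x by simp
    then have "h x \<in> S" using inv_into_into[OF x] FS[OF c] by auto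
    moreover have "\<forall>y\<in>{y \<in> W. h y \<in> S}. complex_differentiable_at (\<lambda>y. \<psi> (h y)) y"
      using cdiff_at_compose[of h _ \<psi>] W(3) holD[OF \<psi>(1)] by blast
    ultimately show "\<exists>W h. open W \<and> x \<in> W \<and> (\<forall>y\<in>W. complex_differentiable_at h y) \<and>
        (\<forall>y\<in>\<phi> ` U \<inter> W. h y = ((\<lambda>p. \<psi> (F p)) \<circ> inv_into U \<phi>) y)"
      using W(2,4) by (intro exI[of _ "{y \<in> W. h y \<in> S}"] exI[of _ "\<lambda>y. \<psi> (h y)"]) auto
  qed
qed

lemma holo_into_precompose:
  assumes G: "holo_into S N G" and \<psi>: "hol \<psi> S" "open S" "\<And>x. x \<in> S \<Longrightarrow> \<psi> x \<in> S"
  shows "holo_into S N (\<lambda>x. G (\<psi> x))"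
  unfolding holo_into_def
proof (intro conjI)
  have "continuous_map (top_of_set S) (top_of_set S) \<psi>"
    using hol_continuous[OF \<psi>(1)] \<psi>(3) by (auto simp: continuous_map_in_subtopology)
  then have "continuous_map (top_of_set S) (mtop N) (G \<circ> \<psi>)"
    using G unfolding holo_into_def by (blast intro: continuous_map_compose)
  then show "continuous_map (top_of_set S) (mtop N) (\<lambda>x. G (\<psi> x))" by (simp add: comp_def)
  show "\<forall>(U, \<phi>)\<in>atlas N. holo_on (\<phi> \<circ> (\<lambda>x. G (\<psi> x))) {x \<in> S. G (\<psi> x) \<in> U}"
  proof clarify
    fix U \<phi> assume c: "(U, \<phi>) \<in> atlas N"
    show "holo_on (\<phi> \<circ> (\<lambda>x. G (\<psi> x))) {x \<in> S. G (\<psi> x) \<in> U}"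
      unfolding holo_on_def
    proof
      fix x assume x: "x \<in> {x \<in> S. G (\<psi> x) \<in> U}"
      have "holo_on (\<phi> \<circ> G) {x \<in> S. G x \<in> U}" using G c by (auto simp: holo_into_def)
      moreover have "\<psi> x \<in> {x \<in> S. G x \<in> U}" using x \<psi>(3) by simp
      ultimately obtain W h where W: "open W" "\<psi> x \<in> W" "\<forall>y\<in>W. complex_differentiable_at h y"
          "\<forall>y\<in>{x \<in> S. G x \<in> U} \<inter> W. h y = (\<phi> \<circ> G) y"
        unfolding holo_on_def by blast
      have "open {y \<in> S. \<psi> y \<in> W}" by (rule open_vimage_on[OF \<psi>(2) hol_continuous[OF \<psi>(1)] W(1)])
      moreover have "\<forall>y\<in>{y \<in> S. \<psi> y \<in> W}. complex_differentiable_at (\<lambda>y. h (\<psi> y)) y"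
        using cdiff_at_compose[of \<psi> _ h] W(3) holD[OF \<psi>(1)] by blast
      ultimately show "\<exists>W h. open W \<and> x \<in> W \<and> (\<forall>y\<in>W. complex_differentiable_at h y) \<and>
          (\<forall>y\<in>{x \<in> S. G (\<psi> x) \<in> U} \<inter> W. h y = (\<phi> \<circ> (\<lambda>x. G (\<psi> x))) y)"
        using x W(2,4) \<psi>(3) by (intro exI[of _ "{y \<in> S. \<psi> y \<in> W}"] exI[of _ "\<lambda>y. h (\<psi> y)"]) auto
    qed
  qed
qed

lemma polydisc_automorphism:
  fixes a :: "'a::complex_space \<times> 'b::complex_space"
  assumes a: "mnorm a < 1"
  obtains \<psi> :: "'a \<times> 'b \<Rightarrow> 'a \<times> 'b" where "hol \<psi> {x. mnorm x < 1}" "\<And>x. mnorm x < 1 \<Longrightarrow> mnorm (\<psi> x) < 1"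
    "\<And>x. mnorm x < 1 \<Longrightarrow> \<psi> (\<psi> x) = x" "\<psi> a = 0"
proof -
  have a': "norm (fst a) < 1" "norm (snd a) < 1" using a by (auto simp: mnorm_less)
  obtain f where f: "hol f (ball 0 1)" "\<And>z. norm z < 1 \<Longrightarrow> norm (f z) < 1"
    "\<And>z. norm z < 1 \<Longrightarrow> f (f z) = z" "f (fst a) = 0"
    by (rule ball_automorphism[OF a'(1)]) (rule that)
  obtain g where g: "hol g (ball 0 1)" "\<And>z. norm z < 1 \<Longrightarrow> norm (g z) < 1"
    "\<And>z. norm z < 1 \<Longrightarrow> g (g z) = z" "g (snd a) = 0"
    by (rule ball_automorphism[OF a'(2)]) (rule that)
  have hp: "hol (\<lambda>x. f (fst x)) {x :: 'a \<times> 'b. mnorm x < 1}" "hol (\<lambda>x. g (snd x)) {x :: 'a \<times> 'b. mnorm x < 1}"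
    by (rule hol_compose[OF hol_clinear[OF clinear_fst] f(1)], auto simp: mnorm_less)
       (rule hol_compose[OF hol_clinear[OF clinear_snd] g(1)], auto simp: mnorm_less)
  show thesis
  proof (rule that[of "\<lambda>x. (f (fst x), g (snd x))"])
    show "hol (\<lambda>x. (f (fst x), g (snd x))) {x :: 'a \<times> 'b. mnorm x < 1}"
      using hp cdiff_at_Pair unfolding hol_def by blast
  qed (auto simp: mnorm_less f g prod_eq_iff)
qed

lemma normalized_exhaustion:
  fixes M :: "('a, complex \<times> (complex ^ 'm)) cmanifold" and Mseq :: "nat \<Rightarrow> 'a set"
  assumes M: "complex_manifold M" and Mo: "\<And>j. openin (mtop M) (Mseq j)"
    and Minc: "\<And>j. Mseq j \<subseteq> Mseq (Suc j)" and Mun: "(\<Union>j. Mseq j) = topspace (mtop M)"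
    and bih: "\<And>j. biholomorphic_to (open_submanifold M (Mseq j)) {x :: complex \<times> (complex ^ 'm). mnorm x < 1}"
  obtains F :: "nat \<Rightarrow> 'a \<Rightarrow> complex \<times> (complex ^ 'm)" and G
  where "exhausted_manifold M Mseq F G" "\<And>j k. j \<le> k \<Longrightarrow> F k (G j 0) = 0"
proof -
  define S where "S = {x :: complex \<times> (complex ^ 'm). mnorm x < 1}"
  have So: "open S" unfolding S_def by (rule cnorm_open[OF cnorm_mnorm])
  have S0: "0 \<in> S" by (simp add: S_def)
  let ?N = "\<lambda>j. open_submanifold M (Mseq j)"
  have ts: "topspace (mtop (?N j)) = Mseq j" for j
    using openin_subset[OF Mo[of j]] by (auto simp: open_submanifold_def)
  have "\<forall>j. \<exists>F G. holo_from (?N j) F \<and> holo_into S (?N j) G \<and> F ` Mseq j \<subseteq> S \<and>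
        (\<forall>p\<in>Mseq j. G (F p) = p) \<and> (\<forall>y\<in>S. F (G y) = y)"
    using bih unfolding biholomorphic_to_def ts S_def[symmetric] by blast
  then obtain F0 G0 where FG: "\<And>j. holo_from (?N j) (F0 j)" "\<And>j. holo_into S (?N j) (G0 j)"
    "\<And>j. F0 j ` Mseq j \<subseteq> S" "\<And>j p. p \<in> Mseq j \<Longrightarrow> G0 j (F0 j p) = p" "\<And>j y. y \<in> S \<Longrightarrow> F0 j (G0 j y) = y"
    by metis
  have inc: "Mseq j \<subseteq> Mseq k" if "j \<le> k" for j k using lift_Suc_mono_le[of Mseq, OF Minc that] .
  have G0_in: "G0 j y \<in> Mseq j" if "y \<in> S" for j y
    using continuous_map_image_subset_topspace[of "top_of_set S" "mtop (?N j)" "G0 j"] FG(2)[of j] that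
    unfolding ts holo_into_def by auto
  define p where "p = G0 0 0"
  have p: "p \<in> Mseq j" for j using G0_in[OF S0, of 0] inc[of 0 j] by (auto simp: p_def)
  have "\<forall>j. \<exists>\<psi>. hol \<psi> S \<and> (\<forall>x\<in>S. \<psi> x \<in> S \<and> \<psi> (\<psi> x) = x) \<and> \<psi> (F0 j p) = 0"
  proof
    fix j
    have "mnorm (F0 j p) < 1" using FG(3)[of j] p[of j] by (auto simp: S_def)
    then obtain \<psi> where "hol \<psi> {x. mnorm x < 1}" "\<And>x. mnorm x < 1 \<Longrightarrow> mnorm (\<psi> x) < 1"
      "\<And>x. mnorm x < 1 \<Longrightarrow> \<psi> (\<psi> x) = x" "\<psi> (F0 j p) = 0"
      by (rule polydisc_automorphism) (rule that)
    then show "\<exists>\<psi>. hol \<psi> S \<and> (\<forall>x\<in>S. \<psi> x \<in> S \<and> \<psi> (\<psi> x) = x) \<and> \<psi> (F0 j p) = 0"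
      by (intro exI[of _ \<psi>]) (simp add: S_def)
  qed
  then obtain \<psi> where \<psi>: "\<And>j. hol (\<psi> j) S" "\<And>j x. x \<in> S \<Longrightarrow> \<psi> j x \<in> S"
    "\<And>j x. x \<in> S \<Longrightarrow> \<psi> j (\<psi> j x) = x" "\<And>j. \<psi> j (F0 j p) = 0" by metis
  \<comment> \<open>Each \<open>\<psi> j\<close> is an involution, so the same map normalises the
    chart and its inverse.\<close>
  define F where "F j q = \<psi> j (F0 j q)" for j q
  define G where "G j x = G0 j (\<psi> j x)" for j x
  have F0S: "F0 j q \<in> S" if "q \<in> Mseq j" for j q using FG(3)[of j] that by blast
  have G0p: "G j 0 = p" for j
    using \<psi>(3)[OF F0S[OF p, of j], of j] FG(4)[OF p] by (simp add: G_def \<psi>(4))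
  have "exhausted_manifold M Mseq F G"
  proof (unfold_locales, unfold S_def[symmetric])
    show "holo_from (?N j) (F j)" for j unfolding F_def
    proof (rule holo_from_postcompose[OF FG(1) \<psi>(1) So])
      fix U \<phi> assume "(U, \<phi>) \<in> atlas (?N j)"
      then have "U \<subseteq> Mseq j" by (auto simp: open_submanifold_def)
      then show "F0 j ` U \<subseteq> S" using FG(3)[of j] by blast
    qed
    show "holo_into S (?N j) (G j)" for j unfolding G_def
      by (rule holo_into_precompose[OF FG(2) \<psi>(1) So \<psi>(2)])
  qed (simp_all add: M Mo inc Mun F_def G_def \<psi>(2,3) F0S FG(4,5))
  moreover have "F k (G j 0) = 0" for j k by (simp add: G0p F_def \<psi>(4))
  ultimately show thesis by (rule that)
qed

locale convergent_exhaustion = exhausted_manifold M Mseq F G S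
  for M :: "('a, complex \<times> (complex ^ 'm)) cmanifold" and Mseq F G S +
  fixes \<alpha> :: "nat \<Rightarrow> complex \<times> (complex ^ 'm) \<Rightarrow> complex \<times> (complex ^ 'm)" and \<rho>
  assumes zero: "\<And>j k. j \<le> k \<Longrightarrow> F k (G j 0) = 0"
    and lim: "\<And>j. luc (\<lambda>k x. F k (G j x)) (\<alpha> j) S"
    and lim': "luc \<alpha> \<rho> S"
begin

sublocale tower: polydisc_tower "\<lambda>j k x. F k (G j x)" \<alpha> \<rho> S
  by unfold_locales (simp_all add: S_def[symmetric] tr_in tr_immersive tr_inj tr_comp zero lim lim')

text \<open>Hyperbolicity enters through the injectivity of the \<open>\<alpha> j\<close>: points
  that they identify have vanishing Kobayashi distance.\<close>

lemma hyperbolic_limit: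
  assumes hyp: "kobayashi_hyperbolic M"
  shows "biholomorphic_to M S"
proof -
  have inj: "inj_on (\<alpha> j) S" for j
  proof (rule inj_onI)
    fix x y assume x: "x \<in> S" and y: "y \<in> S" and eq: "\<alpha> j x = \<alpha> j y"
    have "(\<lambda>k. F k (G j y) - F k (G j x)) \<longlonglongrightarrow> \<alpha> j y - \<alpha> j x"
      by (intro tendsto_diff luc_pointwise[OF lim] x y)
    then have "kobayashi_dist M (G j x) (G j y) = 0"
      by (intro kobayashi_dist_zero zero x y) (simp_all add: eq)
    moreover have "G j z \<in> topspace (mtop M)" if "z \<in> S" for z using G_in[OF that] Mun by blast
    ultimately have eq': "G j x = G j y" using hyp x y unfolding kobayashi_hyperbolic_def by blast
    show "x = y" using FG[OF x, of j] FG[OF y, of j] unfolding eq' by (rule trans[OF sym])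
  qed
  have Z: "(\<Union>j. \<alpha> j ` S) = S"
  proof (intro equalityI subsetI)
    fix y assume "y \<in> S"
    then have "\<exists>j. y \<in> \<alpha> j ` S" by (rule tower.injective_limit(2)[OF inj])
    then show "y \<in> (\<Union>j. \<alpha> j ` S)" by simp
  qed (use tower.\<alpha>_in in blast)
  show ?thesis
    by (rule biholomorphic_to_direct_limit[where \<beta> = \<alpha> and l = "\<lambda>x. x" and l' = "\<lambda>x. x"])
       (use tower.injective_limit(1)[OF inj] inj tower.\<alpha>_f clinear_id Z in \<open>simp_all only: image_ident\<close>)
qed

text \<open>The corank is read at the common centre \<open>G 0 0\<close>, where the zero set of the
  metric is linearly isomorphic to the kernel of the derivative of \<open>\<alpha> 0\<close>;
  dimension one makes that kernel a line.\<close>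

lemma corank_one_splitting:
  assumes corank: "has_kobayashi_corank M 1"
  obtains e :: "complex ^ 'm \<Rightarrow> complex \<times> (complex ^ 'm)" and \<pi> and \<beta> :: "nat \<Rightarrow> _ \<Rightarrow> complex \<times> (complex ^ 'm)"
  where "clinear e" "clinear \<pi>" "\<And>y. \<pi> (e y) = y" "\<And>x. mnorm (e (\<pi> x)) \<le> mnorm x"
    "\<And>j x. x \<in> S \<Longrightarrow> immersive (\<beta> j) x" "\<And>j. inj_on (\<beta> j) S"
    "\<And>j k x. j \<le> k \<Longrightarrow> x \<in> S \<Longrightarrow> \<beta> k (F k (G j x)) = \<beta> j x"
    "(\<Union>j. \<beta> j ` S) = {z. mnorm (e (snd z)) < 1}"
proof -
  have S0: "0 \<in> S" by (rule tower.S_zero)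
  have pM: "G 0 0 \<in> topspace (mtop M)" using G_in[OF S0] Mun by blast
  then obtain U \<phi> where c: "(U, \<phi>) \<in> atlas M" "G 0 0 \<in> U" using chart_at by blast
  obtain A where A: "clinear A" "(\<alpha> 0 has_derivative A) (at 0)"
    using holD[OF tower.\<alpha>_hol S0] by (rule cdiff_at_E)
  obtain L L' where L: "clinear L" "clinear L'" "\<And>v. L (L' v) = v" "\<And>v. L' (L v) = v"
    "\<And>v. kobayashi_metric M (U, \<phi>) (G 0 0) v = 0 \<longleftrightarrow> A (L v) = 0"
    by (rule kobayashi_metric_kernel[OF zero lim tower.\<alpha>_f tower.\<alpha>_in tower.\<alpha>_zero tower.\<alpha>_hol A c]) (assumption | rule that)+
  let ?K = "{v. A (L v) = 0}"
  have dim: "complex_vector.dim ?K = 1"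
    using corank[unfolded has_kobayashi_corank_def, rule_format, OF pM c(1)] c(2) by (simp add: L(5))
  obtain B where B: "B \<subseteq> ?K" "complex_vector.independent B" "?K \<subseteq> complex_vector.span B" "card B = 1"
    using complex_vector.basis_exists[of ?K] dim by metis
  obtain v0 where v0: "B = {v0}" using B(4) by (rule card_1_singletonE)
  have "v0 \<noteq> 0" using B(2) complex_vector.dependent_zero[of B] v0 by blast
  then have u0: "L v0 \<noteq> 0" using L(4)[of v0] linear_0[OF clinear_imp_linear[OF L(2)]] by metis
  have ker: "A v = 0 \<longleftrightarrow> (\<exists>c. v = c *\<^sub>C L v0)" for v
  proof
    assume "A v = 0"
    then have "L' v \<in> complex_vector.span {v0}" using B(3) v0 by (auto simp: L(3))
    then obtain c where "L' v = c *\<^sub>C v0" by (auto simp: complex_vector.span_singleton)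
    then have "v = c *\<^sub>C L v0" using L(3)[of v] clinear_scaleC[OF L(1)] by metis
    then show "\<exists>c. v = c *\<^sub>C L v0" by blast
  next
    assume "\<exists>c. v = c *\<^sub>C L v0"
    moreover have "A (L v0) = 0" using B(1) v0 by blast
    ultimately show "A v = 0" by (auto simp: clinear_scaleC[OF A(1)])
  qed
  obtain e :: "complex ^ 'm \<Rightarrow> complex \<times> (complex ^ 'm)" and \<pi> and \<beta> :: "nat \<Rightarrow> _ \<Rightarrow> complex \<times> (complex ^ 'm)"
    where *: "clinear e" "clinear \<pi>" "\<And>y. \<pi> (e y) = y" "\<And>x. mnorm (e (\<pi> x)) \<le> mnorm x"
      "\<And>j x. x \<in> S \<Longrightarrow> immersive (\<beta> j) x" "\<And>j. inj_on (\<beta> j) S"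
      "\<And>j k x. j \<le> k \<Longrightarrow> x \<in> S \<Longrightarrow> \<beta> k (F k (G j x)) = \<beta> j x"
      "\<And>j x. x \<in> S \<Longrightarrow> mnorm (e (snd (\<beta> j x))) < 1"
      "\<And>z. mnorm (e (snd z)) < 1 \<Longrightarrow> \<exists>j. z \<in> \<beta> j ` S"
    by (rule tower.corank_one_limit[OF A u0 ker]) (rule that)
  have img: "(\<Union>j. \<beta> j ` S) = {z. mnorm (e (snd z)) < 1}"
  proof (intro equalityI subsetI)
    fix z :: "complex \<times> (complex ^ 'm)" assume "z \<in> {z. mnorm (e (snd z)) < 1}"
    then have "\<exists>j. z \<in> \<beta> j ` S" using *(9)[of z] by simp
    then show "z \<in> (\<Union>j. \<beta> j ` S)" by simp
  qed (use *(8) in blast)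
  show thesis by (rule that[of e \<pi> \<beta>, OF *(1-7) img])
qed

end

text \<open>Two extractions are needed, one in the target index for all \<open>j\<close> at once and
  one for the resulting limits \<open>\<alpha> j\<close>. Reindexing the exhaustion itself by their
  composition \<open>s\<close> turns both into convergence along the full sequence, and the union is
  unchanged.\<close>

lemma convergent_exhaustion_exists:
  fixes M :: "('a, complex \<times> (complex ^ 'm)) cmanifold" and Mseq :: "nat \<Rightarrow> 'a set"
  assumes M: "complex_manifold M" and Mo: "\<And>j. openin (mtop M) (Mseq j)"
    and Minc: "\<And>j. Mseq j \<subseteq> Mseq (Suc j)" and Mun: "(\<Union>j. Mseq j) = topspace (mtop M)"
    and bih: "\<And>j. biholomorphic_to (open_submanifold M (Mseq j)) {x :: complex \<times> (complex ^ 'm). mnorm x < 1}"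
  obtains N F G \<alpha> \<rho> where "convergent_exhaustion M N F G \<alpha> \<rho>"
proof -
  obtain F :: "nat \<Rightarrow> 'a \<Rightarrow> complex \<times> (complex ^ 'm)" and G
    where E: "exhausted_manifold M Mseq F G" and zero: "\<And>j k. j \<le> k \<Longrightarrow> F k (G j 0) = 0"
    by (rule normalized_exhaustion[OF assms]) (rule that)
  define S where "S = {x :: complex \<times> (complex ^ 'm). mnorm x < 1}"
  interpret E: exhausted_manifold M Mseq F G S by (rule E) (simp add: S_def)
  have bd: "norm x \<le> 2" if "x \<in> S" for x :: "complex \<times> (complex ^ 'm)"
    using norm_le_2_mnorm[of x] that by (simp add: S_def)
  have ev: "\<forall>\<^sub>F k in sequentially. j \<le> k" for j :: nat by (rule eventually_ge_at_top)
  have eh: "ehol (\<lambda>k x. F k (G j x)) S" for j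
    by (rule eholI, rule eventually_mono[OF ev]) (blast intro: immersive_hol E.tr_immersive)
  have lb: "elb (\<lambda>k x. F k (G j x)) S" for j
    unfolding elb_def
    by (intro allI impI exI[of _ 2] eventually_mono[OF ev[of j]]) (use bd E.tr_in in blast)
  obtain \<alpha> \<nu> where \<nu>: "strict_mono (\<nu> :: nat \<Rightarrow> nat)" "\<And>j. luc (\<lambda>n x. F (\<nu> n) (G j x)) (\<alpha> j) S"
    by (rule montel_family[where U = "\<lambda>_. S" and f = "\<lambda>j k x. F k (G j x)", OF E.S_open eh lb]) (rule that)
  have \<nu>j: "\<forall>\<^sub>F n in sequentially. j \<le> \<nu> n" for j
    by (rule eventually_mono[OF ev[of j]]) (use seq_suble[OF \<nu>(1)] order_trans in blast)
  have \<alpha>_hol: "hol (\<alpha> j) S" for j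
  proof (rule weierstrass[OF E.S_open \<nu>(2)])
    show "ehol (\<lambda>n x. F (\<nu> n) (G j x)) S"
      by (rule eholI, rule eventually_mono[OF \<nu>j]) (blast intro: immersive_hol E.tr_immersive)
  qed
  have \<alpha>_bd: "norm (\<alpha> j x) \<le> 2" if x: "x \<in> S" for j x
  proof (rule tendsto_upperbound[OF tendsto_norm[OF luc_pointwise[OF \<nu>(2) x]]])
    show "\<forall>\<^sub>F n in sequentially. norm (F (\<nu> n) (G j x)) \<le> 2"
      by (rule eventually_mono[OF \<nu>j]) (rule bd[OF E.tr_in[OF _ x]])
  qed simp
  obtain \<rho> \<mu> where \<mu>: "strict_mono (\<mu> :: nat \<Rightarrow> nat)" "luc (\<lambda>n. \<alpha> (\<nu> (\<mu> n))) \<rho> S"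
    by (rule montel_single[of S "\<lambda>n. \<alpha> (\<nu> n)", OF E.S_open ehol_always[OF \<alpha>_hol] elb_bounded[OF \<alpha>_bd]])
       (assumption | rule that)+
  define s where "s = (\<lambda>n. \<nu> (\<mu> n))"
  have s: "strict_mono s" using strict_mono_o[OF \<nu>(1) \<mu>(1)] by (simp add: s_def comp_def)
  have sle: "s j \<le> s k" if "j \<le> k" for j k using s that by (rule strict_mono_leD)
  have un: "(\<Union>j. Mseq (s j)) = (\<Union>j. Mseq j)"
    using E.Minc[OF seq_suble[OF s]] by blast
  have "convergent_exhaustion M (\<lambda>j. Mseq (s j)) (\<lambda>j. F (s j)) (\<lambda>j. G (s j)) (\<lambda>j. \<alpha> (s j)) \<rho>"
  proof (unfold_locales, unfold S_def[symmetric])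
    show "luc (\<lambda>k x. F (s k) (G (s j) x)) (\<alpha> (s j)) S" for j
      using luc_subseq[OF \<nu>(2) \<mu>(1)] by (simp add: s_def)
    show "luc (\<lambda>j. \<alpha> (s j)) \<rho> S" using \<mu>(2) by (simp add: s_def)
  qed (simp_all add: M Mo un Mun E.Minc sle E.F_from E.G_into E.F_S E.GF E.FG zero)
  then show thesis by (rule that)
qed

section \<open>The target of the corank one case\<close>

lemma vec_axis_expansion: "(\<Sum>i\<in>UNIV. y $ i *\<^sub>C axis i (1::complex)) = (y :: complex ^ 'm)"
  by (simp add: vec_eq_iff scaleC_vec_def scaleC_complex_def axis_def if_distrib cong: if_cong)

lemma range_injective_linear:
  fixes e :: "complex ^ 'm \<Rightarrow> 'a::complex_space"
  assumes e: "clinear e" and \<pi>: "clinear \<pi>" "\<And>y. \<pi> (e y) = y"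
  shows "complex_vector.subspace (range e)" "complex_vector.dim (range e) = CARD('m)"
proof -
  have e_sum: "e (sum f A) = (\<Sum>i\<in>A. e (f i))" for f and A :: "'m set"
    by (rule linear_sum[OF clinear_imp_linear[OF e]])
  have \<pi>_sum: "\<pi> (sum f A) = (\<Sum>i\<in>A. \<pi> (f i))" for f and A :: "'m set"
    by (rule linear_sum[OF clinear_imp_linear[OF \<pi>(1)]])
  show sub: "complex_vector.subspace (range e)"
  proof (rule complex_vector.subspaceI)
    show "0 \<in> range e" using linear_0[OF clinear_imp_linear[OF e]] by (metis rangeI)
    show "x + y \<in> range e" if "x \<in> range e" "y \<in> range e" for x y
      using that linear_add[OF clinear_imp_linear[OF e]] by (metis (no_types, lifting) imageE rangeI)
    show "c *\<^sub>C x \<in> range e" if "x \<in> range e" for c x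
      using that clinear_scaleC[OF e] by (metis (no_types, lifting) imageE rangeI)
  qed
  define b where "b i = e (axis i 1)" for i
  have b_inj: "inj b"
  proof (rule injI)
    fix i j assume "b i = b j"
    then have "axis i (1::complex) = axis j 1" using \<pi>(2) by (metis b_def)
    then show "i = j" by (simp add: axis_eq_axis)
  qed
  have "complex_vector.independent (range b)"
  proof
    assume "complex_vector.dependent (range b)"
    then obtain u i where u: "u (b i) \<noteq> 0" "(\<Sum>v\<in>range b. u v *\<^sub>C v) = 0"
      by (auto simp: complex_vector.dependent_finite)
    have "(\<Sum>i\<in>UNIV. u (b i) *\<^sub>C b i) = 0" using u(2) by (simp add: sum.reindex[OF b_inj])
    then have "(\<Sum>i\<in>UNIV. \<pi> (u (b i) *\<^sub>C b i)) = 0"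
      using \<pi>_sum linear_0[OF clinear_imp_linear[OF \<pi>(1)]] by metis
    then have "(\<Sum>i\<in>UNIV. (\<chi> i. u (b i)) $ i *\<^sub>C axis i (1::complex)) = 0"
      by (simp add: clinear_scaleC[OF \<pi>(1)] b_def \<pi>(2))
    then have "(\<chi> i. u (b i)) = 0" by (simp only: vec_axis_expansion)
    then show False using u(1) by (simp add: vec_eq_iff)
  qed
  moreover have "range e \<subseteq> complex_vector.span (range b)"
  proof clarify
    fix y
    have "e (\<Sum>i\<in>UNIV. y $ i *\<^sub>C axis i 1) = (\<Sum>i\<in>UNIV. y $ i *\<^sub>C b i)"
      by (simp add: e_sum clinear_scaleC[OF e] b_def)
    then have "e y = (\<Sum>i\<in>UNIV. y $ i *\<^sub>C b i)" by (simp only: vec_axis_expansion)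
    also have "\<dots> \<in> complex_vector.span (range b)"
      by (intro complex_vector.span_sum complex_vector.span_scale complex_vector.span_base rangeI)
    finally show "e y \<in> complex_vector.span (range b)" .
  qed
  moreover have "range b \<subseteq> range e" by (auto simp: b_def)
  ultimately show "complex_vector.dim (range e) = CARD('m)"
    using complex_vector.basis_card_eq_dim[of "range b" "range e"] card_image[OF b_inj] by simp
qed

text \<open>The linear projection \<open>e \<circ> \<pi>\<close> does not increase
  \<open>mnorm\<close>, so it maps \<open>\<Omega>\<close> into itself and is the
  retraction.\<close>

lemma retract_onto_slice:
  fixes e :: "complex ^ 'm \<Rightarrow> complex \<times> (complex ^ 'm)"
  assumes e: "clinear e" and \<pi>: "clinear \<pi>" "\<And>y. \<pi> (e y) = y"
    and le: "\<And>x. mnorm (e (\<pi> x)) \<le> mnorm x"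
  shows "holomorphic_retract (range e \<inter> \<Omega>) \<Omega>"
  unfolding holomorphic_retract_def
proof (intro exI conjI)
  let ?r = "\<lambda>x. e (\<pi> x)"
  have in\<Omega>: "?r x \<in> \<Omega>" if "x \<in> \<Omega>" for x using le[of x] that unfolding mnorm_ball[symmetric] by simp
  show "holo_on ?r \<Omega>"
    by (rule hol_imp_holo_on[OF open_Times[OF open_ball open_ball] hol_clinear[OF clinear_compose[OF e \<pi>(1)]]])
  show "?r ` \<Omega> \<subseteq> \<Omega>" using in\<Omega> by blast
  show "\<forall>x\<in>\<Omega>. ?r (?r x) = ?r x" by (simp add: \<pi>(2))
  show "range e \<inter> \<Omega> = ?r ` \<Omega>"
  proof (intro equalityI subsetI)
    fix x assume x: "x \<in> range e \<inter> \<Omega>"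
    then have eq: "x = ?r x" using \<pi>(2) by auto
    show "x \<in> ?r ` \<Omega>" by (rule image_eqI[of x ?r x, OF eq]) (use x in blast)
  qed (use in\<Omega> in blast)
qed

text \<open>For a base of dimension at least two the slice \<open>range e \<inter> \<Omega>\<close>
  can be kept. In dimension one the base is a disc for the norm \<open>mnorm \<circ> e\<close>,
  which is a multiple of the Euclidean one, and a dilation identifies it with
  \<open>{0} \<times> \<bool>\<close>, the graph of the zero function.\<close>

lemma corank_one_target:
  fixes e :: "complex ^ 'm \<Rightarrow> complex \<times> (complex ^ 'm)"
  assumes e: "clinear e" and \<pi>: "clinear \<pi>" "\<And>y. \<pi> (e y) = y"
    and le: "\<And>x. mnorm (e (\<pi> x)) \<le> mnorm x"
  obtains Z :: "(complex \<times> (complex ^ 'm)) set" and l :: "_ \<Rightarrow> _ \<times> complex" and l' :: "_ \<Rightarrow> complex \<times> (complex ^ 'm)"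
  where "clinear l" "clinear l'" "\<And>v. l' (l v) = v" "Z \<times> UNIV = l ` {z. mnorm (e (snd z)) < 1}"
    "holomorphic_retract Z \<Omega>"
    "(graph_over \<bool> Z \<and> linear_subspace_of (\<bool> :: (complex ^ 'm) set) \<bool> CARD('m)) \<or> (\<exists>k\<ge>2. linear_subspace_of Z \<Omega> k)"
proof (cases "CARD('m) \<ge> 2")
  case True
  define Z where "Z = range e \<inter> \<Omega>"
  show thesis
  proof (rule that[of "\<lambda>z. (e (snd z), fst z)" "\<lambda>w. (snd w, \<pi> (fst w))" Z])
    show "clinear (\<lambda>z :: complex \<times> (complex ^ 'm). (e (snd z), fst z))"
      by (intro clinear_Pair clinear_compose[OF e clinear_snd] clinear_fst)
    show "clinear (\<lambda>w :: (complex \<times> (complex ^ 'm)) \<times> complex. (snd w, \<pi> (fst w)))"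
      by (intro clinear_Pair clinear_compose[OF \<pi>(1) clinear_fst] clinear_snd)
    show "Z \<times> UNIV = (\<lambda>z. (e (snd z), fst z)) ` {z :: complex \<times> (complex ^ 'm). mnorm (e (snd z)) < 1}"
    proof (intro equalityI subsetI)
      fix w assume "w \<in> Z \<times> (UNIV :: complex set)"
      then obtain z t where zt: "z \<in> Z" "w = (z, t)" by (rule SigmaE) auto
      from zt(1) have z: "z \<in> range e" "z \<in> \<Omega>" by (simp_all only: Z_def Int_iff)
      from z(1) obtain y where y: "z = e y" by (rule rangeE)
      from z(2) have "mnorm (e y) < 1" unfolding mnorm_ball[symmetric] y by simp
      then have "(t, y) \<in> {z. mnorm (e (snd z)) < 1}" by simp
      moreover have "w = (\<lambda>z. (e (snd z), fst z)) (t, y)" using zt y by simp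
      ultimately show "w \<in> (\<lambda>z. (e (snd z), fst z)) ` {z. mnorm (e (snd z)) < 1}" by blast
    next
      fix w assume "w \<in> (\<lambda>z. (e (snd z), fst z)) ` {z :: complex \<times> (complex ^ 'm). mnorm (e (snd z)) < 1}"
      then obtain z :: "complex \<times> (complex ^ 'm)" where z: "w = (e (snd z), fst z)" "mnorm (e (snd z)) < 1"
        by (rule imageE) simp
      then have "e (snd z) \<in> \<Omega>" unfolding mnorm_ball[symmetric] by simp
      then show "w \<in> Z \<times> (UNIV :: complex set)" unfolding z(1) Z_def by blast
    qed
    show "holomorphic_retract Z \<Omega>" unfolding Z_def by (rule retract_onto_slice[OF e \<pi> le])
    have "linear_subspace_of Z \<Omega> CARD('m)"
      unfolding linear_subspace_of_def Z_def using range_injective_linear[OF e \<pi>] by blast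
    then show "(graph_over \<bool> Z \<and> linear_subspace_of (\<bool> :: (complex ^ 'm) set) \<bool> CARD('m)) \<or> (\<exists>k\<ge>2. linear_subspace_of Z \<Omega> k)"
      using True by blast
  qed (simp add: \<pi>(2))
next
  case False
  then have "CARD('m) = 1" using zero_less_card_finite[where 'a = 'm] by linarith
  then obtain i0 where UNIV: "(UNIV :: 'm set) = {i0}" by (rule card_1_singletonE)
  then have i0: "i = i0" for i :: 'm by blast
  \<comment> \<open>On a complex line any two complex norms are proportional; \<open>r\<close> is
    the ratio of \<open>mnorm \<circ> e\<close> to the Euclidean norm.\<close>
  define r where "r = mnorm (e (axis i0 1))"
  have "axis i0 (1::complex) \<noteq> 0" by (simp add: axis_eq_0_iff)
  then have "e (axis i0 1) \<noteq> 0" using \<pi>(2) linear_0[OF clinear_imp_linear[OF \<pi>(1)]] by metis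
  then have r: "r > 0" unfolding r_def using mnorm_eq_0 not_less by blast
  have y_eq: "y = y $ i0 *\<^sub>C axis i0 1" for y :: "complex ^ 'm"
    by (simp add: vec_eq_iff scaleC_vec_def scaleC_complex_def axis_def) (metis i0)
  have norm_y: "norm y = cmod (y $ i0)" for y :: "complex ^ 'm"
    by (simp add: norm_vec_def L2_set_def UNIV)
  have e_norm: "mnorm (e y) = norm (r *\<^sub>R y)" for y
  proof -
    have "mnorm (e (y $ i0 *\<^sub>C axis i0 1)) = cmod (y $ i0) * r"
      by (simp add: clinear_scaleC[OF e] cnorm_scaleC[OF cnorm_mnorm] r_def)
    then show ?thesis using r by (simp flip: y_eq add: norm_y)
  qed
  define Z :: "(complex \<times> (complex ^ 'm)) set" where "Z = {0} \<times> \<bool>"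
  have lin_r: "clinear (\<lambda>y. s *\<^sub>R y)" for s :: real
    by (simp add: clinear_iff scaleC_scaleC mult.commute scaleC_add_right flip: scaleC_of_real)
  show thesis
  proof (rule that[of "\<lambda>z. ((0, r *\<^sub>R snd z), fst z)" "\<lambda>w. (snd w, inverse r *\<^sub>R snd (fst w))" Z])
    show "clinear (\<lambda>z :: complex \<times> (complex ^ 'm). ((0 :: complex, r *\<^sub>R snd z), fst z))"
      by (intro clinear_Pair clinear_compose[OF lin_r clinear_snd] clinear_fst clinear_zero_map)
    show "clinear (\<lambda>w :: (complex \<times> (complex ^ 'm)) \<times> complex. (snd w, inverse r *\<^sub>R snd (fst w)))"
      by (intro clinear_Pair clinear_compose[OF lin_r] clinear_compose[OF clinear_snd clinear_fst] clinear_snd)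
    show "Z \<times> UNIV = (\<lambda>z. ((0, r *\<^sub>R snd z), fst z)) ` {z :: complex \<times> (complex ^ 'm). mnorm (e (snd z)) < 1}"
    proof (intro equalityI subsetI)
      fix w assume "w \<in> Z \<times> (UNIV :: complex set)"
      then obtain y t where w: "w = ((0, y), t)" "norm y < 1" by (auto simp: Z_def)
      have "w = (\<lambda>z. ((0, r *\<^sub>R snd z), fst z)) (t, inverse r *\<^sub>R y)" using r w by simp
      moreover have "(t, inverse r *\<^sub>R y) \<in> {z. mnorm (e (snd z)) < 1}" using r w by (simp add: e_norm field_simps)
      ultimately show "w \<in> (\<lambda>z. ((0, r *\<^sub>R snd z), fst z)) ` {z. mnorm (e (snd z)) < 1}" by blast
    qed (auto simp: Z_def e_norm)
    show "holomorphic_retract Z \<Omega>"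
      unfolding holomorphic_retract_def
    proof (intro exI conjI)
      let ?r = "\<lambda>x :: complex \<times> (complex ^ 'm). (0 :: complex, snd x)"
      show "holo_on ?r \<Omega>"
        by (rule hol_imp_holo_on[OF open_Times[OF open_ball open_ball] hol_clinear[OF clinear_Pair[OF clinear_zero_map clinear_snd]]])
      show "Z = ?r ` \<Omega>"
      proof (intro equalityI subsetI)
        fix x assume "x \<in> Z"
        then have "x = ?r x" "x \<in> \<Omega>" by (auto simp: Z_def)
        then show "x \<in> ?r ` \<Omega>" by (rule image_eqI[of x ?r x])
      qed (auto simp: Z_def)
    qed auto
    have "graph_over \<bool> Z"
      unfolding graph_over_def
      by (rule exI[of _ "\<lambda>_. 0"]) (auto simp: Z_def hol_def cdiff_at_const intro!: hol_imp_holo_on)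
    moreover have "linear_subspace_of (\<bool> :: (complex ^ 'm) set) \<bool> CARD('m)"
      unfolding linear_subspace_of_def
      using range_injective_linear[OF clinear_id clinear_id] by (intro exI[of _ UNIV]) auto
    ultimately show "(graph_over \<bool> Z \<and> linear_subspace_of (\<bool> :: (complex ^ 'm) set) \<bool> CARD('m)) \<or> (\<exists>k\<ge>2. linear_subspace_of Z \<Omega> k)"
      by blast
  qed (use r in simp)
qed

theorem theorem5p1:
  fixes M :: "('a, complex \<times> (complex ^ 'm)) cmanifold"
    and Mseq :: "nat \<Rightarrow> 'a set"
  assumes "complex_manifold M"
    and "\<And>j. openin (mtop M) (Mseq j)"
    and "\<And>j. Mseq j \<subseteq> Mseq (Suc j)"
    and "(\<Union>j. Mseq j) = topspace (mtop M)"
    and "\<And>j. biholomorphic_to (open_submanifold M (Mseq j)) (\<Omega> :: (complex \<times> (complex ^ 'm)) set)"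
  shows "(kobayashi_hyperbolic M \<longrightarrow>
            biholomorphic_to M (\<Omega> :: (complex \<times> (complex ^ 'm)) set)) \<and>
         (\<not> kobayashi_hyperbolic M \<and> has_kobayashi_corank M 1 \<longrightarrow>
            (\<exists>Z :: (complex \<times> (complex ^ 'm)) set.
               holomorphic_retract Z \<Omega> \<and>
               biholomorphic_to M (Z \<times> (UNIV :: complex set)) \<and>
               (boundary_disc Z \<or>
                graph_over_disc Z \<or>
                (\<exists>B k. linear_subspace_of B \<bool> k \<and> graph_over B Z) \<or>
                (\<exists>k\<ge>2. linear_subspace_of Z \<Omega> k)) \<and>
               (graph_over \<bool> Z \<or> (\<exists>k\<ge>2. linear_subspace_of Z \<Omega> k))))"
proof -
  obtain N F G \<alpha> \<rho> where "convergent_exhaustion M N F G \<alpha> \<rho>"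
    by (rule convergent_exhaustion_exists[OF assms[folded mnorm_ball]]) (rule that)
  then interpret convergent_exhaustion M N F G "\<Omega> :: (complex \<times> (complex ^ 'm)) set" \<alpha> \<rho>
    by (simp_all only: mnorm_ball)
  show ?thesis
  proof (intro conjI impI)
    show "biholomorphic_to M (\<Omega> :: (complex \<times> (complex ^ 'm)) set)" if "kobayashi_hyperbolic M"
      by (rule hyperbolic_limit[OF that])
    assume "\<not> kobayashi_hyperbolic M \<and> has_kobayashi_corank M 1"
    then have corank: "has_kobayashi_corank M 1" ..
    obtain e :: "complex ^ 'm \<Rightarrow> complex \<times> (complex ^ 'm)" and \<pi> and \<beta> :: "nat \<Rightarrow> _ \<Rightarrow> complex \<times> (complex ^ 'm)"
      where e: "clinear e" and \<pi>: "clinear \<pi>" "\<And>y. \<pi> (e y) = y" and le: "\<And>x. mnorm (e (\<pi> x)) \<le> mnorm x"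
        and \<beta>: "\<And>j x. x \<in> \<Omega> \<Longrightarrow> immersive (\<beta> j) x" "\<And>j. inj_on (\<beta> j) \<Omega>"
          "\<And>j k x. j \<le> k \<Longrightarrow> x \<in> \<Omega> \<Longrightarrow> \<beta> k (F k (G j x)) = \<beta> j x"
        and img: "(\<Union>j. \<beta> j ` \<Omega>) = {z. mnorm (e (snd z)) < 1}"
      by (rule corank_one_splitting[OF corank]) (rule that)
    obtain Z :: "(complex \<times> (complex ^ 'm)) set" and l :: "_ \<Rightarrow> _ \<times> complex" and l' :: "_ \<Rightarrow> complex \<times> (complex ^ 'm)"
      where l: "clinear l" "clinear l'" "\<And>v. l' (l v) = v" "Z \<times> UNIV = l ` {z. mnorm (e (snd z)) < 1}"
        and Z: "holomorphic_retract Z \<Omega>"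
          "(graph_over \<bool> Z \<and> linear_subspace_of (\<bool> :: (complex ^ 'm) set) \<bool> CARD('m)) \<or> (\<exists>k\<ge>2. linear_subspace_of Z \<Omega> k)"
      by (rule corank_one_target[OF e \<pi> le]) (rule that)
    have "biholomorphic_to M (Z \<times> (UNIV :: complex set))"
      by (rule biholomorphic_to_direct_limit[OF \<beta> l(1-3)]) (use l(4) img in simp_all)
    then show "\<exists>Z :: (complex \<times> (complex ^ 'm)) set.
               holomorphic_retract Z \<Omega> \<and>
               biholomorphic_to M (Z \<times> (UNIV :: complex set)) \<and>
               (boundary_disc Z \<or>
                graph_over_disc Z \<or>
                (\<exists>B k. linear_subspace_of B \<bool> k \<and> graph_over B Z) \<or>
                (\<exists>k\<ge>2. linear_subspace_of Z \<Omega> k)) \<and>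
               (graph_over \<bool> Z \<or> (\<exists>k\<ge>2. linear_subspace_of Z \<Omega> k))"
      using Z by (intro exI[of _ Z]) blast
  qed
qed

end
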